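(* Let $n\ge 1$, $p\ge 2$, $\Omega\subset\mathbb{R}^n$ open, $0<T<\infty$, $\Omega_T=\Omega\times(0,T)$, and $0<\alpha\le 1$. Let $\mathcal{A}:\Omega_T\times\mathbb{R}^n\to\mathbb{R}^n$ be a Carathéodory function such that, for some constants $0<\nu\le L$, for a.e. $(x,t)\in\Omega_T$ and all $\xi,\eta\in\mathbb{R}^n$: $\mathcal{A}(x,t,\xi)\cdot\xi\ge\nu|\xi|^p$, $|\mathcal{A}(x,t,\xi)|\le L|\xi|^{p-1}$, and $(\mathcal{A}(x,t,\xi)-\mathcal{A}(x,t,\eta))\cdot(\xi-\eta)>0$ whenever $\xi\neq\eta$. Let $E\subset\Omega_T$ be a closed set and let $u\in C(\Omega_T)$ be a weak solution of $\partial_t u-\operatorname{div}\mathcal{A}(x,t,\nabla u)=0$ in $\Omega_T\setminus E$ such that, for some $M>0$, $$|u(z)-u(z_0)|\le M\, d_\alpha(z,z_0)^\alpha$$ for every $z_0\in E$ and every $z\in\Omega_T$. If $\mathcal{H}^{n+\alpha}_{(\alpha)}(E)=0$, then $u$ is a weak solution of $\partial_t u-\operatorname{div}\mathcal{A}(x,t,\nabla u)=0$ in $\Omega_T$.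
   Context: Weak solutions: for an open set $U\subset\mathbb{R}^{n+1}$, $u$ is a weak solution of $\partial_t u-\operatorname{div}\mathcal{A}(x,t,\nabla u)=0$ in $U$ if for every cylinder $\Omega'\times(t_1,t_2)\Subset U$ ($\Omega'\subset\mathbb{R}^n$ open) one has $u\in L^p(t_1,t_2;W^{1,p}(\Omega'))$ and $\int -u\,\partial_t\varphi+\mathcal{A}(x,t,\nabla u)\cdot\nabla\varphi\,dx\,dt=0$ for all $\varphi\in C_c^\infty(\Omega'\times(t_1,t_2))$. Metric: $d_\alpha((x,t),(y,s))=\max\{|x-y|,\,|t-s|^{1/(p+\alpha(2-p))}\}$. Cylinders: for $z_0=(x_0,t_0)$, $r>0$, $\lambda>0$, $Q_{r,\lambda}(z_0)=B(x_0,r)\times(t_0-\lambda^{2-p}r^p,\,t_0+\lambda^{2-p}r^p)$; in particular $Q_{r,r^\alpha}(z_0)=B(x_0,r)\times(t_0-r^{p+\alpha(2-p)},\,t_0+r^{p+\alpha(2-p)})$. Parabolic Hausdorff measure: for $E\subset\mathbb{R}^{n+1}$ and $\sigma\ge0$, $\mathcal{H}^{\sigma}_{(\alpha)}(E)=\lim_{\delta\downarrow0}\inf\{\sum_{i=1}^\infty r_i^\sigma : E\subset\bigcup_{i}Q_{r_i,r_i^\alpha}(z_i),\ 0<r_i<\delta\}$. *)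

theory Defs
  imports "HOL-Analysis.Analysis"
begin

fun Ck :: "nat \<Rightarrow> ('a::euclidean_space \<Rightarrow> real) \<Rightarrow> bool" where
  "Ck 0 f = continuous_on UNIV f"
| "Ck (Suc k) f = (f differentiable_on UNIV \<and>
      (\<forall>b\<in>Basis. Ck k (\<lambda>x. frechet_derivative f (at x) b)))"

definition smooth_fun :: "('a::euclidean_space \<Rightarrow> real) \<Rightarrow> bool" where
  "smooth_fun f \<longleftrightarrow> (\<forall>k. Ck k f)"

definition tsupp :: "('a::euclidean_space \<Rightarrow> real) \<Rightarrow> 'a set" where
  "tsupp f = closure {x. f x \<noteq> 0}"

definition test_fun :: "'a::euclidean_space set \<Rightarrow> ('a \<Rightarrow> real) \<Rightarrow> bool" where
  "test_fun V \<phi> \<longleftrightarrow> smooth_fun \<phi> \<and> compact (tsupp \<phi>) \<and> tsupp \<phi> \<subseteq> V"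

definition xpart :: "((real^'n) \<times> real \<Rightarrow> real) \<Rightarrow> 'n \<Rightarrow> (real^'n) \<times> real \<Rightarrow> real" where
  "xpart \<phi> i z = frechet_derivative \<phi> (at z) (axis i 1, 0)"

definition tpart :: "((real^'n) \<times> real \<Rightarrow> real) \<Rightarrow> (real^'n) \<times> real \<Rightarrow> real" where
  "tpart \<phi> z = frechet_derivative \<phi> (at z) (0, 1)"

definition xgrad :: "((real^'n) \<times> real \<Rightarrow> real) \<Rightarrow> (real^'n) \<times> real \<Rightarrow> real^'n" where
  "xgrad \<phi> z = (\<chi> i. xpart \<phi> i z)"

definition Lp_on :: "real \<Rightarrow> 'a::euclidean_space set \<Rightarrow> ('a \<Rightarrow> 'b::euclidean_space) \<Rightarrow> bool" where
  "Lp_on p V f \<longleftrightarrow> set_borel_measurable lebesgue V f \<and>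
      set_integrable lebesgue V (\<lambda>z. norm (f z) powr p)"

definition weak_xgrad :: "((real^'n) \<times> real) set \<Rightarrow> ((real^'n) \<times> real \<Rightarrow> real)
    \<Rightarrow> ((real^'n) \<times> real \<Rightarrow> real^'n) \<Rightarrow> bool" where
  "weak_xgrad V u g \<longleftrightarrow> (\<forall>\<phi> i. test_fun V \<phi> \<longrightarrow>
      (LINT z:V|lebesgue. u z * xpart \<phi> i z) = - (LINT z:V|lebesgue. g z $ i * \<phi> z))"

text \<open>Weak solution of u_t - div A(x,t,Du) = 0 in the open set U.  The condition
u in L^p(t1,t2;W^{1,p}(Omega')) is rendered as: u and its weak spatial gradient g
belong to L^p(Omega' x (t1,t2)).\<close>
definition weak_solution :: "real \<Rightarrow> ((real^'n) \<times> real \<Rightarrow> real^'n \<Rightarrow> real^'n)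
    \<Rightarrow> ((real^'n) \<times> real \<Rightarrow> real) \<Rightarrow> ((real^'n) \<times> real) set \<Rightarrow> bool" where
  "weak_solution p A u U \<longleftrightarrow>
    (\<forall>(\<Omega>'::(real^'n) set) t1 t2.
       open \<Omega>' \<and> compact (closure (\<Omega>' \<times> {t1<..<t2})) \<and> closure (\<Omega>' \<times> {t1<..<t2}) \<subseteq> U \<longrightarrow>
       (\<exists>g. Lp_on p (\<Omega>' \<times> {t1<..<t2}) u \<and> Lp_on p (\<Omega>' \<times> {t1<..<t2}) g \<and>
            weak_xgrad (\<Omega>' \<times> {t1<..<t2}) u g \<and>
            (\<forall>\<phi>. test_fun (\<Omega>' \<times> {t1<..<t2}) \<phi> \<longrightarrow>
               (LINT z:(\<Omega>' \<times> {t1<..<t2})|lebesgue.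
                   - u z * tpart \<phi> z + A z (g z) \<bullet> xgrad \<phi> z) = 0)))"

definition d_par :: "real \<Rightarrow> real \<Rightarrow> (real^'n) \<times> real \<Rightarrow> (real^'n) \<times> real \<Rightarrow> real" where
  "d_par p \<alpha> z w = max (norm (fst z - fst w)) (\<bar>snd z - snd w\<bar> powr (1 / (p + \<alpha> * (2 - p))))"

definition Qcyl :: "real \<Rightarrow> real \<Rightarrow> real \<Rightarrow> (real^'n) \<times> real \<Rightarrow> ((real^'n) \<times> real) set" where
  "Qcyl p r lam z0 = ball (fst z0) r \<times>
      {snd z0 - lam powr (2 - p) * r powr p <..< snd z0 + lam powr (2 - p) * r powr p}"

definition par_hausdorff_delta :: "real \<Rightarrow> real \<Rightarrow> real \<Rightarrow> real \<Rightarrow> ((real^'n) \<times> real) set \<Rightarrow> ennreal" where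
  "par_hausdorff_delta p \<alpha> \<sigma> \<delta> E =
     (INF c \<in> {(r, z). (\<forall>i. 0 < r i \<and> r i < \<delta>) \<and>
                      E \<subseteq> (\<Union>i. Qcyl p (r i) (r i powr \<alpha>) (z i))}.
        (\<Sum>i. ennreal (fst c i powr \<sigma>)))"

definition par_hausdorff :: "real \<Rightarrow> real \<Rightarrow> real \<Rightarrow> ((real^'n) \<times> real) set \<Rightarrow> ennreal" where
  "par_hausdorff p \<alpha> \<sigma> E = Lim (at_right 0) (\<lambda>\<delta>. par_hausdorff_delta p \<alpha> \<sigma> \<delta> E)"

end

theory Submission
  imports Defs
begin

text \<open>Write \<open>s = p + \<alpha> (2 - p)\<close> and \<open>\<sigma> = n + \<alpha>\<close>. A compact piece of \<open>E\<close> is covered by finitely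
many cylinders with centres \<open>z\<^sub>j\<close> in \<open>E\<close>, radii \<open>r\<^sub>j\<close> and small cost \<open>\<Sum> r\<^sub>j powr \<sigma>\<close>; a cover with
the fewest members is automatically packed. Maxima of cutoffs of these cylinders give functions
\<open>\<psi>\<close> that vanish near \<open>E\<close>. Testing the equation for \<open>u\<close> off \<open>E\<close> with \<open>(u - u z\<^sub>i)\<close> times a power of
\<open>\<psi>\<close> yields a Caccioppoli inequality in which the gradients of the cutoffs of the smaller cylinders are
absorbed: the oscillation of \<open>u\<close> on the \<open>j\<close>-th cylinder is at most \<open>M (3 r\<^sub>j) powr \<alpha>\<close>, and the time
derivative of \<open>\<psi>\<close> telescopes over the cylinders, so constants may be subtracted from \<open>u\<close> in each of
them. With the packing this bootstraps to \<open>\<integral> |\<nabla>u|\<^sup>p \<le> C r\<^sub>i powr (\<sigma> + \<alpha>)\<close> on the \<open>i\<close>-th cylinder, away from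
the zero set of \<open>\<psi>\<close>. Consequently \<open>|\<nabla>u|\<^sup>p\<close> is locally integrable across \<open>E\<close>, and inserting \<open>\<psi>\<close>
into the weak formulation costs at most \<open>C \<Sum> r\<^sub>j powr \<sigma>\<close>, which tends to zero.\<close>

section \<open>Differentiable functions and mollification\<close>

text \<open>The powers of r decide everything. A cylinder of radius r has volume of order r^(n+s),
  and u oscillates on it by at most a multiple of r^\<alpha>. With s = p + \<alpha>(2-p) the two
  right-hand terms of the Caccioppoli inequality, (r^\<alpha>/r)^p and r^(2\<alpha>)/r^s times the
  volume, are both of order r^(n+2\<alpha>) = r^(\<sigma>+\<alpha>). Young's inequality with weight
  r^(-\<alpha>) then bounds the integral of |\<nabla>u|^(p-1)/r over the cylinder by r^\<sigma>,
  which is exactly what the Hausdorff hypothesis makes small. One obstacle is overlap: the cylinders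
  of a cover have all sizes and may meet with unbounded multiplicity, so a large cylinder feels the
  cutoffs of all smaller ones inside it. Another is that u need not have a time derivative, so (u -
  c) \<zeta> is not an admissible test function. Mollifying u, its gradient and the flux together
  makes the equation a pointwise identity, and the growth bound supplies the majorant under which
  the product of mollified flux and mollified gradient converges.\<close>

lemma Ck_Suc_imp: "Ck (Suc k) f \<Longrightarrow> Ck k f"
proof (induction k arbitrary: f)
  case 0
  then show ?case by (auto intro: differentiable_imp_continuous_on)
next
  case (Suc k)
  then show ?case by (metis Ck.simps(2))
qed

lemma Ck_const [simp]: "Ck k (\<lambda>z. c)"
proof (induction k arbitrary: c)
  case (Suc k)
  then show ?case by (auto simp: frechet_derivative_const)
qed auto

lemma Ck_add: "Ck k f \<Longrightarrow> Ck k g \<Longrightarrow> Ck k (\<lambda>z. f z + g z)"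
proof (induction k arbitrary: f g)
  case 0
  then show ?case by (auto intro!: continuous_intros)
next
  case (Suc k)
  then have df: "\<And>z. f differentiable at z" and dg: "\<And>z. g differentiable at z"
    by (auto simp: differentiable_on_def)
  have "frechet_derivative (\<lambda>z. f z + g z) (at z) =
     (\<lambda>v. frechet_derivative f (at z) v + frechet_derivative g (at z) v)" for z
    using frechet_derivative_at[symmetric, OF has_derivative_add[OF
      df[unfolded frechet_derivative_works] dg[unfolded frechet_derivative_works]]] .
  then show ?case using Suc by (auto simp: differentiable_on_def)
qed

lemma Ck_mult: "Ck k f \<Longrightarrow> Ck k g \<Longrightarrow> Ck k (\<lambda>z. f z * g z)"
proof (induction k arbitrary: f g)
  case 0
  then show ?case by (auto intro!: continuous_intros)
next
  case (Suc k)
  then have df: "\<And>z. f differentiable at z" and dg: "\<And>z. g differentiable at z"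
    by (auto simp: differentiable_on_def)
  have "frechet_derivative (\<lambda>z. f z * g z) (at z) =
     (\<lambda>v. f z * frechet_derivative g (at z) v + frechet_derivative f (at z) v * g z)" for z
    using frechet_derivative_at[symmetric, OF has_derivative_mult[OF
      df[unfolded frechet_derivative_works] dg[unfolded frechet_derivative_works]]] .
  moreover have "Ck k f" "Ck k g" using Suc.prems Ck_Suc_imp by blast+
  ultimately show ?case using Suc df dg
    by (auto simp: differentiable_on_def intro!: Ck_add)
qed

lemma Ck_cmult: "Ck k f \<Longrightarrow> Ck k (\<lambda>z. c * f z)"
  using Ck_mult[OF Ck_const] .

lemma Ck_inner: "Ck k (\<lambda>z. (z - a) \<bullet> b)"
proof (cases k)
  case 0
  then show ?thesis by (auto intro!: continuous_intros)
next
  case (Suc m)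
  have *: "((\<lambda>z. (z - a) \<bullet> b) has_derivative (\<lambda>v. v \<bullet> b)) (at z)" for z
    by (auto intro!: derivative_eq_intros)
  have "frechet_derivative (\<lambda>z. (z - a) \<bullet> b) (at z) = (\<lambda>v. v \<bullet> b)" for z
    using frechet_derivative_at[symmetric, OF *] .
  then show ?thesis using Suc * by (auto simp: differentiable_on_def differentiable_def)
qed

section \<open>A smooth bump built from exp(-1/x)\<close>

text \<open>The polynomial parameter makes the family closed under differentiation, so that
  smoothness takes a single induction over the order. The constant polynomial 1 gives the usual bump
  profile.\<close>

definition flat :: "real poly \<Rightarrow> real \<Rightarrow> real" where
  "flat P x = (if x \<le> 0 then 0 else poly P (1/x) * exp (-1/x))"

text \<open>The extra factor \<open>y ^ k\<close> serves the induction over coefficients: peeling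
  off the constant term of \<open>pCons a P\<close> leaves y times \<open>P\<close>, which is the
  same claim with \<open>Suc k\<close>.\<close>

lemma poly_times_exp_neg_tendsto_0: "((\<lambda>y. y ^ k * poly P y * exp (- y)) \<longlongrightarrow> (0::real)) at_top"
proof (induction P arbitrary: k)
  case 0
  then show ?case by simp
next
  case (pCons a P)
  have "((\<lambda>y. a * (y ^ k / exp y) + y ^ Suc k * poly P y * exp (- y)) \<longlongrightarrow> a * 0 + 0) at_top"
    by (intro tendsto_intros tendsto_power_div_exp_0 pCons)
  then show ?case by (simp add: algebra_simps exp_minus divide_inverse)
qed

text \<open>With y = 1/x the derivative in x of P(y) exp(-y) is y^2 (P - P')(y) exp(-y), and
  \<open>[:0,0,1:]\<close> is y^2. At 0 the right difference quotient is y P(y) exp(-y), which tends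
  to 0 as y grows.\<close>

lemma flat_has_derivative:
  "(flat P has_real_derivative flat ([:0,0,1:] * (P - pderiv P)) x) (at x)"
proof -
  consider "x < 0" | "x > 0" | "x = 0" by linarith
  then show ?thesis
  proof cases
    case 1
    have "((\<lambda>x. 0) has_real_derivative 0) (at x)" by simp
    then have "(flat P has_real_derivative 0) (at x)"
      by (rule DERIV_cong_ev[THEN iffD1, rotated -1])
         (use 1 in \<open>auto simp: flat_def eventually_nhds intro!: exI[of _ "{..<0}"]\<close>)
    then show ?thesis using 1 by (simp add: flat_def)
  next
    case 2
    have "((\<lambda>x. poly P (1/x) * exp (-1/x)) has_real_derivative
       poly ([:0,0,1:] * (P - pderiv P)) (1/x) * exp (-1/x)) (at x)"
      using 2 by (auto intro!: derivative_eq_intros DERIV_chain2[OF poly_DERIV]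
          simp: field_simps power2_eq_square)
    then have "(flat P has_real_derivative poly ([:0,0,1:] * (P - pderiv P)) (1/x) * exp (-1/x)) (at x)"
      by (rule DERIV_cong_ev[THEN iffD1, rotated -1])
         (use 2 in \<open>auto simp: flat_def eventually_nhds intro!: exI[of _ "{0<..}"]\<close>)
    then show ?thesis using 2 by (simp add: flat_def)
  next
    case 3
    have r: "((\<lambda>h. flat P h / h) \<longlongrightarrow> 0) (at_right 0)"
    proof -
      have "((\<lambda>h. (inverse h) ^ 1 * poly P (inverse h) * exp (- inverse h)) \<longlongrightarrow> (0::real)) (at_right 0)"
        by (rule filterlim_compose[OF poly_times_exp_neg_tendsto_0 filterlim_inverse_at_top_right])
      then show ?thesis
        by (rule Lim_transform_eventually)
           (rule eventually_mono[OF eventually_at_right_less[of 0]], simp add: flat_def divide_inverse)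
    qed
    have l: "((\<lambda>h. flat P h / h) \<longlongrightarrow> 0) (at_left 0)"
      by (rule tendsto_eventually)
         (auto simp: flat_def eventually_at_filter)
    have "((\<lambda>h. flat P h / h) \<longlongrightarrow> 0) (at 0)"
      using l r by (simp add: filterlim_split_at)
    then show ?thesis using 3 by (simp add: DERIV_def flat_def)
  qed
qed

text \<open>The inner map is quadratic, so each derivative is another member of the family times an
  affine factor; hence the induction over k with P arbitrary.\<close>

lemma Ck_flat: "Ck k (\<lambda>z::'a::euclidean_space. flat P (c - (z - a) \<bullet> (z - a)))"
proof (induction k arbitrary: P)
  have der: "((\<lambda>z::'a. flat P (c - (z - a) \<bullet> (z - a))) has_derivative
     (\<lambda>v. flat ([:0,0,1:] * (P - pderiv P)) (c - (z - a) \<bullet> (z - a)) * (-2 * ((z - a) \<bullet> v)))) (at z)" for z P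
  proof -
    have "((\<lambda>z::'a. c - (z - a) \<bullet> (z - a)) has_derivative (\<lambda>v. -2 * ((z - a) \<bullet> v))) (at z)"
      by (auto intro!: derivative_eq_intros simp: inner_commute)
    from has_derivative_compose[OF this flat_has_derivative[unfolded has_field_derivative_def]]
    show ?thesis .
  qed
  {
    case 0
    have "(\<lambda>z::'a. flat P (c - (z - a) \<bullet> (z - a))) differentiable_on UNIV"
      using der by (auto simp: differentiable_on_def differentiable_def)
    then show ?case by (simp add: differentiable_imp_continuous_on)
  next
    case (Suc k)
    have fd: "frechet_derivative (\<lambda>z::'a. flat P (c - (z - a) \<bullet> (z - a))) (at z) =
     (\<lambda>v. flat ([:0,0,1:] * (P - pderiv P)) (c - (z - a) \<bullet> (z - a)) * (-2 * ((z - a) \<bullet> v)))" for z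
      using frechet_derivative_at[symmetric, OF der] .
    have "(\<lambda>z::'a. flat P (c - (z - a) \<bullet> (z - a))) differentiable_on UNIV"
      using der by (auto simp: differentiable_on_def differentiable_def)
    then show ?case
      unfolding Ck.simps fd by (intro conjI ballI Ck_mult Ck_cmult Ck_inner Suc)
  }
qed

lemma integrable_lebesgue_compact_support:
  fixes f :: "'a::euclidean_space \<Rightarrow> 'b::euclidean_space"
  assumes "continuous_on UNIV f" "compact S" "\<And>z. z \<notin> S \<Longrightarrow> f z = 0"
  shows "integrable lebesgue f" "integrable lborel f"
proof -
  have "integrable lborel (\<lambda>x. indicator S x *\<^sub>R f x)"
    by (rule borel_integrable_compact) (use assms in \<open>auto intro: continuous_on_subset\<close>)
  moreover have "(\<lambda>x. indicator S x *\<^sub>R f x) = f"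
    using assms(3) by (auto simp: indicator_def fun_eq_iff)
  ultimately show "integrable lborel f" by simp
  then show "integrable lebesgue f"
    using borel_measurable_integrable integrable_completion by blast
qed

definition mollifier :: "real \<Rightarrow> 'a::euclidean_space \<Rightarrow> real" where
  "mollifier e w = flat 1 (e^2 - w \<bullet> w) / (LINT x|lebesgue. flat 1 (e^2 - (x::'a) \<bullet> x))"

lemma flat_one: "flat 1 x = (if x \<le> 0 then 0 else exp (-1/x))"
  by (simp add: flat_def)

text \<open>The integrand is strictly positive on the ball of radius e, so a vanishing integral
  would make that ball negligible. Positivity permits the normalisation in
  \<open>mollifier\<close>.\<close>

lemma mollifier_integral_pos:
  assumes "e > 0"
  shows "(LINT x|lebesgue. flat 1 (e^2 - (x::'a::euclidean_space) \<bullet> x)) > 0"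
    "integrable lebesgue (\<lambda>x::'a. flat 1 (e^2 - x \<bullet> x))"
proof -
  let ?f = "\<lambda>x::'a. flat 1 (e^2 - x \<bullet> x)"
  have c: "continuous_on UNIV ?f" using Ck_flat[of 0 1 "e^2" 0] by simp
  show i: "integrable lebesgue ?f"
    by (rule integrable_lebesgue_compact_support[OF c, of "cball 0 e"])
       (use assms in \<open>auto simp: flat_one power2_norm_eq_inner[symmetric] not_le dest: power2_less_imp_less\<close>)
  have "0 \<le> ?f x" for x by (simp add: flat_one)
  moreover have "\<not> (AE x in lebesgue. ?f x = 0)"
  proof
    assume "AE x in lebesgue. ?f x = 0"
    moreover have "x \<notin> ball 0 e" if "?f x = 0" for x
      using that assms power_strict_mono[of "norm x" e 2]
      by (auto simp: flat_one power2_norm_eq_inner[symmetric] split: if_splits)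
    ultimately have "AE x in lebesgue. x \<notin> ball (0::'a) e"
      by (auto elim: eventually_mono)
    then have "ball (0::'a) e \<in> null_sets lebesgue"
      by (subst AE_iff_null_sets) auto
    then have "negligible (ball (0::'a) e)" by (simp add: negligible_iff_null_sets)
    then show False using assms open_not_negligible[of "ball (0::'a) e"] by auto
  qed
  ultimately show "(LINT x|lebesgue. ?f x) > 0"
    using integral_nonneg_eq_0_iff_AE[OF i] by (metis (mono_tags, lifting) AE_I2 integral_nonneg_AE less_le)
qed

lemma mollifier_nonneg: "e > 0 \<Longrightarrow> mollifier e w \<ge> 0"
  using mollifier_integral_pos(1)[of e, where 'a='a] by (simp add: mollifier_def flat_one)

lemma mollifier_eq_0: "e > 0 \<Longrightarrow> norm w \<ge> e \<Longrightarrow> mollifier e w = 0"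
  using power_mono[of e "norm w" 2]
  by (auto simp: mollifier_def flat_one power2_norm_eq_inner[symmetric])

lemma mollifier_minus: "mollifier e (x - y) = mollifier e (y - x)"
proof -
  have "(x - y) \<bullet> (x - y) = (y - x) \<bullet> (y - x)"
    by (simp add: inner_diff inner_commute)
  then show ?thesis by (simp add: mollifier_def)
qed

lemma mollifier_integral: "e > 0 \<Longrightarrow> (LINT x|lebesgue. mollifier e x) = 1"
  unfolding mollifier_def using mollifier_integral_pos[of e, where 'a='a] by simp

lemma mollifier_Ck: "Ck k (\<lambda>y. mollifier e (y - z))"
proof -
  have "Ck k (\<lambda>y. (1 / (LINT x|lebesgue. flat 1 (e^2 - (x::'a) \<bullet> x))) * flat 1 (e^2 - (y - z) \<bullet> (y - z)))"
    by (intro Ck_cmult Ck_flat)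
  then show ?thesis by (simp add: mollifier_def)
qed

lemma mollifier_Ck': "Ck k (\<lambda>y. mollifier e (z - y))"
  using mollifier_Ck[of k e z] by (simp add: mollifier_minus)

text \<open>Kernels centred at z are admissible in the definition of a weak solution; inserting them
  turns weak identities into pointwise identities between convolutions.\<close>

lemma mollifier_test_fun:
  fixes z :: "'a::euclidean_space"
  assumes "e > 0" "cball z e \<subseteq> V"
  shows "test_fun V (\<lambda>y. mollifier e (z - y))"
proof -
  have "tsupp (\<lambda>y. mollifier e (z - y)) \<subseteq> cball z e"
    unfolding tsupp_def
    by (rule closure_minimal) (use assms mollifier_eq_0[of e] in \<open>force simp: dist_norm\<close>, simp)
  moreover have "compact (tsupp (\<lambda>y. mollifier e (z - y)))"
    using calculation unfolding tsupp_def
    by (meson bounded_cball bounded_subset closed_closure compact_eq_bounded_closed)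
  ultimately show ?thesis using assms mollifier_Ck' by (auto simp: test_fun_def smooth_fun_def)
qed

section \<open>Calculus of continuously differentiable functions\<close>

abbreviation C1 :: "('a::euclidean_space \<Rightarrow> real) \<Rightarrow> bool" where
  "C1 \<equiv> Ck (Suc 0)"

abbreviation pd :: "'a::euclidean_space \<Rightarrow> ('a \<Rightarrow> real) \<Rightarrow> 'a \<Rightarrow> real" where
  "pd v f z \<equiv> frechet_derivative f (at z) v"

lemma C1_differentiable: "C1 f \<Longrightarrow> f differentiable (at z)"
  by (auto simp: differentiable_on_def)

lemma C1_has_derivative: "C1 f \<Longrightarrow> (f has_derivative (\<lambda>v. pd v f z)) (at z)"
  using C1_differentiable frechet_derivative_works by metis

lemma C1_continuous: "C1 f \<Longrightarrow> continuous_on S f"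
  by (meson Ck.simps(1) Ck_Suc_imp continuous_on_subset subset_UNIV)

lemma pd_eq: "(f has_derivative f') (at z) \<Longrightarrow> pd v f z = f' v"
  by (metis frechet_derivative_at)

lemma linear_eq_sum_Basis:
  fixes f :: "'a::euclidean_space \<Rightarrow> real"
  assumes "bounded_linear f"
  shows "f v = (\<Sum>b\<in>Basis. (v \<bullet> b) * f b)"
proof -
  interpret bounded_linear f by fact
  have "f v = f (\<Sum>b\<in>Basis. (v \<bullet> b) *\<^sub>R b)" by (simp add: euclidean_representation)
  also have "\<dots> = (\<Sum>b\<in>Basis. (v \<bullet> b) * f b)" by (simp add: sum scaleR)
  finally show ?thesis .
qed

text \<open>\<open>Ck\<close> asks for continuity only along \<open>Basis\<close>; linearity of the
  derivative carries it to every direction v.\<close>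

lemma C1_pd_continuous:
  assumes "C1 f" shows "continuous_on S (pd v f)"
proof -
  have "pd v f z = (\<Sum>b\<in>Basis. (v \<bullet> b) * pd b f z)" for z
    using linear_eq_sum_Basis[OF has_derivative_bounded_linear[OF C1_has_derivative[OF assms]]] .
  moreover have "continuous_on S (\<lambda>z. \<Sum>b\<in>Basis. (v \<bullet> b) * pd b f z)"
    using assms by (intro continuous_intros) (auto intro: continuous_on_subset)
  ultimately show ?thesis by simp
qed

lemma C1I:
  assumes "\<And>z. (f has_derivative f' z) (at z)" "\<And>v. continuous_on UNIV (\<lambda>z. f' z v)"
  shows "C1 f"
proof -
  have "pd v f z = f' z v" for v z using pd_eq assms(1) by blast
  then show ?thesis using assms by (auto simp: differentiable_on_def differentiable_def)
qed

lemma C1_power: "C1 f \<Longrightarrow> C1 (\<lambda>z. f z ^ q)"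
  by (induction q) (auto intro!: Ck_mult simp del: Ck.simps)

lemma C1_diff: "C1 f \<Longrightarrow> C1 g \<Longrightarrow> C1 (\<lambda>z. f z - g z)"
  using Ck_add[OF _ Ck_cmult[of _ g "-1"], of "Suc 0" f] by simp

lemma pd_mult: "C1 f \<Longrightarrow> C1 g \<Longrightarrow> pd v (\<lambda>z. f z * g z) z = f z * pd v g z + pd v f z * g z"
  by (rule pd_eq) (rule has_derivative_mult[OF C1_has_derivative C1_has_derivative])

lemma pd_cmult: "C1 f \<Longrightarrow> pd v (\<lambda>z. c * f z) z = c * pd v f z"
  by (rule pd_eq) (rule has_derivative_mult_right[OF C1_has_derivative])

lemma pd_diff: "C1 f \<Longrightarrow> C1 g \<Longrightarrow> pd v (\<lambda>z. f z - g z) z = pd v f z - pd v g z"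
  by (rule pd_eq) (rule has_derivative_diff[OF C1_has_derivative C1_has_derivative])

lemma pd_const: "pd v (\<lambda>z. c) z = 0"
  by (rule pd_eq) (rule has_derivative_const)

lemma pd_power: "C1 f \<Longrightarrow> pd v (\<lambda>z. f z ^ q) z = of_nat q * f z ^ (q - 1) * pd v f z"
  by (rule pd_eq) (auto intro!: derivative_eq_intros C1_has_derivative)

lemma pd_eq_0_outside:
  assumes "closed S" "\<And>z. z \<notin> S \<Longrightarrow> f z = 0" "z \<notin> S"
  shows "pd v f z = 0"
proof -
  have "((\<lambda>z. 0) has_derivative (\<lambda>v. 0)) (at z)" by simp
  then have "(f has_derivative (\<lambda>v. 0)) (at z)"
    by (rule has_derivative_transform_within_open[of _ _ _ _ "- S"]) (use assms in auto)
  then show ?thesis by (rule pd_eq)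
qed

lemma bounded_compact_support:
  fixes f :: "'a::euclidean_space \<Rightarrow> real"
  assumes "continuous_on UNIV f" "compact S" "\<And>z. z \<notin> S \<Longrightarrow> f z = 0"
  obtains B where "B > 0" "\<And>z. \<bar>f z\<bar> \<le> B"
proof -
  have "compact (f ` S)" using assms by (auto intro: compact_continuous_image continuous_on_subset)
  then obtain B where "B > 0" "\<forall>x\<in>f ` S. norm x \<le> B"
    using compact_imp_bounded bounded_pos by blast
  then show ?thesis using assms(3) that[of B] by (metis abs_zero image_eqI less_imp_le real_norm_def)
qed

text \<open>All derivatives vanish outside S, so their bounds on S are global and the mean value
  inequality applies on the whole space. The constant later dominates difference quotients.\<close>

lemma C1_lipschitz:
  assumes "C1 f" "compact S" "\<And>z. z \<notin> S \<Longrightarrow> f z = 0"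
  obtains B where "\<And>x y. \<bar>f x - f y\<bar> \<le> B * norm (x - y)"
proof -
  have "\<exists>B. \<forall>z. \<bar>pd b f z\<bar> \<le> B" for b
    using bounded_compact_support[OF C1_pd_continuous[OF assms(1)] assms(2)]
      pd_eq_0_outside[of S f] compact_imp_closed[OF assms(2)] assms(3) by metis
  then obtain B where B: "\<And>b z. \<bar>pd b f z\<bar> \<le> B b" by metis
  have "norm (f x - f y) \<le> (\<Sum>b\<in>Basis. B b) * norm (x - y)" for x y
  proof (rule differentiable_bound[OF convex_UNIV])
    fix z show "(f has_derivative (\<lambda>v. pd v f z)) (at z within UNIV)"
      using C1_has_derivative[OF assms(1)] by simp
    show "onorm (\<lambda>v. pd v f z) \<le> (\<Sum>b\<in>Basis. B b)"
    proof (rule onorm_le)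
      fix v
      have "norm (pd v f z) = \<bar>\<Sum>b\<in>Basis. (v \<bullet> b) * pd b f z\<bar>"
        unfolding real_norm_def
        by (rule arg_cong[where f=abs], rule linear_eq_sum_Basis)
           (rule has_derivative_bounded_linear[OF C1_has_derivative[OF assms(1)]])
      also have "\<dots> \<le> (\<Sum>b\<in>Basis. B b * norm v)"
      proof (rule order_trans[OF sum_abs sum_mono])
        fix b :: 'a assume b: "b \<in> Basis"
        show "\<bar>(v \<bullet> b) * pd b f z\<bar> \<le> B b * norm v"
        proof -
          have "\<bar>pd b f z\<bar> \<le> B b" by (rule B)
          from mult_mono[OF this Basis_le_norm[OF b, of v] order_trans[OF abs_ge_zero this]]
          show ?thesis by (simp add: abs_mult mult.commute)
        qed
      qed
      finally show "norm (pd v f z) \<le> (\<Sum>b\<in>Basis. B b) * norm v" by (simp add: sum_distrib_right)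
    qed
  qed auto
  then show ?thesis using that unfolding real_norm_def by blast
qed

lemma borel_measurable_lebesgue:
  "f \<in> borel_measurable borel \<Longrightarrow> f \<in> borel_measurable lebesgue"
  by (simp add: measurable_completion)

lemma continuous_measurable_lebesgue:
  "continuous_on UNIV f \<Longrightarrow> f \<in> borel_measurable lebesgue"
  by (intro borel_measurable_lebesgue borel_measurable_continuous_onI)

section \<open>Convolution and differentiation under the integral sign\<close>

definition convol :: "('a::euclidean_space \<Rightarrow> real) \<Rightarrow> ('a \<Rightarrow> 'b::euclidean_space) \<Rightarrow> 'a \<Rightarrow> 'b" where
  "convol k f z = (LINT y|lebesgue. k (z - y) *\<^sub>R f y)"

lemma convol_integrable:
  fixes f :: "'a::euclidean_space \<Rightarrow> 'b::euclidean_space"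
  assumes "continuous_on UNIV k" "\<And>w. \<bar>k w\<bar> \<le> B" "integrable lebesgue f"
  shows "integrable lebesgue (\<lambda>y. k (z - y) *\<^sub>R f y)"
proof (rule Bochner_Integration.integrable_bound)
  show "integrable lebesgue (\<lambda>y. B * norm (f y))" using assms by simp
  have "continuous_on UNIV (\<lambda>y. k (z - y))"
    by (rule continuous_on_compose2[OF assms(1)]) (auto intro!: continuous_intros)
  then show "(\<lambda>y. k (z - y) *\<^sub>R f y) \<in> borel_measurable lebesgue"
    using borel_measurable_integrable[OF assms(3)]
    by (intro borel_measurable_scaleR[OF continuous_measurable_lebesgue])
  have "norm (k (z - y) *\<^sub>R f y) \<le> norm (B * norm (f y))" for y
    using mult_right_mono[OF order_trans[OF assms(2)[of "z - y"] abs_ge_self], of "norm (f y)"]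
    by (simp add: abs_mult)
  then show "AE y in lebesgue. norm (k (z - y) *\<^sub>R f y) \<le> norm (B * norm (f y))" by simp
qed

lemma convol_continuous:
  fixes f :: "'a::euclidean_space \<Rightarrow> 'b::euclidean_space"
  assumes "continuous_on UNIV k" "\<And>w. \<bar>k w\<bar> \<le> B" "integrable lebesgue f"
  shows "continuous_on S (convol k f)"
proof (rule continuous_on_subset[OF _ subset_UNIV], unfold continuous_on_sequentially, intro ballI allI impI)
  fix x a assume "(\<forall>n. x n \<in> UNIV) \<and> x \<longlonglongrightarrow> (a::'a)"
  then have x: "x \<longlonglongrightarrow> a" by simp
  show "(convol k f \<circ> x) \<longlonglongrightarrow> convol k f a"
    unfolding convol_def o_def
  proof (rule integral_dominated_convergence[where w="\<lambda>y. B * norm (f y)"])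
    show "integrable lebesgue (\<lambda>y. B * norm (f y))" using assms by simp
    show "(\<lambda>y. k (a - y) *\<^sub>R f y) \<in> borel_measurable lebesgue"
      "\<And>i. (\<lambda>y. k (x i - y) *\<^sub>R f y) \<in> borel_measurable lebesgue"
      using convol_integrable[OF assms] borel_measurable_integrable by blast+
    show "AE y in lebesgue. (\<lambda>i. k (x i - y) *\<^sub>R f y) \<longlonglongrightarrow> k (a - y) *\<^sub>R f y"
    proof (intro AE_I2 tendsto_intros)
      fix y
      have "isCont k (a - y)" using assms(1) by (simp add: continuous_on_eq_continuous_at)
      then show "(\<lambda>i. k (x i - y)) \<longlonglongrightarrow> k (a - y)"
        by (rule isCont_tendsto_compose) (intro tendsto_intros x)
    qed
    show "AE y in lebesgue. norm (k (x i - y) *\<^sub>R f y) \<le> B * norm (f y)" for i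
      by (intro AE_I2) (simp add: mult_right_mono assms(2))
  qed
qed

text \<open>Dominated convergence along sequences: the Lipschitz constant L of k bounds its
  difference quotients and its directional derivatives alike, so 2 L |f| is a majorant.\<close>

lemma convol_has_derivative:
  fixes f :: "'a::euclidean_space \<Rightarrow> real"
  assumes k: "C1 k" "compact S" "\<And>z. z \<notin> S \<Longrightarrow> k z = 0" and f: "integrable lebesgue f"
  shows "(convol k f has_derivative (\<lambda>v. convol (pd v k) f z)) (at z)"
proof -
  note kc = C1_continuous[OF k(1)] C1_pd_continuous[OF k(1)]
  have pd0: "w \<notin> S \<Longrightarrow> pd v k w = 0" for v w
    using pd_eq_0_outside[of S k] compact_imp_closed[OF k(2)] k(3) by blast
  obtain B where B: "\<And>w. \<bar>k w\<bar> \<le> B" using bounded_compact_support[OF kc(1) k(2,3)] by metis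
  have "\<exists>B. \<forall>w. \<bar>pd v k w\<bar> \<le> B" for v
    using bounded_compact_support[OF kc(2) k(2) pd0] by metis
  then obtain D where D: "\<And>v w. \<bar>pd v k w\<bar> \<le> D v" by metis
  obtain L where L: "\<And>x y. \<bar>k x - k y\<bar> \<le> L * norm (x - y)" using C1_lipschitz[OF k] by blast
  have ik: "integrable lebesgue (\<lambda>y. k (x - y) * f y)" for x
    using convol_integrable[OF kc(1) B f] by simp
  have ipk: "integrable lebesgue (\<lambda>y. pd v k (x - y) * f y)" for x v
    using convol_integrable[OF kc(2) D f] by simp
  have lin: "linear (\<lambda>v. pd v k w)" for w
    using has_derivative_bounded_linear[OF C1_has_derivative[OF k(1)]] bounded_linear.linear by blast
  have lin': "linear (\<lambda>v. convol (pd v k) f z)"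
    unfolding convol_def
    by (rule linearI) (use ipk in \<open>simp_all add: linear_add[OF lin] linear_scale[OF lin] algebra_simps\<close>)
  let ?Q = "\<lambda>x y. (k (x - y) - k (z - y) - pd (x - z) k (z - y)) / norm (x - z)"
  have "((\<lambda>x. (convol k f x - convol k f z - convol (pd (x - z) k) f z) /\<^sub>R norm (x - z)) \<longlongrightarrow> 0) (at z)"
    unfolding tendsto_at_iff_sequentially o_def
  proof (intro allI impI)
    fix X assume XN: "\<forall>i. X i \<in> UNIV - {z}" and X: "X \<longlonglongrightarrow> z"
    have pdb: "\<bar>pd v k w\<bar> \<le> L * norm v" for v w
    proof -
      have d: "(k has_derivative (\<lambda>v. pd v k w)) (at w)" by (rule C1_has_derivative[OF k(1)])
      have "((\<lambda>h. k (w + h *\<^sub>R v)) has_real_derivative pd v k w) (at 0)"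
      proof -
        have "((\<lambda>h. k (w + h *\<^sub>R v)) has_derivative (\<lambda>h. pd (h *\<^sub>R v) k w)) (at 0)"
          by (rule has_derivative_compose[where f="\<lambda>h. w + h *\<^sub>R v" and f'="\<lambda>h. h *\<^sub>R v" and g=k and g'="\<lambda>v. pd v k w"])
             (use d in \<open>auto intro!: derivative_eq_intros\<close>)
        then show ?thesis
          unfolding has_field_derivative_def by (simp add: linear_scale[OF lin] mult.commute[of _ "pd v k w"])
      qed
      then have lim: "(\<lambda>h. \<bar>(k (w + h *\<^sub>R v) - k w) / h\<bar>) \<midarrow>0\<rightarrow> \<bar>pd v k w\<bar>"
        unfolding DERIV_def by (intro tendsto_rabs) simp
      show ?thesis
      proof (rule tendsto_upperbound[OF lim])
        show "\<forall>\<^sub>F h in at 0. \<bar>(k (w + h *\<^sub>R v) - k w) / h\<bar> \<le> L * norm v"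
        proof (rule eventually_at_filter[THEN iffD2], intro always_eventually allI impI)
          fix h :: real assume "h \<noteq> 0"
          moreover have "\<bar>k (w + h *\<^sub>R v) - k w\<bar> \<le> L * norm v * \<bar>h\<bar>"
            using L[of "w + h *\<^sub>R v" w] by (simp add: mult_ac)
          ultimately show "\<bar>(k (w + h *\<^sub>R v) - k w) / h\<bar> \<le> L * norm v"
            by (simp add: field_simps)
        qed
      qed simp
    qed
    have "(\<lambda>i. LINT y|lebesgue. ?Q (X i) y * f y) \<longlonglongrightarrow> (LINT y|(lebesgue :: 'a measure). (0::real))"
    proof (rule integral_dominated_convergence[where w="\<lambda>y. 2 * L * norm (f y)"])
      show "integrable lebesgue (\<lambda>y. 2 * L * norm (f y))" using f by simp
      have e: "?Q x y * f y = (k (x - y) * f y - k (z - y) * f y - pd (x - z) k (z - y) * f y) / norm (x - z)" for x y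
        by (simp add: field_simps)
      show "(\<lambda>y. ?Q (X i) y * f y) \<in> borel_measurable lebesgue" for i
        unfolding e using ik ipk by (intro borel_measurable_divide borel_measurable_diff) auto
      show "AE y in lebesgue. (\<lambda>i. ?Q (X i) y * f y) \<longlonglongrightarrow> 0"
      proof (intro AE_I2)
        fix y
        have "((\<lambda>w. (k w - k (z - y) - pd (w - (z - y)) k (z - y)) / norm (w - (z - y))) \<longlongrightarrow> 0) (at (z - y))"
          using C1_has_derivative[OF k(1), of "z - y"]
          unfolding has_derivative_at_within by (simp add: divide_inverse mult.commute)
        then have "((\<lambda>w. (k w - k (z - y) - pd (w - (z - y)) k (z - y)) / norm (w - (z - y))) \<circ> (\<lambda>i. X i - y)) \<longlonglongrightarrow> 0"
          unfolding tendsto_at_iff_sequentially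
          by (elim allE[of _ "\<lambda>i. X i - y"] impE) (use XN in \<open>auto intro!: tendsto_intros X\<close>)
        then have "(\<lambda>i. ?Q (X i) y) \<longlonglongrightarrow> 0"
          by (simp add: o_def)
        from tendsto_mult[OF this tendsto_const[of "f y"]] show "(\<lambda>i. ?Q (X i) y * f y) \<longlonglongrightarrow> 0" by simp
      qed
      show "AE y in lebesgue. norm (?Q (X i) y * f y) \<le> 2 * L * norm (f y)" for i
      proof (intro AE_I2)
        fix y
        have "X i \<noteq> z" using XN by auto
        moreover have "\<bar>k (X i - y) - k (z - y) - pd (X i - z) k (z - y)\<bar> \<le> 2 * L * norm (X i - z)"
          using L[of "X i - y" "z - y"] pdb[where v="X i - z" and w="z - y"] by simp
        ultimately have "\<bar>?Q (X i) y\<bar> \<le> 2 * L" by (simp add: field_simps)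
        then show "norm (?Q (X i) y * f y) \<le> 2 * L * norm (f y)"
          unfolding real_norm_def abs_mult by (rule mult_right_mono) simp
      qed
    qed simp
    moreover have "(LINT y|lebesgue. ?Q x y * f y) =
        (convol k f x - convol k f z - convol (pd (x - z) k) f z) /\<^sub>R norm (x - z)" for x
    proof -
      have "(LINT y|lebesgue. ?Q x y * f y) = (LINT y|lebesgue. (k (x - y) * f y - k (z - y) * f y - pd (x - z) k (z - y) * f y) / norm (x - z))"
        by (rule Bochner_Integration.integral_cong) (auto simp: field_simps)
      then show ?thesis
        using ik ipk by (simp add: convol_def divide_inverse mult.commute)
    qed
    ultimately show "(\<lambda>i. (convol k f (X i) - convol k f z - convol (pd (X i - z) k) f z) /\<^sub>R norm (X i - z)) \<longlonglongrightarrow> 0"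
      by simp
  qed
  then show ?thesis
    unfolding has_derivative_at_within using lin' linear_conv_bounded_linear by blast
qed

lemma convol_C1:
  fixes f :: "'a::euclidean_space \<Rightarrow> real"
  assumes k: "C1 k" "compact S" "\<And>z. z \<notin> S \<Longrightarrow> k z = 0" and f: "integrable lebesgue f"
  shows "C1 (convol k f)" "pd v (convol k f) z = convol (pd v k) f z"
proof -
  have pd0: "w \<notin> S \<Longrightarrow> pd v k w = 0" for v w
    using pd_eq_0_outside[of S k] compact_imp_closed[OF k(2)] k(3) by blast
  have "continuous_on UNIV (convol (pd v k) f)" for v
    using bounded_compact_support[OF C1_pd_continuous[OF k(1)] k(2) pd0]
      convol_continuous[OF C1_pd_continuous[OF k(1)] _ f] by metis
  then show "C1 (convol k f)" using convol_has_derivative[OF assms] by (rule C1I[rotated])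
  show "pd v (convol k f) z = convol (pd v k) f z"
    using pd_eq[OF convol_has_derivative[OF assms]] .
qed

lemma lebesgue_integral_reflect:
  fixes g :: "'a::euclidean_space \<Rightarrow> real"
  assumes "continuous_on UNIV g"
  shows "(LINT y|lebesgue. g (z - y)) = (LINT y|lebesgue. g y)"
proof -
  have [measurable]: "g \<in> borel_measurable borel" using assms by (rule borel_measurable_continuous_onI)
  have "lborel = density (distr lborel borel (\<lambda>x::'a. z + (-1) *\<^sub>R x)) (\<lambda>_. 1)"
    using lborel_affine[of "-1" z] by simp
  then have "lborel = distr lborel borel (\<lambda>x::'a. z - x)"
    by (simp add: density_1)
  then have "(LINT y|lborel. g y) = (LINT y|distr lborel borel (\<lambda>x. z - x). g y)" by simp
  also have "\<dots> = (LINT y|lborel. g (z - y))" by (rule integral_distr) auto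
  finally show ?thesis by (simp add: integral_completion)
qed

text \<open>Convolving F with the indicator of a large ball gives a function that is constant near
  0, its value being the integral of F. So its derivative at 0 vanishes, and this derivative is also
  the integral of the derivative of F.\<close>

lemma integral_pd_eq_0:
  assumes F: "C1 F" "compact S" "\<And>z. z \<notin> S \<Longrightarrow> F z = 0"
  shows "(LINT z|lebesgue. pd v F z) = 0"
proof -
  obtain r where r: "\<And>z. z \<in> S \<Longrightarrow> norm z \<le> r"
    using compact_imp_bounded[OF F(2)] by (auto simp: bounded_iff)
  \<comment> \<open>Radius r + 1 keeps the support of F (z - y), as a function of y, inside the ball
    for every z of norm at most 1.\<close>
  define f where "f = (indicator (cball 0 (r + 1)) :: 'a \<Rightarrow> real)"
  have f: "integrable lebesgue f" unfolding f_def
    using lmeasurable_iff_integrable lmeasurable_cball by blast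
  have pd0: "w \<notin> S \<Longrightarrow> pd v F w = 0" for v w
    using pd_eq_0_outside[of S F] compact_imp_closed[OF F(2)] F(3) by blast
  have g: "convol g f z = (LINT y|lebesgue. g y)"
    if g: "continuous_on UNIV g" "\<And>z. z \<notin> S \<Longrightarrow> g z = 0" and z: "norm z \<le> 1" for g z
  proof -
    have "g (z - y) * f y = g (z - y)" for y
    proof (cases "z - y \<in> S")
      case True
      then have "norm (z - y) \<le> r" by (rule r)
      then have "norm y \<le> r + 1"
        using z norm_triangle_ineq4[of z "z - y"] by simp
      then show ?thesis by (simp add: f_def)
    qed (simp add: that)
    then have "convol g f z = (LINT y|lebesgue. g (z - y))" unfolding convol_def
      by (intro Bochner_Integration.integral_cong) auto
    then show ?thesis by (simp add: lebesgue_integral_reflect[OF g(1)])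
  qed
  have "((\<lambda>z. (LINT y|lebesgue. F y)) has_derivative (\<lambda>v. 0)) (at (0::'a))" by simp
  then have "(convol F f has_derivative (\<lambda>v. 0)) (at 0)"
    by (rule has_derivative_transform_within_open[of _ _ _ _ "ball 0 1"])
       (use g[OF C1_continuous[OF F(1)] F(3)] in auto)
  then have "0 = pd v (convol F f) 0" by (rule pd_eq[symmetric])
  also have "\<dots> = (LINT z|lebesgue. pd v F z)"
    using convol_C1(2)[OF F f] g[OF C1_pd_continuous[OF F(1)] pd0] by simp
  finally show ?thesis by simp
qed

section \<open>Mollification in L1\<close>

lemma mollifier_nn_integral:
  fixes y :: "'a::euclidean_space"
  assumes "e > 0"
  shows "(\<integral>\<^sup>+z. ennreal (mollifier e (z - y)) \<partial>lborel) = 1"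
proof -
  have c: "continuous_on UNIV (mollifier e :: 'a \<Rightarrow> real)"
    using mollifier_Ck[of 0 e 0] by simp
  then have [measurable]: "(mollifier e :: 'a \<Rightarrow> real) \<in> borel_measurable borel"
    by (rule borel_measurable_continuous_onI)
  have i: "integrable lborel (mollifier e :: 'a \<Rightarrow> real)"
    by (rule integrable_lebesgue_compact_support(2)[OF c, of "cball 0 e"])
       (use assms in \<open>auto intro: mollifier_eq_0\<close>)
  have "(\<integral>\<^sup>+z. ennreal (mollifier e (z - y)) \<partial>lborel) = (\<integral>\<^sup>+z. ennreal (mollifier e z) \<partial>distr lborel borel ((+) (- y)))"
    by (subst nn_integral_distr) auto
  also have "\<dots> = (\<integral>\<^sup>+z. ennreal (mollifier e (z::'a)) \<partial>lborel)" by (simp add: lborel_distr_plus)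
  also have "\<dots> = ennreal (LINT z|lborel. mollifier e (z::'a))"
    by (rule nn_integral_eq_integral[OF i]) (simp add: mollifier_nonneg assms)
  also have "(LINT z|lborel. mollifier e (z::'a)) = 1"
    using mollifier_integral[OF assms, where 'a='a] by (simp add: integral_completion)
  finally show ?thesis by simp
qed

lemma mollifier_continuous: "continuous_on S (mollifier e)"
  using mollifier_Ck[of 0 e 0] by (auto intro: continuous_on_subset)

lemma mollifier_C1: "C1 (mollifier e)"
  using mollifier_Ck[of "Suc 0" e 0] by simp

lemma mollifier_bounded:
  assumes "e > 0" obtains B where "\<And>w::'a::euclidean_space. \<bar>mollifier e w\<bar> \<le> B"
proof -
  have "w \<notin> cball 0 e \<Longrightarrow> mollifier e w = 0" for w :: 'a
    by (rule mollifier_eq_0[OF assms]) auto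
  from bounded_compact_support[OF mollifier_continuous compact_cball this]
  show ?thesis using that by blast
qed

lemma convol_mollifier_integrable:
  fixes f :: "'a::euclidean_space \<Rightarrow> 'b::euclidean_space"
  assumes "e > 0" "integrable lebesgue f"
  shows "integrable lebesgue (\<lambda>y. mollifier e (z - y) *\<^sub>R f y)"
  using mollifier_bounded[OF assms(1)] convol_integrable[OF mollifier_continuous _ assms(2)] by metis

lemma convol_mollifier_continuous:
  fixes f :: "'a::euclidean_space \<Rightarrow> 'b::euclidean_space"
  assumes "e > 0" "integrable lebesgue f"
  shows "continuous_on S (convol (mollifier e) f)"
  using mollifier_bounded[OF assms(1)] convol_continuous[OF mollifier_continuous _ assms(2)] by metis

text \<open>Tonelli and the unit mass of the kernel. \<open>convol_L1_tendsto\<close> uses the bound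
  to keep approximation errors small after mollification.\<close>

lemma convol_L1_bound:
  fixes f :: "'a::euclidean_space \<Rightarrow> 'b::euclidean_space"
  assumes e: "e > 0" and f: "integrable lebesgue f"
  shows "integrable lebesgue (convol (mollifier e) f)"
    "(LINT z|lebesgue. norm (convol (mollifier e) f z)) \<le> (LINT z|lebesgue. norm (f z))"
proof -
  let ?k = "mollifier e :: 'a \<Rightarrow> real"
  have [measurable]: "?k \<in> borel_measurable borel"
    by (rule borel_measurable_continuous_onI) (rule mollifier_continuous)
  have "f \<in> borel_measurable lebesgue" using f by (rule borel_measurable_integrable)
  then have "(\<lambda>y. ennreal (norm (f y))) \<in> borel_measurable lebesgue" by measurable
  \<comment> \<open>Tonelli is applied over \<open>lborel\<close>, so norm f is replaced by a Borel
    function equal to it almost everywhere.\<close>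
  from completion_ex_borel_measurable[OF this]
  obtain g where g[measurable]: "g \<in> borel_measurable lborel" and ae: "AE y in lborel. ennreal (norm (f y)) = g y"
    by blast
  have g': "g \<in> borel_measurable borel" using g by simp
  have c: "continuous_on UNIV (convol ?k f)" using convol_mollifier_continuous[OF assms] .
  then have [measurable]: "convol ?k f \<in> borel_measurable borel"
    by (rule borel_measurable_continuous_onI)
  have le: "ennreal (norm (convol ?k f z)) \<le> (\<integral>\<^sup>+y. ennreal (?k (z - y)) * g y \<partial>lborel)" for z
  proof -
    have "ennreal (norm (convol ?k f z)) \<le> (\<integral>\<^sup>+y. norm (?k (z - y) *\<^sub>R f y) \<partial>lebesgue)"
      unfolding convol_def
      by (rule integral_norm_bound_ennreal) (rule convol_mollifier_integrable[OF assms])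
    also have "\<dots> = (\<integral>\<^sup>+y. norm (?k (z - y) *\<^sub>R f y) \<partial>lborel)"
      by (simp add: nn_integral_completion)
    also have "\<dots> = (\<integral>\<^sup>+y. ennreal (?k (z - y)) * g y \<partial>lborel)"
      by (rule nn_integral_cong_AE) (use ae in eventually_elim, simp add: mollifier_nonneg e ennreal_mult)
    finally show ?thesis .
  qed
  have "(\<integral>\<^sup>+z. ennreal (norm (convol ?k f z)) \<partial>lborel)
      \<le> (\<integral>\<^sup>+z. (\<integral>\<^sup>+y. ennreal (?k (z - y)) * g y \<partial>lborel) \<partial>lborel)"
    by (intro nn_integral_mono le)
  also have "\<dots> = (\<integral>\<^sup>+y. (\<integral>\<^sup>+z. ennreal (?k (z - y)) * g y \<partial>lborel) \<partial>lborel)"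
    by (rule lborel_pair.Fubini'[symmetric]) (use g' in measurable)
  also have "\<dots> = (\<integral>\<^sup>+y. g y \<partial>lborel)"
    by (simp add: nn_integral_multc mollifier_nn_integral e)
  also have "\<dots> = (\<integral>\<^sup>+y. ennreal (norm (f y)) \<partial>lborel)"
    by (rule nn_integral_cong_AE) (use ae in eventually_elim, simp)
  also have "\<dots> = (\<integral>\<^sup>+y. ennreal (norm (f y)) \<partial>lebesgue)" by (simp add: nn_integral_completion)
  also have "\<dots> = ennreal (LINT y|lebesgue. norm (f y))"
    by (rule nn_integral_eq_integral) (use f in auto)
  finally have *: "(\<integral>\<^sup>+z. ennreal (norm (convol ?k f z)) \<partial>lebesgue) \<le> ennreal (LINT y|lebesgue. norm (f y))"
    by (simp add: nn_integral_completion)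
  show i: "integrable lebesgue (convol ?k f)"
    by (rule integrableI_bounded) (use continuous_measurable_lebesgue[OF c] * in \<open>auto intro: le_less_trans\<close>)
  have "ennreal (LINT z|lebesgue. norm (convol ?k f z)) = (\<integral>\<^sup>+z. ennreal (norm (convol ?k f z)) \<partial>lebesgue)"
    by (rule nn_integral_eq_integral[symmetric]) (use i in auto)
  with * have "ennreal (LINT z|lebesgue. norm (convol ?k f z)) \<le> ennreal (LINT z|lebesgue. norm (f z))"
    by simp
  then show "(LINT z|lebesgue. norm (convol ?k f z)) \<le> (LINT z|lebesgue. norm (f z))"
    by (subst (asm) ennreal_le_iff) (auto intro: integral_nonneg_AE)
qed

text \<open>Induction over integrable functions. For an indicator, a closed set inside and an open
  set outside leave a small gap, and an Urysohn function between them errs only on that gap.\<close>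

lemma L1_approx_continuous_integrable:
  fixes f :: "'a::euclidean_space \<Rightarrow> 'b::euclidean_space"
  assumes "integrable lebesgue f"
  shows "\<forall>e>0. \<exists>h. continuous_on UNIV h \<and> integrable lebesgue h \<and> (LINT z|lebesgue. norm (f z - h z)) < e"
  using assms
proof induction
  case (base A c)
  show ?case
  proof (intro allI impI)
    fix e :: real assume e: "e > 0"
    \<comment> \<open>Two gaps of measure below e' cost at most 2 e' norm c < e; the added 1 covers
      c = 0.\<close>
    define e' where "e' = e / (2 * (norm c + 1))"
    have e': "e' > 0" using e by (simp add: e'_def add_nonneg_pos)
    obtain T where T: "closed T" "T \<subseteq> A" "A - T \<in> lmeasurable" "emeasure lebesgue (A - T) < ennreal e'"
      using sets_lebesgue_inner_closed[OF base(1) e'] .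
    obtain U where U: "open U" "A \<subseteq> U" "U - A \<in> lmeasurable" "emeasure lebesgue (U - A) < ennreal e'"
      using sets_lebesgue_outer_open[OF base(1) e'] .
    have "A \<in> lmeasurable" using base by (auto simp: fmeasurable_def)
    then have Um: "U \<in> lmeasurable"
      using U by (metis Diff_partition fmeasurable.Un)
    obtain v :: "'a \<Rightarrow> real" where v: "continuous_on UNIV v" "\<And>x. v x \<in> closed_segment 1 0"
      "\<And>x. x \<in> T \<Longrightarrow> v x = 1" "\<And>x. x \<in> - U \<Longrightarrow> v x = 0"
      using Urysohn[of T "- U" 1 0] T U by auto
    have v01: "0 \<le> v x" "v x \<le> 1" for x
      using v(2)[of x] by (auto simp: closed_segment_eq_real_ivl)
    have iU: "integrable lebesgue (indicator U :: 'a \<Rightarrow> real)" using Um lmeasurable_iff_integrable by blast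
    have vm: "v \<in> borel_measurable lebesgue" using v(1) by (rule continuous_measurable_lebesgue)
    have iv: "integrable lebesgue v"
      by (rule Bochner_Integration.integrable_bound[OF iU vm])
         (use v01 v(4) in \<open>auto simp: indicator_def intro!: AE_I2\<close>)
    define W where "W = (U - A) \<union> (A - T)"
    have Wm: "W \<in> lmeasurable" unfolding W_def using U T by blast
    have "measure lebesgue W \<le> measure lebesgue (U - A) + measure lebesgue (A - T)"
      unfolding W_def by (rule measure_Un_le) (use U T in auto)
    moreover have "measure lebesgue (U - A) < e'" "measure lebesgue (A - T) < e'"
      using U T e' by (auto simp: emeasure_eq_measure2 ennreal_less_iff)
    ultimately have mW: "measure lebesgue W < 2 * e'" by simp
    have iW: "integrable lebesgue (indicator W :: 'a \<Rightarrow> real)" using Wm lmeasurable_iff_integrable by blast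
    have iA: "integrable lebesgue (indicator A :: 'a \<Rightarrow> real)" using \<open>A \<in> lmeasurable\<close> lmeasurable_iff_integrable by blast
    have "(LINT z|lebesgue. norm (indicator A z *\<^sub>R c - v z *\<^sub>R c)) \<le> (LINT z|lebesgue. indicator W z * norm c)"
    proof (rule integral_mono)
      fix z
      have "\<bar>indicator A z - v z\<bar> \<le> indicator W z"
        using v01[of z] v(3,4)[of z] T(2) U(2) by (auto simp: indicator_def W_def)
      then have "\<bar>indicator A z - v z\<bar> * norm c \<le> indicator W z * norm c"
        by (rule mult_right_mono) simp
      then show "norm (indicator A z *\<^sub>R c - v z *\<^sub>R c) \<le> indicator W z * norm c"
        by (simp add: scaleR_diff_left[symmetric])
    qed (use iv iA iW in auto)
    also have "\<dots> = measure lebesgue W * norm c" by simp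
    also have "\<dots> \<le> 2 * e' * norm c" using mW by (intro mult_right_mono) auto
    also have "\<dots> < e" using e by (simp add: e'_def field_simps add_nonneg_pos add_pos_nonneg)
    finally show "\<exists>h. continuous_on UNIV h \<and> integrable lebesgue h \<and> (LINT z|lebesgue. norm (indicator A z *\<^sub>R c - h z)) < e"
      using v(1) iv by (intro exI[of _ "\<lambda>z. v z *\<^sub>R c"]) (auto intro!: continuous_intros)
  qed
next
  case (add f g)
  show ?case
  proof (intro allI impI)
    fix e :: real assume e: "e > 0"
    obtain h where h: "continuous_on UNIV h" "integrable lebesgue h" "(LINT z|lebesgue. norm (f z - h z)) < e/2"
      using add.IH(1) e half_gt_zero by blast
    obtain k where k: "continuous_on UNIV k" "integrable lebesgue k" "(LINT z|lebesgue. norm (g z - k z)) < e/2"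
      using add.IH(2) e half_gt_zero by blast
    have "(LINT z|lebesgue. norm (f z + g z - (h z + k z))) \<le> (LINT z|lebesgue. norm (f z - h z) + norm (g z - k z))"
      by (rule integral_mono) (use add h k in \<open>auto intro: norm_diff_triangle_ineq\<close>)
    also have "\<dots> < e" using add h k by simp
    finally show "\<exists>h. continuous_on UNIV h \<and> integrable lebesgue h \<and> (LINT z|lebesgue. norm (f z + g z - h z)) < e"
      using h k by (intro exI[of _ "\<lambda>z. h z + k z"]) (auto intro!: continuous_intros)
  qed
next
  case (lim f s)
  show ?case
  proof (intro allI impI)
    fix e :: real assume e: "e > 0"
    \<comment> \<open>The majorant 3 norm f comes from the approximants, which satisfy norm (s i z)
      \<le> 2 norm (f z).\<close>
    have "(\<lambda>i. LINT z|lebesgue. norm (f z - s i z)) \<longlonglongrightarrow> (LINT z|(lebesgue::'a measure). (0::real))"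
    proof (rule integral_dominated_convergence[where w="\<lambda>z. 3 * norm (f z)"])
      show "integrable lebesgue (\<lambda>z. 3 * norm (f z))" using lim.hyps by simp
      show "(\<lambda>z. norm (f z - s i z)) \<in> borel_measurable lebesgue" for i
        using borel_measurable_integrable[OF lim.hyps(1)] borel_measurable_integrable[OF lim.hyps(4)] by measurable
      show "AE z in lebesgue. (\<lambda>i. norm (f z - s i z)) \<longlonglongrightarrow> 0"
      proof (intro AE_I2)
        fix z
        have "(\<lambda>i. norm (f z - s i z)) \<longlonglongrightarrow> norm (f z - f z)"
          by (intro tendsto_intros lim.hyps) auto
        then show "(\<lambda>i. norm (f z - s i z)) \<longlonglongrightarrow> 0" by simp
      qed
      show "AE z in lebesgue. norm (norm (f z - s i z)) \<le> 3 * norm (f z)" for i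
      proof (intro AE_I2)
        fix z
        show "norm (norm (f z - s i z)) \<le> 3 * norm (f z)"
          using norm_triangle_ineq4[of "f z" "s i z"] lim.hyps(3)[of z i] by simp
      qed
    qed simp
    then have "(\<lambda>i. LINT z|lebesgue. norm (f z - s i z)) \<longlonglongrightarrow> 0" by simp
    then have "\<forall>\<^sub>F i in sequentially. (LINT z|lebesgue. norm (f z - s i z)) < e/2"
      using e by (intro order_tendstoD) auto
    then obtain i where i: "(LINT z|lebesgue. norm (f z - s i z)) < e/2"
      using eventually_happens by force
    obtain h where h: "continuous_on UNIV h" "integrable lebesgue h" "(LINT z|lebesgue. norm (s i z - h z)) < e/2"
      using lim.IH e half_gt_zero by blast
    have "(LINT z|lebesgue. norm (f z - h z)) \<le> (LINT z|lebesgue. norm (f z - s i z) + norm (s i z - h z))"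
      by (rule integral_mono) (use lim.hyps h in \<open>auto intro: norm_diff_triangle_le\<close>)
    also have "\<dots> < e" using lim.hyps h i by simp
    finally show "\<exists>h. continuous_on UNIV h \<and> integrable lebesgue h \<and> (LINT z|lebesgue. norm (f z - h z)) < e"
      using h by blast
  qed
qed

text \<open>The continuous approximant is truncated by radial cutoffs that equal 1 up to radius i -
  1; dominated convergence makes the truncation error small.\<close>

lemma L1_approx_compact_support:
  fixes f :: "'a::euclidean_space \<Rightarrow> 'b::euclidean_space"
  assumes f: "integrable lebesgue f" and e: "e > 0"
  obtains h :: "'a \<Rightarrow> 'b" and r where "continuous_on UNIV h" "\<And>z::'a. norm z \<ge> r \<Longrightarrow> h z = 0" "integrable lebesgue h"
    "(LINT z|lebesgue. norm (f z - h z)) < e"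
proof -
  obtain h where h: "continuous_on UNIV h" "integrable lebesgue h" "(LINT z|lebesgue. norm (f z - h z)) < e/2"
    using L1_approx_continuous_integrable[OF f] e half_gt_zero by blast
  define c where "c i z = max 0 (min 1 (real i - norm z))" for i :: nat and z :: 'a
  have c01: "0 \<le> c i z" "c i z \<le> 1" for i z by (auto simp: c_def)
  have cc: "continuous_on UNIV (\<lambda>z. c i z *\<^sub>R h z)" for i
    unfolding c_def by (intro continuous_intros h)
  have ci: "integrable lebesgue (\<lambda>z. c i z *\<^sub>R h z)" for i
    by (rule Bochner_Integration.integrable_bound[OF h(2) continuous_measurable_lebesgue[OF cc]])
       (auto intro!: AE_I2 mult_left_le_one_le simp: c01)
  have "(\<lambda>i. LINT z|lebesgue. norm (h z - c i z *\<^sub>R h z)) \<longlonglongrightarrow> (LINT z|(lebesgue::'a measure). (0::real))"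
  proof (rule integral_dominated_convergence[where w="\<lambda>z. norm (h z)"])
    show "(\<lambda>z. norm (h z - c i z *\<^sub>R h z)) \<in> borel_measurable lebesgue" for i
      using borel_measurable_integrable[OF h(2)] borel_measurable_integrable[OF ci] by measurable
    show "AE z in lebesgue. (\<lambda>i. norm (h z - c i z *\<^sub>R h z)) \<longlonglongrightarrow> 0"
    proof (intro AE_I2 tendsto_eventually)
      fix z :: 'a
      obtain N :: nat where "norm z + 1 \<le> real N" using real_arch_simple by blast
      then show "\<forall>\<^sub>F i in sequentially. norm (h z - c i z *\<^sub>R h z) = 0"
        by (intro eventually_sequentiallyI[of N]) (auto simp: c_def)
    qed
    show "AE z in lebesgue. norm (norm (h z - c i z *\<^sub>R h z)) \<le> norm (h z)" for i
    proof (intro AE_I2)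
      fix z
      have "norm (h z - c i z *\<^sub>R h z) = (1 - c i z) * norm (h z)"
        using c01[of i z] by (metis abs_of_nonneg diff_ge_0_iff_ge norm_scaleR scaleR_diff_left scaleR_one)
      also have "\<dots> \<le> norm (h z)" using c01[of i z] by (intro mult_left_le_one_le) auto
      finally show "norm (norm (h z - c i z *\<^sub>R h z)) \<le> norm (h z)" by simp
    qed
  qed (use h in auto)
  then have "(\<lambda>i. LINT z|lebesgue. norm (h z - c i z *\<^sub>R h z)) \<longlonglongrightarrow> 0" by simp
  then have "\<forall>\<^sub>F i in sequentially. (LINT z|lebesgue. norm (h z - c i z *\<^sub>R h z)) < e/2"
    using e by (intro order_tendstoD) auto
  then obtain i where i: "(LINT z|lebesgue. norm (h z - c i z *\<^sub>R h z)) < e/2"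
    using eventually_happens by force
  show ?thesis
  proof
    show "continuous_on UNIV (\<lambda>z. c i z *\<^sub>R h z)" "integrable lebesgue (\<lambda>z. c i z *\<^sub>R h z)" by fact+
    show "norm z \<ge> real i \<Longrightarrow> c i z *\<^sub>R h z = 0" for z :: 'a by (auto simp: c_def)
    have "(LINT z|lebesgue. norm (f z - c i z *\<^sub>R h z)) \<le> (LINT z|lebesgue. norm (f z - h z) + norm (h z - c i z *\<^sub>R h z))"
      by (rule integral_mono) (use f h ci in \<open>auto intro: norm_diff_triangle_le\<close>)
    also have "\<dots> < e" using f h i ci by simp
    finally show "(LINT z|lebesgue. norm (f z - c i z *\<^sub>R h z)) < e" .
  qed
qed

lemma mollifier_integral_shift:
  fixes z :: "'a::euclidean_space"
  assumes "e > 0" shows "(LINT y|lebesgue. mollifier e (z - y)) = 1" "integrable lebesgue (\<lambda>y. mollifier e (z - y))"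
proof -
  show "(LINT y|lebesgue. mollifier e (z - y)) = 1"
    using lebesgue_integral_reflect[OF mollifier_continuous, of e z] mollifier_integral[OF assms] by simp
  show "integrable lebesgue (\<lambda>y. mollifier e (z - y))"
    by (rule integrable_lebesgue_compact_support[of _ "cball z e"])
       (use assms mollifier_Ck'[of 0 e z] in \<open>auto simp: dist_norm intro!: mollifier_eq_0\<close>)
qed

text \<open>Averaging against a probability kernel cannot leave a closed ball that contains all
  averaged values. With d = 0 this says that mollification keeps locally constant values, with c = 0
  that it keeps bounds.\<close>

lemma convol_mollifier_near:
  fixes h :: "'a::euclidean_space \<Rightarrow> 'b::euclidean_space"
  assumes e: "e > 0" and h: "integrable lebesgue h" and n: "\<And>y. norm (z - y) < e \<Longrightarrow> norm (h y - c) \<le> d"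
    and d: "d \<ge> 0"
  shows "norm (convol (mollifier e) h z - c) \<le> d"
proof -
  let ?k = "\<lambda>y. mollifier e (z - y)"
  note k = mollifier_integral_shift[OF e, of z]
  have "convol (mollifier e) h z - c = (LINT y|lebesgue. ?k y *\<^sub>R h y) - (LINT y|lebesgue. ?k y *\<^sub>R c)"
    using k by (simp add: convol_def)
  also have "\<dots> = (LINT y|lebesgue. ?k y *\<^sub>R h y - ?k y *\<^sub>R c)"
    by (rule Bochner_Integration.integral_diff[symmetric]) (use convol_mollifier_integrable[OF e h] k in auto)
  also have "norm \<dots> \<le> (LINT y|lebesgue. norm (?k y *\<^sub>R h y - ?k y *\<^sub>R c))"
    by (rule integral_norm_bound)
  also have "\<dots> \<le> (LINT y|lebesgue. ?k y * d)"
  proof (rule integral_mono)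
    show "integrable lebesgue (\<lambda>y. norm (?k y *\<^sub>R h y - ?k y *\<^sub>R c))"
      using convol_mollifier_integrable[OF e h] k by auto
    fix y
    show "norm (?k y *\<^sub>R h y - ?k y *\<^sub>R c) \<le> ?k y * d"
    proof (cases "norm (z - y) < e")
      case True
      then show ?thesis using n[OF True] mollifier_nonneg[OF e, of "z - y"]
        by (simp add: scaleR_diff_right[symmetric] mult_left_mono)
    qed (use mollifier_eq_0[OF e, of "z - y"] in auto)
  qed (use k in auto)
  also have "\<dots> = d" using k by simp
  finally show ?thesis .
qed

lemma convol_diff:
  fixes f g :: "'a::euclidean_space \<Rightarrow> 'b::euclidean_space"
  assumes "e > 0" "integrable lebesgue f" "integrable lebesgue g"
  shows "convol (mollifier e) (\<lambda>y. f y - g y) z = convol (mollifier e) f z - convol (mollifier e) g z"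
  unfolding convol_def scaleR_diff_right
  by (rule Bochner_Integration.integral_diff) (auto intro!: convol_mollifier_integrable assms)

text \<open>Three-term estimate: the compactly supported approximant h is uniformly continuous near
  its support, so its mollification is uniformly close to it; the error f - h is controlled in L1
  before and after mollification.\<close>

lemma convol_L1_tendsto:
  fixes f :: "'a::euclidean_space \<Rightarrow> 'b::euclidean_space"
  assumes f: "integrable lebesgue f" and eps: "eps > 0"
  obtains \<delta> where "\<delta> > 0"
    "\<And>e. 0 < e \<Longrightarrow> e < \<delta> \<Longrightarrow> (LINT z|lebesgue. norm (convol (mollifier e) f z - f z)) < eps"
proof -
  obtain h r where h: "continuous_on UNIV h" "\<And>z. norm z \<ge> r \<Longrightarrow> h z = 0" "integrable lebesgue h"
    "(LINT z|lebesgue. norm (f z - h z)) < eps/3"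
    using L1_approx_compact_support[OF f, of "eps/3"] eps by auto
  \<comment> \<open>V is the volume of a ball outside which h and its mollification both vanish, so
    a uniform error d costs at most d V < eps/3.\<close>
  define V where "V = measure lebesgue (cball (0::'a) (r + 2))"
  define d where "d = eps / (3 * (V + 1))"
  have V: "V \<ge> 0" by (simp add: V_def)
  have d: "d > 0" using eps V by (simp add: d_def)
  have "uniformly_continuous_on (cball 0 (r + 2)) h"
    by (rule compact_uniformly_continuous) (auto intro: continuous_on_subset[OF h(1)])
  then obtain \<delta>' where \<delta>': "\<delta>' > 0" "\<And>x y. x \<in> cball 0 (r + 2) \<Longrightarrow> y \<in> cball 0 (r + 2) \<Longrightarrow> dist y x < \<delta>' \<Longrightarrow> dist (h y) (h x) < d"
    using d unfolding uniformly_continuous_on_def by metis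
  define \<delta> where "\<delta> = min 1 \<delta>'"
  have near: "norm (h y - h z) \<le> d * indicator (cball 0 (r + 2)) z" if "norm (z - y) < \<delta>" for y z
  proof -
    have yz: "norm y \<le> norm z + 1" "norm z \<le> norm y + 1" "dist y z < \<delta>'"
      using that norm_triangle_ineq2[of y z] norm_triangle_ineq2[of z y]
      by (auto simp: \<delta>_def dist_norm norm_minus_commute)
    consider "norm z \<le> r + 1" | "r + 1 < norm z" "norm z \<le> r + 2" | "r + 2 < norm z" by linarith
    then show ?thesis
    proof cases
      case 1
      then show ?thesis using \<delta>'(2)[of z y] yz by (simp add: dist_norm)
    next
      case 2
      then show ?thesis using yz d h(2)[of z] h(2)[of y] by simp
    next
      case 3
      then show ?thesis using yz d h(2)[of z] h(2)[of y] by simp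
    qed
  qed
  show ?thesis
  proof (rule that[of \<delta>])
    show "\<delta> > 0" using \<delta>' by (simp add: \<delta>_def)
    fix e :: real assume e: "0 < e" "e < \<delta>"
    let ?m = "convol (mollifier e)"
    note i = convol_L1_bound(1)[OF e(1)]
    have nb: "norm (?m h z - h z) \<le> d * indicator (cball 0 (r + 2)) z" for z
      by (rule convol_mollifier_near[OF e(1) h(3)]) (use near e d in auto)
    have "integrable lebesgue (indicator (cball 0 (r + 2)) :: 'a \<Rightarrow> real)"
      using lmeasurable_iff_integrable lmeasurable_cball by blast
    have "(LINT z|lebesgue. norm (?m h z - h z)) \<le> (LINT z|lebesgue. d * indicator (cball (0::'a) (r + 2)) z)"
      by (rule integral_mono[OF _ _ nb])
         (use i[OF h(3)] h \<open>integrable lebesgue (indicator (cball 0 (r + 2)) :: 'a \<Rightarrow> real)\<close> in \<open>auto simp del: integrable_indicator_iff\<close>)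
    also have "\<dots> = d * V" by (simp add: V_def)
    also have "\<dots> < eps/3" using eps V by (simp add: d_def field_simps)
    finally have 1: "(LINT z|lebesgue. norm (?m h z - h z)) < eps/3" .
    have 2: "(LINT z|lebesgue. norm (?m f z - ?m h z)) < eps/3"
      using convol_L1_bound(2)[OF e(1), of "\<lambda>z. f z - h z"] f h by (simp add: convol_diff e)
    have "(LINT z|lebesgue. norm (?m f z - f z)) \<le>
       (LINT z|lebesgue. norm (?m f z - ?m h z) + norm (?m h z - h z) + norm (f z - h z))"
    proof (rule integral_mono)
      fix z
      show "norm (?m f z - f z) \<le> norm (?m f z - ?m h z) + norm (?m h z - h z) + norm (f z - h z)"
        using norm_triangle_ineq[of "?m f z - ?m h z" "?m h z - h z"]
          norm_triangle_ineq4[of "?m f z - h z" "f z - h z"] by simp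
    qed (use f h i[OF f] i[OF h(3)] in auto)
    also have "\<dots> < eps" using 1 2 h f i[OF f] i[OF h(3)] by simp
    finally show "(LINT z|lebesgue. norm (?m f z - f z)) < eps" .
  qed
qed

text \<open>Radii with L1 errors below 2^(-k) make the sum of the errors integrable. This yields
  both almost everywhere convergence, as for the terms of a convergent series, and the majorant norm
  f plus that sum.\<close>

lemma convol_AE_dominated_sequence:
  fixes f :: "'a::euclidean_space \<Rightarrow> 'b::euclidean_space"
  assumes f: "integrable lebesgue f" and e0: "e0 > 0"
  obtains e G where "\<And>k::nat. 0 < e k \<and> e k < e0" "e \<longlonglongrightarrow> 0" "integrable lebesgue G"
    "AE z in lebesgue. \<forall>k. norm (convol (mollifier (e k)) f z) \<le> G z"
    "AE z in lebesgue. (\<lambda>k. convol (mollifier (e k)) f z) \<longlonglongrightarrow> f z"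
proof -
  have "\<exists>e. 0 < e \<and> e < e0 \<and> e < 1 / Suc k \<and> (LINT z|lebesgue. norm (convol (mollifier e) f z - f z)) < (1/2)^k" for k :: nat
  proof -
    obtain \<delta> where \<delta>: "\<delta> > 0" "\<And>e. 0 < e \<Longrightarrow> e < \<delta> \<Longrightarrow> (LINT z|lebesgue. norm (convol (mollifier e) f z - f z)) < (1/2)^k"
      using convol_L1_tendsto[OF f, of "(1/2)^k"] by auto
    have "0 < min e0 (min (1 / Suc k) \<delta>)" using e0 \<delta> by simp
    then obtain e where "0 < e" "e < min e0 (min (1 / Suc k) \<delta>)" using dense by blast
    then show ?thesis using \<delta> by (intro exI[of _ e]) auto
  qed
  then obtain e where e: "\<And>k::nat. 0 < e k" "\<And>k. e k < e0" "\<And>k. e k < 1 / Suc k"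
    "\<And>k. (LINT z|lebesgue. norm (convol (mollifier (e k)) f z - f z)) < (1/2)^k" by metis
  define D where "D k z = norm (convol (mollifier (e k)) f z - f z)" for k z
  have Di: "integrable lebesgue (D k)" for k
    unfolding D_def using convol_L1_bound(1)[OF e(1) f] f by auto
  have [measurable]: "D k \<in> borel_measurable lebesgue" for k
    using Di borel_measurable_integrable by blast
  have D0: "D k z \<ge> 0" for k z by (simp add: D_def)
  have "(\<integral>\<^sup>+z. (\<Sum>k. ennreal (D k z)) \<partial>lebesgue) = (\<Sum>k. \<integral>\<^sup>+z. ennreal (D k z) \<partial>lebesgue)"
    by (rule nn_integral_suminf) measurable
  also have "\<dots> \<le> (\<Sum>k. ennreal ((1/2)^k))"
  proof (rule suminf_le)
    fix k
    have "(\<integral>\<^sup>+z. ennreal (D k z) \<partial>lebesgue) = ennreal (LINT z|lebesgue. D k z)"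
      by (rule nn_integral_eq_integral[OF Di]) (simp add: D0)
    then show "(\<integral>\<^sup>+z. ennreal (D k z) \<partial>lebesgue) \<le> ennreal ((1/2)^k)"
      using e(4)[of k] by (simp add: D_def ennreal_leI)
  qed auto
  also have "\<dots> < \<infinity>"
    by (subst suminf_ennreal_eq[OF _ geometric_sums]) auto
  finally have fin: "(\<integral>\<^sup>+z. (\<Sum>k. ennreal (D k z)) \<partial>lebesgue) < \<infinity>" .
  have AEfin: "AE z in lebesgue. (\<Sum>k. ennreal (D k z)) \<noteq> \<infinity>"
    by (rule nn_integral_noteq_infinite) (use fin in auto)
  define S where "S z = enn2real (\<Sum>k. ennreal (D k z))" for z
  have Sm: "S \<in> borel_measurable lebesgue" unfolding S_def by measurable
  have "(\<integral>\<^sup>+z. ennreal (norm (S z)) \<partial>lebesgue) \<le> (\<integral>\<^sup>+z. (\<Sum>k. ennreal (D k z)) \<partial>lebesgue)"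
    by (rule nn_integral_mono) (simp add: S_def enn2real_nonneg ennreal_enn2real_if)
  then have Si: "integrable lebesgue S"
    using fin Sm by (intro integrableI_bounded) (auto intro: le_less_trans)
  have good: "summable (\<lambda>k. D k z) \<and> (\<forall>k. D k z \<le> S z)" if "(\<Sum>k. ennreal (D k z)) \<noteq> \<infinity>" for z
  proof -
    have s: "summable (\<lambda>k. D k z)" using that D0 by (intro summable_suminf_not_top) auto
    then have "S z = (\<Sum>k. D k z)"
      unfolding S_def by (subst suminf_ennreal2) (auto simp: D0 suminf_nonneg)
    then show ?thesis using s sum_le_suminf[OF s, of "{k}" for k] D0 by auto
  qed
  show ?thesis
  proof (rule that[of e "\<lambda>z. norm (f z) + S z"])
    show "0 < e k \<and> e k < e0" for k using e by simp
    show "e \<longlonglongrightarrow> 0"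
      by (rule tendsto_sandwich[OF _ _ tendsto_const LIMSEQ_inverse_real_of_nat])
         (use e(1,3) in \<open>auto intro!: always_eventually less_imp_le simp: inverse_eq_divide\<close>)
    show "integrable lebesgue (\<lambda>z. norm (f z) + S z)" using f Si by simp
    show "AE z in lebesgue. \<forall>k. norm (convol (mollifier (e k)) f z) \<le> norm (f z) + S z"
      using AEfin
    proof eventually_elim
      case (elim z)
      then have "D k z \<le> S z" for k using good by blast
      then show ?case
        unfolding D_def using norm_triangle_sub order_trans add_left_mono by metis
    qed
    show "AE z in lebesgue. (\<lambda>k. convol (mollifier (e k)) f z) \<longlonglongrightarrow> f z"
      using AEfin
    proof eventually_elim
      case (elim z)
      then have "(\<lambda>k. D k z) \<longlonglongrightarrow> 0" using good summable_LIMSEQ_zero by blast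
      then show ?case unfolding D_def using LIM_zero_cancel tendsto_norm_zero_iff by blast
    qed
  qed
qed

section \<open>Weak solutions\<close>

lemma lebesgue_measurable_AE_cong:
  fixes f g :: "'a::euclidean_space \<Rightarrow> 'b::topological_space"
  assumes "AE z in lebesgue. f z = g z" "f \<in> borel_measurable lebesgue"
  shows "g \<in> borel_measurable lebesgue"
proof (rule measurableI)
  fix S :: "'b set" assume "S \<in> sets borel"
  then have m: "f -` S \<inter> space lebesgue \<in> sets lebesgue" using assms(2) by (rule measurable_sets[rotated])
  have "AE z in lebesgue. z \<in> f -` S \<inter> space lebesgue \<longleftrightarrow> z \<in> g -` S \<inter> space lebesgue"
    using assms(1) by eventually_elim simp
  then show "g -` S \<inter> space lebesgue \<in> sets lebesgue"
    using m by (rule completion.in_sets_AE) simp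
qed simp

text \<open>Completeness makes measurability insensitive to null sets. If f is not measurable then
  neither is g, and both integrals take the default value 0.\<close>

lemma lebesgue_integral_AE_cong:
  fixes f g :: "'a::euclidean_space \<Rightarrow> 'b::euclidean_space"
  assumes "AE z in lebesgue. f z = g z"
  shows "integral\<^sup>L lebesgue f = integral\<^sup>L lebesgue g"
proof (cases "f \<in> borel_measurable lebesgue")
  case True
  then show ?thesis
    using lebesgue_measurable_AE_cong[OF assms] assms by (intro integral_cong_AE) auto
next
  case False
  have "AE z in lebesgue. g z = f z" using assms by eventually_elim simp
  then have "g \<notin> borel_measurable lebesgue" using lebesgue_measurable_AE_cong False by blast
  then show ?thesis
    using False borel_measurable_integrable not_integrable_integral_eq by metis
qed

lemma lebesgue_integrable_AE_cong:
  fixes f g :: "'a::euclidean_space \<Rightarrow> 'b::euclidean_space"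
  assumes "AE z in lebesgue. f z = g z" "integrable lebesgue f"
  shows "integrable lebesgue g"
proof (rule integrable_cong_AE_imp[OF assms(2)])
  show "g \<in> borel_measurable lebesgue"
    using lebesgue_measurable_AE_cong[OF assms(1) borel_measurable_integrable[OF assms(2)]] .
qed (use assms(1) in auto)

text \<open>Simple functions reduce the composition to finitely many constant arguments, and
  continuity in the second variable passes to the limit. Setting A to 0 where continuity fails makes
  that limit hold at every point.\<close>

lemma caratheodory_measurable:
  fixes A :: "'a::euclidean_space \<Rightarrow> 'b::euclidean_space \<Rightarrow> 'b"
  assumes S: "S \<in> sets lebesgue"
    and A: "\<And>\<xi>. set_borel_measurable lebesgue S (\<lambda>z. A z \<xi>)"
    and c: "AE z in lebesgue. z \<in> S \<longrightarrow> continuous_on UNIV (A z)"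
    and f: "f \<in> borel_measurable lebesgue"
  shows "set_borel_measurable lebesgue S (\<lambda>z. A z (f z))"
proof -
  define N where "N = {z. z \<in> S \<longrightarrow> continuous_on UNIV (A z)}"
  define B where "B z \<xi> = (if z \<in> N then indicator S z *\<^sub>R A z \<xi> else 0)" for z \<xi>
  have Bm: "(\<lambda>z. B z \<xi>) \<in> borel_measurable lebesgue" for \<xi>
  proof (rule lebesgue_measurable_AE_cong)
    show "(\<lambda>z. indicator S z *\<^sub>R A z \<xi>) \<in> borel_measurable lebesgue"
      using A by (simp add: set_borel_measurable_def)
    show "AE z in lebesgue. indicator S z *\<^sub>R A z \<xi> = B z \<xi>"
      using c by eventually_elim (auto simp: B_def N_def)
  qed
  obtain s where s: "\<And>i. simple_function lebesgue (s i)" "\<And>x. (\<lambda>i. s i x) \<longlonglongrightarrow> f x"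
    using borel_measurable_implies_sequence_metric[OF f] by force
  have m: "(\<lambda>z. B z (s i z)) \<in> borel_measurable lebesgue" for i
  proof (rule measurable_compose_countable'[where I="range (s i)" and f="\<lambda>\<xi> z. B z \<xi>"])
    show "s i \<in> lebesgue \<rightarrow>\<^sub>M count_space (range (s i))"
      using measurable_simple_function[OF s(1)[of i]] by (rule measurable_count_space_extend[rotated 2]) auto
    show "countable (range (s i))"
      using simple_functionD(1)[OF s(1)[of i]] by (simp add: countable_finite)
  qed (rule Bm)
  have l: "(\<lambda>i. B z (s i z)) \<longlonglongrightarrow> B z (f z)" for z
  proof (cases "z \<in> N \<and> z \<in> S")
    case True
    then have "isCont (A z) (f z)" by (simp add: N_def continuous_on_eq_continuous_at)
    then show ?thesis using True isCont_tendsto_compose[OF _ s(2)] by (simp add: B_def)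
  qed (auto simp: B_def)
  have "(\<lambda>z. B z (f z)) \<in> borel_measurable lebesgue"
    by (rule borel_measurable_LIMSEQ_metric[OF m l])
  then have "(\<lambda>z. indicator S z *\<^sub>R A z (f z)) \<in> borel_measurable lebesgue"
    by (rule lebesgue_measurable_AE_cong[rotated]) (use c in eventually_elim, auto simp: B_def N_def)
  then show ?thesis by (simp add: set_borel_measurable_def)
qed

section \<open>Uniqueness and gluing of weak gradients\<close>

lemma test_fun_mono: "test_fun V \<phi> \<Longrightarrow> V \<subseteq> W \<Longrightarrow> test_fun W \<phi>"
  by (auto simp: test_fun_def)

lemma test_fun_C1: "test_fun V \<phi> \<Longrightarrow> C1 \<phi>"
  using smooth_fun_def test_fun_def by blast

lemma outside_tsupp: "z \<notin> tsupp \<phi> \<Longrightarrow> \<phi> z = 0"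
  using closure_subset[THEN subsetD, of z "{x. \<phi> x \<noteq> 0}"] by (auto simp: tsupp_def)

lemma closed_tsupp: "closed (tsupp \<phi>)"
  by (simp add: tsupp_def)

lemma pd_outside_tsupp: "z \<notin> tsupp \<phi> \<Longrightarrow> pd v \<phi> z = 0"
  by (rule pd_eq_0_outside[OF closed_tsupp outside_tsupp])

text \<open>Fundamental lemma of the calculus of variations: kernels of small radius around z are
  test functions on V, so the mollifications of f at z are eventually 0, while they converge to f
  almost everywhere.\<close>

lemma AE_zero_of_test_fun:
  fixes f :: "'a::euclidean_space \<Rightarrow> real"
  assumes V: "open V" and f: "set_integrable lebesgue V f"
    and 0: "\<And>\<phi>. test_fun V \<phi> \<Longrightarrow> (LINT z:V|lebesgue. f z * \<phi> z) = 0"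
  shows "AE z in lebesgue. z \<in> V \<longrightarrow> f z = 0"
proof -
  define F where "F z = indicator V z *\<^sub>R f z" for z
  have Fi: "integrable lebesgue F" using f by (simp add: set_integrable_def F_def[abs_def])
  obtain e G where e': "\<And>k::nat. 0 < e k \<and> e k < 1" and e: "e \<longlonglongrightarrow> 0" "integrable lebesgue G"
    "AE z in lebesgue. \<forall>k. norm (convol (mollifier (e k)) F z) \<le> G z"
    "AE z in lebesgue. (\<lambda>k. convol (mollifier (e k)) F z) \<longlonglongrightarrow> F z"
    using convol_AE_dominated_sequence[OF Fi zero_less_one] by blast
  show ?thesis
    using e(4)
  proof eventually_elim
    case (elim z)
    show ?case
    proof
      assume z: "z \<in> V"
      then obtain r where r: "r > 0" "cball z r \<subseteq> V" using V open_contains_cball by blast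
      have "\<forall>\<^sub>F k in sequentially. e k < r" using e(1) r(1) by (intro order_tendstoD) auto
      then have "\<forall>\<^sub>F k in sequentially. convol (mollifier (e k)) F z = 0"
      proof eventually_elim
        case (elim k)
        then have "cball z (e k) \<subseteq> V" using r(2) by auto
        from 0[OF mollifier_test_fun[OF conjunct1[OF e'] this]]
        show ?case by (simp add: convol_def F_def set_lebesgue_integral_def mult_ac)
      qed
      then have "(\<lambda>k. convol (mollifier (e k)) F z) \<longlonglongrightarrow> 0" by (rule tendsto_eventually)
      then have "F z = 0" using elim LIMSEQ_unique by blast
      then show "f z = 0" using z by (simp add: F_def)
    qed
  qed
qed

lemma set_integrable_of_Lp:
  fixes f :: "'a::euclidean_space \<Rightarrow> 'b::euclidean_space"
  assumes "Lp_on p V f" "p \<ge> 1" "V \<in> lmeasurable"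
  shows "set_integrable lebesgue V f"
  unfolding set_integrable_def
proof (rule Bochner_Integration.integrable_bound)
  have "integrable lebesgue (indicator V :: 'a \<Rightarrow> real)" using assms(3) lmeasurable_iff_integrable by blast
  then show "integrable lebesgue (\<lambda>z. indicator V z + indicator V z * norm (f z) powr p)"
    using assms(1) unfolding Lp_on_def set_integrable_def by auto
  show "(\<lambda>z. indicator V z *\<^sub>R f z) \<in> borel_measurable lebesgue"
    using assms(1) by (simp add: Lp_on_def set_borel_measurable_def)
  have "x \<le> 1 + x powr p" if "x \<ge> 0" for x :: real
  proof (cases "x \<le> 1")
    case False
    then have "x powr 1 \<le> x powr p" using assms(2) by (intro powr_mono) auto
    then show ?thesis using False by simp
  qed (simp add: add_increasing2)
  then show "AE z in lebesgue. norm (indicator V z *\<^sub>R f z) \<le> norm (indicator V z + indicator V z * norm (f z) powr p)"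
    by (auto simp: indicator_def intro!: AE_I2)
qed

lemma open_bounded_lmeasurable: "open V \<Longrightarrow> bounded V \<Longrightarrow> V \<in> lmeasurable"
  by (simp add: bounded_set_imp_lmeasurable)

text \<open>The components of g - h annihilate every test function on the overlap. This consistency
  is what allows gradients given on separate cylinders to be glued.\<close>

lemma weak_xgrad_unique:
  fixes V W :: "((real^'n) \<times> real) set"
  assumes V: "open V" "bounded V" and W: "open W" "bounded W" and p: "p \<ge> 1"
    and g: "Lp_on p V g" "weak_xgrad V u g" and h: "Lp_on p W h" "weak_xgrad W u h"
  shows "AE z in lebesgue. z \<in> V \<inter> W \<longrightarrow> g z = h z"
proof -
  have si: "set_integrable lebesgue V g" "set_integrable lebesgue W h"
    using set_integrable_of_Lp g h p V W open_bounded_lmeasurable by blast+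
  have VW: "V \<inter> W \<in> sets lebesgue" using V W by (simp add: open_Int)
  have "AE z in lebesgue. z \<in> V \<inter> W \<longrightarrow> g z $ i - h z $ i = 0" for i
  proof (rule AE_zero_of_test_fun)
    show "open (V \<inter> W)" using V W by auto
    have "set_integrable lebesgue (V \<inter> W) g" "set_integrable lebesgue (V \<inter> W) h"
      using si VW by (auto intro: set_integrable_subset)
    then have s: "set_integrable lebesgue (V \<inter> W) (\<lambda>z. g z $ i)" "set_integrable lebesgue (V \<inter> W) (\<lambda>z. h z $ i)"
      unfolding set_integrable_def
      using integrable_bounded_linear[OF bounded_linear_vec_nth[of i]] by force+
    then show "set_integrable lebesgue (V \<inter> W) (\<lambda>z. g z $ i - h z $ i)" by auto
    fix \<phi> :: "(real^'n) \<times> real \<Rightarrow> real" assume \<phi>: "test_fun (V \<inter> W) \<phi>"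
    have out: "z \<notin> V \<inter> W \<Longrightarrow> \<phi> z = 0" "z \<notin> V \<inter> W \<Longrightarrow> xpart \<phi> i z = 0" for z
      using \<phi> outside_tsupp[of z \<phi>] pd_outside_tsupp[of z \<phi>] by (auto simp: test_fun_def xpart_def)
    have tV: "test_fun V \<phi>" and tW: "test_fun W \<phi>" using \<phi> test_fun_mono by blast+
    have eq: "(LINT z:V|lebesgue. k z * \<psi> z) = (LINT z:V \<inter> W|lebesgue. k z * \<psi> z)"
      "(LINT z:W|lebesgue. k z * \<psi> z) = (LINT z:V \<inter> W|lebesgue. k z * \<psi> z)"
      if "\<And>z. z \<notin> V \<inter> W \<Longrightarrow> \<psi> z = 0" for k \<psi> :: "(real^'n) \<times> real \<Rightarrow> real"
      unfolding set_lebesgue_integral_def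
      by (rule Bochner_Integration.integral_cong; use that in \<open>force simp: indicator_def\<close>)+
    have "(LINT z:V \<inter> W|lebesgue. g z $ i * \<phi> z) = (LINT z:V \<inter> W|lebesgue. h z $ i * \<phi> z)"
      using g(2)[unfolded weak_xgrad_def, rule_format, OF tV, of i]
        h(2)[unfolded weak_xgrad_def, rule_format, OF tW, of i]
        eq[OF out(1)] eq[OF out(2)] by simp
    moreover have "set_integrable lebesgue (V \<inter> W) (\<lambda>z. k z * \<phi> z)" if "set_integrable lebesgue (V \<inter> W) k"
      for k :: "(real^'n) \<times> real \<Rightarrow> real"
    proof -
      have c: "continuous_on UNIV \<phi>" using C1_continuous test_fun_C1 tV by blast
      have "\<And>z. z \<notin> tsupp \<phi> \<Longrightarrow> \<phi> z = 0" by (rule outside_tsupp)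
      moreover have "compact (tsupp \<phi>)" using tV by (simp add: test_fun_def)
      ultimately obtain B where B: "\<And>z. \<bar>\<phi> z\<bar> \<le> B" using bounded_compact_support[OF c] by metis
      have ki: "integrable lebesgue (\<lambda>z. indicator (V \<inter> W) z *\<^sub>R k z)" using that by (simp add: set_integrable_def)
      have "integrable lebesgue (\<lambda>z. (indicator (V \<inter> W) z *\<^sub>R k z) * \<phi> z)"
      proof (rule Bochner_Integration.integrable_bound)
        show "integrable lebesgue (\<lambda>z. B * norm (indicator (V \<inter> W) z *\<^sub>R k z))" using ki by simp
        show "(\<lambda>z. (indicator (V \<inter> W) z *\<^sub>R k z) * \<phi> z) \<in> borel_measurable lebesgue"
          using borel_measurable_integrable[OF ki] continuous_measurable_lebesgue[OF c] by (rule borel_measurable_times)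
        have "norm ((indicator (V \<inter> W) z *\<^sub>R k z) * \<phi> z) \<le> norm (B * norm (indicator (V \<inter> W) z *\<^sub>R k z))" for z
          using mult_left_mono[OF order_trans[OF B[of z] abs_ge_self], of "norm (indicator (V \<inter> W) z *\<^sub>R k z)"]
          by (simp add: abs_mult mult_ac)
        then show "AE z in lebesgue. norm ((indicator (V \<inter> W) z *\<^sub>R k z) * \<phi> z) \<le> norm (B * norm (indicator (V \<inter> W) z *\<^sub>R k z))"
          by simp
      qed
      then show ?thesis by (simp add: set_integrable_def mult_ac)
    qed
    ultimately show "(LINT z:V \<inter> W|lebesgue. (g z $ i - h z $ i) * \<phi> z) = 0"
      using s by (simp add: left_diff_distrib)
  qed
  then have "AE z in lebesgue. \<forall>i\<in>UNIV. z \<in> V \<inter> W \<longrightarrow> g z $ i - h z $ i = 0"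
    by (intro AE_finite_allI) auto
  then show ?thesis by eventually_elim (auto simp: vec_eq_iff)
qed

text \<open>The definition of weak solution speaks only of cylinders compactly contained in U, so
  each point needs one. Radius e/3 suffices because a distance is at most the sum of its spatial and
  temporal parts.\<close>

lemma small_cylinder:
  fixes z :: "(real^'n) \<times> real"
  assumes "open U" "z \<in> U"
  obtains r where "r > 0" "closure (ball (fst z) r \<times> {snd z - r<..<snd z + r}) \<subseteq> U"
    "compact (closure (ball (fst z) r \<times> {snd z - r<..<snd z + r}))"
proof -
  obtain e where e: "e > 0" "ball z e \<subseteq> U" using assms open_contains_ball by blast
  define r where "r = e/3"
  have r: "r > 0" using e by (simp add: r_def)
  have cl: "closure (ball (fst z) r \<times> {snd z - r<..<snd z + r}) = cball (fst z) r \<times> {snd z - r..snd z + r}"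
    using r by (simp add: closure_Times)
  have "cball (fst z) r \<times> {snd z - r..snd z + r} \<subseteq> ball z e"
  proof
    fix w assume "w \<in> cball (fst z) r \<times> {snd z - r..snd z + r}"
    then have "dist (fst z) (fst w) \<le> r" "dist (snd z) (snd w) \<le> r" by (auto simp: dist_real_def)
    then have "dist z w \<le> r + r"
      unfolding dist_prod_def using sqrt_sum_squares_le_sum[of "dist (fst z) (fst w)" "dist (snd z) (snd w)"] by simp
    then show "w \<in> ball z e" using r by (simp add: r_def)
  qed
  then have "closure (ball (fst z) r \<times> {snd z - r<..<snd z + r}) \<subseteq> U" using cl e by blast
  moreover have "compact (closure (ball (fst z) r \<times> {snd z - r<..<snd z + r}))"
    unfolding cl by (intro compact_Times) auto
  ultimately show ?thesis using that r by blast
qed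

text \<open>\<open>weak_solution\<close> provides a gradient for each cylinder, without relating
  them. A countable subcover and uniqueness on overlaps produce one measurable g that serves locally
  everywhere.\<close>

lemma weak_solution_global_gradient:
  fixes U :: "((real^'n) \<times> real) set"
  assumes U: "open U" and p: "p \<ge> 1" and w: "weak_solution p A u U"
  obtains g where "g \<in> borel_measurable lebesgue"
    "\<And>z. z \<in> U \<Longrightarrow> \<exists>W. open W \<and> z \<in> W \<and> W \<subseteq> U \<and> set_integrable lebesgue W (\<lambda>z. norm (g z) powr p) \<and>
       weak_xgrad W u g \<and>
       (\<forall>\<phi>. test_fun W \<phi> \<longrightarrow> (LINT z:W|lebesgue. - u z * tpart \<phi> z + A z (g z) \<bullet> xgrad \<phi> z) = 0)"
proof (cases "U = {}")
  case True
  then show ?thesis using that[of "\<lambda>_. 0"] by simp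
next
  case False
  define good where "good W g \<longleftrightarrow> Lp_on p W g \<and> weak_xgrad W u g \<and>
     (\<forall>\<phi>. test_fun W \<phi> \<longrightarrow> (LINT z:W|lebesgue. - u z * tpart \<phi> z + A z (g z) \<bullet> xgrad \<phi> z) = 0)" for W g
  define Fam where "Fam = {W. open W \<and> bounded W \<and> W \<subseteq> U \<and> Ex (good W)}"
  have "U \<subseteq> \<Union>Fam"
  proof
    fix z assume z: "z \<in> U"
    obtain r where r: "r > 0" "closure (ball (fst z) r \<times> {snd z - r<..<snd z + r}) \<subseteq> U"
      "compact (closure (ball (fst z) r \<times> {snd z - r<..<snd z + r}))" using small_cylinder[OF U z] by blast
    let ?W = "ball (fst z) r \<times> {snd z - r<..<snd z + r}"
    have "Ex (good ?W)"
      using w[unfolded weak_solution_def, rule_format, of "ball (fst z) r" "snd z - r" "snd z + r"] r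
      unfolding good_def by auto
    moreover have "open ?W" "bounded ?W" by (auto intro!: open_Times bounded_Times)
    moreover have "?W \<subseteq> U" by (rule order_trans[OF closure_subset r(2)])
    ultimately have "?W \<in> Fam" unfolding Fam_def by blast
    moreover have "z \<in> ?W" using r(1) by (cases z) auto
    ultimately show "z \<in> \<Union>Fam" by blast
  qed
  then have UF: "\<Union>Fam = U" by (auto simp: Fam_def)
  have op: "\<And>W. W \<in> Fam \<Longrightarrow> open W" by (simp add: Fam_def)
  obtain F' where F'0: "F' \<subseteq> Fam" "countable F'" "\<Union>F' = \<Union>Fam"
    using Lindelof[OF op] by metis
  then have F': "F' \<subseteq> Fam" "countable F'" "\<Union>F' = U" by (simp_all add: UF)
  then have ne: "F' \<noteq> {}" using False by auto
  define C where "C = from_nat_into F'"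
  have C: "range C = F'" unfolding C_def using F'(2) ne by (simp add: range_from_nat_into)
  then have CF: "C k \<in> Fam" for k using F'(1) C by (metis rangeI subsetD)
  then have "\<exists>g. good (C k) g" for k unfolding Fam_def by simp
  then obtain G where G: "\<And>k. good (C k) (G k)" by metis
  have Co: "open (C k)" "bounded (C k)" "C k \<subseteq> U" for k using CF[of k] unfolding Fam_def by simp_all
  have Cs: "C k \<in> sets lebesgue" for k using Co(1) by simp
  have UC: "U = (\<Union>k. C k)" using C F'(3) by simp
  \<comment> \<open>The least index of a member containing z is a measurable choice, since every
    \<open>C k\<close> is measurable.\<close>
  define idx where "idx z = (LEAST k. z \<in> C k)" for z
  have idx: "z \<in> C (idx z)" if "z \<in> U" for z
    using that unfolding UC idx_def by (auto intro: LeastI)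
  define g where "g z = indicator (C (idx z)) z *\<^sub>R G (idx z) z" for z
  have gm: "g \<in> borel_measurable lebesgue" unfolding g_def
  proof (rule measurable_compose_countable'[where I=UNIV and f="\<lambda>k z. indicator (C k) z *\<^sub>R G k z"])
    show "(\<lambda>z. indicator (C k) z *\<^sub>R G k z) \<in> borel_measurable lebesgue" for k
      using G[of k] by (simp add: good_def Lp_on_def set_borel_measurable_def)
    show "idx \<in> lebesgue \<rightarrow>\<^sub>M count_space UNIV"
      unfolding idx_def by (rule measurable_Least) (use Cs in \<open>simp add: pred_def\<close>)
  qed auto
  have "AE z in lebesgue. \<forall>k l. z \<in> C k \<inter> C l \<longrightarrow> G k z = G l z"
    unfolding AE_all_countable using weak_xgrad_unique[OF Co(1,2) Co(1,2) p] G unfolding good_def by blast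
  then have ae: "AE z in lebesgue. \<forall>k. z \<in> C k \<longrightarrow> G k z = g z"
  proof eventually_elim
    case (elim z)
    show ?case
    proof (intro allI impI)
      fix k assume k: "z \<in> C k"
      then have "z \<in> C (idx z)" using idx Co(3) by (meson subsetD)
      then show "G k z = g z" using elim[rule_format, of k "idx z"] k by (simp add: g_def)
    qed
  qed
  show ?thesis
  proof (rule that[OF gm])
    fix z assume "z \<in> U"
    then obtain k where k: "z \<in> C k" unfolding UC by (elim UN_E)
    have cong: "(LINT z:C k|lebesgue. h z (G k z)) = (LINT z:C k|lebesgue. h z (g z))" for h :: "(real^'n) \<times> real \<Rightarrow> real^'n \<Rightarrow> real"
      unfolding set_lebesgue_integral_def
      by (rule lebesgue_integral_AE_cong) (use ae in eventually_elim, auto simp: indicator_def)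
    have "set_integrable lebesgue (C k) (\<lambda>z. norm (G k z) powr p)" using G[of k] by (simp add: good_def Lp_on_def)
    moreover have "AE z in lebesgue. indicator (C k) z *\<^sub>R norm (G k z) powr p = indicator (C k) z *\<^sub>R norm (g z) powr p"
      using ae by eventually_elim (auto simp: indicator_def)
    ultimately have "set_integrable lebesgue (C k) (\<lambda>z. norm (g z) powr p)"
      unfolding set_integrable_def
      by (rule lebesgue_integrable_AE_cong[rotated])
    moreover have "weak_xgrad (C k) u g"
      using G[of k] cong[of "\<lambda>z w. w $ i * \<phi> z" for i \<phi>] by (simp add: good_def weak_xgrad_def)
    moreover have "(LINT z:C k|lebesgue. - u z * tpart \<phi> z + A z (g z) \<bullet> xgrad \<phi> z) = 0" if "test_fun (C k) \<phi>" for \<phi>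
      using G[of k] cong[of "\<lambda>z w. - u z * tpart \<phi> z + A z w \<bullet> xgrad \<phi> z"] that by (simp add: good_def)
    ultimately show "\<exists>W. open W \<and> z \<in> W \<and> W \<subseteq> U \<and> set_integrable lebesgue W (\<lambda>z. norm (g z) powr p) \<and>
       weak_xgrad W u g \<and>
       (\<forall>\<phi>. test_fun W \<phi> \<longrightarrow> (LINT z:W|lebesgue. - u z * tpart \<phi> z + A z (g z) \<bullet> xgrad \<phi> z) = 0)"
      using Co k by (intro exI[of _ "C k"]) blast
  qed
qed

section \<open>Local mollification of a weak solution\<close>

lemma powr_mult_le_sum_powr:
  fixes x y :: real
  assumes "x \<ge> 0" "y \<ge> 0" "p \<ge> 1"
  shows "x powr (p - 1) * y \<le> x powr p + y powr p"
proof -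
  have e: "t powr (p - 1) * t = t powr p" if "t \<ge> 0" for t :: real
    using that powr_mult_base[of t "p - 1"] by (cases "t = 0") (auto simp: mult.commute)
  show ?thesis
  proof (cases "y \<le> x")
    case True
    then have "x powr (p - 1) * y \<le> x powr (p - 1) * x" by (intro mult_left_mono) auto
    then show ?thesis using e[OF assms(1)] powr_ge_zero[of y p] by linarith
  next
    case False
    then have "x powr (p - 1) * y \<le> y powr (p - 1) * y"
      using assms by (intro mult_right_mono powr_mono2) auto
    then show ?thesis using e[OF assms(2)] powr_ge_zero[of x p] by linarith
  qed
qed

text \<open>Packing several functions into one vector-valued function lets a single sequence of
  mollification radii serve all of them.\<close>

lemma integrable_Pair:
  fixes f :: "'a::euclidean_space \<Rightarrow> 'b::euclidean_space" and g :: "'a \<Rightarrow> 'c::euclidean_space"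
  assumes "integrable lebesgue f" "integrable lebesgue g"
  shows "integrable lebesgue (\<lambda>z. (f z, g z))"
proof (rule Bochner_Integration.integrable_bound)
  show "integrable lebesgue (\<lambda>z. norm (f z) + norm (g z))" using assms by simp
  show "(\<lambda>z. (f z, g z)) \<in> borel_measurable lebesgue"
    using assms by (intro borel_measurable_Pair) auto
  show "AE z in lebesgue. norm (f z, g z) \<le> norm (norm (f z) + norm (g z))"
    using norm_Pair_le by (auto intro!: AE_I2)
qed

lemma norm_fst_snd_le: "norm (fst x) \<le> norm x" "norm (snd x) \<le> norm x"
  by (cases x; simp add: norm_fst_le norm_snd_le)+

lemma convol_bounded_linear:
  fixes f :: "'a::euclidean_space \<Rightarrow> 'b::euclidean_space" and T :: "'b \<Rightarrow> 'c::euclidean_space"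
  assumes T: "bounded_linear T" and e: "e > 0" and f: "integrable lebesgue f"
  shows "convol (mollifier e) (\<lambda>y. T (f y)) z = T (convol (mollifier e) f z)"
proof -
  interpret bounded_linear T by fact
  have "convol (mollifier e) (\<lambda>y. T (f y)) z = (LINT y|lebesgue. T (mollifier e (z - y) *\<^sub>R f y))"
    by (simp add: convol_def scaleR)
  also have "\<dots> = T (convol (mollifier e) f z)"
    unfolding convol_def by (rule integral_bounded_linear[OF T convol_mollifier_integrable[OF e f]])
  finally show ?thesis .
qed

lemma mollifier_outside: "e > 0 \<Longrightarrow> w \<notin> cball 0 e \<Longrightarrow> mollifier e w = 0"
  by (rule mollifier_eq_0) auto

lemma pd_mollifier_outside: "e > 0 \<Longrightarrow> w \<notin> cball 0 e \<Longrightarrow> pd v (mollifier e) w = 0"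
  by (rule pd_eq_0_outside[OF closed_cball mollifier_outside])

lemma pd_mollifier_reflect: "pd v (\<lambda>y. mollifier e (z - y)) y = - pd v (mollifier e) (z - y)"
proof -
  have "((\<lambda>y. mollifier e (z - y)) has_derivative (\<lambda>v. pd (- v) (mollifier e) (z - y))) (at y)"
    by (rule has_derivative_compose[where f="\<lambda>y. z - y" and f'="\<lambda>v. - v" and g="mollifier e"])
       (auto intro!: derivative_eq_intros C1_has_derivative[OF mollifier_C1])
  then have "pd v (\<lambda>y. mollifier e (z - y)) y = pd (- v) (mollifier e) (z - y)" by (rule pd_eq)
  also have "\<dots> = - pd v (mollifier e) (z - y)"
    using linear_neg[OF has_derivative_linear[OF C1_has_derivative[OF mollifier_C1]]] .
  finally show ?thesis .
qed

text \<open>Here a stands for the flux A z (g z); its measurability and growth are recorded, and the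
  nonlinearity itself is forgotten. Measurability of u is a condition on the whole space, whereas
  continuity is one on U.\<close>

locale weak_local =
  fixes p L :: real and U :: "((real^'n) \<times> real) set" and u :: "(real^'n) \<times> real \<Rightarrow> real"
    and g a :: "(real^'n) \<times> real \<Rightarrow> real^'n"
  assumes U: "open U" and u: "continuous_on U u" and p: "p \<ge> 1" and L: "L \<ge> 0"
    and um: "u \<in> borel_measurable lebesgue"
    and gm: "g \<in> borel_measurable lebesgue" and am: "a \<in> borel_measurable lebesgue"
    and growth: "AE z in lebesgue. z \<in> U \<longrightarrow> norm (a z) \<le> L * norm (g z) powr (p - 1)"
    and loc: "\<And>z. z \<in> U \<Longrightarrow> \<exists>W. open W \<and> z \<in> W \<and> W \<subseteq> U \<and> set_integrable lebesgue W (\<lambda>z. norm (g z) powr p) \<and>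
       weak_xgrad W u g \<and>
       (\<forall>\<phi>. test_fun W \<phi> \<longrightarrow> (LINT z:W|lebesgue. - u z * tpart \<phi> z + a z \<bullet> xgrad \<phi> z) = 0)"
begin

definition good :: "((real^'n) \<times> real) set \<Rightarrow> bool" where
  "good W \<longleftrightarrow> open W \<and> W \<subseteq> U \<and> set_integrable lebesgue W (\<lambda>z. norm (g z) powr p) \<and>
       weak_xgrad W u g \<and>
       (\<forall>\<phi>. test_fun W \<phi> \<longrightarrow> (LINT z:W|lebesgue. - u z * tpart \<phi> z + a z \<bullet> xgrad \<phi> z) = 0)"

lemma compact_integrable:
  assumes K: "compact K" "K \<subseteq> U"
  shows "set_integrable lebesgue K (\<lambda>z. norm (g z) powr p)"
proof -
  have o: "\<And>W. W \<in> Collect good \<Longrightarrow> open W" by (simp add: good_def)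
  have "K \<subseteq> \<Union>(Collect good)"
  proof
    fix z assume "z \<in> K"
    then have "z \<in> U" using K by blast
    from loc[OF this] show "z \<in> \<Union>(Collect good)" unfolding good_def by blast
  qed
  then obtain F where F: "F \<subseteq> Collect good" "finite F" "K \<subseteq> \<Union>F"
    using compactE[OF K(1) _ o] by metis
  have Fi: "set_integrable lebesgue W (\<lambda>z. norm (g z) powr p)" if "W \<in> F" for W
    using F(1) that unfolding good_def by blast
  have nm: "(\<lambda>z. norm (g z)) \<in> borel_measurable lebesgue" using gm by measurable
  show ?thesis unfolding set_integrable_def
  proof (rule Bochner_Integration.integrable_bound)
    show "integrable lebesgue (\<lambda>z. \<Sum>W\<in>F. indicator W z *\<^sub>R norm (g z) powr p)"
      using Fi unfolding set_integrable_def by (intro Bochner_Integration.integrable_sum)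
    show "(\<lambda>z. indicator K z *\<^sub>R norm (g z) powr p) \<in> borel_measurable lebesgue"
      using fmeasurableD[OF lmeasurable_compact[OF K(1)]]
      by (intro borel_measurable_scaleR borel_measurable_indicator powr_real_measurable
          borel_measurable_const nm)
    show "AE z in lebesgue. norm (indicator K z *\<^sub>R norm (g z) powr p)
       \<le> norm (\<Sum>W\<in>F. indicator W z *\<^sub>R norm (g z) powr p)"
    proof (intro AE_I2)
      fix z
      show "norm (indicator K z *\<^sub>R norm (g z) powr p) \<le> norm (\<Sum>W\<in>F. indicator W z *\<^sub>R norm (g z) powr p)"
      proof (cases "z \<in> K")
        case True
        then obtain W where W: "W \<in> F" "z \<in> W" using F(3) by blast
        have "indicator W z *\<^sub>R norm (g z) powr p \<le> (\<Sum>W\<in>F. indicator W z *\<^sub>R norm (g z) powr p)"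
          by (rule member_le_sum[OF W(1)]) (use F in auto)
        then show ?thesis using True W(2) by simp
      qed simp
    qed
  qed
qed

text \<open>Testing with mollifier kernels yields, pointwise on K, that the spatial gradient of u_k
  is g_k and its time derivative is the divergence of a_k. The delicate point is an integrable
  majorant for the product of a_k and g_k; it comes from mollifying norm g powr p along with the
  rest.\<close>

lemma approximation:
  assumes K: "compact K" "K \<subseteq> U"
  obtains uk :: "nat \<Rightarrow> (real^'n) \<times> real \<Rightarrow> real" and gk ak :: "nat \<Rightarrow> (real^'n) \<times> real \<Rightarrow> real^'n"
    and B :: real and G :: "(real^'n) \<times> real \<Rightarrow> real"
  where "\<And>k. C1 (uk k)" "\<And>k i. C1 (\<lambda>z. ak k z $ i)" "\<And>k. continuous_on UNIV (gk k)" "\<And>k. continuous_on UNIV (ak k)"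
    "\<And>k i z. z \<in> K \<Longrightarrow> pd (axis i 1, 0) (uk k) z = gk k z $ i"
    "\<And>k z. z \<in> K \<Longrightarrow> pd (0, 1) (uk k) z = (\<Sum>i\<in>UNIV. pd (axis i 1, 0) (\<lambda>z. ak k z $ i) z)"
    "\<And>k z. \<bar>uk k z\<bar> \<le> B" "integrable lebesgue G" "0 \<le> B"
    "AE z in lebesgue. \<forall>k. norm (gk k z) \<le> G z \<and> norm (ak k z) \<le> G z \<and> norm (ak k z) * norm (gk k z) \<le> G z"
    "AE z in lebesgue. z \<in> K \<longrightarrow> (\<lambda>k. uk k z) \<longlonglongrightarrow> u z"
    "AE z in lebesgue. z \<in> K \<longrightarrow> (\<lambda>k. gk k z) \<longlonglongrightarrow> g z"
    "AE z in lebesgue. z \<in> K \<longrightarrow> (\<lambda>k. ak k z) \<longlonglongrightarrow> a z"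
proof -
  have o: "\<And>W. W \<in> Collect good \<Longrightarrow> open W" by (simp add: good_def)
  have cov: "K \<subseteq> \<Union>(Collect good)"
  proof
    fix z assume "z \<in> K"
    then have "z \<in> U" using K by blast
    from loc[OF this] show "z \<in> \<Union>(Collect good)" unfolding good_def by blast
  qed
  \<comment> \<open>A Lebesgue number of the cover: around every point of K the ball of this radius
    lies in a set where the weak identities hold.\<close>
  obtain e' where e': "e' > 0" "\<And>z. z \<in> K \<Longrightarrow> \<exists>W\<in>Collect good. ball z e' \<subseteq> W"
    using Heine_Borel_lemma[OF K(1) cov o] by metis
  define e0 where "e0 = e' / 2"
  have e0: "e0 > 0" using e' by (simp add: e0_def)
  have W: "\<exists>W. good W \<and> cball z e0 \<subseteq> W" if "z \<in> K" for z
  proof -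
    have "cball z e0 \<subseteq> ball z e'" using e' by (auto simp: e0_def)
    then show ?thesis using e'(2)[OF that] by (metis mem_Collect_eq order_trans)
  qed
  \<comment> \<open>The closed e0-neighbourhood of K. Truncating to it makes all functions
    integrable and does not alter the mollifications at points of K.\<close>
  define K' where "K' = (\<lambda>(x, y). x + y) ` (K \<times> cball 0 e0)"
  have K'c: "compact K'" unfolding K'_def
    by (intro compact_continuous_image compact_Times K)
       (auto simp: split_beta intro!: continuous_intros)
  have inK': "cball z e0 \<subseteq> K'" if "z \<in> K" for z
  proof
    fix y assume "y \<in> cball z e0"
    then have "(z, y - z) \<in> K \<times> cball 0 e0" using that by (auto simp: dist_norm norm_minus_commute)
    then show "y \<in> K'" unfolding K'_def by (rule rev_image_eqI) simp
  qed
  have K'U: "K' \<subseteq> U"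
  proof
    fix y assume "y \<in> K'"
    then obtain x h where xh: "y = x + h" "x \<in> K" "h \<in> cball 0 e0" unfolding K'_def by auto
    then have "y \<in> cball x e0" by (simp add: dist_norm)
    then show "y \<in> U" using W[OF xh(2)] unfolding good_def by blast
  qed
  have K's: "K' \<in> sets lebesgue" using fmeasurableD[OF lmeasurable_compact[OF K'c]] .
  have Kin: "K \<subseteq> K'" using inK' e0 by (meson centre_in_cball less_imp_le subset_iff)
  define u0 where "u0 z = indicator K' z *\<^sub>R u z" for z
  define g0 where "g0 z = indicator K' z *\<^sub>R g z" for z
  define a0 where "a0 z = indicator K' z *\<^sub>R a z" for z
  define P0 where "P0 z = indicator K' z *\<^sub>R norm (g z) powr p" for z
  have g0m: "g0 \<in> borel_measurable lebesgue" and a0m: "a0 \<in> borel_measurable lebesgue"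
    unfolding g0_def[abs_def] a0_def[abs_def] using gm am K's by measurable
  have P0i: "integrable lebesgue P0"
    using compact_integrable[OF K'c K'U] by (simp add: P0_def[abs_def] set_integrable_def)
  have indi: "integrable lebesgue (indicator K' :: (real^'n) \<times> real \<Rightarrow> real)"
    using lmeasurable_compact[OF K'c] lmeasurable_iff_integrable by blast
  have P0g: "P0 z = norm (g0 z) powr p" for z by (auto simp: P0_def g0_def indicator_def)
  have g0i: "integrable lebesgue g0"
  proof (rule Bochner_Integration.integrable_bound[OF _ g0m])
    show "integrable lebesgue (\<lambda>z. indicator K' z + P0 z)" using P0i indi by simp
    have "norm (g0 z) \<le> indicator K' z + P0 z" for z
      using powr_mult_le_sum_powr[of 1 "norm (g z)" p] p by (auto simp: g0_def P0_def indicator_def)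
    then show "AE z in lebesgue. norm (g0 z) \<le> norm (indicator K' z + P0 z)"
      by (smt (verit) AE_I2 norm_ge_zero real_norm_def)
  qed
  have gr: "AE z in lebesgue. norm (a0 z) \<le> L * norm (g0 z) powr (p - 1)"
    using growth by eventually_elim (use K'U in \<open>auto simp: a0_def g0_def indicator_def\<close>)
  have a0i: "integrable lebesgue a0"
  proof (rule Bochner_Integration.integrable_bound[OF _ a0m])
    show "integrable lebesgue (\<lambda>z. L * (indicator K' z + P0 z))" using P0i indi by simp
    show "AE z in lebesgue. norm (a0 z) \<le> norm (L * (indicator K' z + P0 z))"
      using gr
    proof eventually_elim
      case (elim z)
      have "norm (g0 z) powr (p - 1) * 1 \<le> P0 z + 1"
        using powr_mult_le_sum_powr[of "norm (g0 z)" 1 p] p by (simp add: P0g)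
      moreover have "norm (a0 z) = 0" if "z \<notin> K'" using that by (simp add: a0_def)
      moreover have "P0 z \<ge> 0" by (simp add: P0_def)
      ultimately have "norm (a0 z) \<le> L * (indicator K' z + P0 z)"
        using elim mult_left_mono[of "norm (g0 z) powr (p - 1)" "1 + P0 z" L] L
        by (cases "z \<in> K'") auto
      then show ?case by (metis abs_ge_self order_trans real_norm_def)
    qed
  qed
  obtain B0 where B0: "\<And>z. z \<in> K' \<Longrightarrow> \<bar>u z\<bar> \<le> B0"
  proof -
    have "compact (u ` K')" using K'c K'U u by (auto intro: compact_continuous_image continuous_on_subset)
    then obtain b where "\<forall>x\<in>u ` K'. norm x \<le> b" using compact_imp_bounded bounded_iff by blast
    then show ?thesis using that by auto
  qed
  define B where "B = max 0 B0"
  have B: "\<bar>u0 z\<bar> \<le> B" "B \<ge> 0" for z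
    using B0[of z] by (cases "z \<in> K'"; simp add: u0_def B_def)+
  have u0i: "integrable lebesgue u0"
  proof -
    have "integrable lborel (\<lambda>z. indicator K' z *\<^sub>R u z)"
      by (rule borel_integrable_compact[OF K'c continuous_on_subset[OF u K'U]])
    then show ?thesis unfolding u0_def[abs_def] using borel_measurable_integrable integrable_completion by blast
  qed
  define F where "F z = (u0 z, g0 z, a0 z, P0 z)" for z
  have Fi: "integrable lebesgue F" unfolding F_def[abs_def]
    by (intro integrable_Pair u0i g0i a0i P0i)
  obtain e GF where ek: "\<And>k::nat. 0 < e k \<and> e k < e0" and e: "e \<longlonglongrightarrow> 0" "integrable lebesgue GF"
    "AE z in lebesgue. \<forall>k. norm (convol (mollifier (e k)) F z) \<le> GF z"
    "AE z in lebesgue. (\<lambda>k. convol (mollifier (e k)) F z) \<longlonglongrightarrow> F z"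
    using convol_AE_dominated_sequence[OF Fi e0] by blast
  have ep: "e k > 0" for k using ek by blast
  define cv where "cv k z = convol (mollifier (e k)) F z" for k z
  have cv: "cv k z = (convol (mollifier (e k)) u0 z, convol (mollifier (e k)) g0 z,
      convol (mollifier (e k)) a0 z, convol (mollifier (e k)) P0 z)" for k z
  proof -
    note c = convol_bounded_linear[OF _ ep Fi, of _ k z, symmetric, folded cv_def]
    have "fst (cv k z) = convol (mollifier (e k)) u0 z"
      using c[OF bounded_linear_fst] by (simp add: F_def)
    moreover have "fst (snd (cv k z)) = convol (mollifier (e k)) g0 z"
      using c[OF bounded_linear_fst_comp[OF bounded_linear_snd]] by (simp add: F_def)
    moreover have "fst (snd (snd (cv k z))) = convol (mollifier (e k)) a0 z"
      using c[OF bounded_linear_fst_comp[OF bounded_linear_snd_comp[OF bounded_linear_snd]]] by (simp add: F_def)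
    moreover have "snd (snd (snd (cv k z))) = convol (mollifier (e k)) P0 z"
      using c[OF bounded_linear_snd_comp[OF bounded_linear_snd_comp[OF bounded_linear_snd]]] by (simp add: F_def)
    ultimately show ?thesis by (metis prod.collapse)
  qed
  define uk where "uk k = convol (mollifier (e k)) u0" for k
  define gk where "gk k = convol (mollifier (e k)) g0" for k
  define ak where "ak k = convol (mollifier (e k)) a0" for k
  define Pk where "Pk k = convol (mollifier (e k)) P0" for k
  have comp: "convol (mollifier (e k)) (\<lambda>y. f y $ i) z = convol (mollifier (e k)) f z $ i"
    if "integrable lebesgue f" for f :: "(real^'n) \<times> real \<Rightarrow> real^'n" and k z i
    by (rule convol_bounded_linear[OF bounded_linear_vec_nth ep that])
  have compi: "integrable lebesgue (\<lambda>y. f y $ i)" if "integrable lebesgue f" for f :: "(real^'n) \<times> real \<Rightarrow> real^'n" and i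
    by (rule integrable_bounded_linear[OF bounded_linear_vec_nth that])
  have conv: "C1 (convol (mollifier (e k)) f)"
    "pd v (convol (mollifier (e k)) f) z = convol (pd v (mollifier (e k))) f z"
    if "integrable lebesgue f" for f :: "(real^'n) \<times> real \<Rightarrow> real" and k v z
  proof -
    have o: "w \<notin> cball 0 (e k) \<Longrightarrow> mollifier (e k) w = 0" for w :: "(real^'n) \<times> real"
      by (rule mollifier_outside[OF ep])
    show "C1 (convol (mollifier (e k)) f)"
      "pd v (convol (mollifier (e k)) f) z = convol (pd v (mollifier (e k))) f z"
      using convol_C1[OF mollifier_C1 compact_cball o that] by blast+
  qed
  have testK: "test_fun W (\<lambda>y. mollifier (e k) (z - y))" if "cball z e0 \<subseteq> W" for W z k
    using that ek[of k] by (intro mollifier_test_fun) auto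
  have supp: "y \<in> cball z e0" if "mollifier (e k) (z - y) \<noteq> 0 \<or> pd v (mollifier (e k)) (z - y) \<noteq> 0" for y z k v
  proof (rule ccontr)
    assume "y \<notin> cball z e0"
    then have "norm (z - y) > e0" by (simp add: dist_norm)
    then have "z - y \<notin> cball 0 (e k)" using ek[of k] by (simp add: norm_minus_commute)
    then show False
      using that mollifier_outside[OF ep, of "z - y" k] pd_mollifier_outside[OF ep, of "z - y" k v] by blast
  qed
  \<comment> \<open>By growth, norm (a0 y) norm (g0 x) \<le> L (P0 y + P0 x) for independent points
    x and y. Averaging over both against the kernel bounds the product of the two mollifications by
    2 L \<open>Pk\<close>.\<close>
  have Pk2: "norm (ak k z) * norm (gk k z) \<le> 2 * L * Pk k z" for k z
  proof -
    let ?m = "\<lambda>y. mollifier (e k) (z - y)"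
    note ms = mollifier_integral_shift[OF ep, of k z]
    have mi: "integrable lebesgue (\<lambda>y. ?m y * f y)" if "integrable lebesgue f" for f
      using convol_mollifier_integrable[OF ep that] by simp
    have Pke: "Pk k z = (LINT y|lebesgue. ?m y * P0 y)" by (simp add: Pk_def convol_def)
    have "norm (gk k z) \<le> (LINT y|lebesgue. norm (?m y *\<^sub>R g0 y))"
      unfolding gk_def convol_def by (rule integral_norm_bound)
    then have t: "norm (gk k z) \<le> (LINT y|lebesgue. ?m y * norm (g0 y))"
      by (simp add: mollifier_nonneg ep)
    have ay: "norm (a0 y) * norm (gk k z) \<le> L * (P0 y + Pk k z)"
      if "norm (a0 y) \<le> L * norm (g0 y) powr (p - 1)" for y
    proof -
      have "norm (a0 y) * norm (gk k z) \<le> L * norm (g0 y) powr (p - 1) * (LINT x|lebesgue. ?m x * norm (g0 x))"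
        by (rule mult_mono[OF that t]) (use L in auto)
      also have "\<dots> = (LINT x|lebesgue. ?m x * (L * (norm (g0 y) powr (p - 1) * norm (g0 x))))"
        by (subst integral_mult_right_zero[symmetric]) (simp add: mult_ac)
      also have "\<dots> \<le> (LINT x|lebesgue. ?m x * (L * (P0 y + P0 x)))"
      proof (rule integral_mono)
        show "integrable lebesgue (\<lambda>x. ?m x * (L * (norm (g0 y) powr (p - 1) * norm (g0 x))))"
          by (intro mi integrable_mult_right integrable_norm g0i)
        show "integrable lebesgue (\<lambda>x. ?m x * (L * (P0 y + P0 x)))"
          using ms(2) mi[OF P0i] by (simp add: algebra_simps) 
        fix x
        show "?m x * (L * (norm (g0 y) powr (p - 1) * norm (g0 x))) \<le> ?m x * (L * (P0 y + P0 x))"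
          using powr_mult_le_sum_powr[of "norm (g0 y)" "norm (g0 x)" p] p L
          by (intro mult_left_mono mollifier_nonneg ep) (auto simp: P0g)
      qed
      also have "\<dots> = (LINT x|lebesgue. L * P0 y * ?m x + L * (?m x * P0 x))"
        by (simp add: algebra_simps)
      also have "\<dots> = L * (P0 y + Pk k z)"
        using ms mi[OF P0i] by (simp add: Pke algebra_simps)
      finally show ?thesis .
    qed
    have "norm (ak k z) \<le> (LINT y|lebesgue. norm (?m y *\<^sub>R a0 y))"
      unfolding ak_def convol_def by (rule integral_norm_bound)
    then have "norm (ak k z) * norm (gk k z) \<le> (LINT y|lebesgue. ?m y * norm (a0 y)) * norm (gk k z)"
      by (intro mult_right_mono) (simp_all add: mollifier_nonneg ep)
    also have "\<dots> = (LINT y|lebesgue. ?m y * (norm (a0 y) * norm (gk k z)))"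
      by (subst integral_mult_left_zero[symmetric]) (simp add: mult_ac)
    also have "\<dots> \<le> (LINT y|lebesgue. ?m y * (L * (P0 y + Pk k z)))"
    proof (rule integral_mono_AE)
      show "integrable lebesgue (\<lambda>y. ?m y * (norm (a0 y) * norm (gk k z)))"
        by (intro mi integrable_mult_left integrable_norm a0i)
      show "integrable lebesgue (\<lambda>y. ?m y * (L * (P0 y + Pk k z)))"
        using ms(2) mi[OF P0i] by (simp add: algebra_simps)
      show "AE y in lebesgue. ?m y * (norm (a0 y) * norm (gk k z)) \<le> ?m y * (L * (P0 y + Pk k z))"
        using gr by eventually_elim (intro mult_left_mono mollifier_nonneg ep ay)
    qed
    also have "\<dots> = (LINT y|lebesgue. L * (?m y * P0 y) + L * Pk k z * ?m y)"
      by (simp add: algebra_simps)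
    also have "\<dots> = 2 * L * Pk k z"
      using ms mi[OF P0i] by (simp add: Pke algebra_simps)
    finally show ?thesis .
  qed
  show ?thesis
  proof (rule that[of uk ak gk B "\<lambda>z. (1 + 2 * L) * GF z"])
    fix k i z
    show "C1 (uk k)" unfolding uk_def by (rule conv(1)[OF u0i])
    have akc: "(\<lambda>z. ak k z $ i) = convol (mollifier (e k)) (\<lambda>y. a0 y $ i)" for i
      by (simp add: ak_def comp[OF a0i] fun_eq_iff)
    show "C1 (\<lambda>z. ak k z $ i)" unfolding akc by (rule conv(1)[OF compi[OF a0i]])
    show "continuous_on UNIV (gk k)" "continuous_on UNIV (ak k)"
      unfolding gk_def ak_def by (intro convol_mollifier_continuous ep g0i a0i)+
    show "\<bar>uk k z\<bar> \<le> B"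
      using convol_mollifier_near[OF ep u0i, of z k 0 B] B by (simp add: uk_def)
    assume z: "z \<in> K"
    obtain W where W: "good W" "cball z e0 \<subseteq> W" using W[OF z] by blast
    let ?\<phi> = "\<lambda>y. mollifier (e k) (z - y)"
    have in_both: "indicator W y = (1::real)" "indicator K' y = (1::real)"
      if "mollifier (e k) (z - y) \<noteq> 0 \<or> pd v (mollifier (e k)) (z - y) \<noteq> 0" for y v
      using supp[OF that] W(2) inK'[OF z] by auto
    have u1: "(LINT y:W|lebesgue. u y * pd v ?\<phi> y) = - pd v (uk k) z" for v
    proof -
      have "(LINT y:W|lebesgue. u y * pd v ?\<phi> y) = (LINT y|lebesgue. - (pd v (mollifier (e k)) (z - y) * u0 y))"
        unfolding set_lebesgue_integral_def pd_mollifier_reflect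
        by (rule Bochner_Integration.integral_cong) (use in_both[of _ v] in \<open>force simp: u0_def\<close>)+
      then show ?thesis unfolding uk_def conv(2)[OF u0i] by (simp add: convol_def)
    qed
    have "(LINT y:W|lebesgue. g y $ i * ?\<phi> y) = convol (mollifier (e k)) (\<lambda>y. g0 y $ i) z"
      unfolding set_lebesgue_integral_def convol_def
      by (rule Bochner_Integration.integral_cong) (use in_both in \<open>force simp: g0_def\<close>)+
    then have "(LINT y:W|lebesgue. g y $ i * ?\<phi> y) = gk k z $ i" by (simp add: comp[OF g0i] gk_def)
    moreover have "(LINT y:W|lebesgue. u y * pd (axis i 1, 0) ?\<phi> y) = - (LINT y:W|lebesgue. g y $ i * ?\<phi> y)"
      using W(1) testK[OF W(2)] unfolding good_def weak_xgrad_def xpart_def by blast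
    ultimately show "pd (axis i 1, 0) (uk k) z = gk k z $ i" using u1 by simp
    have ki: "integrable lebesgue (\<lambda>y. pd v (mollifier (e k)) (z - y) * f y)" if f: "integrable lebesgue f" for f :: "(real^'n) \<times> real \<Rightarrow> real" and v
    proof -
      have c: "continuous_on UNIV (pd v (mollifier (e k)))" by (rule C1_pd_continuous[OF mollifier_C1])
      obtain b where "\<And>w. \<bar>pd v (mollifier (e k)) w\<bar> \<le> b"
        using bounded_compact_support[OF c compact_cball pd_mollifier_outside[OF ep]] by blast
      from convol_integrable[OF c this f] show ?thesis by simp
    qed
    have "0 = (LINT y:W|lebesgue. - u y * tpart ?\<phi> y + a y \<bullet> xgrad ?\<phi> y)"
      using W(1) testK[OF W(2)] unfolding good_def by simp
    also have "\<dots> = (LINT y|lebesgue. pd (0, 1) (mollifier (e k)) (z - y) * u0 y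
        - (\<Sum>i\<in>UNIV. pd (axis i 1, 0) (mollifier (e k)) (z - y) * a0 y $ i))"
      unfolding set_lebesgue_integral_def
    proof (rule Bochner_Integration.integral_cong[OF refl])
      fix y
      have 1: "indicator W y * (u y * pd (0, 1) (mollifier (e k)) (z - y)) = pd (0, 1) (mollifier (e k)) (z - y) * u0 y"
        using in_both[of y "(0, 1)"] by (cases "pd (0, 1) (mollifier (e k)) (z - y) = 0") (auto simp: u0_def)
      have 2: "indicator W y * (a y $ i * pd (axis i 1, 0) (mollifier (e k)) (z - y)) = pd (axis i 1, 0) (mollifier (e k)) (z - y) * a0 y $ i" for i
        using in_both[of y "(axis i 1, 0)"] by (cases "pd (axis i 1, 0) (mollifier (e k)) (z - y) = 0") (auto simp: a0_def)
      show "indicator W y *\<^sub>R (- u y * tpart ?\<phi> y + a y \<bullet> xgrad ?\<phi> y) = pd (0, 1) (mollifier (e k)) (z - y) * u0 y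
        - (\<Sum>i\<in>UNIV. pd (axis i 1, 0) (mollifier (e k)) (z - y) * a0 y $ i)"
        unfolding 1[symmetric] 2[symmetric]
        by (simp add: tpart_def xgrad_def xpart_def inner_vec_def pd_mollifier_reflect algebra_simps sum_negf sum_distrib_left)
    qed
    also have "\<dots> = convol (pd (0, 1) (mollifier (e k))) u0 z
        - (\<Sum>i\<in>UNIV. convol (pd (axis i 1, 0) (mollifier (e k))) (\<lambda>y. a0 y $ i) z)"
      using ki[OF u0i] ki[OF compi[OF a0i]] by (simp add: convol_def)
    also have "\<dots> = pd (0, 1) (uk k) z - (\<Sum>i\<in>UNIV. pd (axis i 1, 0) (\<lambda>z. ak k z $ i) z)"
      unfolding akc uk_def conv(2)[OF u0i] conv(2)[OF compi[OF a0i]] ..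
    finally show "pd (0, 1) (uk k) z = (\<Sum>i\<in>UNIV. pd (axis i 1, 0) (\<lambda>z. ak k z $ i) z)" by simp
  next
    show "integrable lebesgue (\<lambda>z. (1 + 2 * L) * GF z)" using e by simp
    show "0 \<le> B" by (rule B)
    show "AE z in lebesgue. \<forall>k. norm (gk k z) \<le> (1 + 2 * L) * GF z \<and> norm (ak k z) \<le> (1 + 2 * L) * GF z \<and>
       norm (ak k z) * norm (gk k z) \<le> (1 + 2 * L) * GF z"
      using e(3)
    proof eventually_elim
      case (elim z)
      show ?case
      proof
        fix k
        have n: "norm (cv k z) \<le> GF z" using elim by (simp add: cv_def)
        have n2: "norm (snd (cv k z)) \<le> GF z"
          by (rule order_trans[OF norm_fst_snd_le(2) n])
        have n3: "norm (snd (snd (cv k z))) \<le> GF z"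
          by (rule order_trans[OF norm_fst_snd_le(2) n2])
        have b: "norm (gk k z) \<le> GF z" "norm (ak k z) \<le> GF z" "norm (Pk k z) \<le> GF z"
          using order_trans[OF norm_fst_snd_le(1) n2] order_trans[OF norm_fst_snd_le(1) n3]
            order_trans[OF norm_fst_snd_le(2) n3]
          by (simp_all add: cv gk_def ak_def Pk_def)
        then have G0: "GF z \<ge> 0" using order_trans[OF norm_ge_zero] by blast
        have "2 * L * Pk k z \<le> 2 * L * GF z" using b(3) L by (intro mult_left_mono) auto
        then show "norm (gk k z) \<le> (1 + 2 * L) * GF z \<and> norm (ak k z) \<le> (1 + 2 * L) * GF z \<and>
       norm (ak k z) * norm (gk k z) \<le> (1 + 2 * L) * GF z"
          using b Pk2[of k z] G0 mult_nonneg_nonneg[OF L G0] by (simp add: algebra_simps)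
      qed
    qed
    have l: "AE z in lebesgue. (\<lambda>k. cv k z) \<longlonglongrightarrow> F z" using e(4) by (simp add: cv_def)
    show "AE z in lebesgue. z \<in> K \<longrightarrow> (\<lambda>k. uk k z) \<longlonglongrightarrow> u z"
      using l
    proof eventually_elim
      case (elim z)
      then have "(\<lambda>k. fst (cv k z)) \<longlonglongrightarrow> fst (F z)" by (rule tendsto_fst)
      then show ?case using Kin by (auto simp: cv F_def uk_def u0_def)
    qed
    show "AE z in lebesgue. z \<in> K \<longrightarrow> (\<lambda>k. gk k z) \<longlonglongrightarrow> g z"
      using l
    proof eventually_elim
      case (elim z)
      then have "(\<lambda>k. fst (snd (cv k z))) \<longlonglongrightarrow> fst (snd (F z))" by (intro tendsto_fst tendsto_snd)
      then show ?case using Kin by (auto simp: cv F_def gk_def g0_def)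
    qed
    show "AE z in lebesgue. z \<in> K \<longrightarrow> (\<lambda>k. ak k z) \<longlonglongrightarrow> a z"
      using l
    proof eventually_elim
      case (elim z)
      then have "(\<lambda>k. fst (snd (snd (cv k z)))) \<longlonglongrightarrow> fst (snd (snd (F z)))" by (intro tendsto_fst tendsto_snd)
      then show ?case using Kin by (auto simp: cv F_def ak_def a0_def)
    qed
  qed
qed

end

section \<open>Energy and gradient identities for C1 test functions\<close>

lemma integral_pd_tsupp_eq_0:
  assumes "C1 F" "compact K" "\<And>z. z \<notin> K \<Longrightarrow> F z = 0"
  shows "integrable lebesgue (pd v F)" "(LINT z|lebesgue. pd v F z) = 0"
proof -
  have "\<And>z. z \<notin> K \<Longrightarrow> pd v F z = 0" using pd_eq_0_outside[OF compact_imp_closed[OF assms(2)] assms(3)] .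
  then show "integrable lebesgue (pd v F)"
    by (rule integrable_lebesgue_compact_support(1)[OF C1_pd_continuous[OF assms(1)] assms(2)])
  show "(LINT z|lebesgue. pd v F z) = 0" by (rule integral_pd_eq_0[OF assms])
qed

lemma C1_bounded:
  assumes "C1 \<zeta>" "compact (tsupp \<zeta>)"
  obtains Z where "Z \<ge> 0" "\<And>z. \<bar>\<zeta> z\<bar> \<le> Z"
proof -
  have o: "z \<notin> tsupp \<zeta> \<Longrightarrow> \<zeta> z = 0" for z by (rule outside_tsupp)
  obtain B where "B > 0" "\<And>z. \<bar>\<zeta> z\<bar> \<le> B"
    using bounded_compact_support[OF C1_continuous[OF assms(1)] assms(2) o] by blast
  then show ?thesis using that[of B] by simp
qed

lemma pd_bounded:
  assumes "C1 \<zeta>" "compact (tsupp \<zeta>)"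
  obtains Z where "Z \<ge> 0" "\<And>z. \<bar>pd v \<zeta> z\<bar> \<le> Z"
proof -
  have o: "z \<notin> tsupp \<zeta> \<Longrightarrow> pd v \<zeta> z = 0" for z by (rule pd_outside_tsupp)
  obtain B where "B > 0" "\<And>z. \<bar>pd v \<zeta> z\<bar> \<le> B"
    using bounded_compact_support[OF C1_pd_continuous[OF assms(1)] assms(2) o] by blast
  then show ?thesis using that[of B] by simp
qed

lemma norm_xgrad_le: "norm (xgrad \<zeta> z) \<le> (\<Sum>i\<in>UNIV. \<bar>pd (axis i 1, 0) \<zeta> z\<bar>)"
  using norm_le_l1_cart[of "xgrad \<zeta> z"] by (simp add: xgrad_def xpart_def)

lemma xgrad_bounded:
  fixes \<zeta> :: "(real^'n) \<times> real \<Rightarrow> real"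
  assumes "C1 \<zeta>" "compact (tsupp \<zeta>)"
  obtains Z where "Z \<ge> 0" "\<And>z. norm (xgrad \<zeta> z) \<le> Z"
proof -
  have "\<exists>Z. Z \<ge> 0 \<and> (\<forall>z. \<bar>pd (axis i 1, 0) \<zeta> z\<bar> \<le> Z)" for i :: 'n
    using pd_bounded[OF assms, of "(axis i 1, 0)"] by blast
  then obtain Z where Z: "\<And>i :: 'n. Z i \<ge> 0" "\<And>i z. \<bar>pd (axis i 1, 0) \<zeta> z\<bar> \<le> Z i" by metis
  have "norm (xgrad \<zeta> z) \<le> (\<Sum>i\<in>UNIV. Z i)" for z
    by (rule order_trans[OF norm_xgrad_le sum_mono]) (rule Z)
  then show ?thesis using that[of "\<Sum>i\<in>UNIV. Z i"] Z(1) by (simp add: sum_nonneg)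
qed

lemma xgrad_continuous: "C1 \<zeta> \<Longrightarrow> continuous_on S (xgrad \<zeta>)"
  unfolding xgrad_def[abs_def] xpart_def by (intro continuous_on_vec_lambda C1_pd_continuous)

lemma xgrad_measurable: "C1 \<zeta> \<Longrightarrow> xgrad \<zeta> \<in> borel_measurable lebesgue"
  by (rule continuous_measurable_lebesgue[OF xgrad_continuous])

lemma tpart_measurable: "C1 \<zeta> \<Longrightarrow> tpart \<zeta> \<in> borel_measurable lebesgue"
  unfolding tpart_def[abs_def] by (rule continuous_measurable_lebesgue[OF C1_pd_continuous])

lemma C1_measurable: "C1 \<zeta> \<Longrightarrow> \<zeta> \<in> borel_measurable lebesgue"
  by (rule continuous_measurable_lebesgue[OF C1_continuous])

lemma xgrad_outside_tsupp: "z \<notin> tsupp \<zeta> \<Longrightarrow> xgrad \<zeta> z = 0"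
  by (simp add: xgrad_def xpart_def pd_outside_tsupp vec_eq_iff)

lemma tpart_outside_tsupp: "z \<notin> tsupp \<zeta> \<Longrightarrow> tpart \<zeta> z = 0"
  by (simp add: tpart_def pd_outside_tsupp)

context weak_local
begin

text \<open>Testing with \<open>(u - c) \<zeta>\<close>; the product rule turns the time term into \<open>(u - c)\<^sup>2 / 2\<close>.\<close>

lemma energy_identity:
  assumes \<zeta>: "C1 \<zeta>" "compact (tsupp \<zeta>)" "tsupp \<zeta> \<subseteq> U"
  shows "(LINT z|lebesgue. (a z \<bullet> g z) * \<zeta> z + (u z - c) * (a z \<bullet> xgrad \<zeta> z) - (u z - c)^2 / 2 * tpart \<zeta> z) = 0"
proof -
  let ?K = "tsupp \<zeta>"
  show ?thesis
  proof (rule approximation[OF \<zeta>(2,3)])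
  fix uk :: "nat \<Rightarrow> (real^'n) \<times> real \<Rightarrow> real" and gk ak :: "nat \<Rightarrow> (real^'n) \<times> real \<Rightarrow> real^'n"
    and B :: real and G :: "(real^'n) \<times> real \<Rightarrow> real"
  assume uk: "\<And>k. C1 (uk k)" and ak: "\<And>k i. C1 (\<lambda>z. ak k z $ i)"
    and gkc: "\<And>k. continuous_on UNIV (gk k)" and akc: "\<And>k. continuous_on UNIV (ak k)"
    and id1: "\<And>k i z. z \<in> ?K \<Longrightarrow> pd (axis i 1, 0) (uk k) z = gk k z $ i"
    and id2: "\<And>k z. z \<in> ?K \<Longrightarrow> pd (0, 1) (uk k) z = (\<Sum>i\<in>UNIV. pd (axis i 1, 0) (\<lambda>z. ak k z $ i) z)"
    and B: "\<And>k z. \<bar>uk k z\<bar> \<le> B" and Gi: "integrable lebesgue G" and B0: "0 \<le> B"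
    and dom: "AE z in lebesgue. \<forall>k. norm (gk k z) \<le> G z \<and> norm (ak k z) \<le> G z \<and> norm (ak k z) * norm (gk k z) \<le> G z"
    and lim: "AE z in lebesgue. z \<in> ?K \<longrightarrow> (\<lambda>k. uk k z) \<longlonglongrightarrow> u z"
    "AE z in lebesgue. z \<in> ?K \<longrightarrow> (\<lambda>k. gk k z) \<longlonglongrightarrow> g z"
    "AE z in lebesgue. z \<in> ?K \<longrightarrow> (\<lambda>k. ak k z) \<longlonglongrightarrow> a z"
  define w where "w k z = uk k z - c" for k z
  have w: "C1 (w k)" for k unfolding w_def[abs_def] by (intro C1_diff uk Ck_const)
  have pw: "pd v (w k) z = pd v (uk k) z" for k v z
    unfolding w_def[abs_def] by (simp add: pd_diff[OF uk Ck_const] pd_const)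
  obtain Z1 where Z1: "Z1 \<ge> 0" "\<And>z. \<bar>\<zeta> z\<bar> \<le> Z1" using C1_bounded[OF \<zeta>(1,2)] by blast
  obtain Z2 where Z2: "Z2 \<ge> 0" "\<And>z. norm (xgrad \<zeta> z) \<le> Z2" using xgrad_bounded[OF \<zeta>(1,2)] by blast
  obtain Z3 where Z3: "Z3 \<ge> 0" "\<And>z. \<bar>tpart \<zeta> z\<bar> \<le> Z3" using pd_bounded[OF \<zeta>(1,2)] unfolding tpart_def by blast
  let ?I = "\<lambda>k z. (ak k z \<bullet> gk k z) * \<zeta> z + w k z * (ak k z \<bullet> xgrad \<zeta> z) - (w k z)^2 / 2 * tpart \<zeta> z"
  \<comment> \<open>The integrand is an exact divergence: the spatial divergence of w \<zeta> a_k
    minus the time derivative of w^2 \<zeta> / 2. The leftover terms cancel because the divergence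
    of a_k is the time derivative of u_k.\<close>
  have zero: "(LINT z|lebesgue. ?I k z) = 0" for k
  proof -
    define Fi where "Fi i z = ak k z $ i * (w k z * \<zeta> z)" for i z
    define F0 where "F0 z = (1/2) * ((w k z)^2 * \<zeta> z)" for z
    have Fi: "C1 (Fi i)" for i unfolding Fi_def[abs_def] by (intro Ck_mult ak w \<zeta>(1))
    have F0: "C1 F0" unfolding F0_def[abs_def] by (intro Ck_mult Ck_cmult C1_power w \<zeta>(1))
    have out: "z \<notin> ?K \<Longrightarrow> Fi i z = 0" "z \<notin> ?K \<Longrightarrow> F0 z = 0" for i z
      by (simp_all add: Fi_def F0_def outside_tsupp)
    note I1 = integral_pd_tsupp_eq_0[OF Fi \<zeta>(2) out(1)]
    note I0 = integral_pd_tsupp_eq_0[OF F0 \<zeta>(2) out(2)]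
    have pFi: "pd v (Fi i) z = ak k z $ i * (w k z * pd v \<zeta> z + pd v (uk k) z * \<zeta> z)
        + pd v (\<lambda>z. ak k z $ i) z * (w k z * \<zeta> z)" for v i z
      unfolding Fi_def[abs_def] by (simp add: pd_mult ak w \<zeta>(1) Ck_mult pw del: Ck.simps)
    have pF0: "pd v F0 z = (1/2) * ((w k z)^2 * pd v \<zeta> z + 2 * w k z * pd v (uk k) z * \<zeta> z)" for v z
      unfolding F0_def[abs_def] pd_cmult[OF Ck_mult[OF C1_power[OF w] \<zeta>(1)]]
        pd_mult[OF C1_power[OF w] \<zeta>(1)] pd_power[OF w] pw by simp
    have "(\<Sum>i\<in>UNIV. pd (axis i 1, 0) (Fi i) z) - pd (0, 1) F0 z = ?I k z" for z
    proof (cases "z \<in> ?K")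
      case True
      have "(\<Sum>i\<in>UNIV. pd (axis i 1, 0) (Fi i) z)
         = (\<Sum>i\<in>UNIV. ak k z $ i * xpart \<zeta> i z * w k z) + (\<Sum>i\<in>UNIV. ak k z $ i * gk k z $ i * \<zeta> z)
          + (\<Sum>i\<in>UNIV. pd (axis i 1, 0) (\<lambda>z. ak k z $ i) z * (w k z * \<zeta> z))"
        unfolding pFi id1[OF True] xpart_def by (simp add: algebra_simps sum.distrib)
      also have "\<dots> = w k z * (ak k z \<bullet> xgrad \<zeta> z) + (ak k z \<bullet> gk k z) * \<zeta> z + pd (0, 1) (uk k) z * (w k z * \<zeta> z)"
        unfolding id2[OF True] by (simp add: inner_vec_def xgrad_def sum_distrib_left sum_distrib_right mult_ac)
      finally show ?thesis unfolding pF0 tpart_def by (simp add: algebra_simps)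
    next
      case False
      then show ?thesis
        by (simp add: pFi pF0 outside_tsupp pd_outside_tsupp xgrad_outside_tsupp tpart_outside_tsupp)
    qed
    then have "(LINT z|lebesgue. ?I k z) = (LINT z|lebesgue. (\<Sum>i\<in>UNIV. pd (axis i 1, 0) (Fi i) z) - pd (0, 1) F0 z)"
      by simp
    also have "\<dots> = 0" using I1 I0 by (simp add: Bochner_Integration.integral_sum)
    finally show ?thesis .
  qed
  define B' where "B' = B + \<bar>c\<bar>"
  have wB: "\<bar>w k z\<bar> \<le> B'" for k z using B[of k z] by (simp add: w_def B'_def)
  have B'0: "B' \<ge> 0" using B0 by (simp add: B'_def)
  have "(\<lambda>k. LINT z|lebesgue. ?I k z) \<longlonglongrightarrow>
     (LINT z|lebesgue. (a z \<bullet> g z) * \<zeta> z + (u z - c) * (a z \<bullet> xgrad \<zeta> z) - (u z - c)^2 / 2 * tpart \<zeta> z)"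
  proof (rule integral_dominated_convergence[where w="\<lambda>z. (Z1 + B' * Z2) * G z + indicator ?K z * (B'^2 * Z3)"])
    show "integrable lebesgue (\<lambda>z. (Z1 + B' * Z2) * G z + indicator ?K z * (B'^2 * Z3))"
      using Gi lmeasurable_compact[OF \<zeta>(2)] lmeasurable_iff_integrable[of ?K] by auto
    note [measurable] = C1_measurable[OF \<zeta>(1)] xgrad_measurable[OF \<zeta>(1)] tpart_measurable[OF \<zeta>(1)] um gm am
      continuous_measurable_lebesgue[OF gkc] continuous_measurable_lebesgue[OF akc] C1_measurable[OF w]
    show "(\<lambda>z. (a z \<bullet> g z) * \<zeta> z + (u z - c) * (a z \<bullet> xgrad \<zeta> z) - (u z - c)^2 / 2 * tpart \<zeta> z) \<in> borel_measurable lebesgue"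
      by measurable
    show "(\<lambda>z. ?I k z) \<in> borel_measurable lebesgue" for k by measurable
    show "AE z in lebesgue. (\<lambda>k. ?I k z) \<longlonglongrightarrow> (a z \<bullet> g z) * \<zeta> z + (u z - c) * (a z \<bullet> xgrad \<zeta> z) - (u z - c)^2 / 2 * tpart \<zeta> z"
      using lim
    proof eventually_elim
      case (elim z)
      show ?case
      proof (cases "z \<in> ?K")
        case True
        then show ?thesis unfolding w_def by (intro tendsto_intros) (use elim in auto)
      qed (simp add: outside_tsupp xgrad_outside_tsupp tpart_outside_tsupp)
    qed
    show "AE z in lebesgue. norm (?I k z) \<le> (Z1 + B' * Z2) * G z + indicator ?K z * (B'^2 * Z3)" for k
      using dom
    proof eventually_elim
      case (elim z)
      then have el: "norm (ak k z) \<le> G z" "norm (ak k z) * norm (gk k z) \<le> G z" by auto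
      have "\<bar>ak k z \<bullet> gk k z\<bar> \<le> G z" using Cauchy_Schwarz_ineq2[of "ak k z" "gk k z"] el by simp
      then have 1: "\<bar>(ak k z \<bullet> gk k z) * \<zeta> z\<bar> \<le> G z * Z1"
        unfolding abs_mult using Z1 by (intro mult_mono) (auto intro: order_trans[OF abs_ge_zero])
      have "\<bar>ak k z \<bullet> xgrad \<zeta> z\<bar> \<le> norm (ak k z) * norm (xgrad \<zeta> z)" by (rule Cauchy_Schwarz_ineq2)
      also have "\<dots> \<le> G z * Z2"
        using el Z2 by (intro mult_mono) (auto intro: order_trans[OF norm_ge_zero])
      finally have 2: "\<bar>w k z * (ak k z \<bullet> xgrad \<zeta> z)\<bar> \<le> B' * (G z * Z2)"
        unfolding abs_mult using wB[of k z] B'0 by (intro mult_mono) auto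
      have 3: "\<bar>(w k z)^2 / 2 * tpart \<zeta> z\<bar> \<le> indicator ?K z * (B'^2 * Z3)"
      proof (cases "z \<in> ?K")
        case True
        have "(w k z)^2 \<le> B'^2" using wB[of k z] B'0 by (simp add: abs_le_square_iff[symmetric])
        then have "(w k z)^2 / 2 \<le> B'^2" using zero_le_power2[of B'] by linarith
        from mult_mono[OF this Z3(2)[of z]] show ?thesis using True by (simp add: abs_mult)
      qed (simp add: tpart_outside_tsupp)
      have "\<bar>x + y - t\<bar> \<le> \<bar>x\<bar> + \<bar>y\<bar> + \<bar>t\<bar>" for x y t :: real by simp
      from order_trans[OF this] 1 2 3 show ?case unfolding real_norm_def
        by (smt (verit) distrib_right mult.assoc mult.commute)
    qed
  qed
  then show ?thesis using zero by (simp add: LIMSEQ_const_iff)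
  qed
qed

text \<open>The derivative of the compactly supported product u_k \<zeta> integrates to 0, and the
  limit in k can be taken. This extends the weak gradient identity from smooth functions on one
  small set to C1 functions supported anywhere in U.\<close>

lemma gradient_identity:
  assumes \<zeta>: "C1 \<zeta>" "compact (tsupp \<zeta>)" "tsupp \<zeta> \<subseteq> U"
  shows "(LINT z|lebesgue. u z * xpart \<zeta> i z + g z $ i * \<zeta> z) = 0"
proof -
  let ?K = "tsupp \<zeta>"
  show ?thesis
  proof (rule approximation[OF \<zeta>(2,3)])
  fix uk :: "nat \<Rightarrow> (real^'n) \<times> real \<Rightarrow> real" and gk ak :: "nat \<Rightarrow> (real^'n) \<times> real \<Rightarrow> real^'n"
    and B :: real and G :: "(real^'n) \<times> real \<Rightarrow> real"
  assume uk: "\<And>k. C1 (uk k)" and gkc: "\<And>k. continuous_on UNIV (gk k)"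
    and id1: "\<And>k i z. z \<in> ?K \<Longrightarrow> pd (axis i 1, 0) (uk k) z = gk k z $ i"
    and B: "\<And>k z. \<bar>uk k z\<bar> \<le> B" and Gi: "integrable lebesgue G" and B0: "0 \<le> B"
    and dom: "AE z in lebesgue. \<forall>k. norm (gk k z) \<le> G z \<and> norm (ak k z) \<le> G z \<and> norm (ak k z) * norm (gk k z) \<le> G z"
    and lim: "AE z in lebesgue. z \<in> ?K \<longrightarrow> (\<lambda>k. uk k z) \<longlonglongrightarrow> u z"
    "AE z in lebesgue. z \<in> ?K \<longrightarrow> (\<lambda>k. gk k z) \<longlonglongrightarrow> g z"
  obtain Z1 where Z1: "Z1 \<ge> 0" "\<And>z. \<bar>\<zeta> z\<bar> \<le> Z1" using C1_bounded[OF \<zeta>(1,2)] by blast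
  obtain Z3 where Z3: "Z3 \<ge> 0" "\<And>z. \<bar>xpart \<zeta> i z\<bar> \<le> Z3" using pd_bounded[OF \<zeta>(1,2)] unfolding xpart_def by blast
  let ?I = "\<lambda>k z. uk k z * xpart \<zeta> i z + gk k z $ i * \<zeta> z"
  have zero: "(LINT z|lebesgue. ?I k z) = 0" for k
  proof -
    have F: "C1 (\<lambda>z. uk k z * \<zeta> z)" by (intro Ck_mult uk \<zeta>(1))
    have out: "z \<notin> ?K \<Longrightarrow> uk k z * \<zeta> z = 0" for z by (simp add: outside_tsupp)
    have "pd (axis i 1, 0) (\<lambda>z. uk k z * \<zeta> z) z = ?I k z" for z
      using id1[where z=z and i=i and k=k] by (cases "z \<in> ?K") (simp_all add: pd_mult uk \<zeta>(1) xpart_def outside_tsupp pd_outside_tsupp del: Ck.simps)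
    then show ?thesis using integral_pd_tsupp_eq_0(2)[OF F \<zeta>(2) out, of "(axis i 1, 0)"] by simp
  qed
  have xm: "xpart \<zeta> i \<in> borel_measurable lebesgue"
    unfolding xpart_def[abs_def] by (rule continuous_measurable_lebesgue[OF C1_pd_continuous[OF \<zeta>(1)]])
  have vm: "(\<lambda>z. f z $ i) \<in> borel_measurable lebesgue" if "f \<in> borel_measurable lebesgue" for f :: "(real^'n) \<times> real \<Rightarrow> real^'n"
    by (rule measurable_compose[OF that]) (intro borel_measurable_continuous_onI continuous_intros)
  have "(\<lambda>k. LINT z|lebesgue. ?I k z) \<longlonglongrightarrow> (LINT z|lebesgue. u z * xpart \<zeta> i z + g z $ i * \<zeta> z)"
  proof (rule integral_dominated_convergence[where w="\<lambda>z. indicator ?K z * (B * Z3) + G z * Z1"])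
    show "integrable lebesgue (\<lambda>z. indicator ?K z * (B * Z3) + G z * Z1)"
      using Gi lmeasurable_compact[OF \<zeta>(2)] lmeasurable_iff_integrable[of ?K] by auto
    note [measurable] = C1_measurable[OF \<zeta>(1)] xm um vm[OF gm]
      vm[OF continuous_measurable_lebesgue[OF gkc]] C1_measurable[OF uk]
    show "(\<lambda>z. u z * xpart \<zeta> i z + g z $ i * \<zeta> z) \<in> borel_measurable lebesgue" by measurable
    show "(\<lambda>z. ?I k z) \<in> borel_measurable lebesgue" for k by measurable
    show "AE z in lebesgue. (\<lambda>k. ?I k z) \<longlonglongrightarrow> u z * xpart \<zeta> i z + g z $ i * \<zeta> z"
      using lim
    proof eventually_elim
      case (elim z)
      show ?case
      proof (cases "z \<in> ?K")
        case True
        then show ?thesis by (intro tendsto_intros) (use elim in auto)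
      qed (simp add: outside_tsupp xpart_def pd_outside_tsupp)
    qed
    show "AE z in lebesgue. norm (?I k z) \<le> indicator ?K z * (B * Z3) + G z * Z1" for k
      using dom
    proof eventually_elim
      case (elim z)
      then have "norm (gk k z) \<le> G z" by auto
      then have "\<bar>gk k z $ i\<bar> \<le> G z" using component_le_norm_cart[of "gk k z" i] by simp
      then have 1: "\<bar>gk k z $ i * \<zeta> z\<bar> \<le> G z * Z1"
        unfolding abs_mult using Z1 by (intro mult_mono) (auto intro: order_trans[OF abs_ge_zero])
      have 3: "\<bar>uk k z * xpart \<zeta> i z\<bar> \<le> indicator ?K z * (B * Z3)"
        using mult_mono[OF B[of k z] Z3(2)[of z] B0]
        by (cases "z \<in> ?K") (simp_all add: abs_mult xpart_def pd_outside_tsupp)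
      show ?case using 1 3 unfolding real_norm_def by linarith
    qed
  qed
  then show ?thesis using zero by (simp add: LIMSEQ_const_iff)
  qed
qed

end

section \<open>Packed covers by parabolic cylinders\<close>

text \<open>For r > 0 and s = p + \<alpha>(2-p) this is \<open>Qcyl p r (r powr \<alpha>) z\<close>.
  With s kept abstract, the covering arguments use only s \<ge> 1.\<close>

definition cyl :: "real \<Rightarrow> (real^'n) \<times> real \<Rightarrow> real \<Rightarrow> ((real^'n) \<times> real) set" where
  "cyl s z r = {w. norm (fst w - fst z) < r \<and> \<bar>snd w - snd z\<bar> < r powr s}"

lemma cyl_Times: "cyl s z r = ball (fst z) r \<times> {snd z - r powr s<..<snd z + r powr s}"
  by (auto simp: cyl_def dist_norm norm_minus_commute)

lemma open_cyl: "open (cyl s z r)"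
  unfolding cyl_Times by (intro open_Times) auto

lemma lmeasurable_cyl: "cyl s z r \<in> lmeasurable"
  unfolding cyl_Times by (intro open_bounded_lmeasurable open_Times bounded_Times) auto

lemma center_in_cyl: "r > 0 \<Longrightarrow> z \<in> cyl s z r"
  by (simp add: cyl_def)

text \<open>This replaces the triangle inequality in the time variable: heights r^s with s \<ge> 1
  add up to no more than the height of the summed radius, so the cylinders behave like
  balls.\<close>

lemma powr_superadditive:
  fixes a b s :: real
  assumes "a \<ge> 0" "b \<ge> 0" "s \<ge> 1"
  shows "a powr s + b powr s \<le> (a + b) powr s"
proof -
  have e: "t powr s = t powr (s - 1) * t" if "t \<ge> 0" for t :: real
    using that powr_mult_base[of t "s - 1"] by (cases "t = 0") (auto simp: mult.commute)
  have "a powr (s - 1) * a + b powr (s - 1) * b \<le> (a + b) powr (s - 1) * a + (a + b) powr (s - 1) * b"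
    using assms by (intro add_mono mult_right_mono powr_mono2) auto
  then show ?thesis using assms by (simp add: e algebra_simps)
qed

lemma cyl_mono:
  assumes "0 \<le> r" "r \<le> r'" "s \<ge> 1" shows "cyl s z r \<subseteq> cyl s z r'"
  using powr_mono2[of s r r'] assms by (auto simp: cyl_def)

text \<open>Triangle inequality through the common point w, directly in space and by superadditivity
  in time.\<close>

lemma cyl_swallow:
  assumes "w \<in> cyl s z r" "w \<in> cyl s z' r'" and r: "0 \<le> r" "0 \<le> r'" "0 \<le> r''" and s: "s \<ge> 1"
  shows "cyl s z' r'' \<subseteq> cyl s z (r + r' + r'')"
proof
  fix v assume v: "v \<in> cyl s z' r''"
  have "norm (fst v - fst z) \<le> norm (fst v - fst z') + norm (fst w - fst z') + norm (fst w - fst z)"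
  proof -
    have "norm ((fst v - fst z') - (fst w - fst z') + (fst w - fst z))
      \<le> norm (fst v - fst z') + norm (fst w - fst z') + norm (fst w - fst z)"
      by (intro order_trans[OF norm_triangle_ineq] add_mono norm_triangle_ineq4 order_refl)
    then show ?thesis by simp
  qed
  moreover have "\<bar>snd v - snd z\<bar> < r powr s + r' powr s + r'' powr s"
    using v assms(1,2) by (auto simp: cyl_def)
  moreover have "r powr s + r' powr s + r'' powr s \<le> (r + r' + r'') powr s"
    using powr_superadditive[of r r' s] powr_superadditive[of "r + r'" r'' s] r s by simp
  ultimately show "v \<in> cyl s z (r + r' + r'')"
    using v assms(1,2) by (auto simp: cyl_def)
qed

lemma measure_cyl:
  fixes z :: "(real^'n) \<times> real"
  assumes "r > 0"
  shows "measure lebesgue (cyl s z r) = 2 * unit_ball_vol (real CARD('n)) * r powr (real CARD('n) + s)"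
proof -
  have "emeasure lborel (cyl s z r) = emeasure (lborel \<Otimes>\<^sub>M lborel) (ball (fst z) r \<times> {snd z - r powr s<..<snd z + r powr s})"
    unfolding cyl_Times lborel_prod ..
  also have "\<dots> = emeasure lborel (ball (fst z) r) * emeasure lborel {snd z - r powr s<..<snd z + r powr s}"
    by (rule lborel.emeasure_pair_measure_Times) auto
  also have "\<dots> = ennreal (unit_ball_vol (real CARD('n)) * r ^ CARD('n)) * ennreal (2 * r powr s)"
    using assms by (simp add: emeasure_ball)
  also have "\<dots> = ennreal (2 * unit_ball_vol (real CARD('n)) * (r ^ CARD('n) * r powr s))"
    using assms by (simp add: ennreal_mult'[symmetric] mult_ac)
  also have "r ^ CARD('n) * r powr s = r powr (real CARD('n) + s)"
    using assms by (simp add: powr_add powr_realpow)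
  finally have "measure lborel (cyl s z r) = 2 * unit_ball_vol (real CARD('n)) * r powr (real CARD('n) + s)"
    by (simp add: measure_def)
  then show ?thesis using open_cyl[of s z r] by simp
qed

text \<open>Centres must lie in K because the Hoelder condition is available only at points of E;
  finiteness lets covers be compared by their number of members.\<close>

definition admissible_cover :: "real \<Rightarrow> real \<Rightarrow> ((real^'n) \<times> real) set \<Rightarrow> real \<Rightarrow> (((real^'n) \<times> real) \<times> real) set \<Rightarrow> bool" where
  "admissible_cover s \<sigma> K \<epsilon> C \<longleftrightarrow> finite C \<and> (\<forall>(z, r)\<in>C. z \<in> K \<and> 0 < r) \<and> K \<subseteq> (\<Union>(z, r)\<in>C. cyl s z r)
     \<and> (\<Sum>(z, r)\<in>C. r powr \<sigma>) \<le> \<epsilon>"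

text \<open>Cylinders that miss K are discarded, and each of the others is recentred at one of its
  points in K. Recentring doubles the radius, hence the factor 2^\<sigma> in the cost.\<close>

lemma admissible_cover_exists:
  fixes K :: "((real^'n) \<times> real) set"
  assumes K: "compact K" and s: "s \<ge> 1" and \<sigma>: "\<sigma> \<ge> 0"
    and r: "\<And>i::nat. 0 < r i" and cov: "K \<subseteq> (\<Union>i. cyl s (z i) (r i))"
    and sum: "(\<Sum>i. ennreal (r i powr \<sigma>)) < ennreal \<epsilon>"
  shows "\<exists>C. admissible_cover s \<sigma> K (2 powr \<sigma> * \<epsilon>) C"
proof -
  have op: "\<And>i. i \<in> UNIV \<Longrightarrow> open (cyl s (z i) (r i))" by (rule open_cyl)
  have "\<exists>F. finite F \<and> K \<subseteq> (\<Union>i\<in>F. cyl s (z i) (r i))"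
    by (rule compactE_image[OF K op cov]) auto
  then obtain F where F: "finite F" "K \<subseteq> (\<Union>i\<in>F. cyl s (z i) (r i))" by blast
  define I where "I = {i \<in> F. K \<inter> cyl s (z i) (r i) \<noteq> {}}"
  have I: "finite I" using F by (simp add: I_def)
  have "\<forall>i\<in>I. \<exists>w. w \<in> K \<and> w \<in> cyl s (z i) (r i)" by (auto simp: I_def)
  then obtain w where w: "\<And>i. i \<in> I \<Longrightarrow> w i \<in> K \<and> w i \<in> cyl s (z i) (r i)" by metis
  define C where "C = (\<lambda>i. (w i, 2 * r i)) ` I"
  have sub: "cyl s (z i) (r i) \<subseteq> cyl s (w i) (2 * r i)" if "i \<in> I" for i
  proof
    fix v assume v: "v \<in> cyl s (z i) (r i)"
    have wi: "w i \<in> cyl s (z i) (r i)" using w[OF that] by simp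
    have "norm (fst v - fst (w i)) < 2 * r i"
      using v wi norm_triangle_ineq4[of "fst v - fst (z i)" "fst (w i) - fst (z i)"] by (simp add: cyl_def)
    moreover have "\<bar>snd v - snd (w i)\<bar> < r i powr s + r i powr s"
      using v wi by (auto simp: cyl_def)
    moreover have "r i powr s + r i powr s \<le> (2 * r i) powr s"
      using powr_superadditive[of "r i" "r i" s] r[of i] s by (simp add: less_imp_le)
    ultimately show "v \<in> cyl s (w i) (2 * r i)" by (simp add: cyl_def)
  qed
  have "K \<subseteq> (\<Union>(z, r)\<in>C. cyl s z r)"
  proof
    fix v assume v: "v \<in> K"
    then obtain i where i: "i \<in> F" "v \<in> cyl s (z i) (r i)" using F by blast
    then have "i \<in> I" using v by (auto simp: I_def)
    then show "v \<in> (\<Union>(z, r)\<in>C. cyl s z r)" using sub i(2) unfolding C_def by fastforce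
  qed
  moreover have "(\<Sum>(z, r)\<in>C. r powr \<sigma>) \<le> 2 powr \<sigma> * \<epsilon>"
  proof -
    \<comment> \<open>Different indices may give the same pair, so the sum over the image is only
      bounded by the sum over the indices.\<close>
    have "(\<Sum>(z, r)\<in>C. r powr \<sigma>) \<le> (\<Sum>i\<in>I. (2 * r i) powr \<sigma>)"
      unfolding C_def using sum_image_le[OF I, of "\<lambda>(z, r). r powr \<sigma>" "\<lambda>i. (w i, 2 * r i)"] by (simp add: o_def)
    also have "\<dots> = 2 powr \<sigma> * (\<Sum>i\<in>I. r i powr \<sigma>)"
      using r by (simp add: powr_mult less_imp_le sum_distrib_left)
    also have "ennreal (\<Sum>i\<in>I. r i powr \<sigma>) \<le> ennreal \<epsilon>"
    proof -
      have "ennreal (\<Sum>i\<in>I. r i powr \<sigma>) = (\<Sum>i\<in>I. ennreal (r i powr \<sigma>))" by simp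
      also have "\<dots> \<le> (\<Sum>i. ennreal (r i powr \<sigma>))" by (rule sum_le_suminf) (use I in auto)
      finally show ?thesis using sum by simp
    qed
    then have "(\<Sum>i\<in>I. r i powr \<sigma>) \<le> \<epsilon>"
    proof -
      have "\<epsilon> > 0" using sum by (metis ennreal_eq_0_iff linorder_not_le not_less_zero)
      then show ?thesis using \<open>ennreal (\<Sum>i\<in>I. r i powr \<sigma>) \<le> ennreal \<epsilon>\<close> by (simp add: ennreal_le_iff)
    qed
    then have "2 powr \<sigma> * (\<Sum>i\<in>I. r i powr \<sigma>) \<le> 2 powr \<sigma> * \<epsilon>" by (intro mult_left_mono) auto
    finally show ?thesis .
  qed
  ultimately have "admissible_cover s \<sigma> K (2 powr \<sigma> * \<epsilon>) C"
    unfolding admissible_cover_def C_def using I w r by auto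
  then show ?thesis by blast
qed

text \<open>An admissible cover with the fewest members packs well: otherwise the members near a
  badly packed one could be replaced by a single larger cylinder at smaller cost.\<close>

lemma admissible_cover_packing:
  fixes K :: "((real^'n) \<times> real) set"
  assumes ex: "\<exists>C. admissible_cover s \<sigma> K \<epsilon> C" and s: "s \<ge> 1" and \<sigma>: "\<sigma> \<ge> 0"
  obtains C where "admissible_cover s \<sigma> K \<epsilon> C"
    "\<And>z r. (z, r) \<in> C \<Longrightarrow>
      (\<Sum>(z', r') \<in> {(z', r') \<in> C. r' \<le> r \<and> cyl s z' (3 * r') \<inter> cyl s z (9 * r) \<noteq> {}}. r' powr \<sigma>) \<le> (13 * r) powr \<sigma>"
proof -
  obtain C where C: "admissible_cover s \<sigma> K \<epsilon> C" and min: "\<And>C'. admissible_cover s \<sigma> K \<epsilon> C' \<Longrightarrow> card C \<le> card C'"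
    using ex_has_least_nat[of "admissible_cover s \<sigma> K \<epsilon>" _ card] ex by metis
  have fin: "finite C" and pos: "\<And>z r. (z, r) \<in> C \<Longrightarrow> z \<in> K \<and> 0 < r"
    and cov: "K \<subseteq> (\<Union>(z, r)\<in>C. cyl s z r)" and cost: "(\<Sum>(z, r)\<in>C. r powr \<sigma>) \<le> \<epsilon>"
    using C unfolding admissible_cover_def by auto
  show ?thesis
  proof (rule that[OF C], rule ccontr)
    fix z r assume zr: "(z, r) \<in> C"
    define S where "S = {(z', r') \<in> C. r' \<le> r \<and> cyl s z' (3 * r') \<inter> cyl s z (9 * r) \<noteq> {}}"
    assume "\<not> (\<Sum>(z', r') \<in> {(z', r') \<in> C. r' \<le> r \<and> cyl s z' (3 * r') \<inter> cyl s z (9 * r) \<noteq> {}}. r' powr \<sigma>) \<le> (13 * r) powr \<sigma>"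
    then have big: "(\<Sum>(z', r')\<in>S. r' powr \<sigma>) > (13 * r) powr \<sigma>" by (simp add: S_def)
    have r: "r > 0" using pos[OF zr] by simp
    have SC: "S \<subseteq> C" by (auto simp: S_def)
    have finS: "finite S" using SC fin finite_subset by blast
    have zrS: "(z, r) \<in> S" using zr r center_in_cyl[of "3 * r" z s] center_in_cyl[of "9 * r" z s] by (auto simp: S_def)
    \<comment> \<open>S needs two members for the exchange to lower their number; a singleton S
      would satisfy the packing bound already.\<close>
    have "S \<noteq> {(z, r)}"
    proof
      assume "S = {(z, r)}"
      then have "r powr \<sigma> > (13 * r) powr \<sigma>" using big by simp
      moreover have "r powr \<sigma> \<le> (13 * r) powr \<sigma>" using r \<sigma> by (intro powr_mono2) auto
      ultimately show False by simp
    qed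
    then obtain c where c: "c \<in> S" "c \<noteq> (z, r)" using zrS by blast
    have "card {c, (z, r)} \<le> card S" using c zrS finS by (intro card_mono) auto
    then have cS: "card S \<ge> 2" using c(2) by simp
    \<comment> \<open>13 = 9 + 3 + 1: through a common point, the cylinder of radius r' around z'
      lies in the one of radius 9 r + 3 r' + r' around z, and r' \<le> r on S.\<close>
    define C' where "C' = insert (z, 13 * r) (C - S)"
    have "card C' \<le> card (C - S) + 1" unfolding C'_def using fin by (simp add: card_insert_if)
    also have "card (C - S) = card C - card S" using SC finS by (simp add: card_Diff_subset)
    finally have less: "card C' < card C" using cS card_mono[OF fin SC] by simp
    have "K \<subseteq> (\<Union>(z, r)\<in>C'. cyl s z r)"
    proof
      fix v assume "v \<in> K"
      then obtain z' r' where v: "(z', r') \<in> C" "v \<in> cyl s z' r'" using cov by auto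
      show "v \<in> (\<Union>(z, r)\<in>C'. cyl s z r)"
      proof (cases "(z', r') \<in> S")
        case True
        then obtain w where w: "w \<in> cyl s z (9 * r)" "w \<in> cyl s z' (3 * r')" and r': "r' \<le> r" by (auto simp: S_def)
        have r'0: "0 < r'" using pos[OF v(1)] by simp
        have "cyl s z' r' \<subseteq> cyl s z (9 * r + 3 * r' + r')"
          by (rule cyl_swallow[OF w]) (use r r'0 s in auto)
        also have "\<dots> \<subseteq> cyl s z (13 * r)" using r r'0 r' s by (intro cyl_mono) auto
        finally show ?thesis using v(2) by (auto simp: C'_def)
      next
        case False
        then show ?thesis using v by (auto simp: C'_def)
      qed
    qed
    moreover have "(\<Sum>(z, r)\<in>C'. r powr \<sigma>) \<le> \<epsilon>"
    proof -
      have "(\<Sum>(z, r)\<in>C'. r powr \<sigma>) \<le> (13 * r) powr \<sigma> + (\<Sum>(z, r)\<in>C - S. r powr \<sigma>)"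
        unfolding C'_def using fin by (simp add: sum.insert_if)
      also have "(\<Sum>(z, r)\<in>C - S. r powr \<sigma>) = (\<Sum>(z, r)\<in>C. r powr \<sigma>) - (\<Sum>(z, r)\<in>S. r powr \<sigma>)"
        by (rule sum_diff[OF fin SC])
      finally show ?thesis using big cost by simp
    qed
    moreover have "\<forall>(z, r)\<in>C'. z \<in> K \<and> 0 < r" using pos pos[OF zr] by (auto simp: C'_def)
    ultimately have "admissible_cover s \<sigma> K \<epsilon> C'" unfolding admissible_cover_def using fin by (simp add: C'_def)
    from min[OF this] less show False by simp
  qed
qed

text \<open>The members are enumerated by decreasing radius because the running maxima in
  \<open>cutoff_family\<close> need each new cylinder to be no larger than its predecessors.\<close>

lemma packed_cover:
  fixes K :: "((real^'n) \<times> real) set"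
  assumes ex: "\<exists>C. admissible_cover s \<sigma> K \<epsilon> C" and s: "s \<ge> 1" and \<sigma>: "\<sigma> \<ge> 0"
  obtains N and z :: "nat \<Rightarrow> (real^'n) \<times> real" and r :: "nat \<Rightarrow> real" where
    "\<And>j. j < N \<Longrightarrow> z j \<in> K" "\<And>j. j < N \<Longrightarrow> 0 < r j" "\<And>i j. i \<le> j \<Longrightarrow> j < N \<Longrightarrow> r j \<le> r i"
    "K \<subseteq> (\<Union>j<N. cyl s (z j) (r j))" "(\<Sum>j<N. r j powr \<sigma>) \<le> \<epsilon>"
    "\<And>i. i < N \<Longrightarrow> (\<Sum>j | j < N \<and> r j \<le> r i \<and> cyl s (z j) (3 * r j) \<inter> cyl s (z i) (9 * r i) \<noteq> {}. r j powr \<sigma>)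
       \<le> (13 * r i) powr \<sigma>"
proof -
  obtain C where C: "admissible_cover s \<sigma> K \<epsilon> C" and pack: "\<And>z r. (z, r) \<in> C \<Longrightarrow>
      (\<Sum>(z', r') \<in> {(z', r') \<in> C. r' \<le> r \<and> cyl s z' (3 * r') \<inter> cyl s z (9 * r) \<noteq> {}}. r' powr \<sigma>) \<le> (13 * r) powr \<sigma>"
    using admissible_cover_packing[OF assms] by blast
  have fin: "finite C" and pos: "\<And>z r. (z, r) \<in> C \<Longrightarrow> z \<in> K \<and> 0 < r"
    and cov: "K \<subseteq> (\<Union>(z, r)\<in>C. cyl s z r)" and cost: "(\<Sum>(z, r)\<in>C. r powr \<sigma>) \<le> \<epsilon>"
    using C unfolding admissible_cover_def by auto
  obtain xs where xs: "set xs = C" "distinct xs" using finite_distinct_list[OF fin] by blast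
  define ys where "ys = sort_key (\<lambda>c. - snd c) xs"
  have ys: "set ys = C" "distinct ys" "sorted (map (\<lambda>c. - snd c) ys)"
    using xs by (simp_all add: ys_def)
  define N where "N = length ys"
  define z where "z j = fst (ys ! j)" for j
  define r where "r j = snd (ys ! j)" for j
  have zr: "ys ! j = (z j, r j)" for j by (simp add: z_def r_def)
  have bij: "bij_betw (\<lambda>j. (z j, r j)) {..<N} C"
    using bij_betw_nth[OF ys(2) _ ys(1)[symmetric], of "{..<N}"] by (simp add: N_def zr[symmetric])
  have inC: "(z j, r j) \<in> C" if "j < N" for j
    using bij that by (auto simp: bij_betw_def)
  have sum_eq: "(\<Sum>(z, r)\<in>{c \<in> C. P c}. r powr \<sigma>) = (\<Sum>j | j < N \<and> P (z j, r j). r j powr \<sigma>)" for P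
  proof -
    have "bij_betw (\<lambda>j. (z j, r j)) {j. j < N \<and> P (z j, r j)} {c \<in> C. P c}"
      using bij unfolding bij_betw_def inj_on_def by auto
    from sum.reindex_bij_betw[OF this, of "\<lambda>(z, r). r powr \<sigma>"] show ?thesis by simp
  qed
  show ?thesis
  proof (rule that[of N z r])
    show "\<And>j. j < N \<Longrightarrow> z j \<in> K" "\<And>j. j < N \<Longrightarrow> 0 < r j" using pos[OF inC] by blast+
    show "r j \<le> r i" if "i \<le> j" "j < N" for i j
      using sorted_nth_mono[OF ys(3) that(1)] that by (simp add: N_def r_def)
    show "K \<subseteq> (\<Union>j<N. cyl s (z j) (r j))"
    proof
      fix v assume "v \<in> K"
      then obtain c where c: "c \<in> C" "v \<in> cyl s (fst c) (snd c)" using cov by auto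
      then obtain j where "j < N" "c = (z j, r j)" using bij by (auto simp: bij_betw_def)
      then show "v \<in> (\<Union>j<N. cyl s (z j) (r j))" using c(2) by auto
    qed
    show "(\<Sum>j<N. r j powr \<sigma>) \<le> \<epsilon>"
      using sum_eq[of "\<lambda>_. True"] cost by (simp add: lessThan_def)
    show "(\<Sum>j | j < N \<and> r j \<le> r i \<and> cyl s (z j) (3 * r j) \<inter> cyl s (z i) (9 * r i) \<noteq> {}. r j powr \<sigma>)
       \<le> (13 * r i) powr \<sigma>" if "i < N" for i
    proof -
      have e: "{(z', r') \<in> C. r' \<le> r i \<and> cyl s z' (3 * r') \<inter> cyl s (z i) (9 * r i) \<noteq> {}}
         = {c \<in> C. snd c \<le> r i \<and> cyl s (fst c) (3 * snd c) \<inter> cyl s (z i) (9 * r i) \<noteq> {}}" by auto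
      show ?thesis
        using pack[OF inC[OF that]] unfolding e sum_eq by simp
    qed
  qed
qed

section \<open>Cutoff functions\<close>

text \<open>Separate constants respect the parabolic scales 1/r in space and 1/r^s in time. The
  property survives maxima, which destroy differentiability; mollification preserves it and restores
  derivatives bounded by the same constants.\<close>

definition Lip2 :: "((real^'n) \<times> real \<Rightarrow> real) \<Rightarrow> real \<Rightarrow> real \<Rightarrow> bool" where
  "Lip2 f a b \<longleftrightarrow> (\<forall>z w. \<bar>f z - f w\<bar> \<le> a * norm (fst z - fst w) + b * \<bar>snd z - snd w\<bar>)"

lemma Lip2_continuous:
  assumes "Lip2 f a b" "a \<ge> 0" "b \<ge> 0" shows "continuous_on S f"
proof (rule continuous_on_subset[OF _ subset_UNIV], unfold continuous_on_iff, intro ballI allI impI)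
  fix z and e :: real assume e: "e > 0"
  define d where "d = e / (a + b + 1)"
  have d: "d > 0" using e assms by (simp add: d_def)
  show "\<exists>d>0. \<forall>w\<in>UNIV. dist w z < d \<longrightarrow> dist (f w) (f z) < e"
  proof (intro exI[of _ d] conjI ballI impI d)
    fix w assume w: "dist w z < d"
    have "norm (fst w - fst z) \<le> dist w z" "\<bar>snd w - snd z\<bar> \<le> dist w z"
      using dist_fst_le[of w z] dist_snd_le[of w z] by (simp_all add: dist_norm)
    then have "a * norm (fst w - fst z) + b * \<bar>snd w - snd z\<bar> \<le> a * dist w z + b * dist w z"
      using assms by (intro add_mono mult_left_mono) auto
    then have "\<bar>f w - f z\<bar> \<le> (a + b) * dist w z"
      using assms(1)[unfolded Lip2_def, rule_format, of w z] by (simp add: algebra_simps)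
    also have "\<dots> \<le> (a + b) * d" using w assms by (intro mult_left_mono) auto
    also have "\<dots> < e" using e assms by (simp add: d_def field_simps)
    finally show "dist (f w) (f z) < e" by (simp add: dist_real_def)
  qed
qed

lemma pd_Lip2:
  assumes f: "C1 f" "Lip2 f a b"
  shows "\<bar>pd v f z\<bar> \<le> a * norm (fst v) + b * \<bar>snd v\<bar>"
proof -
  have d: "(f has_derivative (\<lambda>v. pd v f z)) (at z)" by (rule C1_has_derivative[OF f(1)])
  have lin: "linear (\<lambda>v. pd v f z)" using has_derivative_linear[OF d] .
  have "((\<lambda>h. f (z + h *\<^sub>R v)) has_derivative (\<lambda>h. pd (h *\<^sub>R v) f z)) (at 0)"
    by (rule has_derivative_compose[where f="\<lambda>h. z + h *\<^sub>R v" and f'="\<lambda>h. h *\<^sub>R v" and g=f and g'="\<lambda>v. pd v f z"])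
       (use d in \<open>auto intro!: derivative_eq_intros\<close>)
  then have "((\<lambda>h. f (z + h *\<^sub>R v)) has_real_derivative pd v f z) (at 0)"
    unfolding has_field_derivative_def by (simp add: linear_scale[OF lin] mult.commute[of _ "pd v f z"])
  then have lim: "(\<lambda>h. \<bar>(f (z + h *\<^sub>R v) - f z) / h\<bar>) \<midarrow>0\<rightarrow> \<bar>pd v f z\<bar>"
    unfolding DERIV_def by (intro tendsto_rabs) simp
  show ?thesis
  proof (rule tendsto_upperbound[OF lim])
    show "\<forall>\<^sub>F h in at 0. \<bar>(f (z + h *\<^sub>R v) - f z) / h\<bar> \<le> a * norm (fst v) + b * \<bar>snd v\<bar>"
    proof (rule eventually_at_filter[THEN iffD2], intro always_eventually allI impI)
      fix h :: real assume h: "h \<noteq> 0"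
      have "\<bar>f (z + h *\<^sub>R v) - f z\<bar> \<le> a * norm (h *\<^sub>R fst v) + b * \<bar>h * snd v\<bar>"
        using f(2)[unfolded Lip2_def, rule_format, of "z + h *\<^sub>R v" z] by simp
      also have "\<dots> = (a * norm (fst v) + b * \<bar>snd v\<bar>) * \<bar>h\<bar>" by (simp add: abs_mult algebra_simps)
      finally show "\<bar>(f (z + h *\<^sub>R v) - f z) / h\<bar> \<le> a * norm (fst v) + b * \<bar>snd v\<bar>"
        using h by (simp add: field_simps)
    qed
  qed simp
qed

lemma convol_mollifier_reflect:
  fixes f :: "'a::euclidean_space \<Rightarrow> real"
  assumes "continuous_on UNIV f"
  shows "convol (mollifier e) f z = (LINT y|lebesgue. mollifier e y * f (z - y))"
proof -
  have "continuous_on UNIV (\<lambda>y. mollifier e y * f (z - y))"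
    by (intro continuous_intros mollifier_continuous continuous_on_compose2[OF assms]) auto
  from lebesgue_integral_reflect[OF this, of z] show ?thesis by (simp add: convol_def)
qed

lemma mollifier_times_shift_integrable:
  fixes f :: "'a::euclidean_space \<Rightarrow> real"
  assumes "e > 0" "continuous_on UNIV f"
  shows "integrable lebesgue (\<lambda>y. mollifier e y * f (z - y))"
proof (rule integrable_lebesgue_compact_support(1))
  show "continuous_on UNIV (\<lambda>y. mollifier e y * f (z - y))"
    by (intro continuous_intros mollifier_continuous continuous_on_compose2[OF assms(2)]) auto
  show "compact (cball (0::'a) e)" by simp
  show "y \<notin> cball 0 e \<Longrightarrow> mollifier e y * f (z - y) = 0" for y by (simp add: mollifier_outside[OF assms(1)])
qed

text \<open>The mollification is an average of translates of f, all with the same constants.\<close>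

lemma Lip2_mollified:
  fixes f :: "(real^'n) \<times> real \<Rightarrow> real"
  assumes e: "e > 0" and f: "Lip2 f a b" and ab: "a \<ge> 0" "b \<ge> 0"
  shows "Lip2 (convol (mollifier e) f) a b"
  unfolding Lip2_def
proof (intro allI)
  fix z w :: "(real^'n) \<times> real"
  let ?c = "a * norm (fst z - fst w) + b * \<bar>snd z - snd w\<bar>"
  note c = Lip2_continuous[OF f ab, of UNIV]
  note i = mollifier_times_shift_integrable[OF e c]
  have mi: "integrable lebesgue (mollifier e)" using mollifier_times_shift_integrable[OF e, of "\<lambda>_. 1"] by simp
  have "\<bar>convol (mollifier e) f z - convol (mollifier e) f w\<bar>
      = \<bar>LINT y|lebesgue. mollifier e y * f (z - y) - mollifier e y * f (w - y)\<bar>"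
    using i by (simp add: convol_mollifier_reflect[OF c])
  also have "\<dots> \<le> (LINT y|lebesgue. \<bar>mollifier e y * f (z - y) - mollifier e y * f (w - y)\<bar>)"
    by (rule integral_abs_bound)
  also have "\<dots> \<le> (LINT y|(lebesgue :: ((real^'n) \<times> real) measure). mollifier e y * ?c)"
  proof (rule integral_mono)
    fix y
    have "\<bar>mollifier e y * f (z - y) - mollifier e y * f (w - y)\<bar> = mollifier e y * \<bar>f (z - y) - f (w - y)\<bar>"
      using mollifier_nonneg[OF e, of y] by (simp add: right_diff_distrib[symmetric] abs_mult)
    also have "\<dots> \<le> mollifier e y * ?c"
      using f[unfolded Lip2_def, rule_format, of "z - y" "w - y"] mollifier_nonneg[OF e, of y]
      by (intro mult_left_mono) simp_all
    finally show "\<bar>mollifier e y * f (z - y) - mollifier e y * f (w - y)\<bar> \<le> mollifier e y * ?c" .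
  qed (use i mi in auto)
  also have "\<dots> = ?c" using mollifier_integral[OF e, where 'a="(real^'n) \<times> real"] by simp
  finally show "\<bar>convol (mollifier e) f z - convol (mollifier e) f w\<bar> \<le> ?c" .
qed

lemma mollified_C1:
  assumes "e > 0" "integrable lebesgue f" shows "C1 (convol (mollifier e) f)"
proof -
  have o: "w \<notin> cball 0 e \<Longrightarrow> mollifier e w = 0" for w :: 'a by (rule mollifier_outside[OF assms(1)])
  show ?thesis using convol_C1(1)[OF mollifier_C1 compact_cball o assms(2)] by blast
qed

lemma mollified_const:
  fixes f :: "'a::euclidean_space \<Rightarrow> real"
  assumes "e > 0" "integrable lebesgue f" "\<And>y. norm (z - y) < e \<Longrightarrow> f y = c"
  shows "convol (mollifier e) f z = c"
  using convol_mollifier_near[OF assms(1,2), of z c 0] assms(3) by simp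

text \<open>Distance at most 1/2 from the value 1/2 expresses both bounds at once.\<close>

lemma mollified_range:
  fixes f :: "'a::euclidean_space \<Rightarrow> real"
  assumes e: "e > 0" and f: "integrable lebesgue f" and r: "\<And>y. 0 \<le> f y \<and> f y \<le> 1"
  shows "0 \<le> convol (mollifier e) f z" "convol (mollifier e) f z \<le> 1"
proof -
  have "norm (convol (mollifier e) f z - 1/2) \<le> 1/2"
  proof (rule convol_mollifier_near[OF e f])
    show "norm (f y - 1/2) \<le> 1/2" for y
      unfolding real_norm_def abs_le_iff using r[of y] by linarith
  qed simp
  then show "0 \<le> convol (mollifier e) f z" "convol (mollifier e) f z \<le> 1"
    unfolding real_norm_def abs_le_iff by linarith+
qed

text \<open>A and B are the support radii in units of r and r^s; the value 1 is reached one unit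
  further inside. The slopes are 1/r and 1/r^s.\<close>

definition tent :: "real \<Rightarrow> real \<Rightarrow> real \<Rightarrow> (real^'n) \<times> real \<Rightarrow> real \<Rightarrow> (real^'n) \<times> real \<Rightarrow> real" where
  "tent A B s z r w = max 0 (min 1 (min (A - norm (fst w - fst z) / r) (B - \<bar>snd w - snd z\<bar> / r powr s)))"

lemma tent_range: "0 \<le> tent A B s z r w" "tent A B s z r w \<le> 1"
  by (auto simp: tent_def)

lemma tent_Lip2:
  fixes z :: "(real^'n) \<times> real"
  assumes "r > 0" shows "Lip2 (tent A B s z r) (1 / r) (1 / r powr s)"
  unfolding Lip2_def
proof (intro allI)
  fix v w :: "(real^'n) \<times> real"
  have x: "\<bar>norm (fst v - fst z) / r - norm (fst w - fst z) / r\<bar> \<le> 1 / r * norm (fst v - fst w)"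
    using norm_triangle_ineq3[of "fst v - fst z" "fst w - fst z"] assms
    by (simp add: diff_divide_distrib[symmetric] divide_right_mono)
  have "\<bar>\<bar>snd v - snd z\<bar> - \<bar>snd w - snd z\<bar>\<bar> \<le> \<bar>snd v - snd w\<bar>" by linarith
  then have t: "\<bar>\<bar>snd v - snd z\<bar> / r powr s - \<bar>snd w - snd z\<bar> / r powr s\<bar> \<le> 1 / r powr s * \<bar>snd v - snd w\<bar>"
    using assms by (simp add: diff_divide_distrib[symmetric] divide_right_mono)
  have clamp: "\<bar>max 0 (min 1 a) - max 0 (min 1 b)\<bar> \<le> \<bar>a - b\<bar>" for a b :: real
    by (auto simp: max_def min_def)
  have mn: "\<bar>min (A - a) (B - b) - min (A - a') (B - b')\<bar> \<le> \<bar>a - a'\<bar> + \<bar>b - b'\<bar>" for a b a' b' :: real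
    by (auto simp: min_def)
  show "\<bar>tent A B s z r v - tent A B s z r w\<bar> \<le> 1 / r * norm (fst v - fst w) + 1 / r powr s * \<bar>snd v - snd w\<bar>"
    unfolding tent_def by (rule order_trans[OF clamp order_trans[OF mn add_mono[OF x t]]])
qed

lemma tent_eq_0:
  assumes "r > 0" "A * r \<le> norm (fst w - fst z) \<or> B * r powr s \<le> \<bar>snd w - snd z\<bar>"
  shows "tent A B s z r w = 0"
proof -
  have "A \<le> norm (fst w - fst z) / r \<or> B \<le> \<bar>snd w - snd z\<bar> / r powr s"
    using assms by (simp add: pos_le_divide_eq)
  then show ?thesis unfolding tent_def by linarith
qed

lemma tent_eq_1:
  assumes "r > 0" "norm (fst w - fst z) \<le> (A - 1) * r" "\<bar>snd w - snd z\<bar> \<le> (B - 1) * r powr s"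
  shows "tent A B s z r w = 1"
proof -
  have "norm (fst w - fst z) / r \<le> A - 1" "\<bar>snd w - snd z\<bar> / r powr s \<le> B - 1"
    using assms by (simp_all add: pos_divide_le_eq)
  then show ?thesis unfolding tent_def by linarith
qed

definition box2 :: "(real^'n) \<times> real \<Rightarrow> real \<Rightarrow> real \<Rightarrow> ((real^'n) \<times> real) set" where
  "box2 z a b = cball (fst z) a \<times> cball (snd z) b"

lemma compact_box2: "compact (box2 z a b)"
  unfolding box2_def by (intro compact_Times compact_cball)

lemma mem_box2: "w \<in> box2 z a b \<longleftrightarrow> norm (fst w - fst z) \<le> a \<and> \<bar>snd w - snd z\<bar> \<le> b"
  by (cases w; cases z) (auto simp: box2_def dist_norm norm_minus_commute)

lemma tent_support: "r > 0 \<Longrightarrow> w \<notin> box2 z (A * r) (B * r powr s) \<Longrightarrow> tent A B s z r w = 0"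
  by (rule tent_eq_0) (auto simp: mem_box2)

lemma close_components:
  fixes z y :: "(real^'n) \<times> real"
  assumes "norm (z - y) < e"
  shows "norm (fst z - fst y) < e" "\<bar>snd z - snd y\<bar> < e"
  using assms norm_fst_snd_le[of "z - y"] by auto

lemma powr_two_minus_mono: 
  fixes a s :: real assumes "a \<ge> 1" "s \<ge> 1" shows "a \<le> a powr s"
  using powr_mono[of 1 s a] assms by simp

lemma cylinder_cutoff:
  fixes z :: "(real^'n) \<times> real"
  assumes r: "r > 0" and s: "s \<ge> 1"
  obtains h where "C1 h" "\<And>w. 0 \<le> h w" "\<And>w. h w \<le> 1" "\<And>w. w \<in> cyl s z (3 * r) \<Longrightarrow> h w = 1"
    "\<And>w. w \<notin> cyl s z (9 * r) \<Longrightarrow> h w = 0"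
    "\<And>i w. \<bar>pd (axis i 1, 0) h w\<bar> \<le> 1 / r" "\<And>w. \<bar>pd (0, 1) h w\<bar> \<le> 1 / r powr s"
proof -
  \<comment> \<open>Mollification costs half a unit. In space 3 + 1/2 = A - 1 and A + 1/2 \<le> 9;
    in time 3^s + 1/2 = B - 1 and B + 1/2 \<le> 9^s, since 9^s is at least three times 3^s and 3^s
    \<ge> 3.\<close>
  define A where "A = (9/2 :: real)"
  define B where "B = 3 powr s + 3/2"
  define f where "f = tent A B s z r"
  define e where "e = min r (r powr s) / 2"
  have rs: "r powr s > 0" using r by simp
  have e: "e > 0" "e \<le> r / 2" "e \<le> r powr s / 2" using r rs by (auto simp: e_def)
  have L: "Lip2 f (1 / r) (1 / r powr s)" unfolding f_def by (rule tent_Lip2[OF r])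
  have nn: "1 / r \<ge> 0" "1 / r powr s \<ge> 0" using r by simp_all
  have fi: "integrable lebesgue f"
    by (rule integrable_lebesgue_compact_support(1)[OF Lip2_continuous[OF L nn] compact_box2])
       (unfold f_def, rule tent_support[OF r])
  have B9: "3 powr s * 3 \<le> (9 :: real) powr s"
  proof -
    have "(9::real) powr s = 3 powr s * 3 powr s" by (simp add: powr_mult[symmetric])
    then show ?thesis using powr_two_minus_mono[of 3 s] s by simp
  qed
  have three: "3 \<le> (3::real) powr s" using powr_two_minus_mono[of 3 s] s by simp
  let ?h = "convol (mollifier e) f"
  have Lh: "Lip2 ?h (1 / r) (1 / r powr s)" by (rule Lip2_mollified[OF e(1) L nn])
  have C: "C1 ?h" by (rule mollified_C1[OF e(1) fi])
  show ?thesis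
  proof (rule that[of ?h])
    show "C1 ?h" by (rule C)
    show "0 \<le> ?h w" "?h w \<le> 1" for w
      using mollified_range[OF e(1) fi] tent_range unfolding f_def by blast+
    show "?h w = 1" if w: "w \<in> cyl s z (3 * r)" for w
    proof (rule mollified_const[OF e(1) fi])
      fix y assume y: "norm (w - y) < e"
      note cc = close_components[OF y]
      have "norm (fst y - fst z) \<le> norm (fst w - fst z) + norm (fst w - fst y)"
        using norm_triangle_ineq4[of "fst w - fst z" "fst w - fst y"] by simp
      then have x: "norm (fst y - fst z) \<le> (A - 1) * r"
        using w cc e by (simp add: cyl_def A_def)
      have "\<bar>snd y - snd z\<bar> \<le> 3 powr s * r powr s + r powr s / 2"
        using w cc e r by (auto simp: cyl_def powr_mult)
      then have t: "\<bar>snd y - snd z\<bar> \<le> (B - 1) * r powr s" by (simp add: B_def algebra_simps)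
      show "f y = 1" unfolding f_def by (rule tent_eq_1[OF r x t])
    qed
    show "?h w = 0" if w: "w \<notin> cyl s z (9 * r)" for w
    proof (rule mollified_const[OF e(1) fi])
      fix y assume y: "norm (w - y) < e"
      note cc = close_components[OF y]
      have n: "norm (fst w - fst z) \<le> norm (fst y - fst z) + norm (fst w - fst y)"
        using norm_triangle_ineq[of "fst y - fst z" "fst w - fst y"] by simp
      have "A * r \<le> norm (fst y - fst z) \<or> B * r powr s \<le> \<bar>snd y - snd z\<bar>"
      proof (cases "norm (fst w - fst z) < 9 * r")
        case False
        then show ?thesis using n cc e r by (simp add: A_def)
      next
        case True
        then have "\<bar>snd w - snd z\<bar> \<ge> 9 powr s * r powr s" using w r by (auto simp: cyl_def powr_mult)
        moreover have "9 powr s * r powr s \<ge> (3 powr s * 3) * r powr s" using B9 rs by (intro mult_right_mono) auto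
        moreover have "3 powr s * r powr s \<ge> 3 * r powr s" using three rs by (intro mult_right_mono) auto
        ultimately have "\<bar>snd w - snd z\<bar> \<ge> 3 powr s * r powr s + 6 * r powr s" by (simp add: algebra_simps)
        then show ?thesis using cc e by (auto simp: B_def algebra_simps)
      qed
      then show "f y = 0" unfolding f_def by (rule tent_eq_0[OF r])
    qed
    show "\<bar>pd (axis i 1, 0) ?h w\<bar> \<le> 1 / r" for i w using pd_Lip2[OF C Lh, where v="(axis i 1, 0)" and z=w] by (simp add: norm_axis_1)
    show "\<bar>pd (0, 1) ?h w\<bar> \<le> 1 / r powr s" for w using pd_Lip2[OF C Lh, where v="(0, 1)" and z=w] by simp
  qed
qed

primrec maxes :: "(nat \<Rightarrow> 'a \<Rightarrow> real) \<Rightarrow> nat \<Rightarrow> 'a \<Rightarrow> real" where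
  "maxes t 0 = (\<lambda>_. 0)"
| "maxes t (Suc j) = (\<lambda>w. max (maxes t j w) (t j w))"

lemma maxes_range: "(\<And>j w. 0 \<le> t j w \<and> t j w \<le> 1) \<Longrightarrow> 0 \<le> maxes t k w \<and> maxes t k w \<le> 1"
  by (induction k) (auto simp: max_def)

lemma maxes_ge: "j < k \<Longrightarrow> t j w \<le> maxes t k w"
  by (induction k) (auto simp: less_Suc_eq max_def)

lemma maxes_Lip2:
  assumes "a \<ge> 0" "b \<ge> 0" "\<And>j. j < k \<Longrightarrow> Lip2 (t j) a b"
  shows "Lip2 (maxes t k) a b"
  using assms(3)
proof (induction k)
  case 0
  then show ?case using assms by (simp add: Lip2_def)
next
  case (Suc k)
  then have 1: "Lip2 (maxes t k) a b" and 2: "Lip2 (t k) a b" by auto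
  show ?case unfolding Lip2_def
  proof (intro allI)
    fix z w
    have mx: "\<bar>x - x'\<bar> \<le> c \<Longrightarrow> \<bar>y - y'\<bar> \<le> c \<Longrightarrow> \<bar>max x y - max x' y'\<bar> \<le> c" for x x' y y' c :: real
      by (auto simp: max_def abs_le_iff)
    show "\<bar>maxes t (Suc k) z - maxes t (Suc k) w\<bar> \<le> a * norm (fst z - fst w) + b * \<bar>snd z - snd w\<bar>"
      unfolding maxes.simps by (rule mx) (rule 1[unfolded Lip2_def, rule_format], rule 2[unfolded Lip2_def, rule_format])
  qed
qed

lemma Lip2_mono: "Lip2 f a b \<Longrightarrow> a \<le> a' \<Longrightarrow> b \<le> b' \<Longrightarrow> Lip2 f a' b'"
  unfolding Lip2_def by (meson add_mono mult_right_mono norm_ge_zero abs_ge_zero order_trans)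

lemma maxes_support: "(\<And>j. j < k \<Longrightarrow> w \<notin> S j \<Longrightarrow> t j w = 0) \<Longrightarrow> w \<notin> (\<Union>j<k. S j) \<Longrightarrow> maxes t k w = 0"
  by (induction k) auto

text \<open>Adding the cutoffs by decreasing radius and taking maxima instead of sums, the \<open>k\<close>-th
  increment is Lipschitz at the scale \<open>r k\<close> irrespective of the overlap of the cylinders.\<close>

lemma cutoff_family:
  fixes z :: "nat \<Rightarrow> (real^'n) \<times> real"
  assumes r: "\<And>j. j < N \<Longrightarrow> 0 < r j" and anti: "\<And>i j. i \<le> j \<Longrightarrow> j < N \<Longrightarrow> r j \<le> r i" and s: "s \<ge> 1"
  obtains M :: "nat \<Rightarrow> (real^'n) \<times> real \<Rightarrow> real" where
    "\<And>k. k \<le> N \<Longrightarrow> C1 (M k)" "\<And>k w. k \<le> N \<Longrightarrow> 0 \<le> M k w" "\<And>k w. k \<le> N \<Longrightarrow> M k w \<le> 1" "\<And>w. M 0 w = 0"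
    "\<And>k w. k < N \<Longrightarrow> w \<notin> cyl s (z k) (3 * r k) \<Longrightarrow> M (Suc k) w = M k w"
    "\<And>k w v. k < N \<Longrightarrow> w \<notin> cyl s (z k) (3 * r k) \<Longrightarrow> pd v (M (Suc k)) w = pd v (M k) w"
    "\<And>k w i. k < N \<Longrightarrow> \<bar>pd (axis i 1, 0) (M (Suc k)) w\<bar> \<le> 1 / r k"
    "\<And>k w. k < N \<Longrightarrow> \<bar>pd (0, 1) (M (Suc k)) w\<bar> \<le> 1 / r k powr s"
    "\<And>j k w. j < k \<Longrightarrow> k \<le> N \<Longrightarrow> w \<in> cyl s (z j) (r j) \<Longrightarrow> M k w = 1"
proof -
  \<comment> \<open>Each tent is 1 up to 3/2 units and 0 beyond 5/2. Mollification at a quarter unit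
    leaves the value 1 on the cylinder and a support within 11/4 < 3 units.\<close>
  define t where "t j = tent (5/2) (5/2) s (z j) (r j)" for j
  define m where "m = maxes t"
  have trange: "0 \<le> t j w \<and> t j w \<le> 1" for j w using tent_range unfolding t_def by blast
  have mrange: "0 \<le> m k w \<and> m k w \<le> 1" for k w unfolding m_def by (rule maxes_range[OF trange])
  \<comment> \<open>One mollification radius serves all stages, so that consecutive stages differ
    only within that distance of the new tent.\<close>
  obtain e where e0: "e > 0" and e: "\<And>j. j < N \<Longrightarrow> e \<le> r j / 4 \<and> e \<le> r j powr s / 4"
  proof -
    define X where "X = insert 1 ((\<lambda>j. min (r j / 4) (r j powr s / 4)) ` {..<N})"
    have X: "finite X" "X \<noteq> {}" by (auto simp: X_def)
    have "0 < min (r j / 4) (r j powr s / 4)" if "j < N" for j using r[OF that] by simp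
    then have "\<forall>x\<in>X. 0 < x" unfolding X_def by auto
    then have "Min X > 0" using X by simp
    moreover have "Min X \<le> r j / 4 \<and> Min X \<le> r j powr s / 4" if "j < N" for j
    proof -
      have "Min X \<le> min (r j / 4) (r j powr s / 4)" using X(1) that by (intro Min_le) (auto simp: X_def)
      then show ?thesis by simp
    qed
    ultimately show ?thesis using that by blast
  qed
  have tL: "Lip2 (t j) (1 / r j) (1 / r j powr s)" if "j < N" for j
    unfolding t_def by (rule tent_Lip2[OF r[OF that]])
  \<comment> \<open>Earlier radii are no smaller, hence all tents up to the k-th share its Lipschitz
    constants.\<close>
  have mL: "Lip2 (m (Suc k)) (1 / r k) (1 / r k powr s)" if k: "k < N" for k
    unfolding m_def
  proof (rule maxes_Lip2)
    show "0 \<le> 1 / r k" "0 \<le> 1 / r k powr s" using r[OF k] by simp_all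
    fix j assume j: "j < Suc k"
    have rk: "0 < r k" "r k \<le> r j" using r anti[of j k] j k by auto
    show "Lip2 (t j) (1 / r k) (1 / r k powr s)"
    proof (rule Lip2_mono[OF tL])
      show "j < N" using j k by simp
      show "1 / r j \<le> 1 / r k" using rk by (simp add: frac_le)
      have "r k powr s \<le> r j powr s" using rk s by (intro powr_mono2) auto
      then show "1 / r j powr s \<le> 1 / r k powr s" using rk by (intro frac_le) auto
    qed
  qed
  have m0: "m 0 = (\<lambda>_. 0)" by (simp add: m_def)
  have mc: "continuous_on UNIV (m k)" if "k \<le> N" for k
  proof (cases k)
    case (Suc j)
    then have j: "j < N" using that by simp
    show ?thesis unfolding Suc by (rule Lip2_continuous[OF mL[OF j]]) (use r[OF j] in simp_all)
  qed (simp add: m0)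
  have mi: "integrable lebesgue (m k)" if k: "k \<le> N" for k
  proof (rule integrable_lebesgue_compact_support(1)[OF mc[OF k]])
    show "compact (\<Union>j<k. box2 (z j) (5/2 * r j) (5/2 * r j powr s))"
      by (intro compact_UN compact_box2) auto
    show "m k w = 0" if "w \<notin> (\<Union>j<k. box2 (z j) (5/2 * r j) (5/2 * r j powr s))" for w
      unfolding m_def by (rule maxes_support[OF _ that]) (use k r in \<open>auto simp: t_def intro: tent_support\<close>)
  qed
  define M where "M k = convol (mollifier e) (m k)" for k
  have C: "C1 (M k)" if "k \<le> N" for k unfolding M_def by (rule mollified_C1[OF e0 mi[OF that]])
  have MLip: "Lip2 (M (Suc k)) (1 / r k) (1 / r k powr s)" if k: "k < N" for k
    unfolding M_def by (rule Lip2_mollified[OF e0 mL[OF k]]) (use r[OF k] in simp_all)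
  have same: "M (Suc k) w = M k w" if k: "k < N" and w: "w \<notin> box2 (z k) (11/4 * r k) (11/4 * r k powr s)" for k w
  proof -
    have "convol (mollifier e) (\<lambda>y. m (Suc k) y - m k y) w = 0"
    proof (rule mollified_const[OF e0])
      show "integrable lebesgue (\<lambda>y. m (Suc k) y - m k y)" using mi[of "Suc k"] mi[of k] k by simp
      fix y assume y: "norm (w - y) < e"
      note cc = close_components[OF y]
      have ek: "e \<le> r k / 4" "e \<le> r k powr s / 4" using e[OF k] by auto
      have n: "norm (fst w - fst (z k)) \<le> norm (fst y - fst (z k)) + norm (fst w - fst y)"
        using norm_triangle_ineq[of "fst y - fst (z k)" "fst w - fst y"] by simp
      have "5/2 * r k \<le> norm (fst y - fst (z k)) \<or> 5/2 * r k powr s \<le> \<bar>snd y - snd (z k)\<bar>"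
      proof (cases "norm (fst w - fst (z k)) \<le> 11/4 * r k")
        case False
        then show ?thesis using n cc ek by linarith
      next
        case True
        then have "\<bar>snd w - snd (z k)\<bar> > 11/4 * r k powr s" using w by (simp add: mem_box2)
        then show ?thesis using cc ek by linarith
      qed
      then have "t k y = 0" unfolding t_def by (rule tent_eq_0[OF r[OF k]])
      then show "m (Suc k) y - m k y = 0" using mrange[of k y] by (simp add: m_def)
    qed
    then show ?thesis using convol_diff[OF e0 mi[of "Suc k"] mi[of k]] k by (simp add: M_def)
  qed
  have sub: "box2 (z k) (11/4 * r k) (11/4 * r k powr s) \<subseteq> cyl s (z k) (3 * r k)" if k: "k < N" for k
  proof
    fix w assume w: "w \<in> box2 (z k) (11/4 * r k) (11/4 * r k powr s)"
    have "3 * r k powr s \<le> 3 powr s * r k powr s"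
      using powr_two_minus_mono[of 3 s] s by (intro mult_right_mono) auto
    moreover have "0 < r k powr s" using r[OF k] by simp
    ultimately have "11/4 * r k powr s < (3 * r k) powr s" using r[OF k] by (simp add: powr_mult)
    then show "w \<in> cyl s (z k) (3 * r k)" using w r[OF k] by (auto simp: mem_box2 cyl_def)
  qed
  show ?thesis
  proof (rule that[of M])
    show "C1 (M k)" if "k \<le> N" for k by (rule C[OF that])
    show "0 \<le> M k w" "M k w \<le> 1" if "k \<le> N" for k w
      unfolding M_def using mollified_range[OF e0 mi[OF that] mrange] by blast+
    show "M 0 w = 0" for w unfolding M_def m0 by (simp add: convol_def)
    show "M (Suc k) w = M k w" if "k < N" "w \<notin> cyl s (z k) (3 * r k)" for k w
      using same[OF that(1)] sub[OF that(1)] that(2) by blast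
    show "pd v (M (Suc k)) w = pd v (M k) w" if k: "k < N" and w: "w \<notin> cyl s (z k) (3 * r k)" for k w v
    proof -
      have "pd v (\<lambda>w. M (Suc k) w - M k w) w = 0"
      proof (rule pd_eq_0_outside)
        show "closed (box2 (z k) (11/4 * r k) (11/4 * r k powr s))" by (rule compact_imp_closed[OF compact_box2])
        show "M (Suc k) w - M k w = 0" if "w \<notin> box2 (z k) (11/4 * r k) (11/4 * r k powr s)" for w
          using same[OF k that] by simp
        show "w \<notin> box2 (z k) (11/4 * r k) (11/4 * r k powr s)" using sub[OF k] w by blast
      qed
      then show ?thesis using pd_diff[OF C[of "Suc k"] C[of k], where v=v and z=w] k by simp
    qed
    show "\<bar>pd (axis i 1, 0) (M (Suc k)) w\<bar> \<le> 1 / r k" if "k < N" for k w i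
      using pd_Lip2[OF C[of "Suc k"] MLip[OF that], where v="(axis i 1, 0)" and z=w] that by (simp add: norm_axis_1)
    show "\<bar>pd (0, 1) (M (Suc k)) w\<bar> \<le> 1 / r k powr s" if "k < N" for k w
      using pd_Lip2[OF C[of "Suc k"] MLip[OF that], where v="(0, 1)" and z=w] that by simp
    show "M k w = 1" if jk: "j < k" "k \<le> N" and w: "w \<in> cyl s (z j) (r j)" for j k w
      unfolding M_def
    proof (rule mollified_const[OF e0 mi[OF jk(2)]])
      fix y assume y: "norm (w - y) < e"
      note cc = close_components[OF y]
      have j: "j < N" using jk by simp
      have ek: "e \<le> r j / 4" "e \<le> r j powr s / 4" using e[OF j] by auto
      have "norm (fst y - fst (z j)) \<le> norm (fst w - fst (z j)) + norm (fst w - fst y)"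
        using norm_triangle_ineq4[of "fst w - fst (z j)" "fst w - fst y"] by simp
      then have x: "norm (fst y - fst (z j)) \<le> (5/2 - 1) * r j"
        using w cc ek r[OF j] by (simp add: cyl_def)
      have tt: "\<bar>snd y - snd (z j)\<bar> \<le> (5/2 - 1) * r j powr s"
      proof -
        have "\<bar>snd w - snd (z j)\<bar> < r j powr s" using w by (simp add: cyl_def)
        moreover have "0 < r j powr s" using r[OF j] by simp
        ultimately have "\<bar>snd y - snd (z j)\<bar> \<le> 3/2 * r j powr s" using cc(2) ek(2) by arith
        then show ?thesis by simp
      qed
      have "t j y = 1" unfolding t_def by (rule tent_eq_1[OF r[OF j] x tt])
      then have "1 \<le> m k y" unfolding m_def using maxes_ge[OF jk(1), of t y] by simp
      then show "m k y = 1" using mrange[of k y] by simp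
    qed
  qed
qed

lemma compact_cutoff:
  fixes K D :: "'a::euclidean_space set"
  assumes K: "compact K" "K \<subseteq> D" and D: "open D"
  obtains h where "C1 h" "\<And>w. 0 \<le> h w" "\<And>w. h w \<le> 1" "\<And>w. w \<in> K \<Longrightarrow> h w = 1"
    "compact (tsupp h)" "tsupp h \<subseteq> D"
proof (cases "K = {}")
  case True
  have "tsupp (\<lambda>_::'a. 0::real) = {}" by (simp add: tsupp_def)
  then show ?thesis using that[of "\<lambda>_. 0"] True by (simp del: Ck.simps)
next
  case False
  obtain d where d: "d > 0" "\<And>x. x \<in> K \<Longrightarrow> ball x d \<subseteq> D"
    using Heine_Borel_lemma[OF K(1), of "{D}"] K(2) D by auto
  \<comment> \<open>f is 1 up to distance 2e from K and 0 beyond 3e; after mollification at radius e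
    the support lies within distance 4e = d/2.\<close>
  define e where "e = d / 8"
  have e: "e > 0" using d by (simp add: e_def)
  define f where "f w = max 0 (min 1 (3 - infdist w K / e))" for w
  have fc: "continuous_on UNIV f" unfolding f_def using e by (intro continuous_intros) auto
  define S where "S r = {w. infdist w K \<le> r}" for r
  have Sc: "r > 0 \<Longrightarrow> compact (S r)" for r unfolding S_def by (rule compact_infdist_le[OF False K(1)])
  have fi: "integrable lebesgue f"
    by (rule integrable_lebesgue_compact_support(1)[OF fc Sc[of "3 * e"]]) (use e in \<open>auto simp: S_def f_def field_simps\<close>)
  let ?h = "convol (mollifier e) f"
  have out: "?h w = 0" if "w \<notin> S (4 * e)" for w
  proof (rule mollified_const[OF e fi])
    fix y assume "norm (w - y) < e"
    then have "infdist w K \<le> infdist y K + e" using infdist_triangle[of w K y] by (simp add: dist_norm)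
    then have "infdist y K \<ge> 3 * e" using that by (simp add: S_def)
    then show "f y = 0" using e by (simp add: f_def field_simps)
  qed
  have sub: "tsupp ?h \<subseteq> S (4 * e)"
    unfolding tsupp_def by (rule closure_minimal) (use out compact_imp_closed[OF Sc] e in auto)
  have SD: "S (4 * e) \<subseteq> D"
  proof
    fix w assume "w \<in> S (4 * e)"
    then have "infdist w K < d" using d(1) by (simp add: S_def e_def)
    then obtain x where "x \<in> K" "dist w x < d"
      using infdist_attains_inf[OF compact_imp_closed[OF K(1)] False, of w] by metis
    then show "w \<in> D" using d(2)[of x] by (auto simp: dist_commute)
  qed
  show ?thesis
  proof (rule that[of ?h])
    show "C1 ?h" by (rule mollified_C1[OF e fi])
    have "0 \<le> f y \<and> f y \<le> 1" for y by (auto simp: f_def)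
    then show "0 \<le> ?h w" "?h w \<le> 1" for w using mollified_range[OF e fi] by blast+
    show "?h w = 1" if "w \<in> K" for w
    proof (rule mollified_const[OF e fi])
      fix y assume "norm (w - y) < e"
      then have "infdist y K \<le> e" using infdist_le2[OF that, of y e] by (simp add: dist_norm norm_minus_commute)
      then have "infdist y K / e \<le> 1" using e by simp
      then show "f y = 1" by (simp add: f_def)
    qed
    show "compact (tsupp ?h)"
      using sub Sc[of "4 * e"] e closed_tsupp by (metis compact_Int_closed inf.absorb_iff2 mult_pos_pos zero_less_numeral)
    show "tsupp ?h \<subseteq> D" using sub SD by blast
  qed
qed

section \<open>Energy estimates near the exceptional set\<close>

text \<open>With y = G h^(q/p) the left side is at most y^(p-1) B. If B \<le> \<tau> y the first
  term on the right dominates it, otherwise y < B/\<tau> and the second does. Passing to y uses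
  h^(q-1) \<le> h^((q/p)(p-1)), true for h \<le> 1 because q \<ge> p.\<close>

lemma weighted_young:
  fixes G h B \<tau> p :: real and q :: nat
  assumes G: "G \<ge> 0" and h: "0 \<le> h" "h \<le> 1" and B: "B \<ge> 0" and q: "real q \<ge> p" and p: "p > 1" and \<tau>: "\<tau> > 0"
  shows "G powr (p - 1) * h ^ (q - 1) * B \<le> \<tau> * (G powr p * h ^ q) + \<tau> powr (1 - p) * B powr p"
proof (cases "h = 0 \<or> G = 0")
  case True
  have "q > 1" using q p by simp
  then show ?thesis using True \<tau> G h by (auto simp: zero_power)
next
  case False
  then have h0: "h > 0" and G0: "G > 0" using h G by auto
  have q1: "q > 1" using q p by simp
  define y where "y = G * h powr (real q / p)"
  have y: "y > 0" using h0 G0 by (simp add: y_def)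
  have "real (q - 1) \<ge> real q / p * (p - 1)"
  proof -
    have "real q / p * (p - 1) = real q - real q / p" using p by (simp add: field_simps)
    moreover have "real q / p \<ge> 1" using q p by simp
    ultimately show ?thesis using q1 by (simp add: of_nat_diff)
  qed
  then have "h powr real (q - 1) \<le> h powr (real q / p * (p - 1))"
    using h h0 by (intro powr_mono') auto
  then have hq: "h ^ (q - 1) \<le> (h powr (real q / p)) powr (p - 1)"
    using h0 by (simp add: powr_realpow powr_powr)
  have "G powr (p - 1) * h ^ (q - 1) \<le> G powr (p - 1) * (h powr (real q / p)) powr (p - 1)"
    using hq by (intro mult_left_mono) auto
  also have "\<dots> = y powr (p - 1)" using G0 h0 by (simp add: y_def powr_mult)
  finally have 1: "G powr (p - 1) * h ^ (q - 1) * B \<le> y powr (p - 1) * B" using B by (rule mult_right_mono)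
  have yp: "y powr p = G powr p * h ^ q"
    using G0 h0 p by (simp add: y_def powr_mult powr_powr powr_realpow)
  have yy: "t powr (p - 1) * t = t powr p" if "t > 0" for t :: real
    using powr_add[of t "p - 1" 1] that by simp
  show ?thesis
  proof (cases "B \<le> \<tau> * y")
    case True
    then have "y powr (p - 1) * B \<le> y powr (p - 1) * (\<tau> * y)" by (intro mult_left_mono) auto
    also have "\<dots> = \<tau> * (G powr p * h ^ q)" using yy[OF y] yp by (simp add: mult_ac)
    finally show ?thesis using 1 by (smt (verit) powr_ge_zero mult_nonneg_nonneg)
  next
    case False
    then have B1: "\<tau> * y < B" by simp
    have B0: "B > 0" using mult_pos_pos[OF \<tau> y] B1 by linarith
    have "y \<le> B / \<tau>" using B1 \<tau> by (simp add: pos_le_divide_eq mult.commute)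
    then have "y powr (p - 1) * B \<le> (B / \<tau>) powr (p - 1) * B"
      using y p B by (intro mult_right_mono powr_mono2) auto
    also have "\<dots> = \<tau> powr (1 - p) * B powr p"
    proof -
      have "\<tau> powr (1 - p) = inverse (\<tau> powr (p - 1))" using powr_minus[of \<tau> "p - 1"] by simp
      moreover have "(B / \<tau>) powr (p - 1) = B powr (p - 1) / \<tau> powr (p - 1)"
        by (rule powr_divide)
      ultimately have "(B / \<tau>) powr (p - 1) * B = \<tau> powr (1 - p) * (B powr (p - 1) * B)"
        by (simp add: field_simps)
      then show ?thesis unfolding yy[OF B0] .
    qed
    moreover have "0 \<le> \<tau> * (G powr p * h ^ q)" using \<tau> h by simp
    ultimately show ?thesis using 1 by linarith
  qed
qed

section \<open>The setting and integrability off the exceptional set\<close>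

text \<open>Gathers what is known off E, namely local p-integrability of g and the energy and
  gradient identities, with the Hoelder and covering conditions rephrased by \<open>cyl\<close>.
  Growth and coercivity are stated on the whole space, so g and a are to be thought of as extended
  by 0.\<close>

locale removable =
  fixes p \<alpha> \<nu> L Mh nn :: real and D E :: "((real^'n) \<times> real) set" and u :: "(real^'n) \<times> real \<Rightarrow> real"
    and g a :: "(real^'n) \<times> real \<Rightarrow> real^'n"
  assumes p: "p \<ge> 2" and nn: "nn = real CARD('n)" and \<alpha>: "0 < \<alpha>" "\<alpha> \<le> 1" and \<nu>: "0 < \<nu>" and L: "0 \<le> L" and Mh: "0 < Mh"
    and D: "open D" and Ecl: "closedin (top_of_set D) E"
    and um: "u \<in> borel_measurable lebesgue" and gm: "g \<in> borel_measurable lebesgue" and am: "a \<in> borel_measurable lebesgue"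
    and uc: "continuous_on D u"
    and growth: "AE z in lebesgue. norm (a z) \<le> L * norm (g z) powr (p - 1)"
    and coer: "AE z in lebesgue. \<nu> * norm (g z) powr p \<le> a z \<bullet> g z"
    and loc: "\<And>K. compact K \<Longrightarrow> K \<subseteq> D - E \<Longrightarrow> set_integrable lebesgue K (\<lambda>z. norm (g z) powr p)"
    and energy: "\<And>\<zeta> c. C1 \<zeta> \<Longrightarrow> compact (tsupp \<zeta>) \<Longrightarrow> tsupp \<zeta> \<subseteq> D - E \<Longrightarrow>
      (LINT z|lebesgue. (a z \<bullet> g z) * \<zeta> z + (u z - c) * (a z \<bullet> xgrad \<zeta> z) - (u z - c)^2 / 2 * tpart \<zeta> z) = 0"
    and grad: "\<And>\<zeta> i. C1 \<zeta> \<Longrightarrow> compact (tsupp \<zeta>) \<Longrightarrow> tsupp \<zeta> \<subseteq> D - E \<Longrightarrow>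
      (LINT z|lebesgue. u z * xpart \<zeta> i z + g z $ i * \<zeta> z) = 0"
    and holder: "\<And>z0 z r. z0 \<in> E \<Longrightarrow> z \<in> D \<Longrightarrow> r > 0 \<Longrightarrow> z \<in> cyl (p + \<alpha> * (2 - p)) z0 r \<Longrightarrow> \<bar>u z - u z0\<bar> \<le> Mh * r powr \<alpha>"
    and cover: "\<And>\<epsilon>. \<epsilon> > 0 \<Longrightarrow> \<exists>(r :: nat \<Rightarrow> real) z. (\<forall>i. 0 < r i) \<and> E \<subseteq> (\<Union>i. cyl (p + \<alpha> * (2 - p)) (z i) (r i))
      \<and> (\<Sum>i. ennreal (r i powr (real CARD('n) + \<alpha>))) < ennreal \<epsilon>"
begin

abbreviation s where "s \<equiv> p + \<alpha> * (2 - p)"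
abbreviation \<sigma> where "\<sigma> \<equiv> nn + \<alpha>"

text \<open>An integer exponent at least p: integer powers of C1 cutoffs remain C1, and
  \<open>weighted_young\<close> applies.\<close>

definition q :: nat where "q = nat \<lceil>p\<rceil>"
definition V :: real where "V = 2 * unit_ball_vol nn"

lemma q: "real q \<ge> p" "q \<ge> 2"
proof -
  show "real q \<ge> p" using p unfolding q_def by (simp add: of_nat_ceiling)
  then have "real q \<ge> 2" using p by simp
  then show "q \<ge> 2" by simp
qed

lemma s2: "s \<ge> 2"
proof -
  have "s = 2 + (p - 2) * (1 - \<alpha>)" by (simp add: algebra_simps)
  then show ?thesis using p \<alpha> by simp
qed

lemma V0: "V \<ge> 0"
proof -
  have "nn \<ge> 0" using nn by simp
  then show ?thesis by (simp add: V_def)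
qed

lemma measure_cyl3: "r > 0 \<Longrightarrow> measure lebesgue (cyl s z (c * r)) = V * (c * r) powr (nn + s)" if "c > 0"
  for z :: "(real^'n) \<times> real"
  using measure_cyl[of "c * r" s z, folded nn] that by (simp add: V_def)

text \<open>The integrands tested off E are bounded by multiples of 1 + norm g powr p on compact
  sets that avoid E.\<close>

lemma integrable_dom:
  fixes f :: "(real^'n) \<times> real \<Rightarrow> real"
  assumes "compact K" "K \<subseteq> D - E" "f \<in> borel_measurable lebesgue"
    "AE z in lebesgue. \<bar>f z\<bar> \<le> C * (indicator K z * (1 + norm (g z) powr p))"
  shows "integrable lebesgue f"
proof (rule Bochner_Integration.integrable_bound[OF _ assms(3)])
  have "integrable lebesgue (indicator K :: (real^'n) \<times> real \<Rightarrow> real)"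
    using lmeasurable_compact[OF assms(1)] lmeasurable_iff_integrable by blast
  moreover have "integrable lebesgue (\<lambda>z. indicator K z * norm (g z) powr p)"
    using loc[OF assms(1,2)] by (simp add: set_integrable_def)
  ultimately show "integrable lebesgue (\<lambda>z. C * (indicator K z * (1 + norm (g z) powr p)))"
    by (simp add: distrib_left)
  show "AE z in lebesgue. norm (f z) \<le> norm (C * (indicator K z * (1 + norm (g z) powr p)))"
    using assms(4) by eventually_elim simp
qed

lemma a_bound:
  assumes "norm (a z) \<le> L * norm (g z) powr (p - 1)"
  shows "norm (a z) \<le> L * (1 + norm (g z) powr p)" "\<bar>a z \<bullet> g z\<bar> \<le> L * norm (g z) powr p"
proof -
  have "norm (g z) powr (p - 1) * 1 \<le> norm (g z) powr p + 1 powr p"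
    by (rule powr_mult_le_sum_powr) (use p in auto)
  then have "L * norm (g z) powr (p - 1) \<le> L * (1 + norm (g z) powr p)"
    using L by (intro mult_left_mono) auto
  then show "norm (a z) \<le> L * (1 + norm (g z) powr p)" using assms by linarith
  have "\<bar>a z \<bullet> g z\<bar> \<le> norm (a z) * norm (g z)" by (rule Cauchy_Schwarz_ineq2)
  also have "\<dots> \<le> L * norm (g z) powr (p - 1) * norm (g z)" using assms by (rule mult_right_mono) simp
  also have "\<dots> = L * norm (g z) powr p"
    using powr_mult_base[of "norm (g z)" "p - 1"] by (cases "g z = 0") (auto simp: mult_ac)
  finally show "\<bar>a z \<bullet> g z\<bar> \<le> L * norm (g z) powr p" .
qed

lemma gp_measurable: "(\<lambda>z. norm (g z) powr p) \<in> borel_measurable lebesgue"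
proof -
  have "(\<lambda>z. norm (g z)) \<in> borel_measurable lebesgue" using gm by measurable
  then show ?thesis by (intro powr_real_measurable) auto
qed

lemma u_bounded:
  assumes "compact K" "K \<subseteq> D" obtains B where "B \<ge> 0" "\<And>z. z \<in> K \<Longrightarrow> \<bar>u z\<bar> \<le> B"
proof -
  have "compact (u ` K)" using assms uc by (auto intro: compact_continuous_image continuous_on_subset)
  then obtain b where b: "\<forall>x\<in>u ` K. norm x \<le> b" using compact_imp_bounded bounded_iff by blast
  show ?thesis by (rule that[of "max 0 b"]) (use b in auto)
qed

lemma energy_terms_integrable:
  assumes \<zeta>: "C1 \<zeta>" "compact (tsupp \<zeta>)" "tsupp \<zeta> \<subseteq> D - E"
  shows "integrable lebesgue (\<lambda>z. (a z \<bullet> g z) * \<zeta> z)"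
    "integrable lebesgue (\<lambda>z. (u z - c) * (a z \<bullet> xgrad \<zeta> z))"
    "integrable lebesgue (\<lambda>z. (u z - c)^2 / 2 * tpart \<zeta> z)"
    "integrable lebesgue (\<lambda>z. a z \<bullet> xgrad \<zeta> z)"
    "integrable lebesgue (\<lambda>z. u z * tpart \<zeta> z)"
    "integrable lebesgue (\<lambda>z. norm (g z) powr p * \<zeta> z)"
    "integrable lebesgue (\<lambda>z. u z * xpart \<zeta> i z)"
    "integrable lebesgue (\<lambda>z. g z $ i * \<zeta> z)"
proof -
  let ?K = "tsupp \<zeta>"
  obtain Z1 where Z1: "Z1 \<ge> 0" "\<And>z. \<bar>\<zeta> z\<bar> \<le> Z1" using C1_bounded[OF \<zeta>(1,2)] by blast
  obtain Z2 where Z2: "Z2 \<ge> 0" "\<And>z. norm (xgrad \<zeta> z) \<le> Z2" using xgrad_bounded[OF \<zeta>(1,2)] by blast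
  obtain Z3 where Z3: "Z3 \<ge> 0" "\<And>z. \<bar>tpart \<zeta> z\<bar> \<le> Z3" using pd_bounded[OF \<zeta>(1,2)] unfolding tpart_def by blast
  obtain Z4 where Z4: "Z4 \<ge> 0" "\<And>z. \<bar>xpart \<zeta> i z\<bar> \<le> Z4" using pd_bounded[OF \<zeta>(1,2)] unfolding xpart_def by blast
  obtain B where B: "B \<ge> 0" "\<And>z. z \<in> ?K \<Longrightarrow> \<bar>u z\<bar> \<le> B" using u_bounded[OF \<zeta>(2)] \<zeta>(3) by blast
  have xm: "xpart \<zeta> i \<in> borel_measurable lebesgue"
    unfolding xpart_def[abs_def] by (rule continuous_measurable_lebesgue[OF C1_pd_continuous[OF \<zeta>(1)]])
  have vm: "(\<lambda>z. g z $ i) \<in> borel_measurable lebesgue"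
    by (rule measurable_compose[OF gm]) (intro borel_measurable_continuous_onI continuous_intros)
  note [measurable] = C1_measurable[OF \<zeta>(1)] xgrad_measurable[OF \<zeta>(1)] tpart_measurable[OF \<zeta>(1)] um gm am gp_measurable xm vm
  note out = outside_tsupp[of _ \<zeta>] xgrad_outside_tsupp[of _ \<zeta>] tpart_outside_tsupp[of _ \<zeta>]
  have xout: "z \<notin> ?K \<Longrightarrow> xpart \<zeta> i z = 0" for z by (simp add: xpart_def pd_outside_tsupp)
  have P: "0 \<le> norm (g z) powr p" for z by simp
  note dom = integrable_dom[OF \<zeta>(2,3)]
  have ub: "\<bar>u z - c\<bar> \<le> B + \<bar>c\<bar>" if "z \<in> ?K" for z using B(2)[OF that] by simp
  show "integrable lebesgue (\<lambda>z. (a z \<bullet> g z) * \<zeta> z)"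
  proof (rule dom)
    show "AE z in lebesgue. \<bar>a z \<bullet> g z * \<zeta> z\<bar> \<le> (L * Z1) * (indicator ?K z * (1 + norm (g z) powr p))"
      using growth
    proof eventually_elim
      case (elim z)
      show ?case
      proof (cases "z \<in> ?K")
        case True
        have "\<bar>a z \<bullet> g z\<bar> \<le> L * (1 + norm (g z) powr p)" using a_bound(2)[OF elim] L by (simp add: algebra_simps)
        from mult_mono[OF this Z1(2)] show ?thesis using True L Z1 P[of z] by (simp add: abs_mult mult_ac)
      qed (simp add: out)
    qed
  qed measurable
  have axb: "\<bar>a z \<bullet> xgrad \<zeta> z\<bar> \<le> L * (1 + norm (g z) powr p) * Z2"
    if "norm (a z) \<le> L * norm (g z) powr (p - 1)" for z
    by (rule order_trans[OF Cauchy_Schwarz_ineq2 mult_mono[OF a_bound(1)[OF that] Z2(2)]])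
       (use L P[of z] in auto)
  show "integrable lebesgue (\<lambda>z. (u z - c) * (a z \<bullet> xgrad \<zeta> z))"
  proof (rule dom)
    show "AE z in lebesgue. \<bar>(u z - c) * (a z \<bullet> xgrad \<zeta> z)\<bar> \<le> ((B + \<bar>c\<bar>) * (L * Z2)) * (indicator ?K z * (1 + norm (g z) powr p))"
      using growth
    proof eventually_elim
      case (elim z)
      show ?case
      proof (cases "z \<in> ?K")
        case True
        from mult_mono[OF ub[OF True] axb[OF elim]] show ?thesis using True B(1) by (simp add: abs_mult mult_ac)
      qed (simp add: out)
    qed
  qed measurable
  show "integrable lebesgue (\<lambda>z. a z \<bullet> xgrad \<zeta> z)"
  proof (rule dom)
    show "AE z in lebesgue. \<bar>a z \<bullet> xgrad \<zeta> z\<bar> \<le> (L * Z2) * (indicator ?K z * (1 + norm (g z) powr p))"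
      using growth
    proof eventually_elim
      case (elim z)
      show ?case using axb[OF elim] by (cases "z \<in> ?K") (simp_all add: out mult_ac)
    qed
  qed measurable
  show "integrable lebesgue (\<lambda>z. (u z - c)^2 / 2 * tpart \<zeta> z)"
  proof (rule dom)
    have "\<bar>(u z - c)^2 / 2 * tpart \<zeta> z\<bar> \<le> ((B + \<bar>c\<bar>)^2 / 2 * Z3) * (indicator ?K z * (1 + norm (g z) powr p))" for z
    proof (cases "z \<in> ?K")
      case True
      have "(u z - c)^2 / 2 \<le> (B + \<bar>c\<bar>)^2 / 2" using power_mono[OF ub[OF True], of 2] by simp
      then have "\<bar>(u z - c)^2 / 2\<bar> \<le> (B + \<bar>c\<bar>)^2 / 2" by simp
      from mult_mono[OF this Z3(2)[of z]] have "\<bar>(u z - c)^2 / 2 * tpart \<zeta> z\<bar> \<le> ((B + \<bar>c\<bar>)^2 / 2 * Z3) * 1"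
        by (simp add: abs_mult)
      also have "\<dots> \<le> ((B + \<bar>c\<bar>)^2 / 2 * Z3) * (indicator ?K z * (1 + norm (g z) powr p))"
        using True P[of z] Z3(1) by (intro mult_left_mono) auto
      finally show ?thesis .
    qed (simp add: out)
    then show "AE z in lebesgue. \<bar>(u z - c)^2 / 2 * tpart \<zeta> z\<bar> \<le> ((B + \<bar>c\<bar>)^2 / 2 * Z3) * (indicator ?K z * (1 + norm (g z) powr p))"
      by simp
  qed measurable
  have uint: "integrable lebesgue (\<lambda>z. u z * f z)"
    if f: "f \<in> borel_measurable lebesgue" "\<And>z. \<bar>f z\<bar> \<le> Z" "\<And>z. z \<notin> ?K \<Longrightarrow> f z = 0" "Z \<ge> 0" for f Z
  proof (rule dom)
    show "(\<lambda>z. u z * f z) \<in> borel_measurable lebesgue" using um f(1) by measurable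
    have "\<bar>u z * f z\<bar> \<le> (B * Z) * (indicator ?K z * (1 + norm (g z) powr p))" for z
    proof (cases "z \<in> ?K")
      case True
      from mult_mono[OF B(2)[OF True] f(2)[of z] B(1)] have "\<bar>u z * f z\<bar> \<le> (B * Z) * 1" by (simp add: abs_mult)
      also have "\<dots> \<le> (B * Z) * (indicator ?K z * (1 + norm (g z) powr p))"
        using True P[of z] B(1) f(4) by (intro mult_left_mono) auto
      finally show ?thesis .
    qed (simp add: f)
    then show "AE z in lebesgue. \<bar>u z * f z\<bar> \<le> (B * Z) * (indicator ?K z * (1 + norm (g z) powr p))" by simp
  qed
  show "integrable lebesgue (\<lambda>z. u z * tpart \<zeta> z)" by (rule uint[OF _ Z3(2) out(3) Z3(1)]) measurable
  show "integrable lebesgue (\<lambda>z. u z * xpart \<zeta> i z)" by (rule uint[OF _ Z4(2) xout Z4(1)]) measurable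
  show "integrable lebesgue (\<lambda>z. norm (g z) powr p * \<zeta> z)"
  proof (rule dom)
    have "\<bar>norm (g z) powr p * \<zeta> z\<bar> \<le> Z1 * (indicator ?K z * (1 + norm (g z) powr p))" for z
    proof (cases "z \<in> ?K")
      case True
      have "norm (g z) powr p * \<bar>\<zeta> z\<bar> \<le> (1 + norm (g z) powr p) * Z1" using Z1 P[of z] by (intro mult_mono) auto
      then show ?thesis using True by (simp add: abs_mult mult_ac)
    qed (simp add: out)
    then show "AE z in lebesgue. \<bar>norm (g z) powr p * \<zeta> z\<bar> \<le> Z1 * (indicator ?K z * (1 + norm (g z) powr p))" by simp
  qed measurable
  show "integrable lebesgue (\<lambda>z. g z $ i * \<zeta> z)"
  proof (rule dom)
    have "\<bar>g z $ i * \<zeta> z\<bar> \<le> Z1 * (indicator ?K z * (1 + norm (g z) powr p))" for z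
    proof (cases "z \<in> ?K")
      case True
      have "1 powr (p - 1) * norm (g z) \<le> 1 powr p + norm (g z) powr p"
        by (rule powr_mult_le_sum_powr) (use p in auto)
      then have "\<bar>g z $ i\<bar> \<le> 1 + norm (g z) powr p" using component_le_norm_cart[of "g z" i] by simp
      then have "\<bar>g z $ i\<bar> * \<bar>\<zeta> z\<bar> \<le> (1 + norm (g z) powr p) * Z1" using Z1 P[of z] by (intro mult_mono) auto
      then show ?thesis using True by (simp add: abs_mult mult_ac)
    qed (simp add: out)
    then show "AE z in lebesgue. \<bar>g z $ i * \<zeta> z\<bar> \<le> Z1 * (indicator ?K z * (1 + norm (g z) powr p))" by simp
  qed measurable
qed

text \<open>Subtracting the energy identities for c = 0 and c = 1 leaves the flux term minus (u -
  1/2) times the time derivative of \<zeta>; the constant 1/2 drops out because that derivative has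
  integral 0.\<close>

lemma weak_identity:
  assumes \<zeta>: "C1 \<zeta>" "compact (tsupp \<zeta>)" "tsupp \<zeta> \<subseteq> D - E"
  shows "(LINT z|lebesgue. - u z * tpart \<zeta> z + a z \<bullet> xgrad \<zeta> z) = 0"
proof -
  note i = energy_terms_integrable[OF \<zeta>]
  let ?I = "\<lambda>c z. (a z \<bullet> g z) * \<zeta> z + (u z - c) * (a z \<bullet> xgrad \<zeta> z) - (u z - c)^2 / 2 * tpart \<zeta> z"
  have I: "integrable lebesgue (?I c)" for c using i by auto
  have t: "integrable lebesgue (tpart \<zeta>)" "(LINT z|lebesgue. tpart \<zeta> z) = 0"
    using integral_pd_tsupp_eq_0[OF \<zeta>(1,2), of "(0, 1)"] outside_tsupp[of _ \<zeta>]
    unfolding tpart_def[abs_def] by blast+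
  have t': "integrable lebesgue (\<lambda>z. - (1/2) * tpart \<zeta> z)" using t(1) by simp
  have "(LINT z|lebesgue. ?I 0 z - ?I 1 z + - (1/2) * tpart \<zeta> z) = 0"
    unfolding Bochner_Integration.integral_add[OF Bochner_Integration.integrable_diff[OF I[of 0] I[of 1]] t']
      Bochner_Integration.integral_diff[OF I[of 0] I[of 1]] energy[OF \<zeta>] integral_mult_right_zero t(2) by simp
  moreover have "?I 0 z - ?I 1 z + - (1/2) * tpart \<zeta> z = - u z * tpart \<zeta> z + a z \<bullet> xgrad \<zeta> z" for z
    by (simp add: power2_eq_square field_simps)
  ultimately show ?thesis by simp
qed

end

lemma integrable_bounded_compact:
  fixes f :: "'a::euclidean_space \<Rightarrow> real"
  assumes "K \<in> lmeasurable" "f \<in> borel_measurable lebesgue" "\<And>z. \<bar>f z\<bar> \<le> C * indicator K z"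
  shows "integrable lebesgue f" "\<bar>LINT z|lebesgue. f z\<bar> \<le> C * measure lebesgue K"
proof -
  have iK: "integrable lebesgue (\<lambda>z. C * (indicator K z :: real))"
    using assms(1) lmeasurable_iff_integrable by (intro integrable_mult_right) blast
  show i: "integrable lebesgue f"
    by (rule Bochner_Integration.integrable_bound[OF iK assms(2)])
       (use assms(3) in \<open>auto intro!: AE_I2 intro: order_trans[OF _ abs_ge_self]\<close>)
  have "\<bar>LINT z|lebesgue. f z\<bar> \<le> (LINT z|lebesgue. \<bar>f z\<bar>)" by (rule integral_abs_bound)
  also have "\<dots> \<le> (LINT z|lebesgue. C * indicator K z)"
    by (rule integral_mono) (use i iK assms(3) in auto)
  also have "\<dots> = C * measure lebesgue K" using assms(1) by (simp add: fmeasurableD)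
  finally show "\<bar>LINT z|lebesgue. f z\<bar> \<le> C * measure lebesgue K" .
qed

section \<open>Caccioppoli inequality with a cutoff along the cover\<close>

context removable begin

text \<open>Constants of \<open>main_estimate\<close>; C0 bounds the derivatives of the outer cutoff
  in units of 1/R and 1/R^s. \<open>A3\<close> is the time error of one small cylinder: oscillation
  of the square, bound of the time derivative, volume. \<open>A2\<close> adds the Young remainder of
  its gradient error, and \<open>A1\<close> collects the two terms at scale R.\<close>

definition A3 :: "real \<Rightarrow> real" where
  "A3 C0 = 3/2 * Mh * 3 powr \<alpha> * (real q * (C0 + 2)) * (V * 3 powr (nn + s))"
definition A2 :: "real \<Rightarrow> real \<Rightarrow> real" where
  "A2 C0 \<delta> = \<delta> powr (1 - p) * (2 * L * nn * real q) powr p * (V * 3 powr (nn + s)) + A3 C0"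
definition A1 :: "real \<Rightarrow> real" where
  "A1 C0 = (\<nu> / 2) powr (1 - p) * (L * nn * real q * (C0 + 1)) powr p + real q * (C0 + 1) / 2"

end

text \<open>Fixes the output of \<open>cutoff_family\<close> for a cover of the part of E in the
  support of an outer cutoff \<eta>. Packing is a separate assumption of
  \<open>energy_decay\<close>, since estimates at a single scale do not involve it.\<close>

locale cutoff_config = removable p \<alpha> \<nu> L Mh nn D E u g a
  for p \<alpha> \<nu> L Mh nn :: real and D E :: "((real^'n) \<times> real) set" and u :: "(real^'n) \<times> real \<Rightarrow> real"
    and g a :: "(real^'n) \<times> real \<Rightarrow> real^'n" +
  fixes \<eta> :: "(real^'n) \<times> real \<Rightarrow> real" and N :: nat and zz :: "nat \<Rightarrow> (real^'n) \<times> real" and rr :: "nat \<Rightarrow> real"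
    and M :: "nat \<Rightarrow> (real^'n) \<times> real \<Rightarrow> real"
  assumes \<eta>: "C1 \<eta>" "\<And>w. 0 \<le> \<eta> w" "\<And>w. \<eta> w \<le> 1" "compact (tsupp \<eta>)" "tsupp \<eta> \<subseteq> D"
    and zE: "\<And>j. j < N \<Longrightarrow> zz j \<in> E" and rpos: "\<And>j. j < N \<Longrightarrow> 0 < rr j"
    and anti: "\<And>i j. i \<le> j \<Longrightarrow> j < N \<Longrightarrow> rr j \<le> rr i"
    and cov: "E \<inter> tsupp \<eta> \<subseteq> (\<Union>j<N. cyl s (zz j) (rr j))"
    and MC: "\<And>k. k \<le> N \<Longrightarrow> C1 (M k)" and M0: "\<And>k w. k \<le> N \<Longrightarrow> 0 \<le> M k w" and M1: "\<And>k w. k \<le> N \<Longrightarrow> M k w \<le> 1"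
    and Mz: "\<And>w. M 0 w = 0"
    and Msupp: "\<And>k w. k < N \<Longrightarrow> w \<notin> cyl s (zz k) (3 * rr k) \<Longrightarrow> M (Suc k) w = M k w"
    and Mpd: "\<And>k w v. k < N \<Longrightarrow> w \<notin> cyl s (zz k) (3 * rr k) \<Longrightarrow> pd v (M (Suc k)) w = pd v (M k) w"
    and Mx: "\<And>k w i. k < N \<Longrightarrow> \<bar>pd (axis i 1, 0) (M (Suc k)) w\<bar> \<le> 1 / rr k"
    and Mt: "\<And>k w. k < N \<Longrightarrow> \<bar>pd (0, 1) (M (Suc k)) w\<bar> \<le> 1 / rr k powr s"
    and Mone: "\<And>j k w. j < k \<Longrightarrow> k \<le> N \<Longrightarrow> w \<in> cyl s (zz j) (rr j) \<Longrightarrow> M k w = 1"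
begin

text \<open>\<open>\<psi>\<close> vanishes on the covering cylinders, so whatever carries a factor
  \<eta> \<psi> lives on the compact set \<open>KK\<close> inside D - E, where the identities are
  available. The stages \<open>\<Psi> k\<close> serve to telescope derivatives. \<open>X j\<close>
  is the energy on the tripled cylinder, outside of which the j-th stage changes nothing.\<close>

definition \<psi> where "\<psi> w = 1 - M N w"
definition \<Psi> where "\<Psi> k w = (1 - M k w) ^ q"
definition KK where "KK = tsupp \<eta> - (\<Union>j<N. cyl s (zz j) (rr j))"
definition X where "X j = (LINT w|lebesgue. indicator (cyl s (zz j) (3 * rr j)) w * (norm (g w) powr p * (\<eta> w * \<psi> w) ^ q))"

lemma KK: "compact KK" "KK \<subseteq> D - E"
proof -
  have "open (\<Union>j<N. cyl s (zz j) (rr j))" using open_cyl by blast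
  then show "compact KK" unfolding KK_def by (rule compact_diff[OF \<eta>(4)])
  show "KK \<subseteq> D - E" using cov \<eta>(5) unfolding KK_def by blast
qed

lemma \<psi>: "C1 \<psi>" "0 \<le> \<psi> w" "\<psi> w \<le> 1"
  using C1_diff[OF Ck_const MC[of N], of 1] M0[of N w] M1[of N w] by (simp_all add: \<psi>_def[abs_def] del: Ck.simps)

lemma \<Psi>:
  assumes "k \<le> N" shows "C1 (\<Psi> k)" "0 \<le> \<Psi> k w" "\<Psi> k w \<le> 1"
proof -
  show "C1 (\<Psi> k)" unfolding \<Psi>_def[abs_def] by (intro C1_power C1_diff Ck_const MC assms)
  show "0 \<le> \<Psi> k w" "\<Psi> k w \<le> 1"
    using M0[OF assms, of w] M1[OF assms, of w] by (simp_all add: \<Psi>_def power_le_one)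
qed

lemma \<Psi>N: "\<Psi> N w = \<psi> w ^ q" by (simp add: \<Psi>_def \<psi>_def)

lemma pd_\<Psi>: "k \<le> N \<Longrightarrow> pd v (\<Psi> k) w = - (real q * (1 - M k w) ^ (q - 1) * pd v (M k) w)"
  unfolding \<Psi>_def[abs_def] by (simp add: pd_power[OF C1_diff[OF Ck_const MC]] pd_diff[OF Ck_const MC] pd_const del: Ck.simps)

lemma pd_\<Psi>_le:
  assumes "k \<le> N" shows "\<bar>pd v (\<Psi> k) w\<bar> \<le> real q * \<bar>pd v (M k) w\<bar>"
proof -
  have "0 \<le> 1 - M k w" "1 - M k w \<le> 1" using M0[OF assms, of w] M1[OF assms, of w] by auto
  then have "(1 - M k w) ^ (q - 1) \<le> 1" "0 \<le> (1 - M k w) ^ (q - 1)" by (auto simp: power_le_one)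
  then have "\<bar>pd v (\<Psi> k) w\<bar> = (1 - M k w) ^ (q - 1) * (real q * \<bar>pd v (M k) w\<bar>)"
    using assms by (simp add: pd_\<Psi> abs_mult)
  also have "\<dots> \<le> 1 * (real q * \<bar>pd v (M k) w\<bar>)"
    using \<open>(1 - M k w) ^ (q - 1) \<le> 1\<close> by (intro mult_right_mono) auto
  finally show ?thesis by simp
qed

lemma pd_M0: "pd v (M 0) w = 0"
proof -
  have "M 0 = (\<lambda>_. 0)" using Mz by auto
  then show ?thesis by (simp add: pd_const)
qed

lemma pd_M_bounds:
  assumes "k \<le> N" "r > 0" "\<And>j. j < k \<Longrightarrow> r \<le> rr j"
  shows "\<bar>pd (axis i 1, 0) (M k) w\<bar> \<le> 1 / r" "\<bar>pd (0, 1) (M k) w\<bar> \<le> 1 / r powr s"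
proof -
  have "\<bar>pd (axis i 1, 0) (M k) w\<bar> \<le> 1 / r \<and> \<bar>pd (0, 1) (M k) w\<bar> \<le> 1 / r powr s"
  proof (cases k)
    case 0
    then show ?thesis using assms(2) by (simp add: pd_M0)
  next
    case (Suc j)
    then have j: "j < N" "r \<le> rr j" using assms(1,3) by auto
    have "1 / rr j \<le> 1 / r" using j assms(2) by (simp add: frac_le)
    moreover have "r powr s \<le> rr j powr s" using j assms(2) s2 by (intro powr_mono2) auto
    then have "1 / rr j powr s \<le> 1 / r powr s" using assms(2) by (intro frac_le) auto
    ultimately show ?thesis using Mx[OF j(1), where i=i and w=w] Mt[OF j(1), of w] unfolding Suc by linarith
  qed
  then show "\<bar>pd (axis i 1, 0) (M k) w\<bar> \<le> 1 / r" "\<bar>pd (0, 1) (M k) w\<bar> \<le> 1 / r powr s" by auto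
qed

lemma etapsi_outside: "w \<notin> KK \<Longrightarrow> \<eta> w * \<psi> w = 0"
proof -
  assume "w \<notin> KK"
  then consider "w \<notin> tsupp \<eta>" | j where "j < N" "w \<in> cyl s (zz j) (rr j)" unfolding KK_def by blast
  then show ?thesis
  proof cases
    case 1
    then show ?thesis by (simp add: outside_tsupp)
  next
    case 2
    then show ?thesis using Mone[of j N w] by (simp add: \<psi>_def)
  qed
qed

lemma tsupp_KK:
  assumes "\<And>w. w \<notin> KK \<Longrightarrow> f w = 0"
  shows "compact (tsupp f)" "tsupp f \<subseteq> D - E"
proof -
  have "tsupp f \<subseteq> KK" unfolding tsupp_def
    by (rule closure_minimal) (use assms compact_imp_closed[OF KK(1)] in auto)
  then show "tsupp f \<subseteq> D - E" using KK(2) by blast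
  show "compact (tsupp f)" using \<open>tsupp f \<subseteq> KK\<close> KK(1) closed_tsupp
    by (metis compact_Int_closed inf.absorb_iff2)
qed

lemma X_integrable:
  "integrable lebesgue (\<lambda>w. norm (g w) powr p * (\<eta> w * \<psi> w) ^ q)"
  "integrable lebesgue (\<lambda>w. indicator (cyl s (zz j) (3 * rr j)) w * (norm (g w) powr p * (\<eta> w * \<psi> w) ^ q))"
proof -
  have C: "C1 (\<lambda>w. (\<eta> w * \<psi> w) ^ q)" by (intro C1_power Ck_mult \<eta>(1) \<psi>(1))
  have o: "w \<notin> KK \<Longrightarrow> (\<eta> w * \<psi> w) ^ q = 0" for w using etapsi_outside[of w] q(2) by (simp add: zero_power)
  show *: "integrable lebesgue (\<lambda>w. norm (g w) powr p * (\<eta> w * \<psi> w) ^ q)"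
    by (rule energy_terms_integrable(6)[OF C tsupp_KK[OF o]])
  have "cyl s (zz j) (3 * rr j) \<in> sets lebesgue" using lmeasurable_cyl by (rule fmeasurableD)
  from integrable_mult_indicator[OF this *]
  show "integrable lebesgue (\<lambda>w. indicator (cyl s (zz j) (3 * rr j)) w * (norm (g w) powr p * (\<eta> w * \<psi> w) ^ q))"
    by simp
qed

lemma X_nonneg: "X j \<ge> 0"
  unfolding X_def by (intro integral_nonneg_AE AE_I2) (use \<eta>(2) \<psi>(2) in auto)

text \<open>The stages before b, all of radius at least R, cost 1/R together and not one by one.
  Each later stage alters the derivative only on its own tripled cylinder.\<close>

lemma pd_M_telescope:
  assumes "b \<le> k" "k \<le> N" "R > 0" "\<And>j. j < b \<Longrightarrow> R \<le> rr j"
  shows "\<bar>pd (axis i 1, 0) (M k) w\<bar> \<le> 1 / R + (\<Sum>j\<in>{b..<k}. indicator (cyl s (zz j) (3 * rr j)) w * (2 / rr j))"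
  using assms(1,2)
proof (induction k rule: dec_induct)
  case base
  then show ?case using pd_M_bounds(1)[OF _ assms(3), where k=b and i=i and w=w] assms(4) by simp
next
  case (step k)
  have k: "k < N" "k \<le> N" using step by auto
  have "\<bar>pd (axis i 1, 0) (M (Suc k)) w\<bar> \<le> \<bar>pd (axis i 1, 0) (M k) w\<bar> + indicator (cyl s (zz k) (3 * rr k)) w * (2 / rr k)"
  proof (cases "w \<in> cyl s (zz k) (3 * rr k)")
    case True
    have "\<bar>pd (axis i 1, 0) (M (Suc k)) w\<bar> \<le> 1 / rr k" by (rule Mx[OF k(1)])
    also have "\<dots> \<le> 2 / rr k" using rpos[OF k(1)] by (simp add: divide_right_mono)
    finally show ?thesis using True by simp
  next
    case False
    then show ?thesis using Mpd[OF k(1) False] by simp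
  qed
  also have "\<bar>pd (axis i 1, 0) (M k) w\<bar> \<le> 1 / R + (\<Sum>j\<in>{b..<k}. indicator (cyl s (zz j) (3 * rr j)) w * (2 / rr j))"
    using step.IH k(2) by simp
  finally show ?case using step.hyps(1) by simp
qed

text \<open>Caccioppoli inequality from testing with u - c times the q-th power of H \<psi>.
  Cylinders of radius at least R, the indices below b, act like one cutoff of scale R. The smaller
  ones in J enter through their energies \<open>X j\<close> with weight \<delta> rr^(-\<alpha>), to
  be absorbed later, and through remainders of size rr^\<sigma>.\<close>

lemma main_estimate:
  assumes H: "C1 H" "\<And>w. 0 \<le> H w" "\<And>w. H w \<le> \<eta> w"
    and R: "R > 0" and C0: "C0 \<ge> 0"
    and Hx: "\<And>i w. \<bar>pd (axis i 1, 0) H w\<bar> \<le> C0 / R" and Ht: "\<And>w. \<bar>pd (0, 1) H w\<bar> \<le> C0 / R powr s"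
    and S: "S \<in> lmeasurable" "\<And>w. H w \<noteq> 0 \<Longrightarrow> w \<in> S"
    and osc: "\<And>w. H w \<noteq> 0 \<Longrightarrow> \<bar>u w - c\<bar> \<le> \<omega>" and \<omega>: "Mh * (3 * R) powr \<alpha> \<le> \<omega>"
    and b: "b \<le> N" "\<And>j. j < b \<Longrightarrow> R \<le> rr j" "\<And>j. b \<le> j \<Longrightarrow> j < N \<Longrightarrow> rr j \<le> R"
    and \<delta>: "\<delta> > 0"
  defines "J \<equiv> {j. b \<le> j \<and> j < N \<and> (\<exists>w\<in>cyl s (zz j) (3 * rr j). H w \<noteq> 0)}"
  shows "\<nu> / 2 * (LINT w|lebesgue. norm (g w) powr p * (H w * \<psi> w) ^ q)
    \<le> A1 C0 * ((\<omega> / R) powr p + \<omega>\<^sup>2 / R powr s) * measure lebesgue S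
      + \<omega> * (\<Sum>j\<in>J. \<delta> * rr j powr (- \<alpha>) * X j + A2 C0 \<delta> * rr j powr \<sigma>)"
proof -
  have \<omega>0: "\<omega> \<ge> 0" using \<omega> Mh by (meson less_imp_le mult_nonneg_nonneg order_trans powr_ge_zero)
  have J: "j \<in> J \<Longrightarrow> j < N \<and> 0 < rr j \<and> rr j \<le> R" for j using b(3) rpos by (auto simp: J_def)
  let ?Q = "\<lambda>j. cyl s (zz j) (3 * rr j)"
  define h where "h w = H w * \<psi> w" for w
  have h: "C1 h" unfolding h_def[abs_def] by (intro Ck_mult H(1) \<psi>(1))
  have H1: "H w \<le> 1" for w using H(3)[of w] \<eta>(3)[of w] by linarith
  have h01: "0 \<le> h w" "h w \<le> 1" for w
    using H(2)[of w] H1[of w] \<psi>(2,3)[of w] by (auto simp: h_def mult_le_one)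
  have Hout: "w \<notin> tsupp \<eta> \<Longrightarrow> H w = 0" for w
    using H(2)[of w] H(3)[of w] outside_tsupp[of w \<eta>] by simp
  have hout: "w \<notin> KK \<Longrightarrow> h w = 0" for w
  proof -
    assume "w \<notin> KK"
    then have "\<eta> w * \<psi> w = 0" by (rule etapsi_outside)
    then show "h w = 0" using H(2)[of w] H(3)[of w] by (auto simp: h_def)
  qed
  define \<zeta> where "\<zeta> w = h w ^ q" for w
  have \<zeta>C: "C1 \<zeta>" unfolding \<zeta>_def[abs_def] by (rule C1_power[OF h])
  have \<zeta>out: "w \<notin> KK \<Longrightarrow> \<zeta> w = 0" for w using hout[of w] q(2) by (simp add: \<zeta>_def zero_power)
  note \<zeta> = \<zeta>C tsupp_KK[OF \<zeta>out]
  note int = energy_terms_integrable[OF \<zeta>]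
  have \<zeta>0: "\<zeta> w \<ge> 0" for w by (simp add: \<zeta>_def h01)
  have \<psi>e: "\<psi> = (\<lambda>w. 1 - M N w)" by (simp add: \<psi>_def fun_eq_iff)
  have pd\<psi>: "pd v \<psi> w = - pd v (M N) w" for v w
    unfolding \<psi>e by (simp add: pd_diff[OF Ck_const MC] pd_const del: Ck.simps)
  have pdh: "pd v h w = pd v H w * \<psi> w - H w * pd v (M N) w" for v w
    unfolding h_def[abs_def] using pd_mult[OF H(1) \<psi>(1), where v=v and z=w] by (simp add: pd\<psi>)
  have pd\<zeta>: "pd v \<zeta> w = real q * h w ^ (q - 1) * pd v h w" for v w
    unfolding \<zeta>_def[abs_def] by (rule pd_power[OF h])
  define grow where "grow w = (C0 + 1) / R + (\<Sum>j\<in>J. indicator (?Q j) w * (2 / rr j))" for w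
  have xg: "norm (xgrad \<zeta> w) \<le> nn * real q * h w ^ (q - 1) * grow w" for w
  proof (cases "H w = 0")
    case True
    then have "h w = 0" by (simp add: h_def)
    then have z: "h w ^ (q - 1) = 0" using q(2) by (simp add: zero_power)
    have "pd v \<zeta> w = 0" for v unfolding pd\<zeta> z by simp
    then show ?thesis using norm_xgrad_le[of \<zeta> w] unfolding z by simp
  next
    case False
    \<comment> \<open>Where H does not vanish, a cylinder whose index lies outside J does not
      contain w.\<close>
    have sumJ: "(\<Sum>j\<in>{b..<N}. indicator (?Q j) w * (2 / rr j)) = (\<Sum>j\<in>J. indicator (?Q j) w * (2 / rr j))"
      by (rule sum.mono_neutral_right) (use False in \<open>auto simp: J_def indicator_def\<close>)
    have "\<bar>pd (axis i 1, 0) h w\<bar> \<le> grow w" for i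
    proof -
      have "\<bar>pd (axis i 1, 0) h w\<bar> \<le> \<bar>pd (axis i 1, 0) H w\<bar> * \<psi> w + H w * \<bar>pd (axis i 1, 0) (M N) w\<bar>"
        unfolding pdh using abs_triangle_ineq4[of "pd (axis i 1, 0) H w * \<psi> w" "H w * pd (axis i 1, 0) (M N) w"]
          H(2)[of w] \<psi>(2)[of w] by (simp add: abs_mult)
      also have "\<dots> \<le> \<bar>pd (axis i 1, 0) H w\<bar> * 1 + 1 * \<bar>pd (axis i 1, 0) (M N) w\<bar>"
        using \<psi>(3)[of w] H1[of w] by (intro add_mono mult_left_mono mult_right_mono) auto
      also have "\<dots> \<le> C0 / R + (1 / R + (\<Sum>j\<in>{b..<N}. indicator (?Q j) w * (2 / rr j)))"
        using Hx[where i=i and w=w] pd_M_telescope[OF b(1) order_refl R b(2), where i=i and w=w] by simp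
      also have "\<dots> = grow w" unfolding grow_def sumJ by (simp add: add_divide_distrib)
      finally show ?thesis .
    qed
    then have "\<bar>pd (axis i 1, 0) \<zeta> w\<bar> \<le> real q * h w ^ (q - 1) * grow w" for i
      unfolding pd\<zeta> using h01[of w] by (simp add: abs_mult mult_left_mono)
    then have "(\<Sum>i\<in>UNIV. \<bar>pd (axis i 1, 0) \<zeta> w\<bar>) \<le> (\<Sum>i\<in>(UNIV::'n set). real q * h w ^ (q - 1) * grow w)"
      by (intro sum_mono)
    then show ?thesis using norm_xgrad_le[of \<zeta> w] by (simp add: nn mult_ac)
  qed
  define B1 where "B1 = \<omega> * L * nn * real q * (C0 + 1) / R"
  define Bj where "Bj j = 2 * L * nn * real q / rr j" for j
  \<comment> \<open>With this weight the Young remainder, \<tau>^(1-p) rr^(-p) times the volume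
    rr^(nn+s), scales like rr^\<sigma>.\<close>
  define \<tau> where "\<tau> j = \<delta> * rr j powr (- \<alpha>)" for j
  define G where "G w = norm (g w)" for w
  define P where "P w = norm (g w) powr p * (\<eta> w * \<psi> w) ^ q" for w
  have nn0: "nn \<ge> 0" by (simp add: nn)
  have B10: "B1 \<ge> 0" using \<omega>0 L nn0 C0 R by (simp add: B1_def)
  have Bj0: "j \<in> J \<Longrightarrow> Bj j \<ge> 0" for j using L nn0 J[of j] by (simp add: Bj_def)
  have \<tau>0: "j \<in> J \<Longrightarrow> \<tau> j > 0" for j using \<delta> J[of j] by (simp add: \<tau>_def)
  define K1 where "K1 = (\<nu> / 2) powr (1 - p) * B1 powr p"
  define Kj where "Kj j = \<tau> j powr (1 - p) * Bj j powr p" for j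
  let ?I = "\<lambda>w. (a w \<bullet> g w) * \<zeta> w + (u w - c) * (a w \<bullet> xgrad \<zeta> w) - (u w - c)^2 / 2 * tpart \<zeta> w"
  let ?T = "\<lambda>w. (u w - c)^2 / 2 * tpart \<zeta> w"
  \<comment> \<open>Adding \<open>?T\<close> to \<open>?I\<close> leaves only the coercive term and
    the flux term, while \<open>?I\<close> itself integrates to 0 by the energy identity.\<close>
  let ?RHS = "\<lambda>w. ?I w + ?T w + K1 * indicator S w + \<omega> * (\<Sum>j\<in>J. \<tau> j * (indicator (?Q j) w * P w) + Kj j * indicator (?Q j) w)"
  have pw: "AE w in lebesgue. \<nu> / 2 * (G w powr p * \<zeta> w) \<le> ?RHS w"
    using growth coer
  proof eventually_elim
    case (elim w)
    show ?case
    proof (cases "H w = 0")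
      case True
      then have h0: "h w = 0" by (simp add: h_def)
      have "h w ^ (q - 1) = 0" using h0 q(2) by (simp add: zero_power)
      moreover have "\<zeta> w = 0" using h0 q(2) by (simp add: \<zeta>_def zero_power)
      moreover have "xgrad \<zeta> w = 0" using xg[of w] unfolding \<open>h w ^ (q - 1) = 0\<close> by simp
      moreover have "K1 \<ge> 0" by (simp add: K1_def)
      moreover have "0 \<le> \<omega> * (\<Sum>j\<in>J. \<tau> j * (indicator (?Q j) w * P w) + Kj j * indicator (?Q j) w)"
        using \<tau>0 less_imp_le[OF \<tau>0] \<eta>(2)[of w] \<psi>(2)[of w]
        by (intro mult_nonneg_nonneg[OF \<omega>0] sum_nonneg add_nonneg_nonneg mult_nonneg_nonneg) (auto simp: Kj_def P_def)
      ultimately show ?thesis by simp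
    next
      case False
      then have w: "w \<in> S" "\<bar>u w - c\<bar> \<le> \<omega>" using S(2) osc by auto
      have G0: "G w \<ge> 0" by (simp add: G_def)
      have na: "norm (a w) \<le> L * G w powr (p - 1)" using elim(1) by (simp add: G_def)
      have h0: "h w ^ (q - 1) \<ge> 0" using h01 by simp
      have "\<bar>(u w - c) * (a w \<bullet> xgrad \<zeta> w)\<bar> \<le> \<omega> * (norm (a w) * norm (xgrad \<zeta> w))"
        unfolding abs_mult using w(2) \<omega>0 by (intro mult_mono Cauchy_Schwarz_ineq2) auto
      also have "\<dots> \<le> \<omega> * ((L * G w powr (p - 1)) * (nn * real q * h w ^ (q - 1) * grow w))"
        using \<omega>0 na xg[of w] L by (intro mult_left_mono mult_mono) auto
      also have "\<dots> = G w powr (p - 1) * h w ^ (q - 1) * B1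
          + \<omega> * (\<Sum>j\<in>J. indicator (?Q j) w * (G w powr (p - 1) * h w ^ (q - 1) * Bj j))"
        unfolding grow_def B1_def Bj_def by (simp add: algebra_simps sum_distrib_left)
      also have "\<dots> \<le> (\<nu> / 2 * (G w powr p * h w ^ q) + K1)
          + \<omega> * (\<Sum>j\<in>J. indicator (?Q j) w * (\<tau> j * (G w powr p * h w ^ q) + Kj j))"
      proof (intro add_mono mult_left_mono[OF _ \<omega>0] sum_mono)
        show "G w powr (p - 1) * h w ^ (q - 1) * B1 \<le> \<nu> / 2 * (G w powr p * h w ^ q) + K1"
          unfolding K1_def by (rule weighted_young[OF G0 h01 B10 q(1)]) (use p \<nu> in auto)
        fix j assume j: "j \<in> J"
        have "G w powr (p - 1) * h w ^ (q - 1) * Bj j \<le> \<tau> j * (G w powr p * h w ^ q) + Kj j"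
          unfolding Kj_def by (rule weighted_young[OF G0 h01 Bj0[OF j] q(1) _ \<tau>0[OF j]]) (use p in auto)
        then show "indicator (?Q j) w * (G w powr (p - 1) * h w ^ (q - 1) * Bj j)
          \<le> indicator (?Q j) w * (\<tau> j * (G w powr p * h w ^ q) + Kj j)"
          by (intro mult_left_mono) auto
      qed
      also have "(\<Sum>j\<in>J. indicator (?Q j) w * (\<tau> j * (G w powr p * h w ^ q) + Kj j))
          \<le> (\<Sum>j\<in>J. \<tau> j * (indicator (?Q j) w * P w) + Kj j * indicator (?Q j) w)"
      proof (rule sum_mono)
        fix j assume j: "j \<in> J"
        have "h w \<le> \<eta> w * \<psi> w" unfolding h_def using H(3)[of w] \<psi>(2)[of w] by (rule mult_right_mono)
        then have "h w ^ q \<le> (\<eta> w * \<psi> w) ^ q" using h01 by (intro power_mono) auto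
        then have "G w powr p * h w ^ q \<le> P w" unfolding P_def G_def by (intro mult_left_mono) auto
        then have "\<tau> j * (G w powr p * h w ^ q) + Kj j \<le> \<tau> j * P w + Kj j"
          using less_imp_le[OF \<tau>0[OF j]] by (intro add_mono mult_left_mono) auto
        then show "indicator (?Q j) w * (\<tau> j * (G w powr p * h w ^ q) + Kj j) \<le> \<tau> j * (indicator (?Q j) w * P w) + Kj j * indicator (?Q j) w"
          by (simp add: indicator_def)
      qed
      finally have A: "\<bar>(u w - c) * (a w \<bullet> xgrad \<zeta> w)\<bar> \<le> (\<nu> / 2 * (G w powr p * \<zeta> w) + K1)
          + \<omega> * (\<Sum>j\<in>J. \<tau> j * (indicator (?Q j) w * P w) + Kj j * indicator (?Q j) w)"
        using \<omega>0 by (simp add: \<zeta>_def mult_left_mono)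
      have "\<nu> * (G w powr p * \<zeta> w) \<le> (a w \<bullet> g w) * \<zeta> w"
        using mult_right_mono[OF elim(2) \<zeta>0[of w]] by (simp add: G_def mult_ac)
      then show ?thesis using A w(1) abs_le_D2[OF A] by simp
    qed
  qed
  have Pi: "integrable lebesgue (\<lambda>w. indicator (?Q j) w * P w)" for j unfolding P_def by (rule X_integrable(2))
  have Qi: "integrable lebesgue (indicator (?Q j) :: _ \<Rightarrow> real)" for j
    using lmeasurable_cyl lmeasurable_iff_integrable by blast
  have Si: "integrable lebesgue (indicator S :: _ \<Rightarrow> real)" using S(1) lmeasurable_iff_integrable by blast
  have KSi: "integrable lebesgue (\<lambda>w. K1 * (indicator S w :: real))" using Si by simp
  have Ii: "integrable lebesgue ?I" using int by auto
  have Ti: "integrable lebesgue ?T" using int by auto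
  have Sumi: "integrable lebesgue (\<lambda>w. \<omega> * (\<Sum>j\<in>J. \<tau> j * (indicator (?Q j) w * P w) + Kj j * indicator (?Q j) w))"
    using Pi Qi by (intro integrable_mult_right Bochner_Integration.integrable_sum Bochner_Integration.integrable_add) auto
  have step1: "\<nu> / 2 * (LINT w|lebesgue. norm (g w) powr p * h w ^ q) \<le> (LINT w|lebesgue. ?T w) + K1 * measure lebesgue S
     + \<omega> * (\<Sum>j\<in>J. \<tau> j * X j + Kj j * measure lebesgue (?Q j))"
  proof -
    have "\<nu> / 2 * (LINT w|lebesgue. norm (g w) powr p * h w ^ q) = (LINT w|lebesgue. \<nu> / 2 * (G w powr p * \<zeta> w))"
      by (simp add: G_def \<zeta>_def)
    also have "\<dots> \<le> (LINT w|lebesgue. ?RHS w)"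
    proof (rule integral_mono_AE[OF _ _ pw])
      show "integrable lebesgue (\<lambda>w. \<nu> / 2 * (G w powr p * \<zeta> w))" using int(6) by (simp add: G_def)
      show "integrable lebesgue ?RHS"
        by (rule Bochner_Integration.integrable_add[OF Bochner_Integration.integrable_add[OF Bochner_Integration.integrable_add[OF Ii Ti] KSi] Sumi])
    qed
    also have "\<dots> = (LINT w|lebesgue. ?I w) + (LINT w|lebesgue. ?T w) + K1 * (LINT w|lebesgue. indicator S w)
       + \<omega> * (\<Sum>j\<in>J. \<tau> j * (LINT w|lebesgue. indicator (?Q j) w * P w) + Kj j * (LINT w|lebesgue. indicator (?Q j) w))"
    proof -
      have 1: "integrable lebesgue (\<lambda>w. ?I w + ?T w)" by (rule Bochner_Integration.integrable_add[OF Ii Ti])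
      have 2: "integrable lebesgue (\<lambda>w. K1 * (indicator S w :: real))" using Si by simp
      have 3: "integrable lebesgue (\<lambda>w. \<tau> j * (indicator (?Q j) w * P w) + Kj j * indicator (?Q j) w)" for j
        using Pi Qi by (intro Bochner_Integration.integrable_add integrable_mult_right)
      have 4: "integrable lebesgue (\<lambda>w. \<tau> j * (indicator (?Q j) w * P w))" "integrable lebesgue (\<lambda>w. Kj j * (indicator (?Q j) w :: real))" for j
        by (rule integrable_mult_right, rule Pi, rule integrable_mult_right, rule Qi)
      show ?thesis
        unfolding Bochner_Integration.integral_add[OF Bochner_Integration.integrable_add[OF 1 2] Sumi]
          Bochner_Integration.integral_add[OF 1 2] Bochner_Integration.integral_add[OF Ii Ti]
          integral_mult_right_zero Bochner_Integration.integral_sum[OF 3] Bochner_Integration.integral_add[OF 4] ..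
    qed
    also have "\<dots> = (LINT w|lebesgue. ?T w) + K1 * measure lebesgue S
     + \<omega> * (\<Sum>j\<in>J. \<tau> j * X j + Kj j * measure lebesgue (?Q j))"
      using energy[OF \<zeta>, of c] S(1) fmeasurableD[OF lmeasurable_cyl] by (simp add: X_def P_def fmeasurableD)
    finally show ?thesis .
  qed
  \<comment> \<open>Near small cylinders the time derivative of \<zeta> exceeds the scale R^(-s).
    Writing \<open>\<Psi> N\<close> as \<open>\<Psi> b\<close> minus increments isolates one part of
    scale R and, for each later j, a part whose derivative lives in one tripled cylinder.\<close>
  have step2: "(LINT w|lebesgue. ?T w) \<le> real q * (C0 + 1) / 2 * (\<omega>\<^sup>2 / R powr s) * measure lebesgue S
     + \<omega> * (\<Sum>j\<in>J. A3 C0 * rr j powr \<sigma>)"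
  proof -
    define Hq where "Hq w = H w ^ q" for w
    have Hq: "C1 Hq" unfolding Hq_def[abs_def] by (rule C1_power[OF H(1)])
    have pdHq: "pd v Hq w = real q * H w ^ (q - 1) * pd v H w" for v w
      unfolding Hq_def[abs_def] by (rule pd_power[OF H(1)])
    have Hq01: "0 \<le> Hq w" "Hq w \<le> 1" for w using H(2) H1 by (auto simp: Hq_def power_le_one)
    have pdHqt: "\<bar>pd (0, 1) Hq w\<bar> \<le> real q * C0 / R powr s" for w
    proof -
      have "H w ^ (q - 1) * \<bar>pd (0, 1) H w\<bar> \<le> 1 * (C0 / R powr s)"
        using H(2)[of w] H1[of w] Ht[of w] by (intro mult_mono) (auto simp: power_le_one)
      from mult_left_mono[OF this, of "real q"] show ?thesis unfolding pdHq using H(2)[of w] by (simp add: abs_mult mult_ac)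
    qed
    have zeroH: "Hq w = 0" "pd v Hq w = 0" if "H w = 0" for w v
      using that q(2) by (simp_all add: Hq_def pdHq zero_power)
    define Zb where "Zb w = Hq w * \<Psi> b w" for w
    define Zj where "Zj j w = Hq w * (\<Psi> j w - \<Psi> (Suc j) w)" for j w
    have Zb: "C1 Zb" unfolding Zb_def[abs_def] by (intro Ck_mult Hq \<Psi>(1) b(1))
    have Zj: "C1 (Zj j)" if "j < N" for j unfolding Zj_def[abs_def] using that by (intro Ck_mult Hq C1_diff \<Psi>(1)) auto
    have Zout: "w \<notin> tsupp \<eta> \<Longrightarrow> Zb w = 0" "w \<notin> tsupp \<eta> \<Longrightarrow> Zj j w = 0" for w j
      using Hout[of w] zeroH(1)[of w] by (simp_all add: Zb_def Zj_def)
    have \<zeta>e: "\<zeta> = (\<lambda>w. Hq w * \<Psi> N w)" by (simp add: \<zeta>_def h_def Hq_def \<Psi>N power_mult_distrib fun_eq_iff)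
    have pdZb: "pd v Zb w = Hq w * pd v (\<Psi> b) w + pd v Hq w * \<Psi> b w" for v w
      unfolding Zb_def[abs_def] by (rule pd_mult[OF Hq \<Psi>(1)[OF b(1)]])
    have pdZj: "pd v (Zj j) w = Hq w * (pd v (\<Psi> j) w - pd v (\<Psi> (Suc j)) w) + pd v Hq w * (\<Psi> j w - \<Psi> (Suc j) w)" if "j < N" for v j w
      unfolding Zj_def[abs_def] using pd_mult[OF Hq C1_diff[OF \<Psi>(1)[of j] \<Psi>(1)[of "Suc j"]], where v=v and z=w]
        pd_diff[OF \<Psi>(1)[of j] \<Psi>(1)[of "Suc j"], where v=v and z=w] that by simp
    have tele: "(\<Sum>j\<in>{b..<N}. f j - f (Suc j)) = f b - f N" for f :: "nat \<Rightarrow> real"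
      using sum_Suc_diff'[OF b(1), of f] by (simp add: sum_subtractf)
    have dec: "tpart \<zeta> w = pd (0, 1) Zb w - (\<Sum>j\<in>{b..<N}. pd (0, 1) (Zj j) w)" for w
    proof -
      have "tpart \<zeta> w = Hq w * pd (0, 1) (\<Psi> N) w + pd (0, 1) Hq w * \<Psi> N w"
        unfolding tpart_def \<zeta>e by (rule pd_mult[OF Hq \<Psi>(1)[OF order_refl]])
      moreover have "(\<Sum>j\<in>{b..<N}. pd (0, 1) (Zj j) w) = Hq w * (pd (0, 1) (\<Psi> b) w - pd (0, 1) (\<Psi> N) w) + pd (0, 1) Hq w * (\<Psi> b w - \<Psi> N w)"
        by (simp add: pdZj sum.distrib sum_distrib_left[symmetric] tele[of "\<lambda>j. pd (0, 1) (\<Psi> j) w"] tele[of "\<lambda>j. \<Psi> j w"])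
      ultimately show ?thesis by (simp add: pdZb algebra_simps)
    qed
    have um2: "(\<lambda>w. (u w - c)\<^sup>2 / 2) \<in> borel_measurable lebesgue" using um by measurable
    have pdm: "pd (0, 1) f \<in> borel_measurable lebesgue" if "C1 f" for f :: "(real^'n) \<times> real \<Rightarrow> real"
      by (rule continuous_measurable_lebesgue[OF C1_pd_continuous[OF that]])
    have bb: "\<bar>(u w - c)\<^sup>2 / 2 * pd (0, 1) Zb w\<bar> \<le> (real q * (C0 + 1) / 2 * (\<omega>\<^sup>2 / R powr s)) * indicator S w" for w
    proof (cases "H w = 0")
      case True
      then have "pd (0, 1) Zb w = 0" using zeroH[of w] by (simp add: pdZb)
      then show ?thesis using C0 by (simp add: indicator_def)
    next
      case False
      have "\<bar>pd (0, 1) (\<Psi> b) w\<bar> \<le> real q * (1 / R powr s)"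
        by (rule order_trans[OF pd_\<Psi>_le[OF b(1)] mult_left_mono[OF pd_M_bounds(2)[OF b(1) R b(2)]]]) auto
      then have "\<bar>Hq w * pd (0, 1) (\<Psi> b) w\<bar> \<le> 1 * (real q * (1 / R powr s))"
        unfolding abs_mult using Hq01[of w] by (intro mult_mono) auto
      moreover have "\<bar>pd (0, 1) Hq w * \<Psi> b w\<bar> \<le> (real q * C0 / R powr s) * 1"
        unfolding abs_mult using pdHqt[of w] \<Psi>(2,3)[OF b(1), of w] C0 by (intro mult_mono) auto
      ultimately have 1: "\<bar>pd (0, 1) Zb w\<bar> \<le> real q * (C0 + 1) / R powr s"
        unfolding pdZb by (simp add: algebra_simps add_divide_distrib)
      have "(u w - c)\<^sup>2 \<le> \<omega>\<^sup>2" using power_mono[OF osc[OF False], of 2] by simp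
      then have "\<bar>(u w - c)\<^sup>2 / 2\<bar> \<le> \<omega>\<^sup>2 / 2" by simp
      from mult_mono[OF this 1] show ?thesis using S(2)[OF False] by (simp add: abs_mult mult_ac)
    qed
    note Ib = integrable_bounded_compact[OF S(1) borel_measurable_times[OF um2 pdm[OF Zb]] bb]
    have each: "integrable lebesgue (\<lambda>w. (u w - c)\<^sup>2 / 2 * pd (0, 1) (Zj j) w)
        \<and> - (LINT w|lebesgue. (u w - c)\<^sup>2 / 2 * pd (0, 1) (Zj j) w) \<le> (if j \<in> J then \<omega> * (A3 C0 * rr j powr \<sigma>) else 0)"
      if j: "j \<in> {b..<N}" for j
    proof -
      have jN: "j < N" "b \<le> j" using j by auto
      have rj: "0 < rr j" "rr j \<le> R" using rpos[OF jN(1)] b(3)[OF jN(2,1)] by auto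
      \<comment> \<open>The time derivative of \<open>Zj j\<close> integrates to 0, so a constant
        may be subtracted from (u - c)^2 / 2. Its value at the centre, a point of E, brings in the
        Hoelder bound.\<close>
      define \<kappa> where "\<kappa> = (u (zz j) - c)\<^sup>2 / 2"
      let ?C = "(if j \<in> J then 3/2 * \<omega> * (Mh * (3 * rr j) powr \<alpha>) * (real q * (C0 + 2) / rr j powr s) else 0)"
      have kb: "\<bar>((u w - c)\<^sup>2 / 2 - \<kappa>) * pd (0, 1) (Zj j) w\<bar> \<le> ?C * indicator (?Q j) w" for w
      proof (cases "H w = 0 \<or> w \<notin> ?Q j")
        case True
        have "pd (0, 1) (Zj j) w = 0"
        proof (cases "H w = 0")
          case False
          then have w: "w \<notin> ?Q j" using True by simp
          have "\<Psi> j w = \<Psi> (Suc j) w" using Msupp[OF jN(1) w] by (simp add: \<Psi>_def)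
          moreover have "pd (0, 1) (\<Psi> j) w = pd (0, 1) (\<Psi> (Suc j)) w"
            using Msupp[OF jN(1) w] Mpd[OF jN(1) w] jN(1) by (simp add: pd_\<Psi>)
          ultimately show ?thesis by (simp add: pdZj[OF jN(1)])
        qed (use zeroH[of w] in \<open>simp add: pdZj[OF jN(1)]\<close>)
        moreover have "?C \<ge> 0" using \<omega>0 Mh C0 by simp
        ultimately show ?thesis by (simp add: indicator_def)
      next
        case False
        then have Hw: "H w \<noteq> 0" and w: "w \<in> ?Q j" by auto
        have jJ: "j \<in> J" using Hw w jN by (auto simp: J_def)
        have wD: "w \<in> D" using Hw Hout \<eta>(5) by blast
        have uj: "\<bar>u w - u (zz j)\<bar> \<le> Mh * (3 * rr j) powr \<alpha>"
          by (rule holder[OF zE[OF jN(1)] wD _ w]) (use rj in simp)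
        have "(3 * rr j) powr \<alpha> \<le> (3 * R) powr \<alpha>" using rj \<alpha> by (intro powr_mono2) auto
        then have "Mh * (3 * rr j) powr \<alpha> \<le> \<omega>" using \<omega> Mh by (smt (verit) mult_left_mono)
        then have sum3: "\<bar>u w + u (zz j) - 2 * c\<bar> \<le> 3 * \<omega>" using osc[OF Hw] uj by linarith
        \<comment> \<open>Difference of squares: one factor is an oscillation of order rr^\<alpha>,
          the other is at most 3 \<omega>. This is the origin of the single \<omega> in front of the
          time errors.\<close>
        have keq: "(u w - c)\<^sup>2 / 2 - \<kappa> = (u w - u (zz j)) * (u w + u (zz j) - 2 * c) / 2"
          by (simp add: \<kappa>_def power2_eq_square algebra_simps diff_divide_distrib add_divide_distrib)
        have "\<bar>(u w - c)\<^sup>2 / 2 - \<kappa>\<bar> = \<bar>u w - u (zz j)\<bar> * \<bar>u w + u (zz j) - 2 * c\<bar> / 2"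
          unfolding keq by (simp add: abs_mult)
        also have "\<dots> \<le> (Mh * (3 * rr j) powr \<alpha>) * (3 * \<omega>) / 2"
          using uj sum3 Mh by (intro divide_right_mono mult_mono) auto
        also have "\<dots> = 3/2 * \<omega> * (Mh * (3 * rr j) powr \<alpha>)" by (simp add: mult_ac)
        finally have 1: "\<bar>(u w - c)\<^sup>2 / 2 - \<kappa>\<bar> \<le> 3/2 * \<omega> * (Mh * (3 * rr j) powr \<alpha>)" .
        have "\<bar>pd (0, 1) (M j) w\<bar> \<le> 1 / rr j powr s"
          by (rule pd_M_bounds(2)) (use jN rj anti[of _ j] in auto)
        then have p1: "\<bar>pd (0, 1) (\<Psi> j) w\<bar> \<le> real q * (1 / rr j powr s)"
          using order_trans[OF pd_\<Psi>_le[of j, where v="(0, 1)" and w=w] mult_left_mono[of "\<bar>pd (0, 1) (M j) w\<bar>" "1 / rr j powr s" "real q"]] jN by simp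
        have p2: "\<bar>pd (0, 1) (\<Psi> (Suc j)) w\<bar> \<le> real q * (1 / rr j powr s)"
          using order_trans[OF pd_\<Psi>_le[of "Suc j", where v="(0, 1)" and w=w] mult_left_mono[OF Mt[OF jN(1), of w], of "real q"]] jN by simp
        have "\<bar>Hq w * (pd (0, 1) (\<Psi> j) w - pd (0, 1) (\<Psi> (Suc j)) w)\<bar> \<le> 1 * (2 * real q * (1 / rr j powr s))"
          unfolding abs_mult using Hq01[of w] p1 p2 by (intro mult_mono) auto
        moreover have "\<bar>pd (0, 1) Hq w * (\<Psi> j w - \<Psi> (Suc j) w)\<bar> \<le> (real q * C0 / rr j powr s) * 1"
        proof -
          have "rr j powr s \<le> R powr s" using rj s2 by (intro powr_mono2) auto
          then have "real q * C0 / R powr s \<le> real q * C0 / rr j powr s" using C0 rj by (intro divide_left_mono) auto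
          then have "\<bar>pd (0, 1) Hq w\<bar> \<le> real q * C0 / rr j powr s" using pdHqt[of w] by linarith
          moreover have "\<bar>\<Psi> j w - \<Psi> (Suc j) w\<bar> \<le> 1"
            using \<Psi>(2,3)[of j w] \<Psi>(2,3)[of "Suc j" w] jN by (auto simp: abs_le_iff)
          ultimately show ?thesis unfolding abs_mult using C0 by (intro mult_mono) auto
        qed
        ultimately have 2: "\<bar>pd (0, 1) (Zj j) w\<bar> \<le> real q * (C0 + 2) / rr j powr s"
          unfolding pdZj[OF jN(1)] by (simp add: algebra_simps add_divide_distrib)
        have "\<bar>((u w - c)\<^sup>2 / 2 - \<kappa>) * pd (0, 1) (Zj j) w\<bar> \<le> (3/2 * \<omega> * (Mh * (3 * rr j) powr \<alpha>)) * (real q * (C0 + 2) / rr j powr s)"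
          unfolding abs_mult by (rule mult_mono[OF 1 2]) (use \<omega>0 Mh in auto)
        then show ?thesis using jJ w by simp
      qed
      have um3: "(\<lambda>w. (u w - c)\<^sup>2 / 2 - \<kappa>) \<in> borel_measurable lebesgue" using um by measurable
      note Ik = integrable_bounded_compact[OF lmeasurable_cyl borel_measurable_times[OF um3 pdm[OF Zj[OF jN(1)]]] kb]
      note I0 = integral_pd_tsupp_eq_0[OF Zj[OF jN(1)] \<eta>(4) Zout(2), where v="(0, 1)"]
      have e: "(u w - c)\<^sup>2 / 2 * pd (0, 1) (Zj j) w = ((u w - c)\<^sup>2 / 2 - \<kappa>) * pd (0, 1) (Zj j) w + \<kappa> * pd (0, 1) (Zj j) w" for w
        by (simp add: algebra_simps)
      have i2: "integrable lebesgue (\<lambda>w. \<kappa> * pd (0, 1) (Zj j) w)" using I0(1) by simp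
      have i3: "integrable lebesgue (\<lambda>w. (u w - c)\<^sup>2 / 2 * pd (0, 1) (Zj j) w)"
        unfolding e by (rule Bochner_Integration.integrable_add[OF Ik(1) i2])
      have "(LINT w|lebesgue. (u w - c)\<^sup>2 / 2 * pd (0, 1) (Zj j) w) = (LINT w|lebesgue. ((u w - c)\<^sup>2 / 2 - \<kappa>) * pd (0, 1) (Zj j) w)"
        unfolding e Bochner_Integration.integral_add[OF Ik(1) i2] integral_mult_right_zero using I0(2) by simp
      then have "- (LINT w|lebesgue. (u w - c)\<^sup>2 / 2 * pd (0, 1) (Zj j) w) \<le> ?C * measure lebesgue (?Q j)"
        using Ik(2) by linarith
      also have "\<dots> = (if j \<in> J then \<omega> * (A3 C0 * rr j powr \<sigma>) else 0)"
      proof -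
        have "rr j powr \<alpha> / rr j powr s * rr j powr (nn + s) = rr j powr \<sigma>"
          using rj by (simp add: powr_diff[symmetric] powr_add[symmetric] algebra_simps)
        then have "3/2 * \<omega> * (Mh * (3 * rr j) powr \<alpha>) * (real q * (C0 + 2) / rr j powr s) * measure lebesgue (?Q j)
          = \<omega> * (A3 C0 * rr j powr \<sigma>)"
          unfolding measure_cyl3[of 3 "rr j", OF zero_less_numeral rj(1)] A3_def using rj
          by (simp add: powr_mult mult_ac flip: \<open>_ = rr j powr \<sigma>\<close>)
        then show ?thesis by simp
      qed
      finally show ?thesis using i3 by blast
    qed
    have s1: "- (\<Sum>j\<in>{b..<N}. (LINT w|lebesgue. (u w - c)\<^sup>2 / 2 * pd (0, 1) (Zj j) w))
        \<le> (\<Sum>j\<in>{b..<N}. if j \<in> J then \<omega> * (A3 C0 * rr j powr \<sigma>) else 0)"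
      unfolding sum_negf[symmetric] by (rule sum_mono) (rule conjunct2[OF each])
    have "(LINT w|lebesgue. ?T w) = (LINT w|lebesgue. (u w - c)\<^sup>2 / 2 * pd (0, 1) Zb w - (\<Sum>j\<in>{b..<N}. (u w - c)\<^sup>2 / 2 * pd (0, 1) (Zj j) w))"
      by (simp add: dec right_diff_distrib sum_distrib_left)
    also have "\<dots> = (LINT w|lebesgue. (u w - c)\<^sup>2 / 2 * pd (0, 1) Zb w) - (\<Sum>j\<in>{b..<N}. (LINT w|lebesgue. (u w - c)\<^sup>2 / 2 * pd (0, 1) (Zj j) w))"
      using each Ib(1) by (subst Bochner_Integration.integral_diff) (auto simp: Bochner_Integration.integral_sum)
    also have "\<dots> \<le> real q * (C0 + 1) / 2 * (\<omega>\<^sup>2 / R powr s) * measure lebesgue S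
       + (\<Sum>j\<in>{b..<N}. if j \<in> J then \<omega> * (A3 C0 * rr j powr \<sigma>) else 0)"
      using Ib(2) s1 by linarith
    also have "(\<Sum>j\<in>{b..<N}. if j \<in> J then \<omega> * (A3 C0 * rr j powr \<sigma>) else 0) = \<omega> * (\<Sum>j\<in>J. A3 C0 * rr j powr \<sigma>)"
    proof -
      have "{b..<N} \<inter> J = J" by (auto simp: J_def)
      then show ?thesis by (simp add: sum.inter_restrict[symmetric] sum_distrib_left)
    qed
    finally show ?thesis .
  qed
  have K1e: "K1 = (\<nu> / 2) powr (1 - p) * (L * nn * real q * (C0 + 1)) powr p * (\<omega> / R) powr p"
  proof -
    have "B1 = (L * nn * real q * (C0 + 1)) * (\<omega> / R)" by (simp add: B1_def)
    then have "B1 powr p = (L * nn * real q * (C0 + 1)) powr p * (\<omega> / R) powr p"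
      by (simp only: powr_mult)
    then show ?thesis unfolding K1_def by simp
  qed
  have Kje: "Kj j * measure lebesgue (?Q j) + A3 C0 * rr j powr \<sigma> = A2 C0 \<delta> * rr j powr \<sigma>" if "j \<in> J" for j
  proof -
    have rj: "0 < rr j" using J[OF that] by simp
    have "\<tau> j powr (1 - p) = \<delta> powr (1 - p) * rr j powr (- \<alpha> * (1 - p))"
      using \<delta> rj by (simp add: \<tau>_def powr_mult powr_powr)
    moreover have "Bj j powr p = (2 * L * nn * real q) powr p * rr j powr (- p)"
    proof -
      have "Bj j powr p = (2 * L * nn * real q) powr p / rr j powr p" unfolding Bj_def by (rule powr_divide)
      then show ?thesis by (simp only: powr_minus divide_inverse)
    qed
    moreover have "measure lebesgue (?Q j) = V * 3 powr (nn + s) * rr j powr (nn + s)"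
      unfolding measure_cyl3[of 3 "rr j", OF zero_less_numeral rj] using rj by (simp add: powr_mult)
    moreover have "rr j powr (- \<alpha> * (1 - p)) * rr j powr (- p) * rr j powr (nn + s) = rr j powr \<sigma>"
      using rj by (simp add: powr_add[symmetric] algebra_simps)
    ultimately have "Kj j * measure lebesgue (?Q j) = \<delta> powr (1 - p) * (2 * L * nn * real q) powr p * (V * 3 powr (nn + s)) * rr j powr \<sigma>"
      unfolding Kj_def by (simp add: mult_ac)
    then show ?thesis by (simp add: A2_def algebra_simps)
  qed
  have "\<nu> / 2 * (LINT w|lebesgue. norm (g w) powr p * h w ^ q)
     \<le> (real q * (C0 + 1) / 2 * (\<omega>\<^sup>2 / R powr s) + K1) * measure lebesgue S
      + \<omega> * (\<Sum>j\<in>J. \<tau> j * X j + (Kj j * measure lebesgue (?Q j) + A3 C0 * rr j powr \<sigma>))"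
    using step1 step2 by (simp add: algebra_simps sum.distrib)
  also have "(\<Sum>j\<in>J. \<tau> j * X j + (Kj j * measure lebesgue (?Q j) + A3 C0 * rr j powr \<sigma>)) = (\<Sum>j\<in>J. \<tau> j * X j + A2 C0 \<delta> * rr j powr \<sigma>)"
    using Kje by (intro sum.cong) auto
  also have "(real q * (C0 + 1) / 2 * (\<omega>\<^sup>2 / R powr s) + K1) * measure lebesgue S
     \<le> A1 C0 * ((\<omega> / R) powr p + \<omega>\<^sup>2 / R powr s) * measure lebesgue S"
  proof (rule mult_right_mono)
    define x y cx cy where "x = (\<omega> / R) powr p" and "y = \<omega>\<^sup>2 / R powr s"
      and "cx = (\<nu> / 2) powr (1 - p) * (L * nn * real q * (C0 + 1)) powr p" and "cy = real q * (C0 + 1) / 2"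
    have "0 \<le> x" "0 \<le> y" "0 \<le> cx" "0 \<le> cy" using C0 by (simp_all add: x_def y_def cx_def cy_def)
    then have "cy * y + cx * x \<le> (cx + cy) * (x + y)" by (simp add: algebra_simps)
    then show "real q * (C0 + 1) / 2 * (\<omega>\<^sup>2 / R powr s) + K1 \<le> A1 C0 * ((\<omega> / R) powr p + \<omega>\<^sup>2 / R powr s)"
      unfolding K1e A1_def x_def y_def cx_def cy_def .
  qed simp
  finally show ?thesis by (simp add: h_def \<tau>_def)
qed

end

section \<open>Decay of the energy on the covering cylinders\<close>

context removable begin

text \<open>Constants of the main estimate at R = rr i with \<omega> = Mh (9 R)^\<alpha> and C0 = 2.
  \<open>B3\<close> belongs to the scale of the cylinder itself, \<open>B4\<close> to the packing
  bound with radius 13 R. \<open>\<delta>0\<close> makes B4 \<delta>0 = \<nu>/4, half of the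
  coefficient on the left, and \<open>\<Lambda>0\<close> solves the resulting inequality for the
  largest ratio.\<close>

definition B3 :: real where
  "B3 = A1 2 * ((Mh * 9 powr \<alpha>) powr p + (Mh * 9 powr \<alpha>)\<^sup>2) * (V * 9 powr (nn + s))"
definition B4 :: real where "B4 = Mh * 9 powr \<alpha> * 13 powr \<sigma>"
definition \<delta>0 :: real where "\<delta>0 = \<nu> / (4 * B4)"
definition \<Lambda>0 :: real where "\<Lambda>0 = 4 / \<nu> * (B3 + B4 * A2 2 \<delta>0)"

lemma nn0: "nn \<ge> 0" by (simp add: nn)

lemma A1_nonneg: "C0 \<ge> 0 \<Longrightarrow> A1 C0 \<ge> 0" by (simp add: A1_def)

lemma A2_nonneg: "C0 \<ge> 0 \<Longrightarrow> A2 C0 \<delta> \<ge> 0"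
  using V0 Mh by (simp add: A2_def A3_def)

lemma B4_pos: "B4 > 0" using Mh by (simp add: B4_def)

lemma \<delta>0_pos: "\<delta>0 > 0" using B4_pos \<nu> by (simp add: \<delta>0_def)

lemma \<Lambda>0_nonneg: "\<Lambda>0 \<ge> 0"
proof -
  have "B3 \<ge> 0" using A1_nonneg[of 2] V0 Mh by (simp add: B3_def)
  then show ?thesis using A2_nonneg[of 2 \<delta>0] B4_pos \<nu> by (simp add: \<Lambda>0_def)
qed

lemma \<sigma>_pos: "\<sigma> > 0" using nn0 \<alpha> by simp

end

context cutoff_config begin

text \<open>The ratios \<open>X i / rr i powr (\<sigma> + \<alpha>)\<close> are finitely many; at the largest one the main estimate
  absorbs the contributions of the smaller cylinders by packing.\<close>

lemma energy_decay:
  assumes C\<eta>: "C\<eta> \<ge> 0" "\<And>i w. \<bar>pd (axis i 1, 0) \<eta> w\<bar> \<le> C\<eta>" "\<And>w. \<bar>pd (0, 1) \<eta> w\<bar> \<le> C\<eta>"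
    and small: "\<And>j. j < N \<Longrightarrow> rr j \<le> 1 \<and> C\<eta> * rr j \<le> 1"
    and pack: "\<And>i. i < N \<Longrightarrow> (\<Sum>j | j < N \<and> rr j \<le> rr i \<and> cyl s (zz j) (3 * rr j) \<inter> cyl s (zz i) (9 * rr i) \<noteq> {}. rr j powr \<sigma>)
       \<le> (13 * rr i) powr \<sigma>"
    and i: "i < N"
  shows "X i \<le> \<Lambda>0 * rr i powr (\<sigma> + \<alpha>)"
proof -
  \<comment> \<open>A bound with ratio \<Lambda> on all cylinders returns a bound on each of them in
    which \<Lambda> has the coefficient B4 \<delta>0 = \<nu>/4, against \<nu>/2 on the left.\<close>
  have step: "\<nu> / 2 * X i \<le> (B3 + B4 * (\<delta>0 * \<Lambda> + A2 2 \<delta>0)) * rr i powr (\<sigma> + \<alpha>)"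
    if i: "i < N" and \<Lambda>: "\<And>j. j < N \<Longrightarrow> X j \<le> \<Lambda> * rr j powr (\<sigma> + \<alpha>)" and \<Lambda>0: "\<Lambda> \<ge> 0" for i \<Lambda>
  proof -
    have r: "0 < rr i" by (rule rpos[OF i])
    define R where "R = rr i"
    have R: "R > 0" "R \<le> 1" "C\<eta> * R \<le> 1" using r small[OF i] by (simp_all add: R_def)
    have s1: "s \<ge> 1" using s2 by simp
    obtain h where h: "C1 h" "\<And>w. 0 \<le> h w" "\<And>w. h w \<le> 1" "\<And>w. w \<in> cyl s (zz i) (3 * rr i) \<Longrightarrow> h w = 1"
      "\<And>w. w \<notin> cyl s (zz i) (9 * rr i) \<Longrightarrow> h w = 0"
      "\<And>j w. \<bar>pd (axis j 1, 0) h w\<bar> \<le> 1 / rr i" "\<And>w. \<bar>pd (0, 1) h w\<bar> \<le> 1 / rr i powr s"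
      using cylinder_cutoff[OF r s1, of "zz i"] by metis
    define H where "H w = h w * \<eta> w" for w
    have HC: "C1 H" unfolding H_def[abs_def] by (intro Ck_mult h(1) \<eta>(1))
    have H0: "0 \<le> H w" "H w \<le> \<eta> w" for w
      using h(2,3)[of w] \<eta>(2)[of w] by (auto simp: H_def mult_left_le_one_le)
    have pdH: "\<bar>pd v H w\<bar> \<le> \<bar>pd v h w\<bar> + \<bar>pd v \<eta> w\<bar>" for v w
    proof -
      have "pd v H w = h w * pd v \<eta> w + pd v h w * \<eta> w"
        unfolding H_def[abs_def] by (rule pd_mult[OF h(1) \<eta>(1)])
      then have "\<bar>pd v H w\<bar> \<le> h w * \<bar>pd v \<eta> w\<bar> + \<bar>pd v h w\<bar> * \<eta> w"
        using abs_triangle_ineq[of "h w * pd v \<eta> w" "pd v h w * \<eta> w"] h(2)[of w] \<eta>(2)[of w] by (simp add: abs_mult)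
      also have "\<dots> \<le> 1 * \<bar>pd v \<eta> w\<bar> + \<bar>pd v h w\<bar> * 1"
        using h(3)[of w] \<eta>(3)[of w] by (intro add_mono mult_right_mono mult_left_mono) auto
      finally show ?thesis by simp
    qed
    have C1R: "C\<eta> \<le> 1 / R" using R by (simp add: field_simps)
    have RsR: "R powr s \<le> R" using powr_mono'[of 1 s R] R s1 by simp
    have Rs0: "R powr s > 0" using R by simp
    have "1 / R \<le> 1 / R powr s" using RsR Rs0 by (intro divide_left_mono) (use R in auto)
    then have C1Rs: "C\<eta> \<le> 1 / R powr s" using C1R by linarith
    \<comment> \<open>The radius is so small that \<eta> has no larger derivative bounds than h,
      whence C0 = 2.\<close>
    have Hx: "\<bar>pd (axis j 1, 0) H w\<bar> \<le> 2 / R" for j w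
      using pdH[where v="(axis j 1, 0)" and w=w] h(6)[where w=w and j=j] C\<eta>(2)[where w=w and i=j] C1R by (simp add: R_def)
    have Ht: "\<bar>pd (0, 1) H w\<bar> \<le> 2 / R powr s" for w
      using pdH[where v="(0, 1)" and w=w] h(7)[of w] C\<eta>(3)[of w] C1Rs by (simp add: R_def)
    define S where "S = cyl s (zz i) (9 * rr i)"
    have S: "S \<in> lmeasurable" "H w \<noteq> 0 \<Longrightarrow> w \<in> S" for w
      unfolding S_def using h(5)[of w] by (auto simp: lmeasurable_cyl H_def)
    define \<omega> where "\<omega> = Mh * (9 * R) powr \<alpha>"
    have osc: "\<bar>u w - u (zz i)\<bar> \<le> \<omega>" if "H w \<noteq> 0" for w
    proof -
      have "\<eta> w \<noteq> 0" using that by (auto simp: H_def)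
      then have "w \<in> D" using outside_tsupp[of w \<eta>] \<eta>(5) by blast
      then show ?thesis unfolding \<omega>_def R_def
        using holder[OF zE[OF i], of w "9 * rr i"] S(2)[OF that] r by (simp add: S_def)
    qed
    have "(3 * R) powr \<alpha> \<le> (9 * R) powr \<alpha>" using R \<alpha> by (intro powr_mono2) auto
    then have \<omega>3: "Mh * (3 * R) powr \<alpha> \<le> \<omega>" unfolding \<omega>_def using Mh by (intro mult_left_mono) auto
    have bi: "j < i \<Longrightarrow> R \<le> rr j" "i \<le> j \<Longrightarrow> j < N \<Longrightarrow> rr j \<le> R" for j
      using anti[of j i] anti[of i j] i by (auto simp: R_def)
    define J where "J = {j. i \<le> j \<and> j < N \<and> (\<exists>w\<in>cyl s (zz j) (3 * rr j). H w \<noteq> 0)}"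
    \<comment> \<open>H is supported in the cylinder of radius 9 rr i and J looks at tripled
      cylinders: this is where the 9 and the 3 of the packing bound come from.\<close>
    have J: "J \<subseteq> {j. j < N \<and> rr j \<le> rr i \<and> cyl s (zz j) (3 * rr j) \<inter> cyl s (zz i) (9 * rr i) \<noteq> {}}"
      using bi(2) S(2) unfolding J_def S_def R_def by blast
    have "(\<Sum>j\<in>J. rr j powr \<sigma>) \<le> (\<Sum>j | j < N \<and> rr j \<le> rr i \<and> cyl s (zz j) (3 * rr j) \<inter> cyl s (zz i) (9 * rr i) \<noteq> {}. rr j powr \<sigma>)"
      by (rule sum_mono2[OF _ J]) auto
    also have "\<dots> \<le> (13 * R) powr \<sigma>" using pack[OF i] by (simp add: R_def)
    finally have packJ: "(\<Sum>j\<in>J. rr j powr \<sigma>) \<le> (13 * R) powr \<sigma>" .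
    have \<omega>0: "\<omega> \<ge> 0" using Mh by (simp add: \<omega>_def)
    have main: "\<nu> / 2 * (LINT w|lebesgue. norm (g w) powr p * (H w * \<psi> w) ^ q)
      \<le> A1 2 * ((\<omega> / R) powr p + \<omega>\<^sup>2 / R powr s) * measure lebesgue S
      + \<omega> * (\<Sum>j\<in>J. \<delta>0 * rr j powr (- \<alpha>) * X j + A2 2 \<delta>0 * rr j powr \<sigma>)"
      unfolding J_def
      by (rule main_estimate[OF HC H0 R(1) _ Hx Ht S osc \<omega>3 less_imp_le[OF i] bi \<delta>0_pos]) auto
    have C: "C1 (\<lambda>w. (H w * \<psi> w) ^ q)" by (intro C1_power Ck_mult HC \<psi>(1))
    have o: "(H w * \<psi> w) ^ q = 0" if "w \<notin> KK" for w
      using etapsi_outside[OF that] q(2) by (auto simp: H_def zero_power)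
    have "X i \<le> (LINT w|lebesgue. norm (g w) powr p * (H w * \<psi> w) ^ q)"
      unfolding X_def
    proof (rule integral_mono[OF X_integrable(2) energy_terms_integrable(6)[OF C tsupp_KK[OF o]]])
      fix w
      have "0 \<le> (H w * \<psi> w) ^ q" using H0 \<psi>(2) by simp
      then show "indicator (cyl s (zz i) (3 * rr i)) w * (norm (g w) powr p * (\<eta> w * \<psi> w) ^ q) \<le> norm (g w) powr p * (H w * \<psi> w) ^ q"
        using h(4)[of w] by (auto simp: indicator_def H_def)
    qed
    then have "\<nu> / 2 * X i \<le> \<nu> / 2 * (LINT w|lebesgue. norm (g w) powr p * (H w * \<psi> w) ^ q)"
      using \<nu> by (intro mult_left_mono) auto
    also note main
    also have "A1 2 * ((\<omega> / R) powr p + \<omega>\<^sup>2 / R powr s) * measure lebesgue S = B3 * R powr (\<sigma> + \<alpha>)"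
    proof -
      have mS: "measure lebesgue S = V * 9 powr (nn + s) * R powr (nn + s)"
        unfolding S_def measure_cyl3[of 9 "rr i", OF zero_less_numeral r] by (simp add: powr_mult R_def)
      have w1: "\<omega> = Mh * 9 powr \<alpha> * R powr \<alpha>" by (simp add: \<omega>_def powr_mult)
      have "(\<omega> / R) powr p * R powr (nn + s) = (Mh * 9 powr \<alpha>) powr p * (R powr (\<alpha> * p) * R powr (- p) * R powr (nn + s))"
      proof -
        have "(\<omega> / R) powr p = \<omega> powr p / R powr p" by (rule powr_divide)
        also have "\<omega> powr p = (Mh * 9 powr \<alpha>) powr p * R powr (\<alpha> * p)"
          unfolding w1 by (simp only: powr_mult[of "Mh * 9 powr \<alpha>"] powr_powr)
        finally show ?thesis by (simp add: powr_minus divide_inverse)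
      qed
      also have "R powr (\<alpha> * p) * R powr (- p) * R powr (nn + s) = R powr (\<sigma> + \<alpha>)"
        using R by (simp add: powr_add[symmetric] algebra_simps)
      finally have 1: "(\<omega> / R) powr p * R powr (nn + s) = (Mh * 9 powr \<alpha>) powr p * R powr (\<sigma> + \<alpha>)" .
      have "\<omega>\<^sup>2 / R powr s * R powr (nn + s) = (Mh * 9 powr \<alpha>)\<^sup>2 * (R powr \<alpha> * R powr \<alpha> * R powr (- s) * R powr (nn + s))"
        unfolding w1 powr_minus[of R s] divide_inverse power2_eq_square by (simp only: mult_ac)
      also have "R powr \<alpha> * R powr \<alpha> * R powr (- s) * R powr (nn + s) = R powr (\<sigma> + \<alpha>)"
        using R by (simp add: powr_add[symmetric] algebra_simps)
      finally have 2: "\<omega>\<^sup>2 / R powr s * R powr (nn + s) = (Mh * 9 powr \<alpha>)\<^sup>2 * R powr (\<sigma> + \<alpha>)" .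
      have "A1 2 * ((\<omega> / R) powr p + \<omega>\<^sup>2 / R powr s) * measure lebesgue S
        = A1 2 * (V * 9 powr (nn + s)) * ((\<omega> / R) powr p * R powr (nn + s) + \<omega>\<^sup>2 / R powr s * R powr (nn + s))"
        unfolding mS by (simp add: algebra_simps)
      also have "\<dots> = B3 * R powr (\<sigma> + \<alpha>)" unfolding 1 2 B3_def by (simp add: algebra_simps)
      finally show ?thesis .
    qed
    also have "\<omega> * (\<Sum>j\<in>J. \<delta>0 * rr j powr (- \<alpha>) * X j + A2 2 \<delta>0 * rr j powr \<sigma>) \<le> B4 * (\<delta>0 * \<Lambda> + A2 2 \<delta>0) * R powr (\<sigma> + \<alpha>)"
    proof -
      have "(\<Sum>j\<in>J. \<delta>0 * rr j powr (- \<alpha>) * X j + A2 2 \<delta>0 * rr j powr \<sigma>) \<le> (\<Sum>j\<in>J. (\<delta>0 * \<Lambda> + A2 2 \<delta>0) * rr j powr \<sigma>)"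
      proof (rule sum_mono)
        fix j assume "j \<in> J"
        then have j: "j < N" "0 < rr j" using rpos by (auto simp: J_def)
        have "rr j powr (- \<alpha>) * X j \<le> rr j powr (- \<alpha>) * (\<Lambda> * rr j powr (\<sigma> + \<alpha>))"
          using \<Lambda>[OF j(1)] by (intro mult_left_mono) auto
        also have "\<dots> = \<Lambda> * (rr j powr (- \<alpha>) * rr j powr (\<sigma> + \<alpha>))" by simp
        also have "rr j powr (- \<alpha>) * rr j powr (\<sigma> + \<alpha>) = rr j powr \<sigma>" using j by (simp add: powr_add[symmetric] add.commute)
        finally have "\<delta>0 * (rr j powr (- \<alpha>) * X j) \<le> \<delta>0 * (\<Lambda> * rr j powr \<sigma>)"
          using \<delta>0_pos by (intro mult_left_mono) auto
        then show "\<delta>0 * rr j powr (- \<alpha>) * X j + A2 2 \<delta>0 * rr j powr \<sigma> \<le> (\<delta>0 * \<Lambda> + A2 2 \<delta>0) * rr j powr \<sigma>"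
          by (simp add: algebra_simps)
      qed
      also have "\<dots> = (\<delta>0 * \<Lambda> + A2 2 \<delta>0) * (\<Sum>j\<in>J. rr j powr \<sigma>)" by (simp add: sum_distrib_left)
      also have "\<dots> \<le> (\<delta>0 * \<Lambda> + A2 2 \<delta>0) * (13 * R) powr \<sigma>"
        using packJ \<delta>0_pos \<Lambda>0 A2_nonneg[of 2 \<delta>0] by (intro mult_left_mono) auto
      finally have "\<omega> * (\<Sum>j\<in>J. \<delta>0 * rr j powr (- \<alpha>) * X j + A2 2 \<delta>0 * rr j powr \<sigma>) \<le> \<omega> * ((\<delta>0 * \<Lambda> + A2 2 \<delta>0) * (13 * R) powr \<sigma>)"
        using \<omega>0 by (rule mult_left_mono)
      also have "\<dots> = B4 * (\<delta>0 * \<Lambda> + A2 2 \<delta>0) * (R powr \<alpha> * R powr \<sigma>)"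
        by (simp add: \<omega>_def B4_def powr_mult)
      also have "R powr \<alpha> * R powr \<sigma> = R powr (\<sigma> + \<alpha>)" using R by (simp add: powr_add[symmetric] add.commute)
      finally show ?thesis .
    qed
    finally show ?thesis by (simp add: R_def algebra_simps)
  qed
  define \<Lambda> where "\<Lambda> = Max ((\<lambda>j. X j / rr j powr (\<sigma> + \<alpha>)) ` {..<N})"
  have fin: "finite ((\<lambda>j. X j / rr j powr (\<sigma> + \<alpha>)) ` {..<N})" "(\<lambda>j. X j / rr j powr (\<sigma> + \<alpha>)) ` {..<N} \<noteq> {}"
    using i by auto
  have \<Lambda>ge: "X j / rr j powr (\<sigma> + \<alpha>) \<le> \<Lambda>" if "j < N" for j
    unfolding \<Lambda>_def using fin that by (intro Max_ge) auto
  have le: "X j \<le> \<Lambda> * rr j powr (\<sigma> + \<alpha>)" if "j < N" for j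
  proof -
    have "0 < rr j powr (\<sigma> + \<alpha>)" using rpos[OF that] by simp
    then show ?thesis using \<Lambda>ge[OF that] by (simp add: pos_divide_le_eq)
  qed
  have \<Lambda>nn: "\<Lambda> \<ge> 0" using \<Lambda>ge[OF i] X_nonneg[of i] rpos[OF i] by (meson divide_nonneg_nonneg order_trans powr_ge_zero)
  obtain k where k: "k < N" "\<Lambda> = X k / rr k powr (\<sigma> + \<alpha>)"
    using Max_in[OF fin] unfolding \<Lambda>_def by auto
  have rk: "0 < rr k powr (\<sigma> + \<alpha>)" using rpos[OF k(1)] by simp
  have "\<nu> / 2 * \<Lambda> * rr k powr (\<sigma> + \<alpha>) \<le> (B3 + B4 * (\<delta>0 * \<Lambda> + A2 2 \<delta>0)) * rr k powr (\<sigma> + \<alpha>)"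
    using step[OF k(1) le \<Lambda>nn] k(2) rk by simp
  then have "\<nu> / 2 * \<Lambda> \<le> B3 + B4 * (\<delta>0 * \<Lambda> + A2 2 \<delta>0)" using rk by (rule mult_right_le_imp_le)
  also have "\<dots> = B3 + \<nu> / 4 * \<Lambda> + B4 * A2 2 \<delta>0" using B4_pos by (simp add: \<delta>0_def distrib_left)
  finally have "\<nu> / 4 * \<Lambda> \<le> B3 + B4 * A2 2 \<delta>0" by linarith
  then have "\<Lambda> \<le> \<Lambda>0" using \<nu> by (simp add: \<Lambda>0_def field_simps)
  then have "\<Lambda> * rr i powr (\<sigma> + \<alpha>) \<le> \<Lambda>0 * rr i powr (\<sigma> + \<alpha>)" by (intro mult_right_mono) auto
  then show ?thesis using le[OF i] by linarith
qed

lemma rescaled_decay: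
  assumes "X j \<le> \<Lambda>0 * rr j powr (\<sigma> + \<alpha>)" "j < N"
  shows "rr j powr (- \<alpha>) * X j \<le> \<Lambda>0 * rr j powr \<sigma>"
proof -
  have r: "0 < rr j" using rpos[OF assms(2)] .
  have "rr j powr (- \<alpha>) * X j \<le> rr j powr (- \<alpha>) * (\<Lambda>0 * rr j powr (\<sigma> + \<alpha>))"
    using assms(1) by (intro mult_left_mono) auto
  also have "\<dots> = \<Lambda>0 * (rr j powr (- \<alpha>) * rr j powr (\<sigma> + \<alpha>))" by simp
  also have "rr j powr (- \<alpha>) * rr j powr (\<sigma> + \<alpha>) = rr j powr \<sigma>" using r by (simp add: powr_add[symmetric] add.commute)
  finally show ?thesis .
qed

text \<open>\<open>main_estimate\<close> with H = \<eta>, R = 1, c = 0 and b = 0, so that all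
  cylinders count as small. Decay turns each weighted energy into \<Lambda>0 rr^\<sigma>; since the
  cost is at most 1, the bound is the same for all covers.\<close>

lemma global_energy:
  assumes C\<eta>: "C\<eta> \<ge> 0" "\<And>i w. \<bar>pd (axis i 1, 0) \<eta> w\<bar> \<le> C\<eta>" "\<And>w. \<bar>pd (0, 1) \<eta> w\<bar> \<le> C\<eta>"
    and small: "\<And>j. j < N \<Longrightarrow> rr j \<le> 1" and dec: "\<And>j. j < N \<Longrightarrow> X j \<le> \<Lambda>0 * rr j powr (\<sigma> + \<alpha>)"
    and B: "\<And>w. w \<in> tsupp \<eta> \<Longrightarrow> \<bar>u w\<bar> \<le> B" and cost: "(\<Sum>j<N. rr j powr \<sigma>) \<le> 1"
  shows "\<nu> / 2 * (LINT w|lebesgue. norm (g w) powr p * (\<eta> w * \<psi> w) ^ q)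
    \<le> A1 C\<eta> * (max B (Mh * 3 powr \<alpha>) powr p + (max B (Mh * 3 powr \<alpha>))\<^sup>2) * measure lebesgue (tsupp \<eta>)
      + max B (Mh * 3 powr \<alpha>) * (\<Lambda>0 + A2 C\<eta> 1)"
proof -
  let ?\<omega> = "max B (Mh * 3 powr \<alpha>)"
  have \<omega>0: "?\<omega> \<ge> 0" using Mh by (simp add: le_max_iff_disj)
  define J where "J = {j. 0 \<le> j \<and> j < N \<and> (\<exists>w\<in>cyl s (zz j) (3 * rr j). \<eta> w \<noteq> 0)}"
  have "\<nu> / 2 * (LINT w|lebesgue. norm (g w) powr p * (\<eta> w * \<psi> w) ^ q)
      \<le> A1 C\<eta> * ((?\<omega> / 1) powr p + ?\<omega>\<^sup>2 / 1 powr s) * measure lebesgue (tsupp \<eta>)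
      + ?\<omega> * (\<Sum>j\<in>J. 1 * rr j powr (- \<alpha>) * X j + A2 C\<eta> 1 * rr j powr \<sigma>)"
    unfolding J_def
  proof (rule main_estimate[where c=0])
    show "\<bar>u w - 0\<bar> \<le> ?\<omega>" if "\<eta> w \<noteq> 0" for w using B[of w] outside_tsupp[of w \<eta>] that by fastforce
    show "w \<in> tsupp \<eta>" if "\<eta> w \<noteq> 0" for w using outside_tsupp[of w \<eta>] that by blast
  qed (use \<eta> C\<eta> small lmeasurable_compact[OF \<eta>(4)] in \<open>auto simp del: Ck.simps\<close>)
  also have "(\<Sum>j\<in>J. 1 * rr j powr (- \<alpha>) * X j + A2 C\<eta> 1 * rr j powr \<sigma>) \<le> (\<Sum>j\<in>J. (\<Lambda>0 + A2 C\<eta> 1) * rr j powr \<sigma>)"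
  proof (rule sum_mono)
    fix j assume "j \<in> J"
    then have j: "j < N" by (simp add: J_def)
    show "1 * rr j powr (- \<alpha>) * X j + A2 C\<eta> 1 * rr j powr \<sigma> \<le> (\<Lambda>0 + A2 C\<eta> 1) * rr j powr \<sigma>"
      using rescaled_decay[OF dec[OF j] j] by (simp add: algebra_simps)
  qed
  also have "\<dots> \<le> (\<Lambda>0 + A2 C\<eta> 1) * 1"
  proof -
    have "(\<Sum>j\<in>J. rr j powr \<sigma>) \<le> (\<Sum>j<N. rr j powr \<sigma>)" by (rule sum_mono2) (auto simp: J_def)
    then have "(\<Sum>j\<in>J. rr j powr \<sigma>) \<le> 1" using cost by linarith
    then show ?thesis
      unfolding sum_distrib_left[symmetric] using \<Lambda>0_nonneg A2_nonneg[OF C\<eta>(1), of 1] by (intro mult_left_mono) auto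
  qed
  finally show ?thesis using \<omega>0 by (simp add: mult_left_mono)
qed

section \<open>Errors made by inserting the cutoff\<close>

lemma powr_small: "0 < r \<Longrightarrow> r \<le> 1 \<Longrightarrow> x \<le> y \<Longrightarrow> r powr y \<le> (r::real) powr x"
  by (rule powr_mono') auto

text \<open>The derivative of \<open>\<Psi> N\<close> is telescoped into increments. On each of them
  u minus its value at the centre costs r^\<alpha> r^(-s) r^(nn+s) = r^\<sigma>; the constant part
  is integrated by parts onto \<phi> and costs r^(nn+s), at most r^\<sigma> for r \<le> 1.\<close>

lemma cutoff_error_u:
  assumes \<phi>: "C1 \<phi>" "compact (tsupp \<phi>)" "tsupp \<phi> \<subseteq> tsupp \<eta>" and F: "\<And>w. \<bar>\<phi> w\<bar> \<le> F" "\<And>w. \<bar>pd v \<phi> w\<bar> \<le> F"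
    and v: "v = (0, 1) \<or> (\<exists>i. v = (axis i 1, 0))"
    and small: "\<And>j. j < N \<Longrightarrow> rr j \<le> 1" and B: "\<And>w. w \<in> tsupp \<eta> \<Longrightarrow> \<bar>u w\<bar> \<le> B"
    and zt: "\<And>j. j < N \<Longrightarrow> zz j \<in> tsupp \<eta>"
  shows "\<bar>LINT w|lebesgue. u w * (\<phi> w * pd v (\<Psi> N) w)\<bar>
    \<le> F * (Mh * 3 powr \<alpha> * (2 * real q) + B) * (V * 3 powr (nn + s)) * (\<Sum>j<N. rr j powr \<sigma>)"
proof -
  have F0: "F \<ge> 0" using F(1)[of undefined] by (rule order_trans[OF abs_ge_zero])
  have tD: "tsupp \<phi> \<subseteq> D" using \<phi>(3) \<eta>(5) by blast
  define \<Theta> where "\<Theta> j w = \<Psi> j w - \<Psi> (Suc j) w" for j w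
  have \<Theta>C: "C1 (\<Theta> j)" if "j < N" for j unfolding \<Theta>_def[abs_def] using that by (intro C1_diff \<Psi>(1)) auto
  have pd\<Theta>: "pd v (\<Theta> j) w = pd v (\<Psi> j) w - pd v (\<Psi> (Suc j)) w" if "j < N" for j w
    unfolding \<Theta>_def[abs_def] by (rule pd_diff[OF \<Psi>(1) \<Psi>(1)]) (use that in auto)
  have \<Psi>0: "pd v (\<Psi> 0) w = 0" for w using pd_\<Psi>_le[of 0, where v=v and w=w] by (simp add: pd_M0)
  have "(\<Sum>j<N. f j - f (Suc j)) = f 0 - f N" for f :: "nat \<Rightarrow> real"
    using sum_lessThan_telescope'[of f N] by simp
  from this[of "\<lambda>j. pd v (\<Psi> j) _"] have tele: "pd v (\<Psi> N) w = - (\<Sum>j<N. pd v (\<Theta> j) w)" for w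
    by (simp add: pd\<Theta> \<Psi>0)
  have um': "(\<lambda>w. u w - c) \<in> borel_measurable lebesgue" for c using um by measurable
  have pdm: "pd v f \<in> borel_measurable lebesgue" if "C1 f" for f :: "(real^'n) \<times> real \<Rightarrow> real"
    by (rule continuous_measurable_lebesgue[OF C1_pd_continuous[OF that]])
  have each: "integrable lebesgue (\<lambda>w. u w * (\<phi> w * pd v (\<Theta> j) w)) \<and>
      \<bar>LINT w|lebesgue. u w * (\<phi> w * pd v (\<Theta> j) w)\<bar> \<le> F * (Mh * 3 powr \<alpha> * (2 * real q) + B) * (V * 3 powr (nn + s)) * rr j powr \<sigma>"
    if j: "j < N" for j
  proof -
    have r: "0 < rr j" "rr j \<le> 1" using rpos[OF j] small[OF j] by auto
    let ?Q = "cyl s (zz j) (3 * rr j)"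
    define c where "c = u (zz j)"
    have cB: "\<bar>c\<bar> \<le> B" unfolding c_def by (rule B[OF zt[OF j]])
    \<comment> \<open>For r \<le> 1 the temporal bound r^(-s) also covers the spatial directions, so
      both kinds of v are treated alike.\<close>
    have rs: "1 / rr j \<le> 1 / rr j powr s"
      using powr_small[OF r, of 1 s] s2 r by (intro divide_left_mono) auto
    have pdMb: "\<bar>pd v (M k) w\<bar> \<le> 1 / rr j powr s" if k: "k \<le> Suc j" for k w
    proof -
      have "\<And>l. l < k \<Longrightarrow> rr j \<le> rr l" using anti[of _ j] j k by auto
      then have "\<bar>pd (axis i 1, 0) (M k) w\<bar> \<le> 1 / rr j" "\<bar>pd (0, 1) (M k) w\<bar> \<le> 1 / rr j powr s" for i
        using pd_M_bounds[OF _ r(1), where k=k and w=w] j k by auto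
      then show ?thesis using v rs order_trans by blast
    qed
    have pdb: "\<bar>pd v (\<Theta> j) w\<bar> \<le> 2 * real q / rr j powr s" for w
    proof -
      have "\<bar>pd v (\<Psi> k) w\<bar> \<le> real q * (1 / rr j powr s)" if "k \<le> Suc j" for k
        by (rule order_trans[OF pd_\<Psi>_le mult_left_mono[OF pdMb[OF that]]]) (use j that in auto)
      from this[of j] this[of "Suc j"] show ?thesis unfolding pd\<Theta>[OF j] by simp
    qed
    have \<Theta>b: "\<bar>\<Theta> j w\<bar> \<le> 1" for w
      using \<Psi>(2,3)[of j w] \<Psi>(2,3)[of "Suc j" w] j by (auto simp: \<Theta>_def abs_le_iff)
    have off: "\<Theta> j w = 0" "pd v (\<Theta> j) w = 0" if w: "w \<notin> ?Q" for w
      using Msupp[OF j w] Mpd[OF j w] j by (simp_all add: \<Theta>_def pd\<Theta>[OF j] pd_\<Psi>, simp_all add: \<Psi>_def)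
    have k1: "\<bar>(u w - c) * (\<phi> w * pd v (\<Theta> j) w)\<bar> \<le> (Mh * (3 * rr j) powr \<alpha> * (F * (2 * real q / rr j powr s))) * indicator ?Q w" for w
    proof (cases "w \<in> ?Q \<and> \<phi> w \<noteq> 0")
      case True
      then have wD: "w \<in> D" using outside_tsupp[of w \<phi>] tD by blast
      have "\<bar>u w - c\<bar> \<le> Mh * (3 * rr j) powr \<alpha>" unfolding c_def
        by (rule holder[OF zE[OF j] wD]) (use True r in auto)
      moreover have "\<bar>\<phi> w * pd v (\<Theta> j) w\<bar> \<le> F * (2 * real q / rr j powr s)"
        unfolding abs_mult using F(1) pdb F0 by (intro mult_mono) auto
      ultimately have "\<bar>u w - c\<bar> * \<bar>\<phi> w * pd v (\<Theta> j) w\<bar> \<le> (Mh * (3 * rr j) powr \<alpha>) * (F * (2 * real q / rr j powr s))"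
        using Mh by (intro mult_mono) auto
      then show ?thesis using True unfolding abs_mult[of "u w - c"] by simp
    next
      case False
      then have z: "\<phi> w * pd v (\<Theta> j) w = 0" using off(2)[of w] by auto
      show ?thesis unfolding z using Mh F0 by (simp add: indicator_def)
    qed
    have k2: "\<bar>pd v \<phi> w * \<Theta> j w\<bar> \<le> F * indicator ?Q w" for w
      using mult_mono[OF F(2)[of w] \<Theta>b[of w] F0] off(1)[of w] by (cases "w \<in> ?Q") (simp_all add: abs_mult)
    note I1 = integrable_bounded_compact[OF lmeasurable_cyl borel_measurable_times[OF um' borel_measurable_times[OF C1_measurable[OF \<phi>(1)] pdm[OF \<Theta>C[OF j]]]] k1]
    note I2 = integrable_bounded_compact[OF lmeasurable_cyl borel_measurable_times[OF pdm[OF \<phi>(1)] C1_measurable[OF \<Theta>C[OF j]]] k2]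
    have PC: "C1 (\<lambda>w. \<phi> w * \<Theta> j w)" by (intro Ck_mult \<phi>(1) \<Theta>C j)
    have Pout: "w \<notin> tsupp \<phi> \<Longrightarrow> \<phi> w * \<Theta> j w = 0" for w by (simp add: outside_tsupp)
    note I0 = integral_pd_tsupp_eq_0[OF PC \<phi>(2) Pout, where v=v]
    have e: "u w * (\<phi> w * pd v (\<Theta> j) w) = (u w - c) * (\<phi> w * pd v (\<Theta> j) w) + (c * pd v (\<lambda>w. \<phi> w * \<Theta> j w) w - c * (pd v \<phi> w * \<Theta> j w))" for w
      unfolding pd_mult[OF \<phi>(1) \<Theta>C[OF j]] by (simp add: algebra_simps)
    have i0: "integrable lebesgue (\<lambda>w. c * pd v (\<lambda>w. \<phi> w * \<Theta> j w) w)" "integrable lebesgue (\<lambda>w. c * (pd v \<phi> w * \<Theta> j w))"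
      using I0(1) I2(1) by simp_all
    have i3: "integrable lebesgue (\<lambda>w. u w * (\<phi> w * pd v (\<Theta> j) w))"
      unfolding e by (intro Bochner_Integration.integrable_add Bochner_Integration.integrable_diff I1(1) i0)
    have ie: "(LINT w|lebesgue. u w * (\<phi> w * pd v (\<Theta> j) w)) = (LINT w|lebesgue. (u w - c) * (\<phi> w * pd v (\<Theta> j) w)) - c * (LINT w|lebesgue. pd v \<phi> w * \<Theta> j w)"
      unfolding e Bochner_Integration.integral_add[OF I1(1) Bochner_Integration.integrable_diff[OF i0]]
        Bochner_Integration.integral_diff[OF i0] integral_mult_right_zero using I0(2) by simp
    have cb: "\<bar>c * (LINT w|lebesgue. pd v \<phi> w * \<Theta> j w)\<bar> \<le> B * (F * measure lebesgue ?Q)"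
      unfolding abs_mult using cB I2(2) order_trans[OF abs_ge_zero cB] by (intro mult_mono) auto
    have bnd: "\<bar>LINT w|lebesgue. u w * (\<phi> w * pd v (\<Theta> j) w)\<bar> \<le> (Mh * (3 * rr j) powr \<alpha> * (F * (2 * real q / rr j powr s))) * measure lebesgue ?Q + B * (F * measure lebesgue ?Q)"
      unfolding ie by (rule order_trans[OF abs_triangle_ineq4 add_mono[OF I1(2) cb]])
    have alg: "(Mh * (t * x) * (F * (Q / y))) * (V * (k * z)) + B * (F * (V * (k * z)))
      = F * (Mh * t * Q) * (V * k) * (x * inverse y * z) + F * B * (V * k) * z" for t x y z Q k :: real
      by (simp add: divide_inverse algebra_simps)
    note bnd
    also have "(Mh * (3 * rr j) powr \<alpha> * (F * (2 * real q / rr j powr s))) * measure lebesgue ?Q + B * (F * measure lebesgue ?Q) = F * (Mh * 3 powr \<alpha> * (2 * real q)) * (V * 3 powr (nn + s)) * (rr j powr \<alpha> * rr j powr (- s) * rr j powr (nn + s))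
        + F * B * (V * 3 powr (nn + s)) * rr j powr (nn + s)"
      unfolding measure_cyl3[of 3 "rr j", OF zero_less_numeral r(1)] powr_minus[of "rr j" s] powr_mult
      by (rule alg)
    also have "rr j powr \<alpha> * rr j powr (- s) * rr j powr (nn + s) = rr j powr \<sigma>"
      using r by (simp add: powr_add[symmetric] algebra_simps)
    also have "F * B * (V * 3 powr (nn + s)) * rr j powr (nn + s) \<le> F * B * (V * 3 powr (nn + s)) * rr j powr \<sigma>"
      using powr_small[OF r, of \<sigma> "nn + s"] s2 \<alpha> F0 V0 order_trans[OF abs_ge_zero cB] by (intro mult_left_mono) auto
    finally have "\<bar>LINT w|lebesgue. u w * (\<phi> w * pd v (\<Theta> j) w)\<bar> \<le> F * (Mh * 3 powr \<alpha> * (2 * real q) + B) * (V * 3 powr (nn + s)) * rr j powr \<sigma>"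
      unfolding distrib_left distrib_right by linarith
    then show ?thesis using i3 by blast
  qed
  have "(LINT w|lebesgue. u w * (\<phi> w * pd v (\<Psi> N) w)) = (LINT w|lebesgue. - (\<Sum>j<N. u w * (\<phi> w * pd v (\<Theta> j) w)))"
    by (simp add: tele sum_distrib_left)
  also have "\<dots> = - (\<Sum>j<N. LINT w|lebesgue. u w * (\<phi> w * pd v (\<Theta> j) w))"
    using each by (simp add: Bochner_Integration.integral_sum)
  finally have eq: "(LINT w|lebesgue. u w * (\<phi> w * pd v (\<Psi> N) w)) = - (\<Sum>j<N. LINT w|lebesgue. u w * (\<phi> w * pd v (\<Theta> j) w))" .
  show ?thesis
    unfolding eq abs_minus_cancel sum_distrib_left by (rule order_trans[OF sum_abs sum_mono]) (use each in auto)
qed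

text \<open>Young's inequality with weight rr^(-\<alpha>) splits norm g powr (p - 1) / rr into the
  weighted energy, of size rr^\<sigma> by decay, and a remainder whose integral has the same size.
  As \<eta> = 1 wherever \<phi> is nonzero, \<open>X j\<close> controls the energy there.\<close>

lemma cutoff_error_a:
  assumes \<phi>: "C1 \<phi>" "compact (tsupp \<phi>)" and F: "\<And>w. \<bar>\<phi> w\<bar> \<le> F" and one: "\<And>w. \<phi> w \<noteq> 0 \<Longrightarrow> \<eta> w = 1"
    and dec: "\<And>j. j < N \<Longrightarrow> X j \<le> \<Lambda>0 * rr j powr (\<sigma> + \<alpha>)"
  shows "\<bar>LINT w|lebesgue. \<phi> w * (a w \<bullet> xgrad (\<Psi> N) w)\<bar>
    \<le> F * (\<Lambda>0 + (2 * L * nn * real q) powr p * (V * 3 powr (nn + s))) * (\<Sum>j<N. rr j powr \<sigma>)"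
proof -
  have F0: "F \<ge> 0" using F(1)[of undefined] by (rule order_trans[OF abs_ge_zero])
  let ?Q = "\<lambda>j. cyl s (zz j) (3 * rr j)"
  define P where "P w = norm (g w) powr p * (\<eta> w * \<psi> w) ^ q" for w
  define Bj where "Bj j = 2 * L * nn * real q / rr j" for j
  define \<tau> where "\<tau> j = rr j powr (- \<alpha>)" for j
  define Kj where "Kj j = \<tau> j powr (1 - p) * Bj j powr p" for j
  have Bj0: "j < N \<Longrightarrow> Bj j \<ge> 0" for j using L nn0 rpos[of j] by (simp add: Bj_def)
  have \<tau>0: "j < N \<Longrightarrow> \<tau> j > 0" for j using rpos[of j] by (simp add: \<tau>_def)
  have Mb: "\<bar>pd (axis i 1, 0) (M N) w\<bar> \<le> (\<Sum>j<N. indicator (?Q j) w * (2 / rr j))" for i w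
  \<comment> \<open>Telescoping from b = 0 leaves no large cylinders, and sending the scale R = 1/e
    to infinity removes the term 1/R.\<close>
  proof (rule field_le_epsilon)
    fix e :: real assume e: "e > 0"
    have "\<bar>pd (axis i 1, 0) (M N) w\<bar> \<le> 1 / (1 / e) + (\<Sum>j\<in>{0..<N}. indicator (?Q j) w * (2 / rr j))"
      by (rule pd_M_telescope) (use e in auto)
    then show "\<bar>pd (axis i 1, 0) (M N) w\<bar> \<le> (\<Sum>j<N. indicator (?Q j) w * (2 / rr j)) + e"
      by (simp add: lessThan_atLeast0)
  qed
  have Pi: "integrable lebesgue (\<lambda>w. indicator (?Q j) w * P w)" for j unfolding P_def by (rule X_integrable(2))
  have Qi: "integrable lebesgue (indicator (?Q j) :: _ \<Rightarrow> real)" for j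
    using lmeasurable_cyl lmeasurable_iff_integrable by blast
  have pw: "AE w in lebesgue. \<bar>\<phi> w * (a w \<bullet> xgrad (\<Psi> N) w)\<bar> \<le> F * (\<Sum>j<N. \<tau> j * (indicator (?Q j) w * P w) + Kj j * indicator (?Q j) w)"
    using growth
  proof eventually_elim
    case (elim w)
    have R0: "0 \<le> (\<Sum>j<N. \<tau> j * (indicator (?Q j) w * P w) + Kj j * indicator (?Q j) w)"
      using less_imp_le[OF \<tau>0] \<eta>(2)[of w] \<psi>(2)[of w]
      by (intro sum_nonneg add_nonneg_nonneg mult_nonneg_nonneg) (auto simp: Kj_def P_def)
    show ?case
    proof (cases "\<phi> w = 0")
      case True
      then show ?thesis using F0 R0 by simp
    next
      case False
      then have \<eta>1: "\<eta> w = 1" by (rule one)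
      have \<psi>q: "0 \<le> \<psi> w ^ (q - 1)" using \<psi>(2) by simp
      have "norm (xgrad (\<Psi> N) w) \<le> (\<Sum>i\<in>UNIV. \<bar>pd (axis i 1, 0) (\<Psi> N) w\<bar>)" by (rule norm_xgrad_le)
      also have "\<dots> \<le> (\<Sum>i\<in>(UNIV::'n set). real q * \<psi> w ^ (q - 1) * (\<Sum>j<N. indicator (?Q j) w * (2 / rr j)))"
      proof (rule sum_mono)
        fix i :: 'n
        have "\<bar>pd (axis i 1, 0) (\<Psi> N) w\<bar> = real q * \<psi> w ^ (q - 1) * \<bar>pd (axis i 1, 0) (M N) w\<bar>"
          using \<psi>q by (simp add: pd_\<Psi> \<psi>_def abs_mult)
        also have "\<dots> \<le> real q * \<psi> w ^ (q - 1) * (\<Sum>j<N. indicator (?Q j) w * (2 / rr j))"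
          using \<psi>q by (intro mult_left_mono Mb) auto
        finally show "\<bar>pd (axis i 1, 0) (\<Psi> N) w\<bar> \<le> real q * \<psi> w ^ (q - 1) * (\<Sum>j<N. indicator (?Q j) w * (2 / rr j))" .
      qed
      also have "\<dots> = nn * (real q * \<psi> w ^ (q - 1) * (\<Sum>j<N. indicator (?Q j) w * (2 / rr j)))" by (simp add: nn)
      finally have xg: "norm (xgrad (\<Psi> N) w) \<le> nn * (real q * \<psi> w ^ (q - 1) * (\<Sum>j<N. indicator (?Q j) w * (2 / rr j)))" .
      have "\<bar>a w \<bullet> xgrad (\<Psi> N) w\<bar> \<le> norm (a w) * norm (xgrad (\<Psi> N) w)" by (rule Cauchy_Schwarz_ineq2)
      also have "\<dots> \<le> (L * norm (g w) powr (p - 1)) * (nn * (real q * \<psi> w ^ (q - 1) * (\<Sum>j<N. indicator (?Q j) w * (2 / rr j))))"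
        using elim xg L by (intro mult_mono) auto
      also have "\<dots> = (\<Sum>j<N. indicator (?Q j) w * (norm (g w) powr (p - 1) * \<psi> w ^ (q - 1) * Bj j))"
        unfolding Bj_def by (simp add: sum_distrib_left mult_ac)
      also have "\<dots> \<le> (\<Sum>j<N. \<tau> j * (indicator (?Q j) w * P w) + Kj j * indicator (?Q j) w)"
      proof (rule sum_mono)
        fix j assume "j \<in> {..<N}"
        then have j: "j < N" by simp
        have "norm (g w) powr (p - 1) * \<psi> w ^ (q - 1) * Bj j \<le> \<tau> j * (norm (g w) powr p * \<psi> w ^ q) + Kj j"
          unfolding Kj_def by (rule weighted_young[OF norm_ge_zero \<psi>(2,3) Bj0[OF j] q(1) _ \<tau>0[OF j]]) (use p in auto)
        then show "indicator (?Q j) w * (norm (g w) powr (p - 1) * \<psi> w ^ (q - 1) * Bj j) \<le> \<tau> j * (indicator (?Q j) w * P w) + Kj j * indicator (?Q j) w"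
          by (simp add: indicator_def P_def \<eta>1)
      qed
      finally have "\<bar>a w \<bullet> xgrad (\<Psi> N) w\<bar> \<le> (\<Sum>j<N. \<tau> j * (indicator (?Q j) w * P w) + Kj j * indicator (?Q j) w)" .
      from mult_mono[OF F[of w] this F0] show ?thesis by (simp add: abs_mult)
    qed
  qed
  have 3: "integrable lebesgue (\<lambda>w. \<tau> j * (indicator (?Q j) w * P w) + Kj j * indicator (?Q j) w)" for j
    using Pi Qi by (intro Bochner_Integration.integrable_add integrable_mult_right)
  have 4: "integrable lebesgue (\<lambda>w. \<tau> j * (indicator (?Q j) w * P w))" "integrable lebesgue (\<lambda>w. Kj j * (indicator (?Q j) w :: real))" for j
    by (rule integrable_mult_right, rule Pi, rule integrable_mult_right, rule Qi)
  have Ri: "integrable lebesgue (\<lambda>w. F * (\<Sum>j<N. \<tau> j * (indicator (?Q j) w * P w) + Kj j * indicator (?Q j) w))"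
    using 3 by (intro integrable_mult_right Bochner_Integration.integrable_sum)
  have m: "(\<lambda>w. \<phi> w * (a w \<bullet> xgrad (\<Psi> N) w)) \<in> borel_measurable lebesgue"
  proof -
    note [measurable] = C1_measurable[OF \<phi>(1)] am xgrad_measurable[OF \<Psi>(1)[OF order_refl]]
    show ?thesis by measurable
  qed
  have "\<bar>LINT w|lebesgue. \<phi> w * (a w \<bullet> xgrad (\<Psi> N) w)\<bar> \<le> (LINT w|lebesgue. \<bar>\<phi> w * (a w \<bullet> xgrad (\<Psi> N) w)\<bar>)"
    by (rule integral_abs_bound)
  also have "\<dots> \<le> (LINT w|lebesgue. F * (\<Sum>j<N. \<tau> j * (indicator (?Q j) w * P w) + Kj j * indicator (?Q j) w))"
  proof (rule integral_mono_AE[OF _ Ri pw])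
    show "integrable lebesgue (\<lambda>w. \<bar>\<phi> w * (a w \<bullet> xgrad (\<Psi> N) w)\<bar>)"
    proof (rule Bochner_Integration.integrable_bound[OF Ri])
      show "(\<lambda>w. \<bar>\<phi> w * (a w \<bullet> xgrad (\<Psi> N) w)\<bar>) \<in> borel_measurable lebesgue" using m by measurable
      show "AE w in lebesgue. norm \<bar>\<phi> w * (a w \<bullet> xgrad (\<Psi> N) w)\<bar> \<le> norm (F * (\<Sum>j<N. \<tau> j * (indicator (?Q j) w * P w) + Kj j * indicator (?Q j) w))"
        using pw by eventually_elim (simp add: order_trans[OF _ abs_ge_self])
    qed
  qed
  also have "\<dots> = F * (\<Sum>j<N. \<tau> j * X j + Kj j * measure lebesgue (?Q j))"
    unfolding integral_mult_right_zero Bochner_Integration.integral_sum[OF 3] Bochner_Integration.integral_add[OF 4]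
    using fmeasurableD[OF lmeasurable_cyl] by (simp add: X_def P_def)
  also have "\<dots> \<le> F * (\<Sum>j<N. (\<Lambda>0 + (2 * L * nn * real q) powr p * (V * 3 powr (nn + s))) * rr j powr \<sigma>)"
  proof (rule mult_left_mono[OF sum_mono F0])
    fix j assume "j \<in> {..<N}"
    then have j: "j < N" by simp
    have rj: "0 < rr j" by (rule rpos[OF j])
    have "\<tau> j powr (1 - p) = rr j powr (- \<alpha> * (1 - p))" by (simp add: \<tau>_def powr_powr)
    moreover have "Bj j powr p = (2 * L * nn * real q) powr p * rr j powr (- p)"
    proof -
      have "Bj j powr p = (2 * L * nn * real q) powr p / rr j powr p" unfolding Bj_def by (rule powr_divide)
      then show ?thesis by (simp only: powr_minus divide_inverse)
    qed
    moreover have "measure lebesgue (?Q j) = V * 3 powr (nn + s) * rr j powr (nn + s)"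
      unfolding measure_cyl3[of 3 "rr j", OF zero_less_numeral rj] by (simp add: powr_mult)
    moreover have "rr j powr (- \<alpha> * (1 - p)) * rr j powr (- p) * rr j powr (nn + s) = rr j powr \<sigma>"
      using rj by (simp add: powr_add[symmetric] algebra_simps)
    ultimately have "Kj j * measure lebesgue (?Q j) = (2 * L * nn * real q) powr p * (V * 3 powr (nn + s)) * rr j powr \<sigma>"
      unfolding Kj_def by (simp add: mult_ac)
    then show "\<tau> j * X j + Kj j * measure lebesgue (?Q j) \<le> (\<Lambda>0 + (2 * L * nn * real q) powr p * (V * 3 powr (nn + s))) * rr j powr \<sigma>"
      using rescaled_decay[OF dec[OF j] j] by (simp add: \<tau>_def algebra_simps)
  qed
  finally show ?thesis unfolding sum_distrib_left[symmetric] mult.assoc .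
qed

end

section \<open>One cutoff for each cost\<close>

context removable begin

text \<open>Everything the limit needs from one cover of cost at most \<epsilon>. Neither
  \<open>C\<close> nor \<open>C'\<close> depends on \<epsilon>: energies stay bounded while the
  errors in the weak identities are of order \<epsilon>. The last conjunct will show that E is null
  in the support of \<eta>.\<close>

lemma cutoff_along_cover:
  assumes \<phi>: "C1 \<phi>" "compact (tsupp \<phi>)"
    and \<eta>: "C1 \<eta>" "\<And>w. 0 \<le> \<eta> w" "\<And>w. \<eta> w \<le> 1" "compact (tsupp \<eta>)" "tsupp \<eta> \<subseteq> D"
    and one: "\<And>w. w \<in> tsupp \<phi> \<Longrightarrow> \<eta> w = 1"
    and C\<eta>: "C\<eta> \<ge> 0" "\<And>i w. \<bar>pd (axis i 1, 0) \<eta> w\<bar> \<le> C\<eta>" "\<And>w. \<bar>pd (0, 1) \<eta> w\<bar> \<le> C\<eta>"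
    and B: "\<And>w. w \<in> tsupp \<eta> \<Longrightarrow> \<bar>u w\<bar> \<le> B" "B \<ge> 0"
    and F: "\<And>w. \<bar>\<phi> w\<bar> \<le> F" "\<And>i w. \<bar>pd (axis i 1, 0) \<phi> w\<bar> \<le> F" "\<And>w. \<bar>pd (0, 1) \<phi> w\<bar> \<le> F"
    and \<epsilon>: "0 < \<epsilon>" "\<epsilon> \<le> 1" "C\<eta> * \<epsilon> powr (1 / \<sigma>) \<le> 1"
  defines "C \<equiv> 2 / \<nu> * (A1 C\<eta> * (max B (Mh * 3 powr \<alpha>) powr p + (max B (Mh * 3 powr \<alpha>))\<^sup>2) * measure lebesgue (tsupp \<eta>)
      + max B (Mh * 3 powr \<alpha>) * (\<Lambda>0 + A2 C\<eta> 1))"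
    and "C' \<equiv> F * (Mh * 3 powr \<alpha> * (2 * real q) + B) * (V * 3 powr (nn + s))
       + F * (\<Lambda>0 + (2 * L * nn * real q) powr p * (V * 3 powr (nn + s)))"
  shows "\<exists>\<psi>. C1 \<psi> \<and> (\<forall>w. 0 \<le> \<psi> w \<and> \<psi> w \<le> 1)
    \<and> integrable lebesgue (\<lambda>w. norm (g w) powr p * (\<eta> w * \<psi> w) ^ q)
    \<and> (LINT w|lebesgue. norm (g w) powr p * (\<eta> w * \<psi> w) ^ q) \<le> C
    \<and> (\<forall>w. (\<forall>z\<in>E \<inter> tsupp \<eta>. w \<notin> cyl s z (3 * \<epsilon> powr (1 / \<sigma>))) \<longrightarrow> \<psi> w = 1)
    \<and> \<bar>LINT w|lebesgue. (- u w * tpart \<phi> w + a w \<bullet> xgrad \<phi> w) * \<psi> w ^ q\<bar> \<le> C' * \<epsilon>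
    \<and> (\<forall>i. \<bar>LINT w|lebesgue. (u w * xpart \<phi> i w + g w $ i * \<phi> w) * \<psi> w ^ q\<bar> \<le> C' * \<epsilon>)
    \<and> (\<exists>T\<in>lmeasurable. E \<inter> tsupp \<eta> \<subseteq> T \<and> measure lebesgue T \<le> V * \<epsilon>)"
proof -
  have s1: "s \<ge> 1" using s2 by simp
  have \<sigma>0: "\<sigma> \<ge> 0" using \<sigma>_pos by simp
  have sub: "tsupp \<phi> \<subseteq> tsupp \<eta>"
  proof
    fix w assume "w \<in> tsupp \<phi>"
    then have "\<eta> w \<noteq> 0" using one by simp
    then show "w \<in> tsupp \<eta>" using outside_tsupp[of w \<eta>] by blast
  qed
  let ?K = "E \<inter> tsupp \<eta>"
  have Kc: "compact ?K"
  proof -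
    obtain C where C: "closed C" "E = D \<inter> C" using Ecl by (auto simp: closedin_closed)
    have "?K = tsupp \<eta> \<inter> C" using C(2) \<eta>(5) by blast
    then show ?thesis using compact_Int_closed[OF \<eta>(4) C(1)] by simp
  qed
  \<comment> \<open>Recentring the cover costs the factor 2^\<sigma>, which is divided out
    beforehand.\<close>
  have e': "\<epsilon> / 2 powr \<sigma> > 0" using \<epsilon> by simp
  obtain r0 z0 where rz: "\<And>i::nat. 0 < r0 i" "E \<subseteq> (\<Union>i. cyl s (z0 i) (r0 i))"
    "(\<Sum>i. ennreal (r0 i powr \<sigma>)) < ennreal (\<epsilon> / 2 powr \<sigma>)"
    using cover[OF e'] unfolding nn[symmetric] by blast
  have "?K \<subseteq> (\<Union>i. cyl s (z0 i) (r0 i))" using rz(2) by blast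
  from admissible_cover_exists[OF Kc s1 \<sigma>0 rz(1) this rz(3)]
  have ex: "\<exists>C. admissible_cover s \<sigma> ?K \<epsilon> C" by simp
  show ?thesis
  proof (rule packed_cover[OF ex s1 \<sigma>0])
  fix N and zz :: "nat \<Rightarrow> (real^'n) \<times> real" and rr :: "nat \<Rightarrow> real"
  assume zz: "\<And>j. j < N \<Longrightarrow> zz j \<in> ?K" and rr: "\<And>j. j < N \<Longrightarrow> 0 < rr j"
    and anti: "\<And>i j. i \<le> j \<Longrightarrow> j < N \<Longrightarrow> rr j \<le> rr i"
    and cov: "?K \<subseteq> (\<Union>j<N. cyl s (zz j) (rr j))" and cost: "(\<Sum>j<N. rr j powr \<sigma>) \<le> \<epsilon>"
    and pack: "\<And>i. i < N \<Longrightarrow> (\<Sum>j | j < N \<and> rr j \<le> rr i \<and> cyl s (zz j) (3 * rr j) \<inter> cyl s (zz i) (9 * rr i) \<noteq> {}. rr j powr \<sigma>)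
       \<le> (13 * rr i) powr \<sigma>"
  show ?thesis
  proof (rule cutoff_family[OF rr anti s1])
  fix M :: "nat \<Rightarrow> (real^'n) \<times> real \<Rightarrow> real"
  assume MC: "\<And>k. k \<le> N \<Longrightarrow> C1 (M k)" and M0: "\<And>k w. k \<le> N \<Longrightarrow> 0 \<le> M k w" and M1: "\<And>k w. k \<le> N \<Longrightarrow> M k w \<le> 1"
    and Mz: "\<And>w. M 0 w = 0"
    and Msupp: "\<And>k w. k < N \<Longrightarrow> w \<notin> cyl s (zz k) (3 * rr k) \<Longrightarrow> M (Suc k) w = M k w"
    and Mpd: "\<And>k w v. k < N \<Longrightarrow> w \<notin> cyl s (zz k) (3 * rr k) \<Longrightarrow> pd v (M (Suc k)) w = pd v (M k) w"
    and Mx: "\<And>k w i. k < N \<Longrightarrow> \<bar>pd (axis i 1, 0) (M (Suc k)) w\<bar> \<le> 1 / rr k"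
    and Mt: "\<And>k w. k < N \<Longrightarrow> \<bar>pd (0, 1) (M (Suc k)) w\<bar> \<le> 1 / rr k powr s"
    and Mone: "\<And>j k w. j < k \<Longrightarrow> k \<le> N \<Longrightarrow> w \<in> cyl s (zz j) (rr j) \<Longrightarrow> M k w = 1"
  interpret cc: cutoff_config p \<alpha> \<nu> L Mh nn D E u g a \<eta> N zz rr M
    by unfold_locales (fact | use zz in blast)+
  \<comment> \<open>A single term of the cost bounds its radius by \<epsilon>^(1/\<sigma>), so a
    cheap cover automatically has small members.\<close>
  have rsmall: "rr j \<le> \<epsilon> powr (1 / \<sigma>)" if j: "j < N" for j
  proof -
    have "rr j powr \<sigma> \<le> (\<Sum>j<N. rr j powr \<sigma>)" using j by (intro member_le_sum) auto
    then have "rr j powr \<sigma> \<le> \<epsilon>" using cost by linarith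
    then have "(rr j powr \<sigma>) powr (1 / \<sigma>) \<le> \<epsilon> powr (1 / \<sigma>)" using \<sigma>_pos by (intro powr_mono2) auto
    then show ?thesis using rr[OF j] \<sigma>_pos by (simp add: powr_powr)
  qed
  have e1: "\<epsilon> powr (1 / \<sigma>) \<le> 1" using \<epsilon> \<sigma>_pos by (intro powr_le1) auto
  have r1: "rr j \<le> 1" if "j < N" for j using rsmall[OF that] e1 by linarith
  have small: "rr j \<le> 1 \<and> C\<eta> * rr j \<le> 1" if "j < N" for j
    using r1[OF that] mult_left_mono[OF rsmall[OF that] C\<eta>(1)] \<epsilon>(3) by simp
  have dec: "cc.X j \<le> \<Lambda>0 * rr j powr (\<sigma> + \<alpha>)" if "j < N" for j
    by (rule cc.energy_decay[OF C\<eta> small pack that])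
  have cost1: "(\<Sum>j<N. rr j powr \<sigma>) \<le> 1" using cost \<epsilon> by linarith
  have en: "(LINT w|lebesgue. norm (g w) powr p * (\<eta> w * cc.\<psi> w) ^ q) \<le> C"
    using cc.global_energy[OF C\<eta> r1 dec B(1) cost1] \<nu> unfolding C_def by (simp add: field_simps)
  have far: "cc.\<psi> w = 1" if w: "\<forall>z\<in>?K. w \<notin> cyl s z (3 * \<epsilon> powr (1 / \<sigma>))" for w
  proof -
    have "k \<le> N \<Longrightarrow> M k w = 0" for k
    proof (induction k)
      case (Suc k)
      then have k: "k < N" by simp
      have "cyl s (zz k) (3 * rr k) \<subseteq> cyl s (zz k) (3 * \<epsilon> powr (1 / \<sigma>))"
        using rsmall[OF k] rr[OF k] s1 by (intro cyl_mono) auto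
      then have "w \<notin> cyl s (zz k) (3 * rr k)" using w zz[OF k] by blast
      then show ?case using Msupp[OF k] Suc by simp
    qed (rule Mz)
    then show ?thesis by (simp add: cc.\<psi>_def)
  qed
  define T where "T = (\<Union>j<N. cyl s (zz j) (1 * rr j))"
  have T: "T \<in> lmeasurable" unfolding T_def by (intro fmeasurable.finite_UN lmeasurable_cyl) auto
  have "measure lebesgue T \<le> (\<Sum>j<N. measure lebesgue (cyl s (zz j) (1 * rr j)))"
    unfolding T_def by (rule measure_UNION_le) (auto intro: lmeasurable_cyl fmeasurableD)
  also have "\<dots> \<le> (\<Sum>j<N. V * rr j powr \<sigma>)"
  proof (rule sum_mono)
    fix j assume "j \<in> {..<N}"
    then have j: "j < N" by simp
    have "rr j powr (nn + s) \<le> rr j powr \<sigma>" using rr[OF j] r1[OF j] s1 \<alpha> by (intro powr_mono') auto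
    then show "measure lebesgue (cyl s (zz j) (1 * rr j)) \<le> V * rr j powr \<sigma>"
      unfolding measure_cyl3[of 1 "rr j", OF zero_less_one rr[OF j]] using V0 by (simp add: mult_left_mono)
  qed
  also have "\<dots> \<le> V * \<epsilon>" unfolding sum_distrib_left[symmetric] using cost V0 by (rule mult_left_mono)
  finally have mT: "measure lebesgue T \<le> V * \<epsilon>" .
  have KT: "?K \<subseteq> T" using cov by (simp add: T_def)
  define \<zeta> where "\<zeta> w = \<phi> w * cc.\<Psi> N w" for w
  have \<Psi>C: "C1 (cc.\<Psi> N)" by (rule cc.\<Psi>(1)[OF order_refl])
  have \<zeta>C: "C1 \<zeta>" unfolding \<zeta>_def[abs_def] by (intro Ck_mult \<phi>(1) \<Psi>C)
  have \<Psi>z: "cc.\<Psi> N w = 0" if "w \<notin> cc.KK" "w \<in> tsupp \<phi>" for w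
    using cc.etapsi_outside[OF that(1)] one[OF that(2)] q(2) by (simp add: cc.\<Psi>N zero_power)
  have \<zeta>out: "\<zeta> w = 0" if "w \<notin> cc.KK" for w
    using \<Psi>z[OF that] outside_tsupp[of w \<phi>] by (cases "w \<in> tsupp \<phi>") (simp_all add: \<zeta>_def)
  note \<zeta> = \<zeta>C cc.tsupp_KK[OF \<zeta>out]
  note i\<zeta> = energy_terms_integrable[OF \<zeta>]
  have pd\<zeta>: "pd v \<zeta> w = \<phi> w * pd v (cc.\<Psi> N) w + pd v \<phi> w * cc.\<Psi> N w" for v w
    unfolding \<zeta>_def[abs_def] by (rule pd_mult[OF \<phi>(1) \<Psi>C])
  have iu: "integrable lebesgue (\<lambda>w. u w * (\<phi> w * pd v (cc.\<Psi> N) w))" for v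
  proof -
    have c: "continuous_on UNIV (\<lambda>w. \<phi> w * pd v (cc.\<Psi> N) w)"
      by (intro continuous_on_mult C1_continuous \<phi>(1) C1_pd_continuous \<Psi>C)
    have o: "w \<notin> tsupp \<phi> \<Longrightarrow> \<phi> w * pd v (cc.\<Psi> N) w = 0" for w by (simp add: outside_tsupp)
    obtain Z where Z: "Z > 0" "\<And>w. \<bar>\<phi> w * pd v (cc.\<Psi> N) w\<bar> \<le> Z"
      using bounded_compact_support[OF c \<phi>(2) o] by blast
    show ?thesis
    proof (rule integrable_bounded_compact(1)[OF lmeasurable_compact[OF \<phi>(2)]])
      show "(\<lambda>w. u w * (\<phi> w * pd v (cc.\<Psi> N) w)) \<in> borel_measurable lebesgue"
        by (rule borel_measurable_times[OF um continuous_measurable_lebesgue[OF c]])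
      show "\<bar>u w * (\<phi> w * pd v (cc.\<Psi> N) w)\<bar> \<le> (B * Z) * indicator (tsupp \<phi>) w" for w
      proof (cases "w \<in> tsupp \<phi>")
        case True
        then have "\<bar>u w\<bar> \<le> B" by (rule B(1)[OF subsetD[OF sub]])
        from mult_mono[OF this Z(2) B(2)] show ?thesis using True by (simp add: abs_mult)
      qed (simp add: o)
    qed
  qed
  have F0: "F \<ge> 0" using F(1)[of undefined] by (rule order_trans[OF abs_ge_zero])
  have zt: "zz j \<in> tsupp \<eta>" if "j < N" for j using zz[OF that] by blast
  have Cs: "0 \<le> F * (Mh * 3 powr \<alpha> * (2 * real q) + B) * (V * 3 powr (nn + s))"
    "0 \<le> F * (\<Lambda>0 + (2 * L * nn * real q) powr p * (V * 3 powr (nn + s)))"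
    using F0 Mh B(2) V0 \<Lambda>0_nonneg by simp_all
  have eu: "\<bar>LINT w|lebesgue. u w * (\<phi> w * pd v (cc.\<Psi> N) w)\<bar> \<le> F * (Mh * 3 powr \<alpha> * (2 * real q) + B) * (V * 3 powr (nn + s)) * \<epsilon>"
    if "\<And>w. \<bar>pd v \<phi> w\<bar> \<le> F" "v = (0, 1) \<or> (\<exists>i. v = (axis i 1, 0))" for v
    by (rule order_trans[OF cc.cutoff_error_u[OF \<phi> sub F(1) that r1 B(1) zt] mult_left_mono[OF cost Cs(1)]])
  have ea: "\<bar>LINT w|lebesgue. \<phi> w * (a w \<bullet> xgrad (cc.\<Psi> N) w)\<bar> \<le> F * (\<Lambda>0 + (2 * L * nn * real q) powr p * (V * 3 powr (nn + s))) * \<epsilon>"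
  proof (rule order_trans[OF cc.cutoff_error_a[OF \<phi> F(1) _ dec] mult_left_mono[OF cost Cs(2)]])
    show "\<eta> w = 1" if "\<phi> w \<noteq> 0" for w using one[of w] outside_tsupp[of w \<phi>] that by blast
  qed
  have err1: "\<bar>LINT w|lebesgue. (- u w * tpart \<phi> w + a w \<bullet> xgrad \<phi> w) * cc.\<psi> w ^ q\<bar> \<le> C' * \<epsilon>"
  proof -
    let ?L = "\<lambda>w. (- u w * tpart \<phi> w + a w \<bullet> xgrad \<phi> w) * cc.\<Psi> N w"
    let ?Z = "\<lambda>w. - u w * tpart \<zeta> w + a w \<bullet> xgrad \<zeta> w"
    let ?U = "\<lambda>w. u w * (\<phi> w * pd (0, 1) (cc.\<Psi> N) w)"
    let ?A = "\<lambda>w. \<phi> w * (a w \<bullet> xgrad (cc.\<Psi> N) w)"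
    \<comment> \<open>Product rule for \<phi> \<open>\<Psi> N\<close>: the term with \<zeta>
      integrates to 0 by the weak identity off E, and the other two are the errors estimated
      before.\<close>
    have id: "?L w = ?Z w + ?U w - ?A w" for w
    proof -
      have "xgrad \<zeta> w = \<phi> w *\<^sub>R xgrad (cc.\<Psi> N) w + cc.\<Psi> N w *\<^sub>R xgrad \<phi> w"
        by (simp add: vec_eq_iff xgrad_def xpart_def pd\<zeta> mult.commute)
      moreover have "tpart \<zeta> w = \<phi> w * pd (0, 1) (cc.\<Psi> N) w + tpart \<phi> w * cc.\<Psi> N w" by (simp add: tpart_def pd\<zeta>)
      ultimately show ?thesis by (simp add: inner_add_right algebra_simps)
    qed
    have iZ: "integrable lebesgue ?Z" using i\<zeta>(4,5) by simp
    have iL: "integrable lebesgue ?L"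
    proof -
      obtain Z where Z: "Z \<ge> 0" "\<And>w. norm (xgrad \<phi> w) \<le> Z" using xgrad_bounded[OF \<phi>] by blast
      note [measurable] = um am tpart_measurable[OF \<phi>(1)] xgrad_measurable[OF \<phi>(1)] C1_measurable[OF \<Psi>C]
      have 1: "integrable lebesgue (\<lambda>w. - u w * tpart \<phi> w * cc.\<Psi> N w)"
      proof (rule integrable_bounded_compact(1)[OF lmeasurable_compact[OF \<phi>(2)]])
        show "(\<lambda>w. - u w * tpart \<phi> w * cc.\<Psi> N w) \<in> borel_measurable lebesgue" by measurable
        show "\<bar>- u w * tpart \<phi> w * cc.\<Psi> N w\<bar> \<le> (B * F) * indicator (tsupp \<phi>) w" for w
        proof (cases "w \<in> tsupp \<phi>")
          case True
          then have "\<bar>- u w\<bar> \<le> B" using B(1)[OF subsetD[OF sub]] by simp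
          from mult_mono[OF this F(3)[of w] B(2)] have "\<bar>- u w * tpart \<phi> w\<bar> \<le> B * F" by (simp add: abs_mult tpart_def)
          from mult_mono[OF this, of "\<bar>cc.\<Psi> N w\<bar>" 1] show ?thesis
            using True cc.\<Psi>(2,3)[OF order_refl, of w] B(2) F0 by (simp add: abs_mult)
        qed (simp add: tpart_outside_tsupp)
      qed
      have 2: "integrable lebesgue (\<lambda>w. (a w \<bullet> xgrad \<phi> w) * cc.\<Psi> N w)"
      proof (rule integrable_dom[OF cc.KK])
        show "(\<lambda>w. (a w \<bullet> xgrad \<phi> w) * cc.\<Psi> N w) \<in> borel_measurable lebesgue" by measurable
        show "AE w in lebesgue. \<bar>(a w \<bullet> xgrad \<phi> w) * cc.\<Psi> N w\<bar> \<le> (L * Z) * (indicator cc.KK w * (1 + norm (g w) powr p))"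
          using growth
        proof eventually_elim
          case (elim w)
          show ?case
          proof (cases "w \<in> cc.KK")
            case True
            have "\<bar>a w \<bullet> xgrad \<phi> w\<bar> \<le> (L * (1 + norm (g w) powr p)) * Z"
              by (rule order_trans[OF Cauchy_Schwarz_ineq2 mult_mono[OF a_bound(1)[OF elim] Z(2)]]) (use L in auto)
            from mult_mono[OF this, of "\<bar>cc.\<Psi> N w\<bar>" 1] show ?thesis
              using True cc.\<Psi>(2,3)[OF order_refl, of w] L Z(1) by (simp add: abs_mult mult_ac)
          next
            case False
            then show ?thesis using \<Psi>z[OF False] xgrad_outside_tsupp[of w \<phi>] by (cases "w \<in> tsupp \<phi>") simp_all
          qed
        qed
      qed
      show ?thesis unfolding distrib_right by (rule Bochner_Integration.integrable_add[OF 1 2])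
    qed
    \<comment> \<open>Integrability of \<open>?A\<close> is read off from the identity, whose other
      three terms are integrable.\<close>
    have "integrable lebesgue (\<lambda>w. ?Z w + ?U w - ?L w)"
      by (rule Bochner_Integration.integrable_diff[OF Bochner_Integration.integrable_add[OF iZ iu] iL])
    then have iA: "integrable lebesgue ?A" unfolding id by simp
    have "(LINT w|lebesgue. ?L w) = (LINT w|lebesgue. ?Z w) + (LINT w|lebesgue. ?U w) - (LINT w|lebesgue. ?A w)"
      unfolding id Bochner_Integration.integral_diff[OF Bochner_Integration.integrable_add[OF iZ iu] iA]
        Bochner_Integration.integral_add[OF iZ iu] ..
    then have "(LINT w|lebesgue. ?L w) = (LINT w|lebesgue. ?U w) - (LINT w|lebesgue. ?A w)"
      using weak_identity[OF \<zeta>] by linarith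
    moreover have "x = y - z \<Longrightarrow> \<bar>x\<bar> \<le> \<bar>y\<bar> + \<bar>z\<bar>" for x y z :: real by simp
    ultimately have eq: "\<bar>LINT w|lebesgue. ?L w\<bar> \<le> \<bar>LINT w|lebesgue. ?U w\<bar> + \<bar>LINT w|lebesgue. ?A w\<bar>"
      by blast
    have "\<bar>LINT w|lebesgue. ?U w\<bar> \<le> F * (Mh * 3 powr \<alpha> * (2 * real q) + B) * (V * 3 powr (nn + s)) * \<epsilon>"
      by (rule eu[OF F(3)]) simp
    from order_trans[OF eq add_mono[OF this ea]]
    show ?thesis unfolding C'_def distrib_right[of _ _ \<epsilon>] cc.\<Psi>N .
  qed
  have err2: "\<bar>LINT w|lebesgue. (u w * xpart \<phi> i w + g w $ i * \<phi> w) * cc.\<psi> w ^ q\<bar> \<le> C' * \<epsilon>" for i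
  proof -
    let ?L = "\<lambda>w. (u w * xpart \<phi> i w + g w $ i * \<phi> w) * cc.\<Psi> N w"
    let ?Z = "\<lambda>w. u w * xpart \<zeta> i w + g w $ i * \<zeta> w"
    let ?U = "\<lambda>w. u w * (\<phi> w * pd (axis i 1, 0) (cc.\<Psi> N) w)"
    have id: "?L w = ?Z w - ?U w" for w by (simp add: xpart_def pd\<zeta> \<zeta>_def algebra_simps)
    have iZ: "integrable lebesgue ?Z" using i\<zeta>(7,8) by simp
    have "(LINT w|lebesgue. ?L w) = (LINT w|lebesgue. ?Z w) - (LINT w|lebesgue. ?U w)"
      unfolding id Bochner_Integration.integral_diff[OF iZ iu] ..
    then have eq: "(LINT w|lebesgue. ?L w) = - (LINT w|lebesgue. ?U w)" using grad[OF \<zeta>, of i] by linarith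
    have b: "\<bar>LINT w|lebesgue. ?U w\<bar> \<le> F * (Mh * 3 powr \<alpha> * (2 * real q) + B) * (V * 3 powr (nn + s)) * \<epsilon>"
      by (rule eu[OF F(2)]) blast
    have "0 \<le> F * (\<Lambda>0 + (2 * L * nn * real q) powr p * (V * 3 powr (nn + s))) * \<epsilon>" using Cs(2) \<epsilon> by simp
    then show ?thesis
      unfolding cc.\<Psi>N[symmetric] eq abs_minus_cancel C'_def distrib_right[of _ _ \<epsilon>] using b by linarith
  qed
  show ?thesis
    by (intro exI[of _ cc.\<psi>] conjI allI impI bexI[of _ T] cc.\<psi> cc.X_integrable(1) en far err1 err2 KT mT T) auto
  qed
  qed
qed

end

section \<open>Removability\<close>

context removable begin

text \<open>For radii below 1 the height \<rho>^s is at most \<rho>, so cylinders centred in K lie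
  in shrinking Euclidean balls and finally miss a point at positive distance from K.\<close>

lemma eventually_far:
  assumes K: "compact K" "w \<notin> K" and \<rho>: "\<rho> \<longlonglongrightarrow> 0" "\<And>k. \<rho> k > 0"
  shows "\<forall>\<^sub>F k in sequentially. \<forall>z\<in>K. w \<notin> cyl s z (\<rho> k)"
proof -
  obtain d where d: "d > 0" "ball w d \<subseteq> - K"
    using K open_contains_ball[of "- K"] compact_imp_closed[OF K(1)] by (auto simp: open_Compl)
  have "\<forall>\<^sub>F k in sequentially. \<rho> k < min 1 (d / 2)" using \<rho>(1) d by (intro order_tendstoD) auto
  then show ?thesis
  proof eventually_elim
    case (elim k)
    have r: "0 < \<rho> k" "\<rho> k < 1" "\<rho> k < d / 2" using elim \<rho>(2)[of k] by auto
    have rs: "\<rho> k powr s \<le> \<rho> k" using powr_mono'[of 1 s "\<rho> k"] s2 r by simp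
    show ?case
    proof (intro ballI notI)
      fix z assume z: "z \<in> K" "w \<in> cyl s z (\<rho> k)"
      have "norm (fst w - fst z) < d / 2" "\<bar>snd w - snd z\<bar> < d / 2" using z(2) r rs by (auto simp: cyl_def)
      moreover have "norm (w - z) \<le> norm (fst w - fst z) + norm (snd w - snd z)"
        using norm_Pair_le[of "fst w - fst z" "snd w - snd z"] by (simp add: minus_prod_def)
      ultimately have "dist w z < d" by (simp add: dist_norm)
      then show False using d(2) z(1) by auto
    qed
  qed
qed

text \<open>Limit over covers of vanishing cost. Fatou's lemma turns the uniform energy bound into
  integrability of norm g powr p across E. This gives integrable majorants, so the cutoffs can be
  removed from the integrals while the errors C' e k tend to 0.\<close>

lemma identities_across_E:
  assumes \<phi>: "C1 \<phi>" "compact (tsupp \<phi>)" "tsupp \<phi> \<subseteq> D" and K: "compact K" "K \<subseteq> D"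
  shows "set_integrable lebesgue K (\<lambda>w. norm (g w) powr p)"
    "(LINT w|lebesgue. - u w * tpart \<phi> w + a w \<bullet> xgrad \<phi> w) = 0"
    "(LINT w|lebesgue. u w * xpart \<phi> i w + g w $ i * \<phi> w) = 0"
proof -
  obtain \<eta> where \<eta>: "C1 \<eta>" "\<And>w. 0 \<le> \<eta> w" "\<And>w. \<eta> w \<le> 1" and one: "\<And>w. w \<in> K \<union> tsupp \<phi> \<Longrightarrow> \<eta> w = 1"
    and \<eta>': "compact (tsupp \<eta>)" "tsupp \<eta> \<subseteq> D"
    using compact_cutoff[of "K \<union> tsupp \<phi>" D] \<phi> K D by (metis Un_least compact_Un)
  have bdd: "\<exists>C. C \<ge> 0 \<and> (\<forall>i w. \<bar>pd (axis i 1, 0) f w\<bar> \<le> C) \<and> (\<forall>w. \<bar>pd (0, 1) f w\<bar> \<le> C) \<and> (\<forall>w. \<bar>f w\<bar> \<le> C)"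
    if f: "C1 f" "compact (tsupp f)" for f :: "(real^'n) \<times> real \<Rightarrow> real"
  proof -
    obtain Z1 where Z1: "Z1 \<ge> 0" "\<And>z. \<bar>f z\<bar> \<le> Z1" using C1_bounded[OF f] by blast
    obtain Z2 where Z2: "Z2 \<ge> 0" "\<And>z. norm (xgrad f z) \<le> Z2" using xgrad_bounded[OF f] by blast
    obtain Z3 where Z3: "Z3 \<ge> 0" "\<And>z. \<bar>pd (0, 1) f z\<bar> \<le> Z3" using pd_bounded[OF f] by blast
    have "\<bar>pd (axis i 1, 0) f w\<bar> \<le> Z2" for i w
      using component_le_norm_cart[of "xgrad f w" i] Z2(2)[of w] by (simp add: xgrad_def xpart_def)
    moreover have "x \<le> Z2 \<Longrightarrow> y \<le> Z3 \<Longrightarrow> z \<le> Z1 \<Longrightarrow> x \<le> Z1 + Z2 + Z3 \<and> y \<le> Z1 + Z2 + Z3 \<and> z \<le> Z1 + Z2 + Z3" for x y z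
      using Z1(1) Z2(1) Z3(1) by linarith
    ultimately have "\<bar>pd (axis i 1, 0) f w\<bar> \<le> Z1 + Z2 + Z3 \<and> \<bar>pd (0, 1) f w\<bar> \<le> Z1 + Z2 + Z3 \<and> \<bar>f w\<bar> \<le> Z1 + Z2 + Z3" for i w
      using Z3(2)[of w] Z1(2)[of w] by blast
    then show ?thesis using Z1 Z2 Z3 by (intro exI[of _ "Z1 + Z2 + Z3"]) auto
  qed
  obtain C\<eta> where C\<eta>: "C\<eta> \<ge> 0" "\<And>i w. \<bar>pd (axis i 1, 0) \<eta> w\<bar> \<le> C\<eta>" "\<And>w. \<bar>pd (0, 1) \<eta> w\<bar> \<le> C\<eta>"
    using bdd[OF \<eta>(1) \<eta>'(1)] by blast
  obtain F where F: "F \<ge> 0" "\<And>i w. \<bar>pd (axis i 1, 0) \<phi> w\<bar> \<le> F" "\<And>w. \<bar>pd (0, 1) \<phi> w\<bar> \<le> F" "\<And>w. \<bar>\<phi> w\<bar> \<le> F"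
    using bdd[OF \<phi>(1,2)] by blast
  obtain B where B: "B \<ge> 0" "\<And>w. w \<in> tsupp \<eta> \<Longrightarrow> \<bar>u w\<bar> \<le> B" using u_bounded[OF \<eta>'] by blast
  let ?K = "E \<inter> tsupp \<eta>"
  have Kc: "compact ?K"
  proof -
    obtain C where C: "closed C" "E = D \<inter> C" using Ecl by (auto simp: closedin_closed)
    have "?K = tsupp \<eta> \<inter> C" using C(2) \<eta>'(2) by blast
    then show ?thesis using compact_Int_closed[OF \<eta>'(1) C(1)] by simp
  qed
  \<comment> \<open>The minimum secures the two smallness conditions on the cost in
    \<open>cutoff_along_cover\<close>; division by k + 1 drives the cost to 0.\<close>
  define e where "e k = min 1 ((1 / (C\<eta> + 1)) powr \<sigma>) / real (Suc k)" for k
  have e0: "0 < e k" for k using C\<eta>(1) by (simp add: e_def)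
  have ele: "e k \<le> min 1 ((1 / (C\<eta> + 1)) powr \<sigma>)" for k
    unfolding e_def using divide_left_mono[of 1 "real (Suc k)" "min 1 ((1 / (C\<eta> + 1)) powr \<sigma>)"] by simp
  have e1: "e k \<le> 1" for k using ele[of k] by simp
  have e2: "C\<eta> * e k powr (1 / \<sigma>) \<le> 1" for k
  proof -
    have "e k powr (1 / \<sigma>) \<le> ((1 / (C\<eta> + 1)) powr \<sigma>) powr (1 / \<sigma>)"
      using ele[of k] e0[of k] \<sigma>_pos by (intro powr_mono2) auto
    also have "\<dots> = 1 / (C\<eta> + 1)" using \<sigma>_pos C\<eta>(1) by (simp add: powr_powr)
    finally have "C\<eta> * e k powr (1 / \<sigma>) \<le> C\<eta> * (1 / (C\<eta> + 1))" using C\<eta>(1) by (rule mult_left_mono)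
    also have "\<dots> \<le> 1" using C\<eta>(1) by (simp add: field_simps)
    finally show ?thesis .
  qed
  have elim0: "e \<longlonglongrightarrow> 0" unfolding e_def by (rule LIMSEQ_Suc[OF lim_const_over_n])
  define R where "R C C' k \<psi> \<longleftrightarrow> C1 \<psi> \<and> (\<forall>w. 0 \<le> \<psi> w \<and> \<psi> w \<le> 1)
    \<and> integrable lebesgue (\<lambda>w. norm (g w) powr p * (\<eta> w * \<psi> w) ^ q)
    \<and> (LINT w|lebesgue. norm (g w) powr p * (\<eta> w * \<psi> w) ^ q) \<le> C
    \<and> (\<forall>w. (\<forall>z\<in>?K. w \<notin> cyl s z (3 * e k powr (1 / \<sigma>))) \<longrightarrow> \<psi> w = 1)
    \<and> \<bar>LINT w|lebesgue. (- u w * tpart \<phi> w + a w \<bullet> xgrad \<phi> w) * \<psi> w ^ q\<bar> \<le> C' * e k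
    \<and> (\<forall>i. \<bar>LINT w|lebesgue. (u w * xpart \<phi> i w + g w $ i * \<phi> w) * \<psi> w ^ q\<bar> \<le> C' * e k)
    \<and> (\<exists>T\<in>lmeasurable. ?K \<subseteq> T \<and> measure lebesgue T \<le> V * e k)" for C C' k \<psi>
  \<comment> \<open>The order of quantifiers matters: both constants are fixed before k.\<close>
  have "\<exists>C C'. \<forall>k. \<exists>\<psi>. R C C' k \<psi>"
    unfolding R_def
    by (rule exI, rule exI, rule allI, rule cutoff_along_cover[OF \<phi>(1,2) \<eta> \<eta>' _ C\<eta> B(2,1) F(4,2,3) e0 e1 e2]) (use one in auto)
  then obtain C C' where "\<forall>k. \<exists>\<psi>. R C C' k \<psi>" by blast
  from choice[OF this] obtain \<psi> where R: "\<And>k. R C C' k (\<psi> k)" by blast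
  note R = R[unfolded R_def]
  have \<psi>C: "C1 (\<psi> k)" for k using R[of k] by (elim conjE)
  have \<psi>01: "0 \<le> \<psi> k w \<and> \<psi> k w \<le> 1" for k w using R[of k] by blast
  have Pi: "integrable lebesgue (\<lambda>w. norm (g w) powr p * (\<eta> w * \<psi> k w) ^ q)" for k using R[of k] by (elim conjE)
  have PC: "(LINT w|lebesgue. norm (g w) powr p * (\<eta> w * \<psi> k w) ^ q) \<le> C" for k using R[of k] by (elim conjE)
  have far: "(\<forall>z\<in>?K. w \<notin> cyl s z (3 * e k powr (1 / \<sigma>))) \<Longrightarrow> \<psi> k w = 1" for k w using R[of k] by blast
  have E1: "\<bar>LINT w|lebesgue. (- u w * tpart \<phi> w + a w \<bullet> xgrad \<phi> w) * \<psi> k w ^ q\<bar> \<le> C' * e k" for k using R[of k] by (elim conjE)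
  have E2: "\<bar>LINT w|lebesgue. (u w * xpart \<phi> i w + g w $ i * \<phi> w) * \<psi> k w ^ q\<bar> \<le> C' * e k" for k i using R[of k] by (elim conjE allE)
  have T: "\<exists>T\<in>lmeasurable. ?K \<subseteq> T \<and> measure lebesgue T \<le> V * e k" for k using R[of k] by (elim conjE)
  \<comment> \<open>The covers bound the volume of E in the support of \<eta> by V e k. So this part
    of E is null, and the cutoffs converge to 1 almost everywhere.\<close>
  have Knull: "AE w in lebesgue. w \<notin> ?K"
  proof -
    have Km: "?K \<in> lmeasurable" by (rule lmeasurable_compact[OF Kc])
    have "measure lebesgue ?K \<le> V * e k" for k
    proof -
      obtain T where "T \<in> lmeasurable" "?K \<subseteq> T" "measure lebesgue T \<le> V * e k" using T by blast
      then show ?thesis using measure_mono_fmeasurable[of ?K T lebesgue] Km by (meson fmeasurableD order_trans)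
    qed
    moreover have "(\<lambda>k. V * e k) \<longlonglongrightarrow> V * 0" by (intro tendsto_intros elim0)
    ultimately have "measure lebesgue ?K \<le> V * 0" by (intro LIMSEQ_le_const[of "\<lambda>k. V * e k"]) auto
    then have "measure lebesgue ?K = 0" using measure_nonneg[of lebesgue ?K] by linarith
    then have "?K \<in> null_sets lebesgue" using Km by (simp add: null_sets_def fmeasurableD emeasure_eq_measure2)
    then show ?thesis by (rule AE_not_in)
  qed
  have \<psi>lim: "AE w in lebesgue. (\<lambda>k. \<psi> k w) \<longlonglongrightarrow> 1"
    using Knull
  proof eventually_elim
    case (elim w)
    have "(\<lambda>k. e k powr (1 / \<sigma>)) \<longlonglongrightarrow> 0"
      by (rule tendsto_zero_powrI[OF elim0 tendsto_const]) (use \<sigma>_pos e0 in \<open>auto intro: less_imp_le always_eventually\<close>)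
    then have "(\<lambda>k. 3 * e k powr (1 / \<sigma>)) \<longlonglongrightarrow> 3 * 0" by (intro tendsto_intros)
    then have "(\<lambda>k. 3 * e k powr (1 / \<sigma>)) \<longlonglongrightarrow> 0" by simp
    then have "\<forall>\<^sub>F k in sequentially. \<forall>z\<in>?K. w \<notin> cyl s z (3 * e k powr (1 / \<sigma>))"
      by (rule eventually_far[OF Kc elim]) (use e0 in \<open>simp add: less_imp_neq[symmetric]\<close>)
    then have "\<forall>\<^sub>F k in sequentially. \<psi> k w = 1" by eventually_elim (rule far)
    then show ?case by (rule tendsto_eventually)
  qed
  have G\<eta>: "integrable lebesgue (\<lambda>w. norm (g w) powr p * \<eta> w ^ q)"
  proof (rule integrableI_bounded)
    have \<eta>m: "\<eta> \<in> borel_measurable lebesgue" by (rule C1_measurable[OF \<eta>(1)])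
    show m: "(\<lambda>w. norm (g w) powr p * \<eta> w ^ q) \<in> borel_measurable lebesgue"
      using gp_measurable \<eta>m by (intro borel_measurable_times borel_measurable_power)
    have "(\<integral>\<^sup>+w. ennreal (norm (norm (g w) powr p * \<eta> w ^ q)) \<partial>lebesgue)
      \<le> (\<integral>\<^sup>+w. liminf (\<lambda>k. ennreal (norm (g w) powr p * (\<eta> w * \<psi> k w) ^ q)) \<partial>lebesgue)"
    proof (rule nn_integral_mono_AE)
      show "AE w in lebesgue. ennreal (norm (norm (g w) powr p * \<eta> w ^ q)) \<le> liminf (\<lambda>k. ennreal (norm (g w) powr p * (\<eta> w * \<psi> k w) ^ q))"
        using \<psi>lim
      proof eventually_elim
        case (elim w)
        have "(\<lambda>k. norm (g w) powr p * (\<eta> w * \<psi> k w) ^ q) \<longlonglongrightarrow> norm (g w) powr p * (\<eta> w * 1) ^ q"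
          by (intro tendsto_intros elim)
        then have "(\<lambda>k. ennreal (norm (g w) powr p * (\<eta> w * \<psi> k w) ^ q)) \<longlonglongrightarrow> ennreal (norm (g w) powr p * (\<eta> w * 1) ^ q)"
          by (rule tendsto_ennrealI)
        then have "liminf (\<lambda>k. ennreal (norm (g w) powr p * (\<eta> w * \<psi> k w) ^ q)) = ennreal (norm (g w) powr p * (\<eta> w * 1) ^ q)"
          by (intro lim_imp_Liminf) auto
        then show ?case using \<eta>(2)[of w] by (simp add: abs_mult)
      qed
    qed
    also have "\<dots> \<le> liminf (\<lambda>k. \<integral>\<^sup>+w. ennreal (norm (g w) powr p * (\<eta> w * \<psi> k w) ^ q) \<partial>lebesgue)"
      by (rule nn_integral_liminf) (use borel_measurable_integrable[OF Pi] in measurable)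
    also have "\<dots> \<le> liminf (\<lambda>k. ennreal C)"
    proof (rule Liminf_mono, rule always_eventually, rule allI)
      fix k
      have "(\<integral>\<^sup>+w. ennreal (norm (g w) powr p * (\<eta> w * \<psi> k w) ^ q) \<partial>lebesgue) = ennreal (LINT w|lebesgue. norm (g w) powr p * (\<eta> w * \<psi> k w) ^ q)"
        by (rule nn_integral_eq_integral[OF Pi]) (use \<eta>(2) \<psi>01 in auto)
      then show "(\<integral>\<^sup>+w. ennreal (norm (g w) powr p * (\<eta> w * \<psi> k w) ^ q) \<partial>lebesgue) \<le> ennreal C"
        using PC[of k] by (simp add: ennreal_leI)
    qed
    also have "\<dots> < \<infinity>" by (simp add: Liminf_const)
    finally show "(\<integral>\<^sup>+w. ennreal (norm (norm (g w) powr p * \<eta> w ^ q)) \<partial>lebesgue) < \<infinity>" .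
  qed
  have GK: "set_integrable lebesgue S (\<lambda>w. norm (g w) powr p)" if S: "compact S" "\<And>w. w \<in> S \<Longrightarrow> \<eta> w = 1" for S
    unfolding set_integrable_def
  proof (rule Bochner_Integration.integrable_bound[OF G\<eta>])
    have "S \<in> sets lebesgue" using S(1) by (simp add: fmeasurableD lmeasurable_compact)
    then show "(\<lambda>w. indicator S w *\<^sub>R norm (g w) powr p) \<in> borel_measurable lebesgue"
      using gp_measurable by (intro borel_measurable_scaleR borel_measurable_indicator)
    show "AE w in lebesgue. norm (indicator S w *\<^sub>R norm (g w) powr p) \<le> norm (norm (g w) powr p * \<eta> w ^ q)"
      using S(2) by (intro AE_I2) (auto simp: indicator_def)
  qed
  show "set_integrable lebesgue K (\<lambda>w. norm (g w) powr p)" by (rule GK[OF K(1)]) (simp add: one)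
  have dom: "integrable lebesgue f"
    if f: "f \<in> borel_measurable lebesgue" "AE w in lebesgue. \<bar>f w\<bar> \<le> c * (indicator (tsupp \<phi>) w * (1 + norm (g w) powr p))" for f c
  proof (rule Bochner_Integration.integrable_bound[OF _ f(1)])
    have "integrable lebesgue (indicator (tsupp \<phi>) :: _ \<Rightarrow> real)"
      using lmeasurable_compact[OF \<phi>(2)] lmeasurable_iff_integrable by blast
    moreover have "integrable lebesgue (\<lambda>w. indicator (tsupp \<phi>) w * norm (g w) powr p)"
      using GK[OF \<phi>(2)] one by (simp add: set_integrable_def)
    ultimately show "integrable lebesgue (\<lambda>w. c * (indicator (tsupp \<phi>) w * (1 + norm (g w) powr p)))"
      by (simp add: distrib_left)
    show "AE w in lebesgue. norm (f w) \<le> norm (c * (indicator (tsupp \<phi>) w * (1 + norm (g w) powr p)))"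
      using f(2) by eventually_elim simp
  qed
  have P: "0 \<le> norm (g z) powr p" for z by simp
  have uB: "\<bar>u w\<bar> \<le> B" if "w \<in> tsupp \<phi>" for w
    using B(2)[of w] one[of w] that outside_tsupp[of w \<eta>] by force
  have xm: "xpart \<phi> i \<in> borel_measurable lebesgue" for i
    unfolding xpart_def[abs_def] by (rule continuous_measurable_lebesgue[OF C1_pd_continuous[OF \<phi>(1)]])
  have vm: "(\<lambda>z. g z $ i) \<in> borel_measurable lebesgue" for i
    by (rule measurable_compose[OF gm]) (intro borel_measurable_continuous_onI continuous_intros)
  note [measurable] = C1_measurable[OF \<phi>(1)] xgrad_measurable[OF \<phi>(1)] tpart_measurable[OF \<phi>(1)] um gm am xm vm C1_measurable[OF \<psi>C]
  obtain Z where Z: "Z \<ge> 0" "\<And>z. norm (xgrad \<phi> z) \<le> Z" using xgrad_bounded[OF \<phi>(1,2)] by blast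
  have limit: "(LINT w|lebesgue. f w) = 0"
    if fi: "integrable lebesgue f" and fe: "\<And>k. \<bar>LINT w|lebesgue. f w * \<psi> k w ^ q\<bar> \<le> C' * e k" for f
  proof -
    have [measurable]: "f \<in> borel_measurable lebesgue" using fi by (rule borel_measurable_integrable)
    have "(\<lambda>k. LINT w|lebesgue. f w * \<psi> k w ^ q) \<longlonglongrightarrow> (LINT w|lebesgue. f w)"
    proof (rule integral_dominated_convergence[where w="\<lambda>w. norm (f w)"])
      show "AE w in lebesgue. (\<lambda>k. f w * \<psi> k w ^ q) \<longlonglongrightarrow> f w"
        using \<psi>lim
      proof eventually_elim
        case (elim w)
        have "(\<lambda>k. f w * \<psi> k w ^ q) \<longlonglongrightarrow> f w * 1 ^ q" by (intro tendsto_intros elim)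
        then show ?case by simp
      qed
      show "AE w in lebesgue. norm (f w * \<psi> k w ^ q) \<le> norm (f w)" for k
        using \<psi>01 by (intro AE_I2) (auto simp: abs_mult power_le_one mult_left_le)
    qed (use fi in auto)
    moreover have "(\<lambda>k. LINT w|lebesgue. f w * \<psi> k w ^ q) \<longlonglongrightarrow> 0"
    proof (rule Lim_null_comparison[where g="\<lambda>k. C' * e k"])
      show "\<forall>\<^sub>F k in sequentially. norm (LINT w|lebesgue. f w * \<psi> k w ^ q) \<le> C' * e k" using fe by simp
      have "(\<lambda>k. C' * e k) \<longlonglongrightarrow> C' * 0" by (intro tendsto_intros elim0)
      then show "(\<lambda>k. C' * e k) \<longlonglongrightarrow> 0" by simp
    qed
    ultimately show ?thesis by (rule LIMSEQ_unique)
  qed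
  show "(LINT w|lebesgue. - u w * tpart \<phi> w + a w \<bullet> xgrad \<phi> w) = 0"
  proof (rule limit[OF _ E1], rule dom)
    show "AE w in lebesgue. \<bar>- u w * tpart \<phi> w + a w \<bullet> xgrad \<phi> w\<bar> \<le> (B * F + L * Z) * (indicator (tsupp \<phi>) w * (1 + norm (g w) powr p))"
      using growth
    proof eventually_elim
      case (elim w)
      show ?case
      proof (cases "w \<in> tsupp \<phi>")
        case True
        have "\<bar>u w * tpart \<phi> w\<bar> \<le> B * F"
          using mult_mono[OF uB[OF True] F(3)[of w] B(1)] by (simp add: abs_mult tpart_def)
        also have "\<dots> \<le> (B * F) * (1 + norm (g w) powr p)"
          using mult_left_mono[of 1 "1 + norm (g w) powr p" "B * F"] B(1) F(1) P[of w] by simp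
        finally have 1: "\<bar>u w * tpart \<phi> w\<bar> \<le> (B * F) * (1 + norm (g w) powr p)" .
        have 2: "\<bar>a w \<bullet> xgrad \<phi> w\<bar> \<le> (L * (1 + norm (g w) powr p)) * Z"
          by (rule order_trans[OF Cauchy_Schwarz_ineq2 mult_mono[OF a_bound(1)[OF elim] Z(2)]]) (use L in auto)
        have "\<bar>- u w * tpart \<phi> w + a w \<bullet> xgrad \<phi> w\<bar> \<le> \<bar>u w * tpart \<phi> w\<bar> + \<bar>a w \<bullet> xgrad \<phi> w\<bar>"
          using abs_triangle_ineq[of "- u w * tpart \<phi> w" "a w \<bullet> xgrad \<phi> w"] by simp
        also have "\<dots> \<le> (B * F) * (1 + norm (g w) powr p) + (L * (1 + norm (g w) powr p)) * Z" using 1 2 by (rule add_mono)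
        finally show ?thesis using True by (simp add: algebra_simps)
      qed (simp add: xgrad_outside_tsupp tpart_outside_tsupp)
    qed
  qed measurable
  show "(LINT w|lebesgue. u w * xpart \<phi> i w + g w $ i * \<phi> w) = 0"
  proof (rule limit[OF _ E2], rule dom)
    show "AE w in lebesgue. \<bar>u w * xpart \<phi> i w + g w $ i * \<phi> w\<bar> \<le> (B * F + F) * (indicator (tsupp \<phi>) w * (1 + norm (g w) powr p))"
    proof (rule AE_I2)
      fix w
      show "\<bar>u w * xpart \<phi> i w + g w $ i * \<phi> w\<bar> \<le> (B * F + F) * (indicator (tsupp \<phi>) w * (1 + norm (g w) powr p))"
      proof (cases "w \<in> tsupp \<phi>")
        case True
        have "\<bar>u w * xpart \<phi> i w\<bar> \<le> B * F"
          using mult_mono[OF uB[OF True] F(2)[where i=i and w=w] B(1)] by (simp add: abs_mult xpart_def)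
        also have "\<dots> \<le> (B * F) * (1 + norm (g w) powr p)"
          using mult_left_mono[of 1 "1 + norm (g w) powr p" "B * F"] B(1) F(1) P[of w] by simp
        finally have 1: "\<bar>u w * xpart \<phi> i w\<bar> \<le> (B * F) * (1 + norm (g w) powr p)" .
        have "1 powr (p - 1) * norm (g w) \<le> 1 powr p + norm (g w) powr p"
          by (rule powr_mult_le_sum_powr) (use p in auto)
        then have "\<bar>g w $ i\<bar> \<le> 1 + norm (g w) powr p" using component_le_norm_cart[of "g w" i] by simp
        from mult_mono[OF this F(4)[of w]] have 2: "\<bar>g w $ i * \<phi> w\<bar> \<le> (1 + norm (g w) powr p) * F"
          using P[of w] by (simp add: abs_mult)
        have "\<bar>u w * xpart \<phi> i w + g w $ i * \<phi> w\<bar> \<le> (B * F) * (1 + norm (g w) powr p) + (1 + norm (g w) powr p) * F"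
          by (rule order_trans[OF abs_triangle_ineq add_mono[OF 1 2]])
        then show ?thesis using True by (simp add: algebra_simps)
      qed (simp add: xpart_def pd_outside_tsupp outside_tsupp)
    qed
  qed measurable
qed

end

text \<open>One and the same g is a weak gradient on every cylinder compactly contained in D. Here v
  is the original solution and u its measurable extension; they agree on D, and all integrals in the
  definition run over subsets of D.\<close>

lemma (in removable) weak_solution_across_E:
  assumes vu: "\<And>z. z \<in> D \<Longrightarrow> v z = u z"
    and A: "AE z in lebesgue. z \<in> D \<longrightarrow> A z (g z) = a z"
  shows "weak_solution p A v D"
  unfolding weak_solution_def
proof (intro allI impI)
  fix \<Omega>' :: "(real^'n) set" and t1 t2 :: real
  let ?V = "\<Omega>' \<times> {t1<..<t2}"
  assume "open \<Omega>' \<and> compact (closure ?V) \<and> closure ?V \<subseteq> D"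
  then have V: "open ?V" and K: "compact (closure ?V)" "closure ?V \<subseteq> D" by (auto intro: open_Times)
  have VK: "?V \<subseteq> closure ?V" by (rule closure_subset)
  have VD: "?V \<subseteq> D" using VK K(2) by blast
  have Vm: "?V \<in> lmeasurable"
    using V bounded_subset[OF compact_imp_bounded[OF K(1)] VK] by (rule open_bounded_lmeasurable)
  have Vs: "?V \<in> sets lebesgue" using Vm by (rule fmeasurableD)
  have iv: "indicator ?V z *\<^sub>R v z = indicator ?V z *\<^sub>R u z" for z
    using VD vu by (auto simp: indicator_def)
  have Lu: "Lp_on p ?V v"
    unfolding Lp_on_def
  proof
    show "set_borel_measurable lebesgue ?V v"
      unfolding set_borel_measurable_def iv using um Vs by (intro borel_measurable_scaleR borel_measurable_indicator)
    obtain B where B: "B \<ge> 0" "\<And>z. z \<in> closure ?V \<Longrightarrow> \<bar>u z\<bar> \<le> B" using u_bounded[OF K] by blast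
    have "integrable lebesgue (\<lambda>z. indicator ?V z *\<^sub>R norm (u z) powr p)"
    proof (rule integrable_bounded_compact(1)[OF Vm])
      have "(\<lambda>z. norm (u z)) \<in> borel_measurable lebesgue" using um by measurable
      then have "(\<lambda>z. norm (u z) powr p) \<in> borel_measurable lebesgue" by (intro powr_real_measurable) auto
      then show "(\<lambda>z. indicator ?V z *\<^sub>R norm (u z) powr p) \<in> borel_measurable lebesgue"
        using Vs by (intro borel_measurable_scaleR borel_measurable_indicator)
      show "\<bar>indicator ?V z *\<^sub>R norm (u z) powr p\<bar> \<le> B powr p * indicator ?V z" for z
        using powr_mono2[of p "\<bar>u z\<bar>" B] B(2)[of z] VK p by (auto simp: indicator_def)
    qed
    moreover have "indicator ?V z *\<^sub>R norm (v z) powr p = indicator ?V z *\<^sub>R norm (u z) powr p" for z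
      using VD vu by (auto simp: indicator_def)
    ultimately show "set_integrable lebesgue ?V (\<lambda>z. norm (v z) powr p)" by (simp only: set_integrable_def)
  qed
  have Lg: "Lp_on p ?V g"
    unfolding Lp_on_def
  proof
    show "set_borel_measurable lebesgue ?V g"
      unfolding set_borel_measurable_def using gm Vs by (intro borel_measurable_scaleR borel_measurable_indicator)
    \<comment> \<open>The zero test function is inserted, as only integrability on the compact
      closure is wanted.\<close>
    have "set_integrable lebesgue (closure ?V) (\<lambda>z. norm (g z) powr p)"
      by (rule identities_across_E(1)[of "\<lambda>_. 0", OF _ _ _ K]) (simp_all add: tsupp_def)
    then show "set_integrable lebesgue ?V (\<lambda>z. norm (g z) powr p)"
      using Vs VK by (rule set_integrable_subset)
  qed
  have test: "(LINT z:?V|lebesgue. v z * xpart \<phi> i z) = - (LINT z:?V|lebesgue. g z $ i * \<phi> z)"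
    "(LINT z:?V|lebesgue. - v z * tpart \<phi> z + A z (g z) \<bullet> xgrad \<phi> z) = 0" if \<phi>: "test_fun ?V \<phi>" for \<phi> i
  proof -
    have c: "C1 \<phi>" "compact (tsupp \<phi>)" "tsupp \<phi> \<subseteq> D" and S: "tsupp \<phi> \<subseteq> ?V"
      using \<phi> test_fun_C1[OF \<phi>] VD by (auto simp: test_fun_def)
    have out: "\<phi> z = 0" "pd w \<phi> z = 0" "xgrad \<phi> z = 0" if "z \<notin> ?V" for z w
    proof -
      have "z \<notin> tsupp \<phi>" using S that by (rule contra_subsetD)
      then show "\<phi> z = 0" "pd w \<phi> z = 0" "xgrad \<phi> z = 0"
        by (auto intro: outside_tsupp pd_outside_tsupp xgrad_outside_tsupp)
    qed
    note concl = identities_across_E[OF c c(2,3)]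
    have e1: "indicator ?V z *\<^sub>R (v z * xpart \<phi> i z) = u z * xpart \<phi> i z" for z
      using VD vu out by (cases "z \<in> ?V") (auto simp: xpart_def)
    have e2: "indicator ?V z *\<^sub>R (g z $ i * \<phi> z) = g z $ i * \<phi> z" for z
      using out by (cases "z \<in> ?V") auto
    obtain B where B: "B \<ge> 0" "\<And>z. z \<in> tsupp \<phi> \<Longrightarrow> \<bar>u z\<bar> \<le> B" using u_bounded[OF c(2,3)] by blast
    obtain F where F: "F \<ge> 0" "\<And>z. \<bar>\<phi> z\<bar> \<le> F" using C1_bounded[OF c(1,2)] by blast
    obtain G where G: "G \<ge> 0" "\<And>z. \<bar>pd (axis i 1, 0) \<phi> z\<bar> \<le> G" using pd_bounded[OF c(1,2)] by blast
    have i1: "integrable lebesgue (\<lambda>z. u z * xpart \<phi> i z)"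
    proof (rule integrable_bounded_compact(1)[OF lmeasurable_compact[OF c(2)]])
      have "xpart \<phi> i \<in> borel_measurable lebesgue"
        unfolding xpart_def[abs_def] by (rule continuous_measurable_lebesgue[OF C1_pd_continuous[OF c(1)]])
      then show "(\<lambda>z. u z * xpart \<phi> i z) \<in> borel_measurable lebesgue" using um by (intro borel_measurable_times)
      show "\<bar>u z * xpart \<phi> i z\<bar> \<le> (B * G) * indicator (tsupp \<phi>) z" for z
        using mult_mono[OF B(2)[of z] G(2)[of z] B(1)]
        by (cases "z \<in> tsupp \<phi>") (auto simp: xpart_def abs_mult pd_outside_tsupp)
    qed
    have i2: "integrable lebesgue (\<lambda>z. g z $ i * \<phi> z)"
    proof (rule Bochner_Integration.integrable_bound)
      have "integrable lebesgue (indicator (tsupp \<phi>) :: _ \<Rightarrow> real)"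
        using lmeasurable_compact[OF c(2)] lmeasurable_iff_integrable by blast
      with concl(1) show "integrable lebesgue (\<lambda>z. F * (indicator (tsupp \<phi>) z + indicator (tsupp \<phi>) z * norm (g z) powr p))"
        by (simp add: set_integrable_def)
      have "(\<lambda>z. g z $ i) \<in> borel_measurable lebesgue"
        by (rule measurable_compose[OF gm]) (intro borel_measurable_continuous_onI continuous_intros)
      then show "(\<lambda>z. g z $ i * \<phi> z) \<in> borel_measurable lebesgue"
        using C1_measurable[OF c(1)] by (intro borel_measurable_times)
      show "AE z in lebesgue. norm (g z $ i * \<phi> z) \<le> norm (F * (indicator (tsupp \<phi>) z + indicator (tsupp \<phi>) z * norm (g z) powr p))"
      proof (rule AE_I2)
        fix z
        have "1 powr (p - 1) * norm (g z) \<le> 1 powr p + norm (g z) powr p"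
          by (rule powr_mult_le_sum_powr) (use p in auto)
        then have "\<bar>g z $ i\<bar> \<le> 1 + norm (g z) powr p" using component_le_norm_cart[of "g z" i] by simp
        from mult_mono[OF F(2)[of z] this] F(1)
        show "norm (g z $ i * \<phi> z) \<le> norm (F * (indicator (tsupp \<phi>) z + indicator (tsupp \<phi>) z * norm (g z) powr p))"
          by (cases "z \<in> tsupp \<phi>") (auto simp: abs_mult mult.commute outside_tsupp)
      qed
    qed
    have "(LINT z|lebesgue. u z * xpart \<phi> i z) + (LINT z|lebesgue. g z $ i * \<phi> z) = 0"
      using concl(3)[of i] unfolding Bochner_Integration.integral_add[OF i1 i2] .
    then show "(LINT z:?V|lebesgue. v z * xpart \<phi> i z) = - (LINT z:?V|lebesgue. g z $ i * \<phi> z)"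
      unfolding set_lebesgue_integral_def e1 e2 by linarith
    have "(LINT z:?V|lebesgue. - v z * tpart \<phi> z + A z (g z) \<bullet> xgrad \<phi> z) = (LINT z|lebesgue. - u z * tpart \<phi> z + a z \<bullet> xgrad \<phi> z)"
      unfolding set_lebesgue_integral_def
    proof (rule lebesgue_integral_AE_cong)
      show "AE z in lebesgue. indicator ?V z *\<^sub>R (- v z * tpart \<phi> z + A z (g z) \<bullet> xgrad \<phi> z) = - u z * tpart \<phi> z + a z \<bullet> xgrad \<phi> z"
        using A
      proof eventually_elim
        case (elim z)
        then show ?case using VD vu[of z] out[of z] by (cases "z \<in> ?V") (auto simp: tpart_def)
      qed
    qed
    then show "(LINT z:?V|lebesgue. - v z * tpart \<phi> z + A z (g z) \<bullet> xgrad \<phi> z) = 0" using concl(2) by simp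
  qed
  show "\<exists>g. Lp_on p ?V v \<and> Lp_on p ?V g \<and> weak_xgrad ?V v g \<and>
      (\<forall>\<phi>. test_fun ?V \<phi> \<longrightarrow> (LINT z:?V|lebesgue. - v z * tpart \<phi> z + A z (g z) \<bullet> xgrad \<phi> z) = 0)"
    unfolding weak_xgrad_def using Lu Lg test by blast
qed

section \<open>Translating the hypotheses of the theorem\<close>

lemma Qcyl_eq_cyl: "0 < r \<Longrightarrow> Qcyl p r (r powr \<alpha>) z = cyl (p + \<alpha> * (2 - p)) z r"
  by (simp add: Qcyl_def cyl_Times powr_powr powr_add mult.commute)

text \<open>\<open>Lim\<close> carries information only once the limit is known to exist. It does
  exist and is the supremum over \<delta> > 0, because the premeasure grows as \<delta> shrinks. If
  the supremum is 0, so is the value at \<delta> = 1, which supplies covers of arbitrarily small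
  cost.\<close>

lemma par_hausdorff_zero_cover:
  fixes E :: "((real^'n) \<times> real) set"
  assumes H: "par_hausdorff p \<alpha> \<sigma> E = 0" and \<epsilon>: "0 < \<epsilon>"
  shows "\<exists>(r :: nat \<Rightarrow> real) z. (\<forall>i. 0 < r i) \<and> E \<subseteq> (\<Union>i. cyl (p + \<alpha> * (2 - p)) (z i) (r i))
      \<and> (\<Sum>i. ennreal (r i powr \<sigma>)) < ennreal \<epsilon>"
proof -
  let ?F = "\<lambda>\<delta>. par_hausdorff_delta p \<alpha> \<sigma> \<delta> E"
  have anti: "?F \<delta>' \<le> ?F \<delta>" if "\<delta> \<le> \<delta>'" for \<delta> \<delta>'
    unfolding par_hausdorff_delta_def using that by (intro INF_superset_mono) (auto intro: less_le_trans)
  have "(?F \<longlongrightarrow> (SUP \<delta>\<in>{0<..}. ?F \<delta>)) (at_right 0)"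
  proof (rule increasing_tendsto)
    show "\<forall>\<^sub>F \<delta> in at_right 0. ?F \<delta> \<le> (SUP \<delta>\<in>{0<..}. ?F \<delta>)"
      using eventually_at_right_less[of 0] by eventually_elim (auto intro: SUP_upper)
    fix x assume "x < (SUP \<delta>\<in>{0<..}. ?F \<delta>)"
    then obtain d where d: "d > 0" "x < ?F d" unfolding less_SUP_iff by auto
    have "\<forall>\<^sub>F \<delta> in at_right 0. \<delta> < d" using d(1) by (rule order_tendstoD[OF tendsto_ident_at])
    then show "\<forall>\<^sub>F \<delta> in at_right 0. x < ?F \<delta>"
      by eventually_elim (use d(2) anti less_le_trans less_imp_le in blast)
  qed
  then have "(SUP \<delta>\<in>{0<..}. ?F \<delta>) = 0"
    using H tendsto_Lim[OF trivial_limit_at_right_real] unfolding par_hausdorff_def by metis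
  then have "?F 1 \<le> 0" by (metis SUP_upper greaterThan_iff zero_less_one)
  then have "?F 1 < ennreal \<epsilon>" using \<epsilon> by simp
  then obtain r z where rz: "\<And>i. 0 < r i" "E \<subseteq> (\<Union>i. Qcyl p (r i) (r i powr \<alpha>) (z i))"
    "(\<Sum>i. ennreal (r i powr \<sigma>)) < ennreal \<epsilon>"
    unfolding par_hausdorff_delta_def INF_less_iff by auto
  then show ?thesis by (intro exI[of _ r] exI[of _ z]) (auto simp: Qcyl_eq_cyl)
qed

lemma d_par_le:
  assumes "z \<in> cyl (p + \<alpha> * (2 - p)) z0 r" "0 < p + \<alpha> * (2 - p)" "0 < r"
  shows "d_par p \<alpha> z z0 \<le> r"
proof -
  let ?s = "p + \<alpha> * (2 - p)"
  have "\<bar>snd z - snd z0\<bar> powr (1 / ?s) \<le> (r powr ?s) powr (1 / ?s)"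
    using assms by (intro powr_mono2) (auto simp: cyl_def)
  also have "\<dots> = r" using assms by (simp add: powr_powr)
  finally show ?thesis using assms(1) by (simp add: d_par_def cyl_def)
qed

theorem theorem1p1:
  fixes \<Omega> :: "(real^'n) set" and T p \<alpha> \<nu> L M :: real
    and A :: "(real^'n) \<times> real \<Rightarrow> real^'n \<Rightarrow> real^'n"
    and u :: "(real^'n) \<times> real \<Rightarrow> real"
    and E :: "((real^'n) \<times> real) set"
  defines "\<Omega>T \<equiv> \<Omega> \<times> {0<..<T}"
  assumes "p \<ge> 2" and "open \<Omega>" and "0 < T" and "0 < \<alpha>" and "\<alpha> \<le> 1"
    and "0 < \<nu>" and "\<nu> \<le> L"
    and carath_meas: "\<And>\<xi>. set_borel_measurable lebesgue \<Omega>T (\<lambda>z. A z \<xi>)"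
    and carath_cont: "AE z in lebesgue. z \<in> \<Omega>T \<longrightarrow> continuous_on UNIV (A z)"
    and struct: "AE z in lebesgue. z \<in> \<Omega>T \<longrightarrow>
        (\<forall>\<xi> \<eta>. A z \<xi> \<bullet> \<xi> \<ge> \<nu> * norm \<xi> powr p \<and>
                 norm (A z \<xi>) \<le> L * norm \<xi> powr (p - 1) \<and>
                 (\<xi> \<noteq> \<eta> \<longrightarrow> (A z \<xi> - A z \<eta>) \<bullet> (\<xi> - \<eta>) > 0))"
    and "closedin (top_of_set \<Omega>T) E"
    and "continuous_on \<Omega>T u"
    and "weak_solution p A u (\<Omega>T - E)"
    and "0 < M"
    and "\<forall>z0\<in>E. \<forall>z\<in>\<Omega>T. \<bar>u z - u z0\<bar> \<le> M * d_par p \<alpha> z z0 powr \<alpha>"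
    and "par_hausdorff p \<alpha> (real CARD('n) + \<alpha>) E = 0"
  shows "weak_solution p A u \<Omega>T"
proof -
  define D where "D = \<Omega>T"
  define U where "U = D - E"
  have D: "open D" using \<open>open \<Omega>\<close> by (auto simp: D_def \<Omega>T_def intro: open_Times)
  have Ecl: "closedin (top_of_set D) E" using assms D_def by simp
  have ED: "E \<subseteq> D" using closedin_subset[OF Ecl] by simp
  obtain C where C: "closed C" "E = D \<inter> C" using Ecl by (auto simp: closedin_closed)
  have UDC: "U = D - C" using C(2) by (auto simp: U_def)
  have U: "open U" unfolding UDC using D C(1) by (rule open_Diff)
  have uc: "continuous_on D u" using \<open>continuous_on \<Omega>T u\<close> by (simp add: D_def)
  have ws: "weak_solution p A u U" using \<open>weak_solution p A u (\<Omega>T - E)\<close> by (simp add: D_def U_def)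
  have L: "L \<ge> 0" and p1: "p \<ge> 1" using \<open>0 < \<nu>\<close> \<open>\<nu> \<le> L\<close> \<open>p \<ge> 2\<close> by auto
  obtain g0 where g0: "g0 \<in> borel_measurable lebesgue"
    and loc0: "\<And>z. z \<in> U \<Longrightarrow> \<exists>W. open W \<and> z \<in> W \<and> W \<subseteq> U \<and> set_integrable lebesgue W (\<lambda>z. norm (g0 z) powr p) \<and>
       weak_xgrad W u g0 \<and>
       (\<forall>\<phi>. test_fun W \<phi> \<longrightarrow> (LINT z:W|lebesgue. - u z * tpart \<phi> z + A z (g0 z) \<bullet> xgrad \<phi> z) = 0)"
    using weak_solution_global_gradient[OF U p1 ws] by blast
  \<comment> \<open>Extension by 0 off U makes growth and coercivity hold almost everywhere in the
    whole space. On E it is consistent with the flux, since A z 0 = 0 almost everywhere in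
    D.\<close>
  define g where "g z = (if z \<in> U then g0 z else 0)" for z
  define a where "a z = (if z \<in> U then A z (g0 z) else 0)" for z
  \<comment> \<open>Continuity of u is known on D only; its extension by 0 from the open set D is
    measurable on the whole space.\<close>
  define v where "v z = (if z \<in> D then u z else 0)" for z
  have Ds: "D \<in> sets lebesgue" and Us: "U \<in> sets lebesgue" using D U by auto
  have gm: "g \<in> borel_measurable lebesgue"
    unfolding g_def[abs_def] using g0 Us by (intro measurable_If_set) auto
  have am: "a \<in> borel_measurable lebesgue"
  proof -
    have "(\<lambda>z. indicator D z *\<^sub>R A z (g0 z)) \<in> borel_measurable lebesgue"
      using caratheodory_measurable[OF Ds _ _ g0] carath_meas carath_cont unfolding D_def set_borel_measurable_def by blast
    then have "(\<lambda>z. if z \<in> U then indicator D z *\<^sub>R A z (g0 z) else 0) \<in> borel_measurable lebesgue"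
      using Us by (intro measurable_If_set) auto
    moreover have "(\<lambda>z. if z \<in> U then indicator D z *\<^sub>R A z (g0 z) else 0) = a"
      by (auto simp: a_def U_def fun_eq_iff)
    ultimately show ?thesis by simp
  qed
  have vm: "v \<in> borel_measurable lebesgue"
    unfolding v_def[abs_def]
    by (intro borel_measurable_lebesgue borel_measurable_continuous_on_if uc) (use D in auto)
  have growth: "AE z in lebesgue. norm (a z) \<le> L * norm (g z) powr (p - 1)"
    using struct
  proof eventually_elim
    case (elim z)
    then show ?case using L by (cases "z \<in> U") (auto simp: a_def g_def U_def D_def)
  qed
  have coer: "AE z in lebesgue. \<nu> * norm (g z) powr p \<le> a z \<bullet> g z"
    using struct
  proof eventually_elim
    case (elim z)
    then show ?case by (cases "z \<in> U") (auto simp: a_def g_def U_def D_def)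
  qed
  have Aa: "AE z in lebesgue. z \<in> D \<longrightarrow> A z (g z) = a z"
    using struct
  proof eventually_elim
    case (elim z)
    show ?case
    proof
      assume z: "z \<in> D"
      \<comment> \<open>Growth at \<xi> = 0 forces A z 0 = 0, because \<open>0 powr (p - 1)\<close>
        is 0.\<close>
      then have "norm (A z 0) \<le> L * norm (0 :: real^'n) powr (p - 1)" using elim unfolding D_def by blast
      then have "A z 0 = 0" by simp
      then show "A z (g z) = a z" by (simp add: a_def g_def)
    qed
  qed
  interpret wl: weak_local p L U v g a
  proof
    show "continuous_on U v"
      using continuous_on_subset[OF uc, of U] by (rule continuous_on_eq) (auto simp: U_def v_def)
    show "AE z in lebesgue. z \<in> U \<longrightarrow> norm (a z) \<le> L * norm (g z) powr (p - 1)" using growth by eventually_elim simp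
    fix z assume "z \<in> U"
    from loc0[OF this] obtain W where W: "open W" "z \<in> W" "W \<subseteq> U" "set_integrable lebesgue W (\<lambda>z. norm (g0 z) powr p)"
      "weak_xgrad W u g0" "\<And>\<phi>. test_fun W \<phi> \<Longrightarrow> (LINT z:W|lebesgue. - u z * tpart \<phi> z + A z (g0 z) \<bullet> xgrad \<phi> z) = 0" by blast
    have eq: "g w = g0 w" "a w = A w (g0 w)" "v w = u w" if "w \<in> W" for w
      using W(3) that by (auto simp: g_def a_def v_def U_def)
    have LC: "(LINT z:W|lebesgue. f z) = (LINT z:W|lebesgue. h z)" if "\<And>z. z \<in> W \<Longrightarrow> f z = h z" for f h :: "_ \<Rightarrow> real"
      unfolding set_lebesgue_integral_def using that by (intro Bochner_Integration.integral_cong) (auto simp: indicator_def)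
    have 1: "set_integrable lebesgue W (\<lambda>z. norm (g z) powr p)"
    proof -
      have "(\<lambda>z. indicator W z *\<^sub>R norm (g z) powr p) = (\<lambda>z. indicator W z *\<^sub>R norm (g0 z) powr p)"
        using eq(1) by (auto simp: fun_eq_iff indicator_def)
      then show ?thesis using W(4) by (simp only: set_integrable_def)
    qed
    have 2: "weak_xgrad W v g"
      unfolding weak_xgrad_def
    proof (intro allI impI)
      fix \<phi> i assume "test_fun W \<phi>"
      then have "(LINT z:W|lebesgue. u z * xpart \<phi> i z) = - (LINT z:W|lebesgue. g0 z $ i * \<phi> z)"
        using W(5) by (simp add: weak_xgrad_def)
      moreover have "(LINT z:W|lebesgue. v z * xpart \<phi> i z) = (LINT z:W|lebesgue. u z * xpart \<phi> i z)"
        by (rule LC) (simp add: eq)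
      moreover have "(LINT z:W|lebesgue. g z $ i * \<phi> z) = (LINT z:W|lebesgue. g0 z $ i * \<phi> z)"
        by (rule LC) (simp add: eq)
      ultimately show "(LINT z:W|lebesgue. v z * xpart \<phi> i z) = - (LINT z:W|lebesgue. g z $ i * \<phi> z)" by simp
    qed
    have 3: "(LINT z:W|lebesgue. - v z * tpart \<phi> z + a z \<bullet> xgrad \<phi> z) = 0" if "test_fun W \<phi>" for \<phi>
    proof -
      have "(LINT z:W|lebesgue. - v z * tpart \<phi> z + a z \<bullet> xgrad \<phi> z) = (LINT z:W|lebesgue. - u z * tpart \<phi> z + A z (g0 z) \<bullet> xgrad \<phi> z)"
        by (rule LC) (simp add: eq)
      then show ?thesis using W(6)[OF that] by simp
    qed
    show "\<exists>W. open W \<and> z \<in> W \<and> W \<subseteq> U \<and> set_integrable lebesgue W (\<lambda>z. norm (g z) powr p) \<and> weak_xgrad W v g \<and>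
       (\<forall>\<phi>. test_fun W \<phi> \<longrightarrow> (LINT z:W|lebesgue. - v z * tpart \<phi> z + a z \<bullet> xgrad \<phi> z) = 0)"
      using W(1-3) 1 2 3 by blast
  qed (use U p1 L vm gm am in auto)
  interpret rm: removable p \<alpha> \<nu> L M "real CARD('n)" D E v g a
  proof
    show "continuous_on D v" using uc by (rule continuous_on_eq) (simp add: v_def)
    fix z0 z and r :: real assume z0: "z0 \<in> E" and z: "z \<in> D" and r: "r > 0" and c: "z \<in> cyl (p + \<alpha> * (2 - p)) z0 r"
    have "\<alpha> * (p - 2) \<le> 1 * (p - 2)" using \<open>\<alpha> \<le> 1\<close> \<open>p \<ge> 2\<close> by (intro mult_right_mono) auto
    then have s: "0 < p + \<alpha> * (2 - p)" by (simp add: algebra_simps)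
    have d0: "0 \<le> d_par p \<alpha> z z0" by (simp add: d_par_def le_max_iff_disj)
    have "\<bar>u z - u z0\<bar> \<le> M * d_par p \<alpha> z z0 powr \<alpha>" using \<open>\<forall>z0\<in>E. \<forall>z\<in>\<Omega>T. _\<close> z0 z unfolding D_def by blast
    also have "\<dots> \<le> M * r powr \<alpha>"
      using d_par_le[OF c s r] d0 \<open>0 < \<alpha>\<close> \<open>0 < M\<close> by (intro mult_left_mono powr_mono2) auto
    finally show "\<bar>v z - v z0\<bar> \<le> M * r powr \<alpha>" using z z0 ED by (auto simp: v_def)
  next
    fix \<epsilon> :: real assume "\<epsilon> > 0"
    then show "\<exists>(r :: nat \<Rightarrow> real) z. (\<forall>i. 0 < r i) \<and> E \<subseteq> (\<Union>i. cyl (p + \<alpha> * (2 - p)) (z i) (r i))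
      \<and> (\<Sum>i. ennreal (r i powr (real CARD('n) + \<alpha>))) < ennreal \<epsilon>"
      by (rule par_hausdorff_zero_cover[OF \<open>par_hausdorff p \<alpha> (real CARD('n) + \<alpha>) E = 0\<close>])
  next
    fix K assume "compact K" "K \<subseteq> D - E"
    then show "set_integrable lebesgue K (\<lambda>z. norm (g z) powr p)" by (intro wl.compact_integrable) (auto simp: U_def)
  next
    fix \<zeta> c assume "C1 \<zeta>" "compact (tsupp \<zeta>)" "tsupp \<zeta> \<subseteq> D - E"
    then show "(LINT z|lebesgue. (a z \<bullet> g z) * \<zeta> z + (v z - c) * (a z \<bullet> xgrad \<zeta> z) - (v z - c)^2 / 2 * tpart \<zeta> z) = 0"
      by (intro wl.energy_identity) (auto simp: U_def)
  next
    fix \<zeta> i assume "C1 \<zeta>" "compact (tsupp \<zeta>)" "tsupp \<zeta> \<subseteq> D - E"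
    then show "(LINT z|lebesgue. v z * xpart \<zeta> i z + g z $ i * \<zeta> z) = 0"
      by (intro wl.gradient_identity) (auto simp: U_def)
  qed (fact | use assms L in simp)+
  show ?thesis unfolding D_def[symmetric]
    by (rule rm.weak_solution_across_E[where A = A, OF _ Aa]) (simp add: v_def)
qed

end
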